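(* Let $L>0$, $\Omega=(-L,L)^2$ and $f\in L^2(\Omega)$. For every $r$ with $0<r<L$ there exists a unique solution $u_r\in V_{0,r}$ of the problem $$\int_{\Omega_r}\nabla u_r\cdot\nabla v=\int_{\Omega_r}fv\qquad\text{for all } v\in V_{0,r}.$$ Moreover, extending $u_r$ by zero inside $D_r$ so that $u_r$ is regarded as an element of $H^1_{\mathrm{per}}(\Omega)$: (a) if $\int_\Omega f=0$, then as $r\to0$ $$u_r-\frac{1}{|\Omega|}\int_\Omega u_r\to u_0\qquad\text{and}\qquad \nabla u_r\to\nabla u_0,$$ where the limits are taken in $L^2(\Omega)$ and $u_0\in H^1_{\mathrm{per}}(\Omega)$ is the unique solution of the problem $$\int_\Omega\nabla u_0\cdot\nabla v=\int_\Omega fv\qquad\text{for all } v\in H^1_{\mathrm{per}}(\Omega)$$ that satisfies $\int_\Omega u_0=0$; (b) if $\int_\Omega f\neq0$, then $\|\nabla u_r\|_{L^2}$ is unbounded as $r\to0$.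
   Context: For $0<r<L$, $D_r=B(0,r)$ is the disc of radius $r$ centred at the origin in $\mathbb{R}^2$ and $\Omega_r=(-L,L)^2\setminus D_r$. $H^1_{\mathrm{per}}(\Omega)$ is the space of restrictions to $\Omega$ of functions in $H^1_{\mathrm{loc}}(\mathbb{R}^2)$ that are $2L$-periodic in both coordinate directions. $C^1_{\mathrm{per}}(\overline{\Omega}_r)$ is the space of $C^1$ functions on $\overline{\Omega}_r$ whose $2L$-periodic extension in both directions is $C^1$ (on the periodic extension of $\overline\Omega_r$). $H^1_{\mathrm{per}}(\Omega_r)$ is the closure of $C^1_{\mathrm{per}}(\overline{\Omega}_r)$ in $H^1(\Omega_r)$, and $$V_{0,r}=\{v\in H^1_{\mathrm{per}}(\Omega_r):\ v=0\text{ on }\partial D_r\}$$ (in the sense of traces). Any function in $V_{0,r}$ is extended by zero inside $D_r$ to give a function in $H^1_{\mathrm{per}}(\Omega)$; integrals and norms of $u_r$ over $\Omega$ refer to this extension. *)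

theory Defs
  imports "HOL-Analysis.Analysis"
begin

text \<open>
  Elements of Lebesgue and Sobolev spaces are represented by total functions, of which only the
  values almost everywhere on the set in question matter; uniqueness of such an element therefore
  means uniqueness up to equality almost everywhere.
\<close>

definition L2 :: "'a::euclidean_space set \<Rightarrow> ('a \<Rightarrow> 'b::euclidean_space) set" where
  "L2 U = {u. u \<in> borel_measurable (lebesgue_on U) \<and>
              integrable (lebesgue_on U) (\<lambda>x. (norm (u x))\<^sup>2)}"

definition L2norm :: "'a::euclidean_space set \<Rightarrow> ('a \<Rightarrow> 'b::euclidean_space) \<Rightarrow> real" where
  "L2norm U u = sqrt (\<integral>x. (norm (u x))\<^sup>2 \<partial>lebesgue_on U)"

text \<open>
  \<open>u\<close> is continuously differentiable on \<open>E\<close> with gradient \<open>G\<close>.  When \<open>E\<close> is not open, the derivative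
  at a boundary point is the one relative to \<open>E\<close>, and \<open>G\<close> is continuous up to the boundary.
\<close>

definition has_C1_gradient ::
  "'a::euclidean_space set \<Rightarrow> ('a \<Rightarrow> real) \<Rightarrow> ('a \<Rightarrow> 'a) \<Rightarrow> bool" where
  "has_C1_gradient E u G \<longleftrightarrow>
     continuous_on E G \<and> (\<forall>x\<in>E. (u has_derivative (\<lambda>h. G x \<bullet> h)) (at x within E))"

text \<open>
  Weak gradients on an open set \<open>U\<close>, with continuously differentiable test functions of compact
  support in \<open>U\<close> (as in Brezis, Functional Analysis, Sobolev Spaces and Partial Differential
  Equations, Section 9.1).  The vector-valued identity collects the identities for all the partial
  derivatives.
\<close>

definition has_weak_gradient ::
  "'a::euclidean_space set \<Rightarrow> ('a \<Rightarrow> real) \<Rightarrow> ('a \<Rightarrow> 'a) \<Rightarrow> bool" where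
  "has_weak_gradient U u g \<longleftrightarrow>
     (\<forall>K. compact K \<and> K \<subseteq> U \<longrightarrow> u absolutely_integrable_on K \<and> g absolutely_integrable_on K) \<and>
     (\<forall>\<phi> G. has_C1_gradient UNIV \<phi> G \<and> (\<exists>K. compact K \<and> K \<subseteq> U \<and> (\<forall>x. x \<notin> K \<longrightarrow> \<phi> x = 0)) \<longrightarrow>
        (\<integral>x. u x *\<^sub>R G x \<partial>lebesgue_on U) = - (\<integral>x. \<phi> x *\<^sub>R g x \<partial>lebesgue_on U))"

text \<open>The weak gradient is unique up to equality almost everywhere on \<open>U\<close>.\<close>

definition weak_grad :: "'a::euclidean_space set \<Rightarrow> ('a \<Rightarrow> real) \<Rightarrow> 'a \<Rightarrow> 'a" where
  "weak_grad U u = (SOME g. has_weak_gradient U u g)"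

definition H1 :: "'a::euclidean_space set \<Rightarrow> ('a \<Rightarrow> real) set" where
  "H1 U = {u. u \<in> L2 U \<and> (\<exists>g. has_weak_gradient U u g \<and> g \<in> L2 U)}"

definition H1norm :: "'a::euclidean_space set \<Rightarrow> ('a \<Rightarrow> real) \<Rightarrow> real" where
  "H1norm U u = sqrt ((L2norm U u)\<^sup>2 + (L2norm U (weak_grad U u))\<^sup>2)"

definition H1_loc :: "'a::euclidean_space set \<Rightarrow> ('a \<Rightarrow> real) set" where
  "H1_loc U = {u. (\<forall>K. compact K \<and> K \<subseteq> U \<longrightarrow> u \<in> L2 K) \<and>
                  (\<exists>g. has_weak_gradient U u g \<and> (\<forall>K. compact K \<and> K \<subseteq> U \<longrightarrow> g \<in> L2 K))}"

definition Omega :: "real \<Rightarrow> (real^2) set" where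
  "Omega L = {x. \<forall>i. - L < x $ i \<and> x $ i < L}"

text \<open>The closed disc is removed, so that the perforated square is open.\<close>

definition disc :: "real \<Rightarrow> (real^2) set" where
  "disc r = cball 0 r"

definition Omega_hole :: "real \<Rightarrow> real \<Rightarrow> (real^2) set" where
  "Omega_hole L r = Omega L - disc r"

definition periodic :: "real \<Rightarrow> (real^2 \<Rightarrow> real) \<Rightarrow> bool" where
  "periodic L w \<longleftrightarrow> (\<forall>x i. w (x + axis i (2 * L)) = w x)"

definition periodic_hull :: "real \<Rightarrow> (real^2) set \<Rightarrow> (real^2) set" where
  "periodic_hull L S = {x. \<exists>k::2 \<Rightarrow> int. x + (\<chi> i. 2 * L * of_int (k i)) \<in> S}"

definition H1_per :: "real \<Rightarrow> (real^2 \<Rightarrow> real) set" where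
  "H1_per L = {v. \<exists>w \<in> H1_loc UNIV. periodic L w \<and> (AE x in lebesgue_on (Omega L). v x = w x)}"

definition C1_per_hole :: "real \<Rightarrow> real \<Rightarrow> (real^2 \<Rightarrow> real) set" where
  "C1_per_hole L r = {\<phi>. \<exists>w G. periodic L w \<and> (\<forall>x \<in> closure (Omega_hole L r). \<phi> x = w x) \<and>
                             has_C1_gradient (periodic_hull L (closure (Omega_hole L r))) w G}"

definition H1_per_hole :: "real \<Rightarrow> real \<Rightarrow> (real^2 \<Rightarrow> real) set" where
  "H1_per_hole L r = {v \<in> H1 (Omega_hole L r).
     \<exists>\<phi>. (\<forall>n::nat. \<phi> n \<in> C1_per_hole L r) \<and>
         (\<lambda>n. H1norm (Omega_hole L r) (\<lambda>x. v x - \<phi> n x)) \<longlonglongrightarrow> 0}"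

definition circle_point :: "real \<Rightarrow> real \<Rightarrow> real^2" where
  "circle_point r t = vector [r * cos t, r * sin t]"

text \<open>The \<open>L\<^sup>2\<close> space and norm for arc length on the circle of radius \<open>r\<close>.\<close>

definition circle_L2 :: "real \<Rightarrow> (real^2 \<Rightarrow> real) set" where
  "circle_L2 r = {g. (\<lambda>t. g (circle_point r t)) \<in> L2 {0..2 * pi}}"

definition circle_L2norm :: "real \<Rightarrow> (real^2 \<Rightarrow> real) \<Rightarrow> real" where
  "circle_L2norm r g = sqrt (\<integral>t. (g (circle_point r t))\<^sup>2 * r \<partial>lebesgue_on {0..2 * pi})"

text \<open>
  \<open>g\<close> is the trace of \<open>v\<close> on the boundary of the disc: the trace operator is the continuous extension
  to \<open>H1_per_hole L r\<close> of the restriction of \<open>C\<^sup>1\<close> functions to the circle.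
\<close>

definition has_trace :: "real \<Rightarrow> real \<Rightarrow> (real^2 \<Rightarrow> real) \<Rightarrow> (real^2 \<Rightarrow> real) \<Rightarrow> bool" where
  "has_trace L r v g \<longleftrightarrow> g \<in> circle_L2 r \<and>
     (\<exists>\<phi>. (\<forall>n::nat. \<phi> n \<in> C1_per_hole L r) \<and>
          (\<lambda>n. H1norm (Omega_hole L r) (\<lambda>x. v x - \<phi> n x)) \<longlonglongrightarrow> 0 \<and>
          (\<lambda>n. circle_L2norm r (\<lambda>x. \<phi> n x - g x)) \<longlonglongrightarrow> 0)"

definition V0 :: "real \<Rightarrow> real \<Rightarrow> (real^2 \<Rightarrow> real) set" where
  "V0 L r = {v \<in> H1_per_hole L r. has_trace L r v (\<lambda>x. 0)}"

definition zero_ext :: "real \<Rightarrow> (real^2 \<Rightarrow> real) \<Rightarrow> real^2 \<Rightarrow> real" where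
  "zero_ext r u = (\<lambda>x. if x \<in> disc r then 0 else u x)"

definition hole_solution :: "real \<Rightarrow> (real^2 \<Rightarrow> real) \<Rightarrow> real \<Rightarrow> (real^2 \<Rightarrow> real) \<Rightarrow> bool" where
  "hole_solution L f r u \<longleftrightarrow> u \<in> V0 L r \<and>
     (\<forall>v \<in> V0 L r.
        (\<integral>x. weak_grad (Omega_hole L r) u x \<bullet> weak_grad (Omega_hole L r) v x
              \<partial>lebesgue_on (Omega_hole L r))
        = (\<integral>x. f x * v x \<partial>lebesgue_on (Omega_hole L r)))"

definition limit_solution :: "real \<Rightarrow> (real^2 \<Rightarrow> real) \<Rightarrow> (real^2 \<Rightarrow> real) \<Rightarrow> bool" where
  "limit_solution L f u \<longleftrightarrow> u \<in> H1_per L \<and>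
     (\<forall>v \<in> H1_per L.
        (\<integral>x. weak_grad (Omega L) u x \<bullet> weak_grad (Omega L) v x \<partial>lebesgue_on (Omega L))
        = (\<integral>x. f x * v x \<partial>lebesgue_on (Omega L))) \<and>
     (\<integral>x. u x \<partial>lebesgue_on (Omega L)) = 0"

definition mean :: "real \<Rightarrow> (real^2 \<Rightarrow> real) \<Rightarrow> real" where
  "mean L u = 1 / measure lebesgue (Omega L) * (\<integral>x. u x \<partial>lebesgue_on (Omega L))"

end

theory Submission
  imports Defs
begin

text \<open>
  Functions that are \<open>L\<^sup>2\<close> limits, together with their gradients, of \<open>C\<^sup>1\<close> periodic functions make up
  \<open>H1_per\<close>, and \<open>V0\<close> has a similar description; with the Poincare inequalities this makes both
  problems minimum problems for a coercive quadratic functional.  Since \<open>\<nabla>u\<^sub>r - \<nabla>u\<^sub>0\<close> is orthogonal to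
  \<open>\<nabla>\<phi> - \<nabla>u\<^sub>r\<close> for every \<open>\<phi>\<close> in \<open>V0\<close>, the extension of \<open>u\<^sub>r\<close> is the best approximation of \<open>u\<^sub>0\<close> in
  energy among functions vanishing on \<open>D\<^sub>r\<close>.  A point has zero capacity in the plane: cutoff functions
  vanishing near the origin are arbitrarily close to 1 with arbitrarily small energy.  Multiplying
  smooth approximations of \<open>u\<^sub>0\<close> by them gives (a), and using them as test functions bounds
  \<open>\<bar>\<integral>f\<bar>\<close> by an arbitrarily small multiple of \<open>\<parallel>\<nabla>u\<^sub>r\<parallel> + \<parallel>f\<parallel>\<close>, which gives (b).
\<close>

subsection \<open>Square integrable functions\<close>

text \<open>The working spaces consist of pairs of a function and a gradient.
  \<open>weak_grad\<close> is a choice determined only almost everywhere, whereas linearity and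
  closedness of a set of pairs are plain statements about L^2, and they are what minimisation asks
  for. The main obstacle is the hole. A C^1 function on the closed perforated square need not vanish
  on the circle, so its extension by zero jumps there. Cutting it off in an annulus of area
  proportional to \<delta>, with a gradient of order 1/\<delta>, shows that integration by parts
  fails only by a multiple of the L^2 norm on the circle. A zero trace removes this error in the
  limit, so the extension has a weak gradient on the whole square. The two Poincare inequalities
  play different roles. The bound for functions vanishing on the disc grows like 1/r and serves only
  at a fixed r. Convergence of the functions rests on the inequality for deviations from the mean,
  whose constant 2L does not involve r. Both come from translating periodic functions, without a
  compactness argument.\<close>

lemma L2D:
  assumes "u \<in> L2 U"
  shows "u \<in> borel_measurable (lebesgue_on U)" "integrable (lebesgue_on U) (\<lambda>x. (norm (u x))\<^sup>2)"
  using assms by (auto simp: L2_def)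

lemma L2_inner_integrable:
  assumes "u \<in> L2 U" "v \<in> L2 U"
  shows "integrable (lebesgue_on U) (\<lambda>x. u x \<bullet> v x)"
proof (rule Bochner_Integration.integrable_bound)
  show "integrable (lebesgue_on U) (\<lambda>x. (norm (u x))\<^sup>2 + (norm (v x))\<^sup>2)"
    using assms by (auto dest: L2D)
  have [measurable]: "u \<in> borel_measurable (lebesgue_on U)" "v \<in> borel_measurable (lebesgue_on U)"
    using assms by (auto dest: L2D)
  show "(\<lambda>x. u x \<bullet> v x) \<in> borel_measurable (lebesgue_on U)" by measurable
  have "\<bar>u x \<bullet> v x\<bar> \<le> \<bar>(norm (u x))\<^sup>2 + (norm (v x))\<^sup>2\<bar>" for x
  proof -
    have "\<bar>u x \<bullet> v x\<bar> \<le> norm (u x) * norm (v x)" by (rule Cauchy_Schwarz_ineq2)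
    moreover have "2 * (norm (u x) * norm (v x)) \<le> (norm (u x))\<^sup>2 + (norm (v x))\<^sup>2"
      using sum_squares_bound[of "norm (u x)" "norm (v x)"] by (simp add: mult.assoc)
    moreover have "0 \<le> norm (u x) * norm (v x)" by simp
    ultimately show ?thesis by linarith
  qed
  then show "AE x in lebesgue_on U. norm (u x \<bullet> v x) \<le> norm ((norm (u x))\<^sup>2 + (norm (v x))\<^sup>2)"
    by simp
qed

lemma L2_zero [simp]: "(\<lambda>x. 0) \<in> L2 U"
  by (simp add: L2_def)

lemma L2_add:
  assumes "u \<in> L2 U" "v \<in> L2 U"
  shows "(\<lambda>x. u x + v x) \<in> L2 U"
proof -
  have "(norm (u x + v x))\<^sup>2 = (norm (u x))\<^sup>2 + 2 * (u x \<bullet> v x) + (norm (v x))\<^sup>2" for x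
    by (simp add: power2_norm_eq_inner inner_add inner_commute)
  moreover have "integrable (lebesgue_on U) (\<lambda>x. (norm (u x))\<^sup>2 + 2 * (u x \<bullet> v x) + (norm (v x))\<^sup>2)"
    using L2D(2)[OF assms(1)] L2D(2)[OF assms(2)] L2_inner_integrable[OF assms] by simp
  ultimately show ?thesis
    using assms by (auto simp: L2_def)
qed

lemma L2_scaleR:
  assumes "u \<in> L2 U"
  shows "(\<lambda>x. c *\<^sub>R u x) \<in> L2 U"
  using assms by (auto simp: L2_def power_mult_distrib)

lemma L2_diff:
  assumes "u \<in> L2 U" "v \<in> L2 U"
  shows "(\<lambda>x. u x - v x) \<in> L2 U"
  using L2_add[OF assms(1) L2_scaleR[OF assms(2), of "-1"]] by simp

lemma L2_cong_AE:
  assumes "u \<in> L2 U" "AE x in lebesgue_on U. u x = v x" "v \<in> borel_measurable (lebesgue_on U)"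
  shows "v \<in> L2 U"
proof -
  have "integrable (lebesgue_on U) (\<lambda>x. (norm (v x))\<^sup>2)"
    by (rule integrable_cong_AE_imp[OF L2D(2)[OF assms(1)]]) (use assms in auto)
  then show ?thesis using assms by (auto simp: L2_def)
qed

lemma L2_cong:
  assumes "u \<in> L2 U" "\<And>x. x \<in> U \<Longrightarrow> u x = v x"
  shows "v \<in> L2 U"
proof -
  have "v \<in> borel_measurable (lebesgue_on U)"
    using L2D(1)[OF assms(1)] by (rule measurable_cong[THEN iffD1, rotated]) (use assms in auto)
  moreover have "AE x in lebesgue_on U. u x = v x"
    by (rule AE_I2) (use assms in auto)
  ultimately show ?thesis using L2_cong_AE assms(1) by blast
qed

lemma L2norm_nonneg [simp]: "0 \<le> L2norm U u"
  by (simp add: L2norm_def)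

lemma L2norm_sq: "(L2norm U u)\<^sup>2 = (\<integral>x. (norm (u x))\<^sup>2 \<partial>lebesgue_on U)"
  by (simp add: L2norm_def)

lemma L2norm_sq_inner: "(L2norm U u)\<^sup>2 = (\<integral>x. u x \<bullet> u x \<partial>lebesgue_on U)"
  by (simp add: L2norm_sq power2_norm_eq_inner)

lemma L2norm_zero [simp]: "L2norm U (\<lambda>x. 0) = 0"
  by (simp add: L2norm_def)

lemma L2norm_scaleR: "L2norm U (\<lambda>x. c *\<^sub>R u x) = \<bar>c\<bar> * L2norm U u"
  by (simp add: L2norm_def power_mult_distrib real_sqrt_mult)

lemma L2norm_cong_AE:
  assumes "AE x in lebesgue_on U. u x = v x"
    and "u \<in> borel_measurable (lebesgue_on U)" "v \<in> borel_measurable (lebesgue_on U)"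
  shows "L2norm U u = L2norm U v"
  unfolding L2norm_def by (intro arg_cong[where f=sqrt] integral_cong_AE) (use assms in auto)

lemma L2norm_cong:
  assumes "\<And>x. x \<in> U \<Longrightarrow> u x = v x"
  shows "L2norm U u = L2norm U v"
  unfolding L2norm_def
  by (intro arg_cong[where f=sqrt] Bochner_Integration.integral_cong) (use assms in auto)

text \<open>The quadratic polynomial in \<open>t\<close> on which the Cauchy-Schwarz inequality, the
  parallelogram identity for minimising sequences and the Euler equation all rest.\<close>

lemma L2norm_expand:
  assumes "u \<in> L2 U" "v \<in> L2 U"
  shows "(L2norm U (\<lambda>x. u x + t *\<^sub>R v x))\<^sup>2
    = (L2norm U u)\<^sup>2 + 2 * t * (\<integral>x. u x \<bullet> v x \<partial>lebesgue_on U) + t\<^sup>2 * (L2norm U v)\<^sup>2"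
proof -
  have "(norm (u x + t *\<^sub>R v x))\<^sup>2 = (norm (u x))\<^sup>2 + 2 * t * (u x \<bullet> v x) + t\<^sup>2 * (norm (v x))\<^sup>2" for x
    unfolding power2_norm_eq_inner
    by (simp add: inner_add inner_commute algebra_simps power2_eq_square)
  then show ?thesis
    using L2D(2)[OF assms(1)] L2D(2)[OF assms(2)] L2_inner_integrable[OF assms]
    by (simp add: L2norm_sq)
qed

lemma L2_Cauchy_Schwarz:
  assumes "u \<in> L2 U" "v \<in> L2 U"
  shows "\<bar>\<integral>x. u x \<bullet> v x \<partial>lebesgue_on U\<bar> \<le> L2norm U u * L2norm U v"
proof -
  define a b c where "a = L2norm U u" and "b = L2norm U v"
    and "c = (\<integral>x. u x \<bullet> v x \<partial>lebesgue_on U)"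
  have q: "0 \<le> a\<^sup>2 + 2 * t * c + t\<^sup>2 * b\<^sup>2" for t
    using L2norm_expand[OF assms, of t] unfolding a_def b_def c_def by (metis zero_le_power2)
  have "c\<^sup>2 \<le> (a * b)\<^sup>2"
  proof (cases "b = 0")
    case False
    \<comment> \<open>The parameter \<open>- c / b\<^sup>2\<close> minimises the quadratic;
      multiplying by \<open>b\<^sup>2\<close> turns its nonnegative minimum into the
      inequality.\<close>
    then have "0 \<le> (a\<^sup>2 + 2 * (- c / b\<^sup>2) * c + (- c / b\<^sup>2)\<^sup>2 * b\<^sup>2) * b\<^sup>2"
      using q[of "- c / b\<^sup>2"] by (intro mult_nonneg_nonneg) auto
    also have "\<dots> = a\<^sup>2 * b\<^sup>2 - c\<^sup>2"
      using False by (simp add: field_simps power2_eq_square)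
    finally show ?thesis by (simp add: power_mult_distrib)
  next
    case True
    \<comment> \<open>With \<open>b = 0\<close> the polynomial is affine in \<open>t\<close>, so a
      nonzero slope would make it negative somewhere: the parameter chosen below gives it the value
      -1.\<close>
    have "c = 0"
    proof (rule ccontr)
      assume "c \<noteq> 0"
      then have "2 * (- (a\<^sup>2 + 1) / (2 * c)) * c = - (a\<^sup>2 + 1)" by (simp add: field_simps)
      with q[of "- (a\<^sup>2 + 1) / (2 * c)"] True show False by simp
    qed
    then show ?thesis by simp
  qed
  then have "\<bar>c\<bar> \<le> \<bar>a * b\<bar>" by (simp add: abs_le_square_iff)
  then show ?thesis by (simp add: a_def b_def c_def)
qed

lemma L2norm_triangle:
  assumes "u \<in> L2 U" "v \<in> L2 U"
  shows "L2norm U (\<lambda>x. u x + v x) \<le> L2norm U u + L2norm U v"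
proof -
  have "(L2norm U (\<lambda>x. u x + v x))\<^sup>2 \<le> (L2norm U u + L2norm U v)\<^sup>2"
    using L2norm_expand[OF assms, of 1] L2_Cauchy_Schwarz[OF assms]
    by (simp add: power2_eq_square algebra_simps)
  then show ?thesis by (rule power2_le_imp_le) simp
qed

lemma L2norm_diff_commute: "L2norm U (\<lambda>x. u x - v x) = L2norm U (\<lambda>x. v x - u x)"
  by (simp add: L2norm_def norm_minus_commute)

lemma L2norm_triangle_diff:
  assumes "u \<in> L2 U" "v \<in> L2 U" "w \<in> L2 U"
  shows "L2norm U (\<lambda>x. u x - w x) \<le> L2norm U (\<lambda>x. u x - v x) + L2norm U (\<lambda>x. v x - w x)"
  using L2norm_triangle[OF L2_diff[OF assms(1,2)] L2_diff[OF assms(2,3)]] by simp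

lemma L2norm_le_add:
  assumes "u \<in> L2 U" "v \<in> L2 U"
  shows "L2norm U u \<le> L2norm U (\<lambda>x. u x - v x) + L2norm U v"
  using L2norm_triangle[OF L2_diff[OF assms] assms(2)] by simp

lemma L2_mono_bound:
  assumes "v \<in> L2 U" "u \<in> borel_measurable (lebesgue_on U)" "\<And>x. x \<in> U \<Longrightarrow> norm (u x) \<le> norm (v x)"
  shows "u \<in> L2 U" "L2norm U u \<le> L2norm U v"
proof -
  have "integrable (lebesgue_on U) (\<lambda>x. (norm (u x))\<^sup>2)"
    by (rule Bochner_Integration.integrable_bound[OF L2D(2)[OF assms(1)]])
      (use assms in \<open>auto intro!: power_mono AE_I2\<close>)
  then show "u \<in> L2 U" using assms by (auto simp: L2_def)
  then show "L2norm U u \<le> L2norm U v"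
    unfolding L2norm_def using assms
    by (intro real_sqrt_le_mono integral_mono) (auto dest: L2D intro!: power_mono)
qed

lemma L2_const:
  assumes "U \<in> lmeasurable"
  shows "(\<lambda>x. c) \<in> L2 U" "L2norm U (\<lambda>x. c) = sqrt (measure lebesgue U) * norm c"
proof -
  interpret finite_measure "lebesgue_on U"
    using assms by (rule finite_measure_lebesgue_on)
  show "(\<lambda>x. c) \<in> L2 U"
    by (simp add: L2_def)
  show "L2norm U (\<lambda>x. c) = sqrt (measure lebesgue U) * norm c"
    using assms by (simp add: L2norm_def measure_restrict_space fmeasurableD real_sqrt_mult)
qed

lemma L2_bounded:
  assumes "U \<in> lmeasurable" "u \<in> borel_measurable (lebesgue_on U)" "\<And>x. x \<in> U \<Longrightarrow> norm (u x) \<le> B"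
    "0 \<le> B"
  shows "u \<in> L2 U" "L2norm U u \<le> sqrt (measure lebesgue U) * B"
  using L2_mono_bound[OF L2_const(1)[OF assms(1), of B] assms(2)] assms L2_const(2)[OF assms(1), of B]
  by auto

text \<open>Cauchy-Schwarz against the constant 1. On a set of finite measure the L^2 norm thus
  controls the L^1 norm.\<close>

lemma L2_integrable:
  assumes "U \<in> lmeasurable" "u \<in> L2 U"
  shows "integrable (lebesgue_on U) u"
    and "(\<integral>x. norm (u x) \<partial>lebesgue_on U) \<le> sqrt (measure lebesgue U) * L2norm U u"
proof -
  have n: "(\<lambda>x. norm (u x)) \<in> L2 U" using assms(2) by (auto simp: L2_def)
  have "integrable (lebesgue_on U) (\<lambda>x. norm (u x))"
    using L2_inner_integrable[OF n L2_const(1)[OF assms(1), of 1]] by simp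
  then show "integrable (lebesgue_on U) u"
    using L2D(1)[OF assms(2)] by (simp add: integrable_norm_iff)
  have "L2norm U (\<lambda>x. norm (u x)) = L2norm U u" by (simp add: L2norm_def)
  then show "(\<integral>x. norm (u x) \<partial>lebesgue_on U) \<le> sqrt (measure lebesgue U) * L2norm U u"
    using L2_Cauchy_Schwarz[OF n L2_const(1)[OF assms(1), of 1]] L2_const(2)[OF assms(1), of "1::real"]
    by (simp add: mult.commute)
qed

lemma L2_AE_zero:
  assumes "u \<in> L2 U" "L2norm U u = 0"
  shows "AE x in lebesgue_on U. u x = 0"
proof -
  have "(\<integral>x. (norm (u x))\<^sup>2 \<partial>lebesgue_on U) = 0"
    using assms(2) L2norm_sq[of U u] by simp
  then have "AE x in lebesgue_on U. (norm (u x))\<^sup>2 = 0"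
    by (subst (asm) integral_nonneg_eq_0_iff_AE[OF L2D(2)[OF assms(1)]]) auto
  then show ?thesis by simp
qed

section \<open>Restriction to smaller sets\<close>

lemma integrable_lebesgue_on_subset:
  fixes h :: "'a::euclidean_space \<Rightarrow> 'b::{banach, second_countable_topology}"
  assumes "integrable (lebesgue_on U) h" "V \<subseteq> U" "U \<in> sets lebesgue" "V \<in> sets lebesgue"
  shows "integrable (lebesgue_on V) h"
proof -
  have "set_integrable lebesgue U h"
    using assms by (simp add: integrable_restrict_space set_integrable_def)
  then have "set_integrable lebesgue V h"
    by (rule set_integrable_subset) (use assms in auto)
  then show ?thesis
    using assms by (simp add: integrable_restrict_space set_integrable_def)
qed

lemma borel_measurable_lebesgue_on_subset:
  assumes "u \<in> borel_measurable (lebesgue_on U)" "V \<subseteq> U"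
  shows "u \<in> borel_measurable (lebesgue_on V)"
  using measurable_restrict_mono[OF assms] .

lemma L2_subset:
  assumes "u \<in> L2 U" "V \<subseteq> U" "U \<in> sets lebesgue" "V \<in> sets lebesgue"
  shows "u \<in> L2 V"
  using assms
  by (auto simp: L2_def intro: borel_measurable_lebesgue_on_subset integrable_lebesgue_on_subset)

lemma integral_lebesgue_on_subset_le:
  fixes h :: "'a::euclidean_space \<Rightarrow> real"
  assumes "integrable (lebesgue_on U) h" "V \<subseteq> U" "U \<in> sets lebesgue" "V \<in> sets lebesgue"
    "\<And>x. x \<in> U \<Longrightarrow> 0 \<le> h x"
  shows "(\<integral>x. h x \<partial>lebesgue_on V) \<le> (\<integral>x. h x \<partial>lebesgue_on U)"
proof -
  have U: "set_integrable lebesgue U h"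
    using assms by (simp add: integrable_restrict_space set_integrable_def)
  then have V: "set_integrable lebesgue V h"
    by (rule set_integrable_subset) (use assms in auto)
  have "(LINT x:V|lebesgue. h x) \<le> (LINT x:U|lebesgue. h x)"
    unfolding set_lebesgue_integral_def
    using assms(2,5) U V unfolding set_integrable_def
    by (intro integral_mono) (auto simp: indicator_def)
  then show ?thesis
    using assms by (simp add: integral_restrict_space set_lebesgue_integral_def)
qed

lemma L2norm_subset:
  assumes "u \<in> L2 U" "V \<subseteq> U" "U \<in> sets lebesgue" "V \<in> sets lebesgue"
  shows "L2norm V u \<le> L2norm U u"
  unfolding L2norm_def
  by (intro real_sqrt_le_mono integral_lebesgue_on_subset_le) (use assms in \<open>auto dest: L2D\<close>)

section \<open>Almost everywhere convergence, domination and completeness\<close>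

lemma L2_AE_subseq:
  assumes "\<And>n. u n \<in> L2 U" "v \<in> L2 U" "(\<lambda>n. L2norm U (\<lambda>x. u n x - v x)) \<longlonglongrightarrow> 0"
  shows "\<exists>s::nat\<Rightarrow>nat. strict_mono s \<and> (AE x in lebesgue_on U. (\<lambda>n. u (s n) x) \<longlonglongrightarrow> v x)"
proof -
  have "(\<lambda>n. (L2norm U (\<lambda>x. u n x - v x))\<^sup>2) \<longlonglongrightarrow> 0\<^sup>2"
    by (intro tendsto_power assms)
  then have "\<exists>s::nat\<Rightarrow>nat. strict_mono s \<and>
     (AE x in lebesgue_on U. (\<lambda>n. (norm (u (s n) x - v x))\<^sup>2) \<longlonglongrightarrow> 0)"
    by (intro tendsto_L1_AE_subseq) (use assms in \<open>auto simp: L2norm_sq dest: L2D(2)[OF L2_diff]\<close>)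
  then obtain s :: "nat \<Rightarrow> nat" where s: "strict_mono s"
    "AE x in lebesgue_on U. (\<lambda>n. (norm (u (s n) x - v x))\<^sup>2) \<longlonglongrightarrow> 0" by blast
  have "AE x in lebesgue_on U. (\<lambda>n. u (s n) x) \<longlonglongrightarrow> v x"
    using s(2)
  proof eventually_elim
    fix x assume "(\<lambda>n. (norm (u (s n) x - v x))\<^sup>2) \<longlonglongrightarrow> 0"
    then have "(\<lambda>n. sqrt ((norm (u (s n) x - v x))\<^sup>2)) \<longlonglongrightarrow> sqrt 0" by (rule tendsto_real_sqrt)
    then show "(\<lambda>n. u (s n) x) \<longlonglongrightarrow> v x"
      by (simp add: tendsto_norm_zero_iff LIM_zero_iff)
  qed
  with s(1) show ?thesis by blast
qed

lemma L2_dominated_convergence: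
  assumes "\<And>n. u n \<in> borel_measurable (lebesgue_on U)" "v \<in> borel_measurable (lebesgue_on U)" "h \<in> L2 U"
    "AE x in lebesgue_on U. (\<lambda>n. u n x) \<longlonglongrightarrow> v x"
    "\<And>n. AE x in lebesgue_on U. norm (u n x) \<le> norm (h x)"
  shows "(\<lambda>n. L2norm U (\<lambda>x. u n x - v x)) \<longlonglongrightarrow> 0"
proof -
  have bv: "AE x in lebesgue_on U. \<forall>n. norm (u n x) \<le> norm (h x)"
    using assms(5) by (simp add: AE_all_countable)
  have "(\<lambda>n. \<integral>x. (norm (u n x - v x))\<^sup>2 \<partial>lebesgue_on U) \<longlonglongrightarrow> (\<integral>x. 0 \<partial>lebesgue_on U)"
  proof (rule integral_dominated_convergence)
    \<comment> \<open>The pointwise limit inherits the bound by \<open>h\<close>, so a difference is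
      at most \<open>2 * norm (h x)\<close>; squaring gives the factor 4.\<close>
    show "integrable (lebesgue_on U) (\<lambda>x. 4 * (norm (h x))\<^sup>2)"
      using assms(3) by (auto dest: L2D)
    show "AE x in lebesgue_on U. (\<lambda>i. (norm (u i x - v x))\<^sup>2) \<longlonglongrightarrow> 0"
      using assms(4)
    proof eventually_elim
      fix x assume "(\<lambda>n. u n x) \<longlonglongrightarrow> v x"
      then have "(\<lambda>i. (norm (u i x - v x))\<^sup>2) \<longlonglongrightarrow> (norm (v x - v x))\<^sup>2" by (intro tendsto_intros)
      then show "(\<lambda>i. (norm (u i x - v x))\<^sup>2) \<longlonglongrightarrow> 0" by simp
    qed
    show "AE x in lebesgue_on U. norm ((norm (u i x - v x))\<^sup>2) \<le> 4 * (norm (h x))\<^sup>2" for i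
      using assms(4) bv
    proof eventually_elim
      fix x assume lim: "(\<lambda>n. u n x) \<longlonglongrightarrow> v x" and b: "\<forall>n. norm (u n x) \<le> norm (h x)"
      have "norm (v x) \<le> norm (h x)"
        by (rule LIMSEQ_le_const2[OF tendsto_norm[OF lim]]) (use b in auto)
      then have "norm (u i x - v x) \<le> 2 * norm (h x)"
        using b norm_triangle_ineq4[of "u i x" "v x"] by (smt (verit))
      then have "(norm (u i x - v x))\<^sup>2 \<le> (2 * norm (h x))\<^sup>2" by (intro power_mono) auto
      then show "norm ((norm (u i x - v x))\<^sup>2) \<le> 4 * (norm (h x))\<^sup>2" by (simp add: power_mult_distrib)
    qed
  qed (use assms in auto)
  then have "(\<lambda>n. sqrt (\<integral>x. (norm (u n x - v x))\<^sup>2 \<partial>lebesgue_on U)) \<longlonglongrightarrow> sqrt 0"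
    by (intro tendsto_real_sqrt) simp
  then show ?thesis by (simp add: L2norm_def)
qed

text \<open>Completeness is only needed on sets of finite measure, where a fast Cauchy sequence is
  absolutely summable in \<open>L\<^sup>1\<close> and hence converges almost everywhere.\<close>

lemma L2_complete:
  fixes u :: "nat \<Rightarrow> 'a::euclidean_space \<Rightarrow> 'b::euclidean_space"
  assumes U: "U \<in> lmeasurable" and u: "\<And>n. u n \<in> L2 U"
    and Cauchy: "\<And>e. e > 0 \<Longrightarrow> \<exists>N. \<forall>m\<ge>N. \<forall>n\<ge>N. L2norm U (\<lambda>x. u m x - u n x) < e"
  shows "\<exists>v\<in>L2 U. (\<lambda>n. L2norm U (\<lambda>x. u n x - v x)) \<longlonglongrightarrow> 0"
proof -
  let ?M = "lebesgue_on U"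
  have [measurable]: "u n \<in> borel_measurable ?M" for n using u by (auto dest: L2D)
  \<comment> \<open>Beyond the index \<open>s k\<close> all differences are below
    \<open>(1/2)^k\<close>, so consecutive members of the subsequence have a summable series of L^1
    distances.\<close>
  have "\<exists>s. \<forall>k::nat. (\<forall>m\<ge>s k. \<forall>n\<ge>s k. L2norm U (\<lambda>x. u m x - u n x) < (1/2)^k) \<and> s k < s (Suc k)"
  proof (rule dependent_nat_choice)
    show "\<exists>x. \<forall>m\<ge>x. \<forall>n\<ge>x. L2norm U (\<lambda>x. u m x - u n x) < (1/2)^0"
      using Cauchy[of 1] by auto
    show "\<exists>y. (\<forall>m\<ge>y. \<forall>n\<ge>y. L2norm U (\<lambda>x. u m x - u n x) < (1 / 2) ^ Suc k) \<and> x < y" for x k :: nat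
    proof -
      obtain N where N: "\<forall>m\<ge>N. \<forall>n\<ge>N. L2norm U (\<lambda>x. u m x - u n x) < (1/2)^Suc k"
        using Cauchy[of "(1/2)^Suc k"] by auto
      then show ?thesis by (intro exI[of _ "max N (Suc x)"]) auto
    qed
  qed
  then obtain s where s: "\<And>k m n. m \<ge> s k \<Longrightarrow> n \<ge> s k \<Longrightarrow> L2norm U (\<lambda>x. u m x - u n x) < (1/2)^k"
    and s_mono: "\<And>k. s k < s (Suc k)" by blast
  have "strict_mono s" using s_mono by (simp add: strict_mono_Suc_iff)
  define d where "d k x = norm (u (s (Suc k)) x - u (s k) x)" for k x
  have dm[measurable]: "d k \<in> borel_measurable ?M" for k unfolding d_def by measurable
  define c where "c = sqrt (measure lebesgue U)"
  have c0: "0 \<le> c" by (simp add: c_def)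
  have d1: "(\<integral>\<^sup>+x. ennreal (d k x) \<partial>?M) \<le> ennreal (c * (1/2)^k)" for k
  proof -
    have l2: "(\<lambda>x. u (s (Suc k)) x - u (s k) x) \<in> L2 U" by (intro L2_diff u)
    have i: "integrable ?M (d k)" unfolding d_def using L2_integrable(1)[OF U l2] by simp
    have "(\<integral>x. d k x \<partial>?M) \<le> c * L2norm U (\<lambda>x. u (s (Suc k)) x - u (s k) x)"
      unfolding d_def c_def by (rule L2_integrable(2)[OF U l2])
    also have "\<dots> \<le> c * (1/2)^k"
      using s[of k "s (Suc k)" "s k"] s_mono[of k] c0 by (intro mult_left_mono) auto
    finally have "(\<integral>x. d k x \<partial>?M) \<le> c * (1/2)^k" .
    moreover have "(\<integral>\<^sup>+x. ennreal (d k x) \<partial>?M) = ennreal (\<integral>x. d k x \<partial>?M)"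
      by (rule nn_integral_eq_integral[OF i]) (simp add: d_def)
    ultimately show ?thesis by (simp add: ennreal_leI)
  qed
  have "(\<integral>\<^sup>+x. (\<Sum>k. ennreal (d k x)) \<partial>?M) = (\<Sum>k. \<integral>\<^sup>+x. ennreal (d k x) \<partial>?M)"
    by (rule nn_integral_suminf) simp
  also have "\<dots> \<le> (\<Sum>k. ennreal (c * (1/2)^k))" by (intro suminf_le d1) auto
  also have "\<dots> = ennreal (\<Sum>k. c * (1/2)^k)"
    by (intro suminf_ennreal2) (use c0 in \<open>auto intro!: summable_mult summable_geometric\<close>)
  also have "\<dots> < \<infinity>" by simp
  finally have fin: "(\<integral>\<^sup>+x. (\<Sum>k. ennreal (d k x)) \<partial>?M) \<noteq> \<infinity>" by simp
  have "AE x in ?M. (\<Sum>k. ennreal (d k x)) \<noteq> \<infinity>"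
    by (rule nn_integral_PInf_AE[OF _ fin]) measurable
  then have conv: "AE x in ?M. convergent (\<lambda>k. u (s k) x)"
  proof eventually_elim
    fix x assume "(\<Sum>k. ennreal (d k x)) \<noteq> \<infinity>"
    then have "summable (\<lambda>k. d k x)"
      by (intro summable_suminf_not_top) (auto simp: d_def)
    then have "summable (\<lambda>k. u (s (Suc k)) x - u (s k) x)"
      unfolding d_def by (rule summable_norm_cancel)
    then have "convergent (\<lambda>n. \<Sum>k<n. u (s (Suc k)) x - u (s k) x)"
      by (simp add: summable_iff_convergent)
    then have "convergent (\<lambda>n. (\<Sum>k<n. u (s (Suc k)) x - u (s k) x) + u (s 0) x)"
      by (intro convergent_add convergent_const)
    then show "convergent (\<lambda>k. u (s k) x)"
      by (simp add: sum_lessThan_telescope[of "\<lambda>k. u (s k) x"])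
  qed
  define v where "v x = lim (\<lambda>k. u (s k) x)" for x
  have vm[measurable]: "v \<in> borel_measurable ?M"
    unfolding v_def by (rule borel_measurable_lim_metric) measurable
  have lim: "AE x in ?M. (\<lambda>k. u (s k) x) \<longlonglongrightarrow> v x"
    using conv by eventually_elim (simp add: v_def convergent_LIMSEQ_iff)
  \<comment> \<open>Fatou's lemma along the subsequence passes the Cauchy bound on to the limit. It
    is stated with the nonnegative integral because \<open>u n - v\<close> is not yet known to lie
    in L^2.\<close>
  have bound: "(\<integral>\<^sup>+x. ennreal ((norm (u n x - v x))\<^sup>2) \<partial>?M) \<le> ennreal (((1/2)^k)\<^sup>2)" if n: "n \<ge> s k" for n k
  proof -
    have "(\<integral>\<^sup>+x. ennreal ((norm (u n x - v x))\<^sup>2) \<partial>?M)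
       = (\<integral>\<^sup>+x. liminf (\<lambda>j. ennreal ((norm (u n x - u (s j) x))\<^sup>2)) \<partial>?M)"
    proof (rule nn_integral_cong_AE)
      show "AE x in ?M. ennreal ((norm (u n x - v x))\<^sup>2) = liminf (\<lambda>j. ennreal ((norm (u n x - u (s j) x))\<^sup>2))"
        using lim
      proof eventually_elim
        fix x assume "(\<lambda>k. u (s k) x) \<longlonglongrightarrow> v x"
        then have "(\<lambda>j. ennreal ((norm (u n x - u (s j) x))\<^sup>2)) \<longlonglongrightarrow> ennreal ((norm (u n x - v x))\<^sup>2)"
          by (intro tendsto_ennrealI tendsto_intros)
        then show "ennreal ((norm (u n x - v x))\<^sup>2) = liminf (\<lambda>j. ennreal ((norm (u n x - u (s j) x))\<^sup>2))"
          using lim_imp_Liminf[OF sequentially_bot, symmetric] by blast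
      qed
    qed
    also have "\<dots> \<le> liminf (\<lambda>j. \<integral>\<^sup>+x. ennreal ((norm (u n x - u (s j) x))\<^sup>2) \<partial>?M)"
      by (rule nn_integral_liminf) measurable
    also have "\<dots> \<le> ennreal (((1/2)^k)\<^sup>2)"
    proof (rule Liminf_le)
      show "\<forall>\<^sub>F j in sequentially. (\<integral>\<^sup>+x. ennreal ((norm (u n x - u (s j) x))\<^sup>2) \<partial>?M) \<le> ennreal (((1/2)^k)\<^sup>2)"
        using eventually_ge_at_top[of k]
      proof eventually_elim
        fix j assume "k \<le> j"
        then have "s k \<le> s j" using \<open>strict_mono s\<close> by (simp add: strict_mono_less_eq)
        then have "L2norm U (\<lambda>x. u n x - u (s j) x) \<le> (1/2)^k" using s[of k n "s j"] n by simp
        then have "(L2norm U (\<lambda>x. u n x - u (s j) x))\<^sup>2 \<le> ((1/2)^k)\<^sup>2" by (intro power_mono) auto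
        moreover have "(\<integral>\<^sup>+x. ennreal ((norm (u n x - u (s j) x))\<^sup>2) \<partial>?M)
            = ennreal ((L2norm U (\<lambda>x. u n x - u (s j) x))\<^sup>2)"
          unfolding L2norm_sq by (intro nn_integral_eq_integral L2D L2_diff u) auto
        ultimately show "(\<integral>\<^sup>+x. ennreal ((norm (u n x - u (s j) x))\<^sup>2) \<partial>?M) \<le> ennreal (((1/2)^k)\<^sup>2)"
          by (simp add: ennreal_leI)
      qed
    qed simp
    finally show ?thesis .
  qed
  \<comment> \<open>A single difference in L^2 suffices, since \<open>v\<close> is then a difference
    of two L^2 functions.\<close>
  have "(\<lambda>x. u (s 0) x - v x) \<in> L2 U"
    unfolding L2_def
  proof safe
    show "(\<lambda>x. u (s 0) x - v x) \<in> borel_measurable ?M" by measurable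
    show "integrable ?M (\<lambda>x. (norm (u (s 0) x - v x))\<^sup>2)"
      by (rule integrableI_bounded) (use bound[of 0 "s 0"] in \<open>auto intro: le_less_trans\<close>)
  qed
  from L2_diff[OF u[of "s 0"] this] have v: "v \<in> L2 U" by simp
  have nb: "L2norm U (\<lambda>x. u n x - v x) \<le> (1/2)^k" if n: "n \<ge> s k" for n k
  proof -
    have "(\<integral>\<^sup>+x. ennreal ((norm (u n x - v x))\<^sup>2) \<partial>?M) = ennreal ((L2norm U (\<lambda>x. u n x - v x))\<^sup>2)"
      unfolding L2norm_sq by (intro nn_integral_eq_integral L2D L2_diff u v) auto
    then have "(L2norm U (\<lambda>x. u n x - v x))\<^sup>2 \<le> ((1/2)^k)\<^sup>2"
      using bound[OF n] by (simp add: ennreal_le_iff)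
    then show ?thesis by (rule power2_le_imp_le) simp
  qed
  have "(\<lambda>n. L2norm U (\<lambda>x. u n x - v x)) \<longlonglongrightarrow> 0"
  proof (rule LIMSEQ_I)
    fix e :: real assume "e > 0"
    then obtain k where "(1/2)^k < e" using real_arch_pow_inv[of e "1/2"] by auto
    then show "\<exists>N. \<forall>n\<ge>N. norm (L2norm U (\<lambda>x. u n x - v x) - 0) < e"
      using nb[of k] by (intro exI[of _ "s k"]) (auto intro: le_less_trans)
  qed
  with v show ?thesis by blast
qed

text \<open>The minimum over a closed subspace of the quadratic functional
  \<open>\<parallel>g\<parallel>\<^sup>2 - 2 \<integral> f v\<close> is attained; its Euler equation is the weak form of the problem.\<close>

lemma L2_variational_solution:
  fixes S :: "('a::euclidean_space \<Rightarrow> real) \<Rightarrow> ('a \<Rightarrow> 'b::euclidean_space) \<Rightarrow> bool"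
  assumes U: "U \<in> lmeasurable" and f: "f \<in> L2 U"
    and L2: "\<And>v g. S v g \<Longrightarrow> v \<in> L2 U \<and> g \<in> L2 U"
    and zero: "S (\<lambda>x. 0) (\<lambda>x. 0)"
    and lin: "\<And>v g v' g' t. S v g \<Longrightarrow> S v' g' \<Longrightarrow> S (\<lambda>x. v x + t *\<^sub>R v' x) (\<lambda>x. g x + t *\<^sub>R g' x)"
    and C: "\<And>v g. S v g \<Longrightarrow> L2norm U v \<le> C * L2norm U g" "0 \<le> C"
    and closed: "\<And>v g. v \<in> L2 U \<Longrightarrow> g \<in> L2 U \<Longrightarrow>
      (\<And>e. e > 0 \<Longrightarrow> \<exists>v' g'. S v' g' \<and> L2norm U (\<lambda>x. v x - v' x) < e \<and> L2norm U (\<lambda>x. g x - g' x) < e)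
      \<Longrightarrow> S v g"
  shows "\<exists>u h. S u h \<and> (\<forall>v g. S v g \<longrightarrow>
    (\<integral>x. h x \<bullet> g x \<partial>lebesgue_on U) = (\<integral>x. f x * v x \<partial>lebesgue_on U))"
proof -
  define F where "F v = (\<integral>x. f x * v x \<partial>lebesgue_on U)" for v
  define J where "J v g = (L2norm U g)\<^sup>2 - 2 * F v" for v and g :: "'a \<Rightarrow> 'b"
  define D where "D = L2norm U f * C"
  have Fb: "\<bar>F v\<bar> \<le> L2norm U f * L2norm U v" if "v \<in> L2 U" for v
    using L2_Cauchy_Schwarz[OF f that] by (simp add: F_def)
  have Fint: "integrable (lebesgue_on U) (\<lambda>x. f x * v x)" if "v \<in> L2 U" for v
    using L2_inner_integrable[OF f that] by simp
  have Flin: "F (\<lambda>x. v x + t *\<^sub>R w x) = F v + t * F w" if "v \<in> L2 U" "w \<in> L2 U" for v w t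
  proof -
    have "F (\<lambda>x. v x + t *\<^sub>R w x) = (\<integral>x. f x * v x + t * (f x * w x) \<partial>lebesgue_on U)"
      unfolding F_def by (simp add: algebra_simps)
    also have "\<dots> = F v + t * F w"
      unfolding F_def using Fint[OF that(1)] Fint[OF that(2)] by simp
    finally show ?thesis .
  qed
  have D: "\<bar>F v\<bar> \<le> D * L2norm U g" if "S v g" for v g
  proof -
    have "\<bar>F v\<bar> \<le> L2norm U f * L2norm U v" using Fb L2[OF that] by blast
    also have "\<dots> \<le> L2norm U f * (C * L2norm U g)" by (intro mult_left_mono C that) simp
    finally show ?thesis by (simp add: D_def mult.assoc)
  qed
  \<comment> \<open>Completing the square in \<open>L2norm U g\<close>; coercivity enters through
    \<open>D\<close>, which bounds the linear term by the gradient.\<close>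
  have lower: "- D\<^sup>2 \<le> J v g" if "S v g" for v g
  proof -
    have "0 \<le> (L2norm U g - D)\<^sup>2" by simp
    then have "- D\<^sup>2 \<le> (L2norm U g)\<^sup>2 - 2 * (D * L2norm U g)" by (simp add: power2_eq_square algebra_simps)
    then show ?thesis using D[OF that] unfolding J_def by linarith
  qed
  define m where "m = Inf {J v g |v g. S v g}"
  have bdd: "bdd_below {J v g |v g. S v g}"
    by (rule bdd_belowI[of _ "- D\<^sup>2"]) (use lower in auto)
  have m: "m \<le> J v g" if "S v g" for v g
    unfolding m_def by (rule cInf_lower[OF _ bdd]) (use that in auto)
  have "\<exists>v g. S v g \<and> J v g < m + e" if "e > 0" for e
  proof -
    have "\<exists>y\<in>{J v g |v g. S v g}. y < m + e"
      by (rule cInf_lessD) (use zero that in \<open>auto simp: m_def\<close>)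
    then show ?thesis by auto
  qed
  from this[of "inverse (real (Suc _))"]
  have "\<forall>n. \<exists>v g. S v g \<and> J v g < m + inverse (real (Suc n))" by simp
  then obtain v g where vg: "\<And>n. S (v n) (g n)" "\<And>n. J (v n) (g n) < m + inverse (real (Suc n))"
    by metis
  have v2: "v n \<in> L2 U" and g2: "g n \<in> L2 U" for n using L2 vg(1) by auto
  \<comment> \<open>Parallelogram identity: the midpoint of two near-minimisers is admissible, so
    its value is at least \<open>m\<close>. The linear terms cancel, and the squared distance of the
    gradients is bounded by the two excesses over \<open>m\<close>.\<close>
  have Cg: "(L2norm U (\<lambda>x. g n x - g k x))\<^sup>2 \<le> 2 * (inverse (real (Suc n)) + inverse (real (Suc k)))" for n k
  proof -
    have S1: "S (\<lambda>x. v n x + 1 *\<^sub>R v k x) (\<lambda>x. g n x + 1 *\<^sub>R g k x)" by (intro lin vg)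
    \<comment> \<open>Closure of \<open>S\<close> is available only in the form
      \<open>v + t v'\<close>, so halving is written as an addition to the zero pair.\<close>
    have "S (\<lambda>x. 0 + (1/2) *\<^sub>R (v n x + 1 *\<^sub>R v k x)) (\<lambda>x. 0 + (1/2) *\<^sub>R (g n x + 1 *\<^sub>R g k x))"
      by (rule lin[OF zero S1])
    then have Sm: "m \<le> J (\<lambda>x. 0 + (1/2) *\<^sub>R (v n x + 1 *\<^sub>R v k x)) (\<lambda>x. 0 + (1/2) *\<^sub>R (g n x + 1 *\<^sub>R g k x))"
      by (rule m)
    have F0: "F (\<lambda>x. 0) = 0" by (simp add: F_def)
    have F2: "F (\<lambda>x. 0 + (1/2) *\<^sub>R (v n x + 1 *\<^sub>R v k x)) = (F (v n) + F (v k)) / 2"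
      using Flin[OF L2_zero L2_add[OF v2[of n] v2[of k]], of "1/2"] Flin[OF v2[of n] v2[of k], of 1] F0
      by (simp add: mult.commute)
    define a b c where "a = (L2norm U (g n))\<^sup>2" and "b = (L2norm U (g k))\<^sup>2"
      and "c = (\<integral>x. g n x \<bullet> g k x \<partial>lebesgue_on U)"
    have N1: "(L2norm U (\<lambda>x. g n x - g k x))\<^sup>2 = a - 2 * c + b"
      using L2norm_expand[OF g2[of n] g2[of k], of "-1"] by (simp add: a_def b_def c_def)
    have N2: "(L2norm U (\<lambda>x. 0 + (1/2) *\<^sub>R (g n x + 1 *\<^sub>R g k x)))\<^sup>2 = (a + 2 * c + b) / 4"
    proof -
      have "L2norm U (\<lambda>x. 0 + (1/2) *\<^sub>R (g n x + 1 *\<^sub>R g k x))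
          = (1/2) * L2norm U (\<lambda>x. g n x + 1 *\<^sub>R g k x)"
        using L2norm_scaleR[of U "1/2" "\<lambda>x. g n x + 1 *\<^sub>R g k x"] by simp
      then have "(L2norm U (\<lambda>x. 0 + (1/2) *\<^sub>R (g n x + 1 *\<^sub>R g k x)))\<^sup>2
          = (1/2)\<^sup>2 * (L2norm U (\<lambda>x. g n x + 1 *\<^sub>R g k x))\<^sup>2"
        by (simp only: power_mult_distrib)
      then show ?thesis
        unfolding L2norm_expand[OF g2[of n] g2[of k], of 1]
        by (simp add: a_def b_def c_def power_divide)
    qed
    have "a - 2 * c + b \<le> 2 * (p + q)"
      if "m \<le> (a + 2 * c + b) / 4 - 2 * ((F (v n) + F (v k)) / 2)"
        "a - 2 * F (v n) < m + p" "b - 2 * F (v k) < m + q" for p q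
      using that by argo
    then show ?thesis
      using Sm vg(2)[of n] vg(2)[of k] unfolding N1 J_def N2 F2 a_def[symmetric] b_def[symmetric]
      by blast
  qed
  have Cauchy: "\<exists>N. \<forall>n\<ge>N. \<forall>k\<ge>N. L2norm U (\<lambda>x. g n x - g k x) < e" if "e > 0" for e
  proof -
    have "e\<^sup>2 / 4 > 0" using that by simp
    then obtain N where N: "inverse (real (Suc N)) < e\<^sup>2 / 4" using reals_Archimedean by blast
    have "L2norm U (\<lambda>x. g n x - g k x) < e" if "n \<ge> N" "k \<ge> N" for n k
    proof -
      have "inverse (real (Suc n)) \<le> inverse (real (Suc N))" "inverse (real (Suc k)) \<le> inverse (real (Suc N))"
        using that by (auto intro!: le_imp_inverse_le)
      then have "(L2norm U (\<lambda>x. g n x - g k x))\<^sup>2 < e\<^sup>2" using Cg[of n k] N by argo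
      then show ?thesis using \<open>e > 0\<close> by (auto intro: power2_less_imp_less)
    qed
    then show ?thesis by blast
  qed
  have Sd: "S (\<lambda>x. v n x - v k x) (\<lambda>x. g n x - g k x)" for n k
    using lin[OF vg(1)[of n] vg(1)[of k], of "-1"] by simp
  have Cauchyv: "\<exists>N. \<forall>n\<ge>N. \<forall>k\<ge>N. L2norm U (\<lambda>x. v n x - v k x) < e" if "e > 0" for e
  proof -
    \<comment> \<open>\<open>C + 1\<close> keeps the quotient meaningful when \<open>C\<close> is
      0.\<close>
    have "e / (C + 1) > 0" using that C(2) by (simp add: add_nonneg_pos)
    then obtain N where N: "\<forall>n\<ge>N. \<forall>k\<ge>N. L2norm U (\<lambda>x. g n x - g k x) < e / (C + 1)"
      using Cauchy by blast
    have "L2norm U (\<lambda>x. v n x - v k x) < e" if "n \<ge> N" "k \<ge> N" for n k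
    proof -
      have "L2norm U (\<lambda>x. v n x - v k x) \<le> C * L2norm U (\<lambda>x. g n x - g k x)"
        by (rule C(1)[OF Sd])
      also have "\<dots> \<le> (C + 1) * L2norm U (\<lambda>x. g n x - g k x)" by (intro mult_right_mono) auto
      also have "\<dots> < e" using N that C(2) by (simp add: pos_less_divide_eq mult.commute)
      finally show ?thesis .
    qed
    then show ?thesis by blast
  qed
  obtain h where h: "h \<in> L2 U" "(\<lambda>n. L2norm U (\<lambda>x. g n x - h x)) \<longlonglongrightarrow> 0"
    using L2_complete[OF U g2 Cauchy] by blast
  obtain u where u: "u \<in> L2 U" "(\<lambda>n. L2norm U (\<lambda>x. v n x - u x)) \<longlonglongrightarrow> 0"
    using L2_complete[OF U v2 Cauchyv] by blast
  have Suh: "S u h"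
  proof (rule closed[OF u(1) h(1)])
    fix e :: real assume "e > 0"
    then have "\<forall>\<^sub>F n in sequentially. L2norm U (\<lambda>x. v n x - u x) < e \<and> L2norm U (\<lambda>x. g n x - h x) < e"
      using order_tendstoD(2)[OF u(2), of e] order_tendstoD(2)[OF h(2), of e] by (auto intro: eventually_conj)
    then obtain n where "L2norm U (\<lambda>x. v n x - u x) < e" "L2norm U (\<lambda>x. g n x - h x) < e"
      by (auto simp: eventually_sequentially)
    then show "\<exists>v' g'. S v' g' \<and> L2norm U (\<lambda>x. u x - v' x) < e \<and> L2norm U (\<lambda>x. h x - g' x) < e"
      using vg(1)[of n] L2norm_diff_commute[of U u "v n"] L2norm_diff_commute[of U h "g n"]
      by (intro exI[of _ "v n"] exI[of _ "g n"]) simp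
  qed
  have "J u h \<le> m"
  proof (rule LIMSEQ_le_const2)
    have "(\<lambda>n. L2norm U (g n)) \<longlonglongrightarrow> L2norm U h"
    proof (rule LIM_zero_cancel, rule Lim_null_comparison[OF _ h(2)])
      have "\<bar>L2norm U (g n) - L2norm U h\<bar> \<le> L2norm U (\<lambda>x. g n x - h x)" for n
        using L2norm_le_add[OF g2[of n] h(1)] L2norm_le_add[OF h(1) g2[of n]] L2norm_diff_commute[of U h "g n"]
        by linarith
      then show "\<forall>\<^sub>F n in sequentially. norm (L2norm U (g n) - L2norm U h) \<le> L2norm U (\<lambda>x. g n x - h x)"
        by simp
    qed
    moreover have "(\<lambda>n. F (v n)) \<longlonglongrightarrow> F u"
    proof (rule Lim_null_comparison[THEN LIM_zero_cancel])
      show "(\<lambda>n. L2norm U f * L2norm U (\<lambda>x. v n x - u x)) \<longlonglongrightarrow> 0"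
        using tendsto_mult_right_zero[OF u(2)] by simp
      have "F (v n) - F u = F (\<lambda>x. v n x - u x)" for n
        using Flin[OF v2[of n] u(1), of "-1"] by simp
      then show "\<forall>\<^sub>F n in sequentially. norm (F (v n) - F u) \<le> L2norm U f * L2norm U (\<lambda>x. v n x - u x)"
        using Fb[OF L2_diff[OF v2 u(1)]] by simp
    qed
    ultimately have "(\<lambda>n. ((L2norm U (g n))\<^sup>2 - 2 * F (v n)) - inverse (real (Suc n)))
        \<longlonglongrightarrow> ((L2norm U h)\<^sup>2 - 2 * F u) - 0"
      by (intro tendsto_diff tendsto_power tendsto_mult tendsto_const LIMSEQ_inverse_real_of_nat)
    then show "(\<lambda>n. J (v n) (g n) - inverse (real (Suc n))) \<longlonglongrightarrow> J u h"
      by (simp only: J_def diff_zero)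
    show "\<exists>N. \<forall>n\<ge>N. J (v n) (g n) - inverse (real (Suc n)) \<le> m"
      using vg(2) by (auto simp: algebra_simps less_imp_le)
  qed
  have "(\<integral>x. h x \<bullet> g x \<partial>lebesgue_on U) = F v" if Sv: "S v g" for v g
  proof (rule ccontr)
    define d where "d = (\<integral>x. h x \<bullet> g x \<partial>lebesgue_on U) - F v"
    \<comment> \<open>Along the direction \<open>(v, g)\<close> the functional has slope
      \<open>2 * d\<close> at the minimiser, so the parameter \<open>- d / n\<close> would lower it.
      The summand 1 keeps the denominator positive even if \<open>g\<close> has norm 0.\<close>
    define n where "n = (L2norm U g)\<^sup>2 + 1"
    have "n > 0" by (simp add: n_def add_nonneg_pos)
    assume "\<not> ?thesis"
    then have "d \<noteq> 0" by (simp add: d_def)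
    have Jt: "J u h \<le> J (\<lambda>x. u x + t *\<^sub>R v x) (\<lambda>x. h x + t *\<^sub>R g x)" for t
      using m[OF lin[OF Suh Sv]] \<open>J u h \<le> m\<close> by (rule order_trans[rotated])
    then have pos: "0 \<le> 2 * t * d + t\<^sup>2 * (L2norm U g)\<^sup>2" for t
    proof -
      have "(L2norm U h)\<^sup>2 - 2 * F u \<le> (L2norm U h)\<^sup>2 + 2 * t * (\<integral>x. h x \<bullet> g x \<partial>lebesgue_on U)
          + t\<^sup>2 * (L2norm U g)\<^sup>2 - 2 * (F u + t * F v)"
        using Jt[of t] L2[OF Sv]
          L2norm_expand[OF h(1), of g t] Flin[OF u(1), of v t]
        unfolding J_def by simp
      then show ?thesis unfolding d_def by (simp add: algebra_simps)
    qed
    have "0 \<le> 2 * (- d / n) * d + (- d / n)\<^sup>2 * n"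
    proof -
      have "(- d / n)\<^sup>2 * (L2norm U g)\<^sup>2 \<le> (- d / n)\<^sup>2 * n"
        by (intro mult_left_mono) (auto simp: n_def)
      then show ?thesis using pos[of "- d / n"] by linarith
    qed
    also have "\<dots> = - d\<^sup>2 / n" using \<open>n > 0\<close> by (simp add: field_simps power2_eq_square)
    finally show False using \<open>n > 0\<close> \<open>d \<noteq> 0\<close> by (simp add: field_simps)
  qed
  then show ?thesis using Suh unfolding F_def by blast
qed

subsection \<open>Continuously differentiable functions\<close>

lemma C1_continuous:
  assumes "has_C1_gradient E u G"
  shows "continuous_on E u" "continuous_on E G"
  using assms unfolding has_C1_gradient_def
  by (auto simp: continuous_on_eq_continuous_within intro: has_derivative_continuous)

lemma C1_subset:
  assumes "has_C1_gradient E u G" "F \<subseteq> E"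
  shows "has_C1_gradient F u G"
  using assms unfolding has_C1_gradient_def
  by (auto intro: continuous_on_subset has_derivative_subset)

lemma C1_at:
  assumes "has_C1_gradient E u G" "open E" "x \<in> E"
  shows "(u has_derivative (\<lambda>h. G x \<bullet> h)) (at x)"
  using assms at_within_open[OF assms(3,2)] unfolding has_C1_gradient_def by metis

lemma C1_openI:
  assumes "open E" "continuous_on E G" "\<And>x. x \<in> E \<Longrightarrow> (u has_derivative (\<lambda>h. G x \<bullet> h)) (at x)"
  shows "has_C1_gradient E u G"
  using assms unfolding has_C1_gradient_def by (metis at_within_open)

lemma C1_const:
  fixes E :: "'a::euclidean_space set"
  shows "has_C1_gradient E (\<lambda>x. c) (\<lambda>x. 0)"
proof -
  have "((\<bullet>) (0::'a)) = (\<lambda>h. 0)" by auto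
  then show ?thesis unfolding has_C1_gradient_def by simp
qed

lemma C1_add:
  assumes "has_C1_gradient E u G" "has_C1_gradient E v H"
  shows "has_C1_gradient E (\<lambda>x. u x + v x) (\<lambda>x. G x + H x)"
  using assms unfolding has_C1_gradient_def
  by (auto intro!: continuous_intros derivative_eq_intros simp: inner_add_left)

lemma C1_scaleR:
  assumes "has_C1_gradient E u G"
  shows "has_C1_gradient E (\<lambda>x. c *\<^sub>R u x) (\<lambda>x. c *\<^sub>R G x)"
  using assms unfolding has_C1_gradient_def
  by (auto intro!: continuous_intros derivative_eq_intros)

lemma C1_sum:
  assumes "\<And>i. i \<in> I \<Longrightarrow> has_C1_gradient E (u i) (G i)"
  shows "has_C1_gradient E (\<lambda>x. \<Sum>i\<in>I. u i x) (\<lambda>x. \<Sum>i\<in>I. G i x)"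
  using assms unfolding has_C1_gradient_def
  by (auto intro!: continuous_intros derivative_eq_intros simp: inner_sum_left)

lemma C1_mult:
  assumes "has_C1_gradient E u G" "has_C1_gradient E v H"
  shows "has_C1_gradient E (\<lambda>x. u x * v x) (\<lambda>x. u x *\<^sub>R H x + v x *\<^sub>R G x)"
proof -
  have "((\<lambda>x. u x * v x) has_derivative (\<lambda>h. (u x *\<^sub>R H x + v x *\<^sub>R G x) \<bullet> h)) (at x within E)"
    if "x \<in> E" for x
  proof -
    have "((\<lambda>x. u x * v x) has_derivative (\<lambda>h. u x * (H x \<bullet> h) + (G x \<bullet> h) * v x)) (at x within E)"
      by (rule has_derivative_mult) (use assms that in \<open>auto simp: has_C1_gradient_def\<close>)
    then show ?thesis by (simp add: inner_add_left algebra_simps)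
  qed
  then show ?thesis
    using C1_continuous[OF assms(1)] C1_continuous[OF assms(2)] unfolding has_C1_gradient_def
    by (auto intro!: continuous_intros)
qed

lemma C1_compose_real:
  fixes s :: "real \<Rightarrow> real"
  assumes "has_C1_gradient E u G" "\<And>t. (s has_real_derivative s' t) (at t)" "continuous_on UNIV s'"
  shows "has_C1_gradient E (\<lambda>x. s (u x)) (\<lambda>x. s' (u x) *\<^sub>R G x)"
proof -
  have "((\<lambda>x. s (u x)) has_derivative (\<lambda>h. (s' (u x) *\<^sub>R G x) \<bullet> h)) (at x within E)" if "x \<in> E" for x
  proof -
    have u: "(u has_derivative (\<lambda>h. G x \<bullet> h)) (at x within E)"
      using assms(1) that by (simp add: has_C1_gradient_def)
    have s: "(s has_derivative (\<lambda>h. s' (u x) * h)) (at (u x))"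
      using assms(2)[of "u x"] by (simp add: has_field_derivative_def)
    show ?thesis using has_derivative_compose[OF u s] by simp
  qed
  moreover have "continuous_on E (\<lambda>x. s' (u x))"
    using continuous_on_compose2[OF assms(3) C1_continuous(1)[OF assms(1)]] by simp
  ultimately show ?thesis
    using C1_continuous(2)[OF assms(1)] unfolding has_C1_gradient_def
    by (intro conjI ballI continuous_on_scaleR)
qed

lemma C1_prod_exists:
  assumes "finite I" "\<And>i. i \<in> I \<Longrightarrow> \<exists>G. has_C1_gradient E (u i) G"
  shows "\<exists>G. has_C1_gradient E (\<lambda>x. \<Prod>i\<in>I. u i x) G"
  using assms
proof (induction I rule: finite_induct)
  case empty
  then show ?case using C1_const[of E 1] by auto
next
  case (insert i I)
  then obtain G H where "has_C1_gradient E (u i) G" "has_C1_gradient E (\<lambda>x. \<Prod>i\<in>I. u i x) H"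
    by blast
  from C1_mult[OF this] show ?case using insert.hyps by auto
qed

text \<open>A gradient is determined wherever the function is known on an open set. From this follow
  the vanishing of gradients off the support and the periodicity of gradients.\<close>

lemma C1_unique:
  assumes "has_C1_gradient E u G" "has_C1_gradient E v H" "open F" "F \<subseteq> E" "x \<in> F"
    "\<And>y. y \<in> F \<Longrightarrow> u y = v y"
  shows "G x = H x"
proof -
  have u: "(u has_derivative (\<lambda>h. G x \<bullet> h)) (at x)"
    using C1_at[OF C1_subset[OF assms(1,4)] assms(3,5)] .
  have "(v has_derivative (\<lambda>h. H x \<bullet> h)) (at x)"
    using C1_at[OF C1_subset[OF assms(2,4)] assms(3,5)] .
  then have "(u has_derivative (\<lambda>h. H x \<bullet> h)) (at x)"
    by (rule has_derivative_transform_within_open[OF _ assms(3,5)]) (use assms(6) in auto)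
  from has_derivative_unique[OF u this] have "\<And>h. G x \<bullet> h = H x \<bullet> h" by metis
  then show ?thesis by (metis vector_eq_rdot)
qed

lemma C1_gradient_support:
  assumes "has_C1_gradient UNIV u G" "closed K" "\<And>x. x \<notin> K \<Longrightarrow> u x = 0" "x \<notin> K"
  shows "G x = 0"
  by (rule C1_unique[OF assms(1) C1_const[of UNIV 0], of "- K"]) (use assms in auto)

text \<open>Gluing with one global candidate \<open>G\<close>: functions assembled from pieces, such
  as foldings and extensions by zero, are then checked only near each point.\<close>

lemma C1_local:
  assumes "\<And>x. \<exists>F. open F \<and> x \<in> F \<and> has_C1_gradient F u G"
  shows "has_C1_gradient UNIV u G"
proof (rule C1_openI)
  show "continuous_on UNIV G"
    unfolding continuous_on_eq_continuous_at[OF open_UNIV]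
    using assms by (metis C1_continuous(2) continuous_on_eq_continuous_at)
  show "(u has_derivative (\<lambda>h. G x \<bullet> h)) (at x)" for x
    using assms[of x] C1_at by blast
qed simp

lemma C1_cong_open:
  assumes "has_C1_gradient F u G" "open F" "\<And>x. x \<in> F \<Longrightarrow> u x = v x" "\<And>x. x \<in> F \<Longrightarrow> G x = H x"
  shows "has_C1_gradient F v H"
proof (rule C1_openI[OF assms(2)])
  show "continuous_on F H"
    using C1_continuous(2)[OF assms(1)] assms(4) by (simp cong: continuous_on_cong)
  show "(v has_derivative (\<lambda>h. H x \<bullet> h)) (at x)" if "x \<in> F" for x
    using has_derivative_transform_within_open[OF C1_at[OF assms(1,2) that] assms(2) that] assms that
    by auto
qed

lemma C1_lipschitz:
  assumes "has_C1_gradient UNIV F H" "\<And>x. norm (H x) \<le> B"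
  shows "\<bar>F y - F x\<bar> \<le> B * norm (y - x)"
proof -
  have "norm (F y - F x) \<le> B * norm (y - x)"
  proof (rule differentiable_bound[where S=UNIV])
    show "(F has_derivative (\<lambda>h. H z \<bullet> h)) (at z within UNIV)" for z
      using assms(1) by (simp add: has_C1_gradient_def)
    have "onorm (\<lambda>h. H z \<bullet> h) \<le> norm (H z)" for z
      by (rule onorm_bound) (auto simp: Cauchy_Schwarz_ineq2)
    then show "onorm (\<lambda>h. H z \<bullet> h) \<le> B" for z using assms(2) order_trans by blast
  qed auto
  then show ?thesis by simp
qed

lemma continuous_compact_support_bounded:
  fixes H :: "'a::euclidean_space \<Rightarrow> 'b::euclidean_space"
  assumes "continuous_on UNIV H" "compact K" "\<And>x. x \<notin> K \<Longrightarrow> H x = 0"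
  obtains B where "0 \<le> B" "\<And>x. norm (H x) \<le> B"
proof -
  have "bounded (H ` K)"
    using assms by (meson compact_continuous_image compact_imp_bounded continuous_on_subset subset_UNIV)
  then obtain B where B: "B > 0" "\<And>x. x \<in> K \<Longrightarrow> norm (H x) \<le> B"
    by (auto simp: bounded_pos)
  then have "norm (H x) \<le> B" for x using assms(3)[of x] by (cases "x \<in> K") auto
  then show ?thesis using that[of B] B by simp
qed

section \<open>Integration by parts for continuously differentiable functions\<close>

lemma integral_translation:
  fixes F :: "'a::euclidean_space \<Rightarrow> 'b::euclidean_space"
  assumes "F \<in> borel_measurable borel"
  shows "(\<integral>x. F (c + x) \<partial>lborel) = (\<integral>x. F x \<partial>lborel)"
proof -
  have "(\<integral>x. F x \<partial>lborel) = (\<integral>x. F x \<partial>distr lborel borel ((+) c))"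
    by (simp add: lborel_distr_plus)
  also have "\<dots> = (\<integral>x. F (c + x) \<partial>lborel)" by (rule integral_distr) (use assms in auto)
  finally show ?thesis by simp
qed

lemma integrable_compact_support:
  fixes F :: "'a::euclidean_space \<Rightarrow> 'b::euclidean_space"
  assumes "continuous_on UNIV F" "compact K" "\<And>x. x \<notin> K \<Longrightarrow> F x = 0"
  shows "integrable lborel F"
proof -
  have "integrable lborel (\<lambda>x. indicator K x *\<^sub>R F x)"
    by (rule borel_integrable_compact[OF assms(2) continuous_on_subset[OF assms(1)]]) simp
  moreover have "(\<lambda>x. indicator K x *\<^sub>R F x) = F" using assms(3) by (auto simp: indicator_def)
  ultimately show ?thesis by simp
qed

text \<open>The integral of a difference quotient vanishes by translation invariance.\<close>

lemma integral_gradient_zero: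
  fixes F :: "'a::euclidean_space \<Rightarrow> real"
  assumes F: "has_C1_gradient UNIV F H" and K: "compact K" "\<And>x. x \<notin> K \<Longrightarrow> F x = 0"
  shows "(\<integral>x. H x \<partial>lebesgue) = 0"
proof -
  have H0: "H x = 0" if "x \<notin> K" for x
    by (rule C1_gradient_support[OF F compact_imp_closed[OF K(1)] K(2) that])
  have cF: "continuous_on UNIV F" and cH: "continuous_on UNIV H" using C1_continuous[OF F] .
  have [measurable]: "F \<in> borel_measurable borel" "H \<in> borel_measurable borel"
    using cF cH by (auto intro: borel_measurable_continuous_onI)
  obtain B where B: "0 \<le> B" "\<And>x. norm (H x) \<le> B"
    using continuous_compact_support_bounded[OF cH K(1) H0] by blast
  obtain R where R: "\<And>x. x \<in> K \<Longrightarrow> norm x \<le> R" using compact_imp_bounded[OF K(1)] by (auto simp: bounded_iff)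
  have iF: "integrable lborel F" by (rule integrable_compact_support[OF cF K])
  have iH: "integrable lborel H" by (rule integrable_compact_support[OF cH K(1) H0])
  have "(\<integral>x. H x \<partial>lborel) \<bullet> b = 0" if b: "b \<in> Basis" for b
  proof -
    define q where "q n x = real (Suc n) * (F (inverse (real (Suc n)) *\<^sub>R b + x) - F x)" for n x
    have "(\<lambda>n. \<integral>x. q n x \<partial>lborel) \<longlonglongrightarrow> (\<integral>x. H x \<bullet> b \<partial>lborel)"
    proof (rule integral_dominated_convergence)
      show "(\<lambda>x. H x \<bullet> b) \<in> borel_measurable lborel" "q n \<in> borel_measurable lborel" for n
        unfolding q_def by measurable
      \<comment> \<open>The translations have length at most 1, so the quotients vanish beyond
        radius \<open>R + 1\<close>; within it the Lipschitz constant \<open>B\<close> bounds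
        them.\<close>
      show "integrable lborel (\<lambda>x. indicat_real (cball 0 (R + 1)) x *\<^sub>R B)"
        by (rule borel_integrable_compact) auto
      show "AE x in lborel. (\<lambda>n. q n x) \<longlonglongrightarrow> H x \<bullet> b"
      proof (rule AE_I2)
        fix x
        have "(F has_derivative (\<lambda>h. H x \<bullet> h)) (at x)" using C1_at[OF F] by simp
        moreover have "((\<lambda>t. x + t *\<^sub>R b) has_derivative (\<lambda>t. t *\<^sub>R b)) (at 0)"
          by (auto intro!: derivative_eq_intros)
        ultimately have "((\<lambda>t. F (x + t *\<^sub>R b)) has_derivative (\<lambda>t. H x \<bullet> (t *\<^sub>R b))) (at 0)"
          using has_derivative_compose[of "\<lambda>t. x + t *\<^sub>R b" "\<lambda>t. t *\<^sub>R b" 0 UNIV F "\<lambda>h. H x \<bullet> h"]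
          by simp
        moreover have "(\<lambda>t. H x \<bullet> (t *\<^sub>R b)) = (*) (H x \<bullet> b)" by (auto simp: mult.commute)
        ultimately have "((\<lambda>t. F (x + t *\<^sub>R b)) has_real_derivative (H x \<bullet> b)) (at 0)"
          by (simp add: has_field_derivative_def)
        then have "((\<lambda>t. (F (x + t *\<^sub>R b) - F x) / t) \<longlongrightarrow> H x \<bullet> b) (at 0)"
          by (simp add: DERIV_def)
        moreover have "filterlim (\<lambda>n. inverse (real (Suc n))) (at 0) sequentially"
          by (intro filterlim_atI LIMSEQ_inverse_real_of_nat) auto
        ultimately have "(\<lambda>n. (F (x + inverse (real (Suc n)) *\<^sub>R b) - F x) / inverse (real (Suc n))) \<longlonglongrightarrow> H x \<bullet> b"
          by (rule filterlim_compose)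
        then show "(\<lambda>n. q n x) \<longlonglongrightarrow> H x \<bullet> b"
          by (simp add: q_def divide_inverse add.commute mult.commute)
      qed
      show "AE x in lborel. norm (q n x) \<le> indicat_real (cball 0 (R + 1)) x *\<^sub>R B" for n
      proof (rule AE_I2)
        fix x
        have nb: "norm (inverse (real (Suc n)) *\<^sub>R b) \<le> 1"
          using b by (simp add: inverse_eq_divide)
        show "norm (q n x) \<le> indicat_real (cball 0 (R + 1)) x *\<^sub>R B"
        proof (cases "x \<in> cball 0 (R + 1)")
          case True
          have "\<bar>F (inverse (real (Suc n)) *\<^sub>R b + x) - F x\<bar> \<le> B * norm (inverse (real (Suc n)) *\<^sub>R b)"
            using C1_lipschitz[OF F B(2), of "inverse (real (Suc n)) *\<^sub>R b + x" x] by simp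
          also have "\<dots> = B * inverse (real (Suc n))" using b by simp
          finally have "real (Suc n) * \<bar>F (inverse (real (Suc n)) *\<^sub>R b + x) - F x\<bar>
              \<le> real (Suc n) * (B * inverse (real (Suc n)))" by (intro mult_left_mono) auto
          also have "\<dots> = B" by simp
          finally show ?thesis using True by (simp add: q_def abs_mult)
        next
          case False
          then have "x \<notin> K" using R[of x] by auto
          moreover have "inverse (real (Suc n)) *\<^sub>R b + x \<notin> K"
            using R[of "inverse (real (Suc n)) *\<^sub>R b + x"] False nb
              norm_triangle_ineq4[of "inverse (real (Suc n)) *\<^sub>R b + x" "inverse (real (Suc n)) *\<^sub>R b"]
            by auto
          ultimately show ?thesis using False K(2) by (simp add: q_def)
        qed
      qed
    qed
    moreover have "(\<integral>x. q n x \<partial>lborel) = 0" for n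
    proof -
      have "integrable lborel (\<lambda>x. F (inverse (real (Suc n)) *\<^sub>R b + x))"
        using iF integrable_distr[of "(+) (inverse (real (Suc n)) *\<^sub>R b)" lborel borel F]
        by (simp add: lborel_distr_plus)
      then show ?thesis
        unfolding q_def using iF integral_translation[of F "inverse (real (Suc n)) *\<^sub>R b"] by simp
    qed
    ultimately have "(\<integral>x. H x \<bullet> b \<partial>lborel) = 0" by (simp add: LIMSEQ_const_iff)
    then show ?thesis using iH by simp
  qed
  then have "(\<integral>x. H x \<partial>lborel) = 0" by (intro euclidean_eqI[where 'a='a]) simp
  then show ?thesis by (simp add: integral_completion)
qed

lemma integrable_on_compact_support:
  fixes f :: "'a::euclidean_space \<Rightarrow> 'b::euclidean_space"
  assumes "open U" "compact K" "K \<subseteq> U" "continuous_on K f" "\<And>x. x \<in> U - K \<Longrightarrow> f x = 0"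
  shows "integrable (lebesgue_on U) f"
proof -
  have "integrable lborel (\<lambda>x. indicator K x *\<^sub>R f x)"
    by (rule borel_integrable_compact) (use assms in auto)
  moreover from borel_measurable_integrable[OF this]
  have "(\<lambda>x. indicator K x *\<^sub>R f x) \<in> borel_measurable lborel" .
  ultimately have "integrable lebesgue (\<lambda>x. indicator K x *\<^sub>R f x)"
    by (simp add: integrable_completion)
  moreover have "(\<lambda>x. indicator U x *\<^sub>R f x) = (\<lambda>x. indicator K x *\<^sub>R f x)"
    using assms(3,5) by (auto simp: indicator_def fun_eq_iff)
  ultimately show ?thesis
    using assms(1) by (simp add: integrable_restrict_space)
qed

text \<open>The product of \<open>u\<close> and the test function, extended by zero, is C^1 on the
  whole space, because the test function vanishes near every point outside \<open>U\<close>. The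
  integral of its gradient is therefore 0.\<close>

lemma integration_by_parts_C1:
  fixes u \<phi> :: "'a::euclidean_space \<Rightarrow> real"
  assumes U: "open U" and u: "has_C1_gradient U u Gu" and \<phi>: "has_C1_gradient UNIV \<phi> G"
    and K: "compact K" "K \<subseteq> U" "\<And>x. x \<notin> K \<Longrightarrow> \<phi> x = 0"
  shows "(\<integral>x. u x *\<^sub>R G x \<partial>lebesgue_on U) = - (\<integral>x. \<phi> x *\<^sub>R Gu x \<partial>lebesgue_on U)"
proof -
  have G0: "G x = 0" if "x \<notin> K" for x
    by (rule C1_gradient_support[OF \<phi> compact_imp_closed[OF K(1)] K(3) that])
  define F where "F x = (if x \<in> U then u x * \<phi> x else 0)" for x
  define H where "H x = (if x \<in> U then u x *\<^sub>R G x + \<phi> x *\<^sub>R Gu x else 0)" for x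
  have F: "has_C1_gradient UNIV F H"
  proof (rule C1_local)
    fix x
    show "\<exists>V. open V \<and> x \<in> V \<and> has_C1_gradient V F H"
    proof (cases "x \<in> U")
      case True
      have "has_C1_gradient U F H"
        by (rule C1_cong_open[OF C1_mult[OF u C1_subset[OF \<phi>]] U]) (auto simp: F_def H_def)
      then show ?thesis using True U by blast
    next
      case False
      have "has_C1_gradient (- K) F H"
        by (rule C1_cong_open[OF C1_const[of _ 0]])
          (use K compact_imp_closed G0 in \<open>auto simp: F_def H_def\<close>)
      then show ?thesis using False K compact_imp_closed by (intro exI[of _ "- K"]) auto
    qed
  qed
  have "(\<integral>x. H x \<partial>lebesgue) = 0"
    by (rule integral_gradient_zero[OF F K(1)]) (auto simp: F_def K(3))
  moreover have "(\<integral>x. H x \<partial>lebesgue) = (\<integral>x. u x *\<^sub>R G x + \<phi> x *\<^sub>R Gu x \<partial>lebesgue_on U)"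
    using U by (subst integral_restrict_space)
      (auto intro!: Bochner_Integration.integral_cong simp: H_def indicator_def)
  moreover have "(\<integral>x. u x *\<^sub>R G x + \<phi> x *\<^sub>R Gu x \<partial>lebesgue_on U)
      = (\<integral>x. u x *\<^sub>R G x \<partial>lebesgue_on U) + (\<integral>x. \<phi> x *\<^sub>R Gu x \<partial>lebesgue_on U)"
  proof (rule Bochner_Integration.integral_add)
    have c: "continuous_on K u" "continuous_on K Gu" "continuous_on K \<phi>" "continuous_on K G"
      using C1_continuous[OF u] C1_continuous[OF \<phi>] K(2) continuous_on_subset by blast+
    show "integrable (lebesgue_on U) (\<lambda>x. u x *\<^sub>R G x)" "integrable (lebesgue_on U) (\<lambda>x. \<phi> x *\<^sub>R Gu x)"
      by (rule integrable_on_compact_support[OF U K(1,2)]; use c K(3) G0 in \<open>auto intro!: continuous_intros\<close>)+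
  qed
  ultimately show ?thesis by (simp add: eq_neg_iff_add_eq_0)
qed

lemma continuous_on_compact_abs_integrable:
  fixes f :: "'a::euclidean_space \<Rightarrow> 'b::euclidean_space"
  assumes "continuous_on K f" "compact K"
  shows "f absolutely_integrable_on K"
  unfolding set_integrable_def
  using borel_integrable_compact[OF assms(2,1)]
  by (simp add: integrable_completion borel_measurable_integrable)

lemma C1_has_weak_gradient:
  assumes "open U" "has_C1_gradient U u G"
  shows "has_weak_gradient U u G"
  unfolding has_weak_gradient_def
proof (intro conjI allI impI)
  fix K assume "compact K \<and> K \<subseteq> U"
  then show "u absolutely_integrable_on K" "G absolutely_integrable_on K"
    using C1_continuous[OF assms(2)] continuous_on_subset
    by (blast intro: continuous_on_compact_abs_integrable)+
next
  fix \<phi> H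
  assume "has_C1_gradient UNIV \<phi> H \<and> (\<exists>K. compact K \<and> K \<subseteq> U \<and> (\<forall>x. x \<notin> K \<longrightarrow> \<phi> x = 0))"
  then show "(LINT x|lebesgue_on U. u x *\<^sub>R H x) = - (LINT x|lebesgue_on U. \<phi> x *\<^sub>R G x)"
    using integration_by_parts_C1[OF assms(1,2)] by blast
qed

subsection \<open>A continuously differentiable step function\<close>

text \<open>The quadratic spline rising from 0 to 1 on the unit interval, with second derivative 4
  on the first half and -4 on the second. The class C^1 matches that of the test functions.\<close>

definition step :: "real \<Rightarrow> real" where
  "step t = 2 * (max 0 t)\<^sup>2 - 4 * (max 0 (t - 1/2))\<^sup>2 + 2 * (max 0 (t - 1))\<^sup>2"

definition step' :: "real \<Rightarrow> real" where
  "step' t = 4 * max 0 t - 8 * max 0 (t - 1/2) + 4 * max 0 (t - 1)"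

lemma max_sq_deriv: "((\<lambda>t::real. (max 0 t)\<^sup>2) has_real_derivative 2 * max 0 t) (at t)"
proof -
  consider "t > 0" | "t < 0" | "t = 0" by linarith
  then show ?thesis
  proof cases
    case 1
    have "((\<lambda>t::real. t\<^sup>2) has_real_derivative 2 * max 0 t) (at t)"
      using 1 by (auto intro!: derivative_eq_intros)
    then show ?thesis
      by (rule has_field_derivative_transform_within_open[where S="{0<..}"]) (use 1 in auto)
  next
    case 2
    have "((\<lambda>t::real. 0) has_real_derivative 2 * max 0 t) (at t)"
      using 2 by (auto intro!: derivative_eq_intros)
    then show ?thesis
      by (rule has_field_derivative_transform_within_open[where S="{..<0}"]) (use 2 in auto)
  next
    case 3
    \<comment> \<open>At the kink the difference quotient is bounded by the length of the
      increment.\<close>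
    have "((\<lambda>h::real. (max 0 h)\<^sup>2 / h) \<longlongrightarrow> 0) (at 0)"
    proof (rule Lim_null_comparison)
      show "((\<lambda>h::real. \<bar>h\<bar>) \<longlongrightarrow> 0) (at 0)" by (rule tendsto_eq_intros refl)+ simp
      show "\<forall>\<^sub>F h::real in at 0. norm ((max 0 h)\<^sup>2 / h) \<le> \<bar>h\<bar>"
        by (rule always_eventually) (auto simp: max_def power2_eq_square)
    qed
    then show ?thesis using 3 by (simp add: DERIV_def)
  qed
qed

lemma step_deriv: "(step has_real_derivative step' t) (at t)"
proof -
  have "((\<lambda>t. (max 0 (t - c))\<^sup>2) has_real_derivative 2 * max 0 (t - c)) (at t)" for c :: real
  proof -
    have "((\<lambda>t. t - c) has_real_derivative 1) (at t)" by (auto intro!: derivative_eq_intros)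
    from DERIV_chain2[where f="\<lambda>t. (max 0 t)\<^sup>2" and g="\<lambda>t. t - c", OF max_sq_deriv this]
    show ?thesis by simp
  qed
  from DERIV_add[OF DERIV_diff[OF DERIV_cmult[OF this[of 0], of 2] DERIV_cmult[OF this[of "1/2"], of 4]]
      DERIV_cmult[OF this[of 1], of 2]]
  show ?thesis unfolding step_def [abs_def] step'_def by simp
qed

lemma step'_continuous: "continuous_on A step'"
  unfolding step'_def [abs_def] by (intro continuous_intros)

lemma step_simps: "t \<le> 0 \<Longrightarrow> step t = 0" "1 \<le> t \<Longrightarrow> step t = 1"
    "t \<le> 0 \<Longrightarrow> step' t = 0" "1 \<le> t \<Longrightarrow> step' t = 0"
  by (simp_all add: step_def step'_def max_def power2_eq_square algebra_simps)

lemma step'_bound: "\<bar>step' t\<bar> \<le> 2"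
  by (auto simp: step'_def max_def)

lemma step_range: "0 \<le> step t" "step t \<le> 1"
proof -
  consider "t \<le> 0" | "0 \<le> t" "t \<le> 1/2" | "1/2 \<le> t" "t \<le> 1" | "1 \<le> t" by linarith
  then have "0 \<le> step t \<and> step t \<le> 1"
  proof cases
    case 2
    then have "step t = 2 * t\<^sup>2" by (simp add: step_def)
    moreover have "t\<^sup>2 \<le> (1/2)\<^sup>2" using 2 by (intro power_mono) auto
    ultimately show ?thesis by (simp add: power2_eq_square)
  next
    case 3
    then have "step t = 1 - 2 * (1 - t)\<^sup>2" by (simp add: step_def power2_eq_square algebra_simps)
    moreover have "(1 - t)\<^sup>2 \<le> (1/2)\<^sup>2" using 3 by (intro power_mono) auto
    ultimately show ?thesis by (simp add: power2_eq_square)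
  qed (auto simp: step_simps)
  then show "0 \<le> step t" "step t \<le> 1" by auto
qed

lemma C1_step:
  assumes "has_C1_gradient E u G"
  shows "has_C1_gradient E (\<lambda>x. step (u x)) (\<lambda>x. step' (u x) *\<^sub>R G x)"
  by (rule C1_compose_real[OF assms step_deriv step'_continuous])

subsection \<open>Uniqueness of weak gradients\<close>

text \<open>Because the limit is 0 at \<open>t = 0\<close>, products of such limits single out open
  boxes rather than closed ones.\<close>

lemma step_scaled_tendsto: "(\<lambda>n. step (real n * t)) \<longlonglongrightarrow> (if t > 0 then 1 else 0)"
proof (cases "t > 0")
  case True
  then obtain N where "1 \<le> real N * t" using ex_less_of_nat_mult[of t 1] by (auto intro: less_imp_le)
  then have "\<forall>n\<ge>N. step (real n * t) = 1"
    using True by (auto intro!: step_simps(2) elim!: order_trans mult_right_mono)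
  then have "\<forall>\<^sub>F n in sequentially. step (real n * t) = 1" unfolding eventually_sequentially by blast
  then show ?thesis using True by (simp add: tendsto_eventually)
next
  case False
  then have "real n * t \<le> 0" for n by (simp add: mult_nonneg_nonpos)
  then show ?thesis using False by (simp add: step_simps)
qed

lemma C1_affine: "has_C1_gradient E (\<lambda>x. c * (x \<bullet> i) + d) (\<lambda>x. c *\<^sub>R i)"
  unfolding has_C1_gradient_def
  by (auto intro!: derivative_eq_intros simp: inner_commute)

text \<open>Products of scaled steps are C^1 test functions supported in the closed box and
  converging to the indicator of the open one; dominated convergence then removes the test
  function.\<close>

lemma integral_box_zero:
  fixes g :: "'a::euclidean_space \<Rightarrow> 'b::euclidean_space"
  assumes U: "open U" and g: "\<And>K. compact K \<Longrightarrow> K \<subseteq> U \<Longrightarrow> g absolutely_integrable_on K"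
    and test: "\<And>\<phi> G K. has_C1_gradient UNIV \<phi> G \<Longrightarrow> compact K \<Longrightarrow> K \<subseteq> U \<Longrightarrow>
      (\<And>x. x \<notin> K \<Longrightarrow> \<phi> x = 0) \<Longrightarrow> (\<integral>x. \<phi> x *\<^sub>R g x \<partial>lebesgue_on U) = 0"
    and ab: "cbox a b \<subseteq> U"
  shows "(LINT x:box a b|lebesgue. g x) = 0"
proof -
  define p where "p n x = (\<Prod>i\<in>Basis. step (real n * (x \<bullet> i - a \<bullet> i)) * step (real n * (b \<bullet> i - x \<bullet> i)))"
    for n and x :: 'a
  have C1: "\<exists>G. has_C1_gradient UNIV (p n) G" for n
  proof -
    have "\<exists>G. has_C1_gradient UNIV (\<lambda>x::'a. step (real n * (x \<bullet> i - a \<bullet> i)) * step (real n * (b \<bullet> i - x \<bullet> i))) G"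
      for i
    proof -
      have *: "has_C1_gradient UNIV (\<lambda>x::'a. step (c * (x \<bullet> i) + d)) (\<lambda>x. step' (c * (x \<bullet> i) + d) *\<^sub>R c *\<^sub>R i)" for c d
        by (rule C1_step[OF C1_affine])
      show ?thesis
        using C1_mult[OF *[of "real n" "- real n * (a \<bullet> i)"] *[of "- real n" "real n * (b \<bullet> i)"]]
        by (auto simp: algebra_simps)
    qed
    then show ?thesis unfolding p_def [abs_def] by (intro C1_prod_exists) auto
  qed
  have p0: "p n x = 0" if "x \<notin> cbox a b" for n x
  proof -
    obtain i where "i \<in> Basis" "x \<bullet> i < a \<bullet> i \<or> b \<bullet> i < x \<bullet> i"
      using \<open>x \<notin> cbox a b\<close> by (auto simp: mem_box not_le)
    then have "step (real n * (x \<bullet> i - a \<bullet> i)) * step (real n * (b \<bullet> i - x \<bullet> i)) = 0"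
      by (auto simp: step_simps(1) mult_nonneg_nonpos)
    then show ?thesis using \<open>i \<in> Basis\<close> unfolding p_def by (intro prod_zero) auto
  qed
  have p1: "0 \<le> p n x \<and> p n x \<le> 1" for n x
    unfolding p_def using step_range by (auto intro!: prod_nonneg prod_le_1 mult_le_one)
  have gi: "integrable lebesgue (\<lambda>x. indicator (cbox a b) x *\<^sub>R g x)"
    using g[OF compact_cbox ab] by (simp add: set_integrable_def)
  have pi0: "(\<integral>x. p n x *\<^sub>R (indicator (cbox a b) x *\<^sub>R g x) \<partial>lebesgue) = 0" for n
  proof -
    obtain G where "has_C1_gradient UNIV (p n) G" using C1 by blast
    then have "(\<integral>x. p n x *\<^sub>R g x \<partial>lebesgue_on U) = 0"
      by (rule test[OF _ compact_cbox ab p0])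
    moreover have "(\<integral>x. p n x *\<^sub>R g x \<partial>lebesgue_on U) = (\<integral>x. p n x *\<^sub>R (indicator (cbox a b) x *\<^sub>R g x) \<partial>lebesgue)"
      using U ab p0
      by (subst integral_restrict_space) (auto intro!: Bochner_Integration.integral_cong simp: indicator_def)
    ultimately show ?thesis by simp
  qed
  have pm: "p n \<in> borel_measurable lebesgue" for n
  proof -
    have "continuous_on UNIV (p n)" using C1 C1_continuous(1) by blast
    then have "p n \<in> borel_measurable borel" by (rule borel_measurable_continuous_onI)
    then show ?thesis by (intro measurable_completion) simp
  qed
  have "(\<lambda>n. \<integral>x. p n x *\<^sub>R (indicator (cbox a b) x *\<^sub>R g x) \<partial>lebesgue)
      \<longlonglongrightarrow> (\<integral>x. indicator (box a b) x *\<^sub>R g x \<partial>lebesgue)"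
  proof (rule integral_dominated_convergence)
    show "integrable lebesgue (\<lambda>x. norm (indicat_real (cbox a b) x *\<^sub>R g x))"
      by (rule integrable_norm[OF gi])
    show "AE x in lebesgue. norm (p n x *\<^sub>R indicat_real (cbox a b) x *\<^sub>R g x)
         \<le> norm (indicat_real (cbox a b) x *\<^sub>R g x)" for n
      using p1[of n] by (auto intro!: AE_I2 mult_left_le_one_le simp: mult.assoc)
    show "AE x in lebesgue. (\<lambda>n. p n x *\<^sub>R indicat_real (cbox a b) x *\<^sub>R g x) \<longlonglongrightarrow> indicat_real (box a b) x *\<^sub>R g x"
    proof (rule AE_I2)
      fix x
      have "(\<lambda>n. p n x) \<longlonglongrightarrow> (\<Prod>i\<in>Basis. (if x \<bullet> i - a \<bullet> i > 0 then 1 else 0) * (if b \<bullet> i - x \<bullet> i > 0 then 1 else 0))"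
        unfolding p_def by (intro tendsto_prod tendsto_mult step_scaled_tendsto)
      also have "(\<Prod>i\<in>Basis. (if x \<bullet> i - a \<bullet> i > 0 then 1 else 0) * (if b \<bullet> i - x \<bullet> i > 0 then 1 else 0)) = indicat_real (box a b) x"
      proof (cases "x \<in> box a b")
        case True
        then show ?thesis by (auto simp: mem_box intro!: prod.neutral)
      next
        case False
        then obtain i where "i \<in> Basis" "x \<bullet> i \<le> a \<bullet> i \<or> b \<bullet> i \<le> x \<bullet> i" by (auto simp: mem_box not_less)
        then have "(\<Prod>i\<in>Basis. (if x \<bullet> i - a \<bullet> i > 0 then 1 else 0) * (if b \<bullet> i - x \<bullet> i > 0 then 1 else 0)) = (0::real)"
          by (intro prod_zero bexI[of _ i]) auto
        then show ?thesis using False by simp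
      qed
      finally have "(\<lambda>n. p n x *\<^sub>R indicat_real (cbox a b) x *\<^sub>R g x)
          \<longlonglongrightarrow> indicat_real (box a b) x *\<^sub>R indicat_real (cbox a b) x *\<^sub>R g x"
        by (intro tendsto_intros)
      then show "(\<lambda>n. p n x *\<^sub>R indicat_real (cbox a b) x *\<^sub>R g x) \<longlonglongrightarrow> indicat_real (box a b) x *\<^sub>R g x"
        using box_subset_cbox[of a b] by (auto simp: indicator_def split: if_splits)
    qed
    have m1: "(\<lambda>x. indicat_real (cbox a b) x *\<^sub>R g x) \<in> borel_measurable lebesgue"
      using borel_measurable_integrable[OF gi] .
    then show "(\<lambda>x. p n x *\<^sub>R indicat_real (cbox a b) x *\<^sub>R g x) \<in> borel_measurable lebesgue" for n
      by (rule borel_measurable_scaleR[OF pm])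
    have "(\<lambda>x. indicat_real (box a b) x *\<^sub>R indicat_real (cbox a b) x *\<^sub>R g x) \<in> borel_measurable lebesgue"
      by (rule borel_measurable_scaleR[OF borel_measurable_indicator m1]) simp
    moreover have "(\<lambda>x. indicat_real (box a b) x *\<^sub>R indicat_real (cbox a b) x *\<^sub>R g x) = (\<lambda>x. indicat_real (box a b) x *\<^sub>R g x)"
      using box_subset_cbox[of a b] by (auto simp: indicator_def fun_eq_iff)
    ultimately show "(\<lambda>x. indicat_real (box a b) x *\<^sub>R g x) \<in> borel_measurable lebesgue" by simp
  qed
  then show ?thesis using pi0 by (simp add: LIMSEQ_const_iff set_lebesgue_integral_def)
qed

lemma sigma_finite_lebesgue: "sigma_finite_measure (lebesgue :: 'a::euclidean_space measure)"
proof
  obtain A :: "'a set set" where A: "countable A" "A \<subseteq> sets lborel" "\<Union>A = space lborel"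
    "\<forall>a\<in>A. emeasure lborel a \<noteq> \<infinity>"
    using lborel.sigma_finite_countable by blast
  then have "emeasure lebesgue a \<noteq> \<infinity>" if "a \<in> A" for a
    using that by (auto simp: emeasure_completion main_part_sets)
  then show "\<exists>A. countable A \<and> A \<subseteq> sets lebesgue \<and> \<Union> A = space (lebesgue :: 'a measure)
      \<and> (\<forall>a\<in>A. emeasure lebesgue a \<noteq> \<infinity>)"
    using A by (intro exI[of _ A]) auto
qed

text \<open>Open boxes form an intersection-stable generator of the Borel sets, so vanishing of the
  integral spreads to all of them by induction, \<open>total\<close> serving for complements. A
  Lebesgue set differs from a Borel set only by a null set.\<close>

lemma AE_zero_if_box_integrals_zero:
  fixes h :: "'a::euclidean_space \<Rightarrow> 'b::euclidean_space"
  assumes h: "integrable lebesgue h" and box: "\<And>a b. (LINT x:box a b|lebesgue. h x) = 0"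
    and total: "(\<integral>x. h x \<partial>lebesgue) = 0"
  shows "AE x in lebesgue. h x = 0"
proof (rule sigma_finite_measure.density_zero[OF sigma_finite_lebesgue h])
  have sig: "A \<in> sets lebesgue" if "A \<in> sigma_sets UNIV (range (\<lambda>(a, b). box a b))" for A :: "'a set"
  proof -
    have "A \<in> sets (sigma UNIV (range (\<lambda>(a, b). box a b)))" using that by simp
    then have "A \<in> sets borel" by (simp only: borel_eq_box)
    then show ?thesis by simp
  qed
  have si: "set_integrable lebesgue A h" if "A \<in> sets lebesgue" for A
    unfolding set_integrable_def using h that by (rule integrable_mult_indicator[rotated])
  have B: "(LINT x:A|lebesgue. h x) = 0" if "A \<in> sets borel" for A
  proof -
    have "A \<in> sigma_sets UNIV (range (\<lambda>(a, b). box a b))"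
      using that by (simp add: borel_eq_box)
    then show ?thesis
    proof (induction rule: sigma_sets_induct_disjoint[rotated 2, consumes 1, case_names basic empty compl union stable Pow])
      case stable
      show ?case
        by (auto simp: Int_stable_def box_Int_box)
    next
      case (basic A)
      then show ?case using box by auto
    next
      case (compl A)
      have A: "A \<in> sets lebesgue" using compl(1) by (rule sig)
      have "(LINT x:UNIV|lebesgue. h x) = (LINT x:A \<union> (UNIV - A)|lebesgue. h x)" by simp
      also have "\<dots> = (LINT x:A|lebesgue. h x) + (LINT x:UNIV - A|lebesgue. h x)"
        by (rule set_integral_Un) (use A in \<open>auto intro!: si\<close>)
      finally show ?case using compl total by (simp add: set_lebesgue_integral_def)
    next
      case (union A)
      have A: "A i \<in> sets lebesgue" for i using union(2) by (auto intro: sig)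
      have "(LINT x:(\<Union>i. A i)|lebesgue. h x) = (\<Sum>i. (LINT x:(A i)|lebesgue. h x))"
        by (rule lebesgue_integral_countable_add)
          (use A union(1) in \<open>auto intro!: si simp: disjoint_family_on_def\<close>)
      then show ?case using union by simp
    qed (auto simp: set_lebesgue_integral_def)
  qed
  fix A :: "'a set" assume "A \<in> sets lebesgue"
  then obtain S N N' where "A = S \<union> N" "N \<subseteq> N'" "N' \<in> null_sets lborel" "S \<in> sets lborel"
    by (rule sets_completionE)
  note A = this
  have N: "N' \<in> null_sets lebesgue" using A(3) by (rule null_sets_completionI)
  have "(LINT x:A|lebesgue. h x) = (LINT x:S|lebesgue. h x)"
    unfolding set_lebesgue_integral_def
  proof (rule integral_cong_AE)
    show "AE x in lebesgue. indicat_real A x *\<^sub>R h x = indicat_real S x *\<^sub>R h x"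
      using AE_not_in[OF N] by eventually_elim (use A in \<open>auto simp: indicator_def\<close>)
  qed (use si[of A] si[of S] \<open>A \<in> sets lebesgue\<close> A in
      \<open>auto simp: set_integrable_def intro!: borel_measurable_integrable\<close>)
  then show "(LINT x:A|lebesgue. h x) = 0" using B A(4) by simp
qed

text \<open>The fundamental lemma of the calculus of variations. A countable cover by closed boxes
  reduces it to a single box; truncation to the open box turns every box integral of
  \<open>h\<close> into an integral of \<open>g\<close> over a box whose closure stays in
  \<open>U\<close>.\<close>

lemma weak_zero_AE:
  fixes g :: "'a::euclidean_space \<Rightarrow> 'b::euclidean_space"
  assumes U: "open U" and g: "\<And>K. compact K \<Longrightarrow> K \<subseteq> U \<Longrightarrow> g absolutely_integrable_on K"
    and test: "\<And>\<phi> G K. has_C1_gradient UNIV \<phi> G \<Longrightarrow> compact K \<Longrightarrow> K \<subseteq> U \<Longrightarrow>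
      (\<And>x. x \<notin> K \<Longrightarrow> \<phi> x = 0) \<Longrightarrow> (\<integral>x. \<phi> x *\<^sub>R g x \<partial>lebesgue_on U) = 0"
  shows "AE x in lebesgue_on U. g x = 0"
proof -
  have boxz: "(LINT x:box a b|lebesgue. g x) = 0" if "cbox a b \<subseteq> U" for a b
    by (rule integral_box_zero[OF U _ _ that]) (use g test in blast)+
  obtain D where D: "countable D" "\<And>X. X \<in> D \<Longrightarrow> \<exists>a b. X = cbox a b" "D \<subseteq> Pow U" "\<Union>D = U"
    using open_countable_Union_open_cbox[OF U] by metis
  have "AE x in lebesgue. x \<in> X \<longrightarrow> g x = 0" if "X \<in> D" for X
  proof -
    obtain c d where X: "X = cbox c d" using D(2) \<open>X \<in> D\<close> by blast
    then have cd: "cbox c d \<subseteq> U" using D(3) \<open>X \<in> D\<close> by blast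
    define h where "h x = indicat_real (box c d) x *\<^sub>R g x" for x
    have gi: "integrable lebesgue (\<lambda>x. indicator (cbox c d) x *\<^sub>R g x)"
      using g[OF compact_cbox cd] by (simp add: set_integrable_def)
    have "h = (\<lambda>x. indicat_real (box c d) x *\<^sub>R (indicator (cbox c d) x *\<^sub>R g x))"
      using box_subset_cbox[of c d] by (auto simp: h_def indicator_def fun_eq_iff)
    then have "integrable lebesgue h"
      using integrable_mult_indicator[OF _ gi, of "box c d"] by simp
    then have "AE x in lebesgue. h x = 0"
    proof (rule AE_zero_if_box_integrals_zero)
      show "(LINT x:box a b|lebesgue. h x) = 0" for a b
      proof -
        obtain a' b' where ab: "box a b \<inter> box c d = box a' b'" by (auto simp: box_Int_box)
        have "(LINT x:box a b|lebesgue. h x) = (LINT x:box a' b'|lebesgue. g x)"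
          unfolding set_lebesgue_integral_def ab[symmetric]
          by (intro Bochner_Integration.integral_cong) (auto simp: h_def indicator_def)
        also have "\<dots> = 0"
        proof (cases "box a' b' = {}")
          case False
          then have "cbox a' b' \<subseteq> cbox c d" using ab subset_box(3)[of a' b' c d]
            by (metis Int_lower2 closure_box closure_mono box_eq_empty(1) empty_iff subset_empty Int_empty_right)
          then have "cbox a' b' \<subseteq> U" using cd by blast
          then show ?thesis by (rule boxz)
        qed (simp add: set_lebesgue_integral_def)
        finally show ?thesis .
      qed
      show "(LINT x|lebesgue. h x) = 0"
        using boxz[OF cd] by (simp add: h_def set_lebesgue_integral_def)
    qed
    \<comment> \<open>The faces of the box, where \<open>h\<close> carries no information on
      \<open>g\<close>, form a null set.\<close>
    moreover have "cbox c d - box c d \<in> null_sets lebesgue"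
      using negligible_frontier_interval by (simp add: negligible_iff_null_sets)
    ultimately show ?thesis
      unfolding X using AE_not_in by (fastforce simp: h_def indicator_def split: if_splits)
  qed
  then have "AE x in lebesgue. \<forall>X\<in>D. x \<in> X \<longrightarrow> g x = 0"
    by (intro AE_ball_countable'[OF _ D(1)])
  then have "AE x in lebesgue. x \<in> U \<longrightarrow> g x = 0"
    by (rule eventually_mono) (use D(4) in auto)
  then show ?thesis using U by (simp add: AE_restrict_space_iff)
qed

lemma abs_integrable_scaleR_test:
  fixes g :: "'a::euclidean_space \<Rightarrow> 'b::euclidean_space"
  assumes U: "open U" and K: "compact K" "K \<subseteq> U" and g: "g absolutely_integrable_on K"
    and \<phi>: "continuous_on UNIV \<phi>" "\<And>x. x \<notin> K \<Longrightarrow> \<phi> x = (0::real)"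
  shows "integrable (lebesgue_on U) (\<lambda>x. \<phi> x *\<^sub>R g x)"
proof -
  obtain B where B: "0 \<le> B" "\<And>x. norm (\<phi> x) \<le> B"
    using continuous_compact_support_bounded[OF \<phi>(1) K(1) \<phi>(2)] by blast
  have gi: "integrable lebesgue (\<lambda>x. indicator K x *\<^sub>R g x)"
    using g by (simp add: set_integrable_def)
  have "\<phi> \<in> borel_measurable borel" by (rule borel_measurable_continuous_onI[OF \<phi>(1)])
  then have pm: "\<phi> \<in> borel_measurable lebesgue" by (intro measurable_completion) simp
  have "integrable lebesgue (\<lambda>x. \<phi> x *\<^sub>R (indicator K x *\<^sub>R g x))"
  proof (rule Bochner_Integration.integrable_bound)
    show "integrable lebesgue (\<lambda>x. B *\<^sub>R (indicator K x *\<^sub>R g x))"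
      by (rule integrable_scaleR_right[OF gi])
    show "(\<lambda>x. \<phi> x *\<^sub>R (indicator K x *\<^sub>R g x)) \<in> borel_measurable lebesgue"
      by (rule borel_measurable_scaleR[OF pm borel_measurable_integrable[OF gi]])
    show "AE x in lebesgue. norm (\<phi> x *\<^sub>R (indicator K x *\<^sub>R g x)) \<le> norm (B *\<^sub>R (indicat_real K x *\<^sub>R g x))"
    proof (rule AE_I2)
      fix x
      have "\<bar>\<phi> x\<bar> * norm (indicat_real K x *\<^sub>R g x) \<le> \<bar>B\<bar> * norm (indicat_real K x *\<^sub>R g x)"
        using B(1) B(2)[of x] by (intro mult_right_mono) auto
      then show "norm (\<phi> x *\<^sub>R (indicator K x *\<^sub>R g x)) \<le> norm (B *\<^sub>R (indicat_real K x *\<^sub>R g x))"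
        by (simp only: norm_scaleR)
    qed
  qed
  moreover have "(\<lambda>x. indicator U x *\<^sub>R (\<phi> x *\<^sub>R g x)) = (\<lambda>x. \<phi> x *\<^sub>R (indicator K x *\<^sub>R g x))"
    using K \<phi>(2) by (auto simp: indicator_def fun_eq_iff)
  ultimately show ?thesis using U by (simp add: integrable_restrict_space)
qed

text \<open>The components of \<open>G\<close> act as scalar test functions multiplying
  \<open>u\<close>.\<close>

lemma abs_integrable_times_test:
  fixes u :: "'a::euclidean_space \<Rightarrow> real" and G :: "'a \<Rightarrow> 'b::euclidean_space"
  assumes U: "open U" and K: "compact K" "K \<subseteq> U" and u: "u absolutely_integrable_on K"
    and G: "continuous_on UNIV G" "\<And>x. x \<notin> K \<Longrightarrow> G x = 0"
  shows "integrable (lebesgue_on U) (\<lambda>x. u x *\<^sub>R G x)"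
proof -
  have "integrable (lebesgue_on U) (\<lambda>x. (u x *\<^sub>R G x) \<bullet> b)" if "b \<in> Basis" for b
    using abs_integrable_scaleR_test[OF U K u, of "\<lambda>x. G x \<bullet> b"] G
    by (simp add: continuous_on_inner mult.commute)
  then have "integrable (lebesgue_on U) (\<lambda>x. \<Sum>b\<in>Basis. ((u x *\<^sub>R G x) \<bullet> b) *\<^sub>R b)"
    by (intro Bochner_Integration.integrable_sum integrable_scaleR_left)
  then show ?thesis by (simp only: euclidean_representation)
qed

section \<open>Calculus of weak gradients\<close>

lemma has_weak_gradientD:
  assumes "has_weak_gradient U u g"
  shows "compact K \<Longrightarrow> K \<subseteq> U \<Longrightarrow> u absolutely_integrable_on K"
    and "compact K \<Longrightarrow> K \<subseteq> U \<Longrightarrow> g absolutely_integrable_on K"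
    and "has_C1_gradient UNIV \<phi> G \<Longrightarrow> compact K \<Longrightarrow> K \<subseteq> U \<Longrightarrow> (\<And>x. x \<notin> K \<Longrightarrow> \<phi> x = 0) \<Longrightarrow>
      (\<integral>x. u x *\<^sub>R G x \<partial>lebesgue_on U) = - (\<integral>x. \<phi> x *\<^sub>R g x \<partial>lebesgue_on U)"
  using assms unfolding has_weak_gradient_def by blast+

lemma has_weak_gradientI:
  assumes "\<And>K. compact K \<Longrightarrow> K \<subseteq> U \<Longrightarrow> u absolutely_integrable_on K"
    and "\<And>K. compact K \<Longrightarrow> K \<subseteq> U \<Longrightarrow> g absolutely_integrable_on K"
    and "\<And>\<phi> G K. has_C1_gradient UNIV \<phi> G \<Longrightarrow> compact K \<Longrightarrow> K \<subseteq> U \<Longrightarrow> (\<And>x. x \<notin> K \<Longrightarrow> \<phi> x = 0) \<Longrightarrow>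
      (\<integral>x. u x *\<^sub>R G x \<partial>lebesgue_on U) = - (\<integral>x. \<phi> x *\<^sub>R g x \<partial>lebesgue_on U)"
  shows "has_weak_gradient U u g"
  using assms unfolding has_weak_gradient_def by blast

lemma weak_gradient_unique:
  assumes U: "open U" and g: "has_weak_gradient U u g" and h: "has_weak_gradient U u h"
  shows "AE x in lebesgue_on U. g x = h x"
proof -
  have "AE x in lebesgue_on U. g x - h x = 0"
  proof (rule weak_zero_AE[OF U])
    show "(\<lambda>x. g x - h x) absolutely_integrable_on K" if "compact K" "K \<subseteq> U" for K
      using has_weak_gradientD(2)[OF g that] has_weak_gradientD(2)[OF h that] by (rule set_integral_diff(1))
    fix \<phi> G K assume \<phi>: "has_C1_gradient UNIV \<phi> G" "compact K" "K \<subseteq> U" "\<And>x. x \<notin> K \<Longrightarrow> \<phi> x = 0"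
    have i: "integrable (lebesgue_on U) (\<lambda>x. \<phi> x *\<^sub>R g x)" "integrable (lebesgue_on U) (\<lambda>x. \<phi> x *\<^sub>R h x)"
      using abs_integrable_scaleR_test[OF U \<phi>(2,3) _ C1_continuous(1)[OF \<phi>(1)] \<phi>(4)]
        has_weak_gradientD(2)[OF g \<phi>(2,3)] has_weak_gradientD(2)[OF h \<phi>(2,3)] by auto
    have "(\<integral>x. \<phi> x *\<^sub>R g x \<partial>lebesgue_on U) = (\<integral>x. \<phi> x *\<^sub>R h x \<partial>lebesgue_on U)"
      using has_weak_gradientD(3)[OF g \<phi>] has_weak_gradientD(3)[OF h \<phi>] by simp
    then show "(\<integral>x. \<phi> x *\<^sub>R (g x - h x) \<partial>lebesgue_on U) = 0"
      using i by (simp add: scaleR_diff_right)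
  qed
  then show ?thesis by simp
qed

text \<open>The bridge between the arbitrary choice \<open>weak_grad\<close> and an explicit
  gradient: arguments are carried out with the latter and transferred through this equality.\<close>

lemma weak_grad_AE:
  assumes "open U" "has_weak_gradient U u g"
  shows "AE x in lebesgue_on U. weak_grad U u x = g x"
  using weak_gradient_unique[OF assms(1) _ assms(2)] someI[of "has_weak_gradient U u" g] assms(2)
  unfolding weak_grad_def by blast

text \<open>Measurability is assembled from countably many closed boxes that cover
  \<open>U\<close>.\<close>

lemma measurable_if_abs_integrable:
  fixes g :: "'a::euclidean_space \<Rightarrow> 'b::euclidean_space"
  assumes U: "open U" and g: "\<And>K. compact K \<Longrightarrow> K \<subseteq> U \<Longrightarrow> g absolutely_integrable_on K"
  shows "g \<in> borel_measurable (lebesgue_on U)"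
proof -
  obtain D where D: "countable D" "\<And>X. X \<in> D \<Longrightarrow> \<exists>a b. X = cbox a b" "D \<subseteq> Pow U" "\<Union>D = U"
    using open_countable_Union_open_cbox[OF U] by metis
  show ?thesis
  proof (rule measurable_piecewise_restrict[OF D(1)])
    fix X assume "X \<in> D"
    then obtain c d where X: "X = cbox c d" "X \<subseteq> U" using D by blast
    show "X \<inter> space (lebesgue_on U) \<in> sets (lebesgue_on U)"
      using X U by (simp add: sets_restrict_space_iff Int_absorb2)
    have "integrable (lebesgue_on X) g"
      using g[of X] X by (simp add: set_integrable_def integrable_restrict_space)
    then have "g \<in> borel_measurable (lebesgue_on X)" by (rule borel_measurable_integrable)
    then show "g \<in> borel_measurable (restrict_space (lebesgue_on U) X)"
      using X U by (simp add: restrict_restrict_space Int_absorb1)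
  qed (use D in auto)
qed

lemma weak_grad_has:
  assumes "has_weak_gradient U u g"
  shows "has_weak_gradient U u (weak_grad U u)"
  using someI[of "has_weak_gradient U u" g] assms unfolding weak_grad_def by blast

lemma weak_grad_measurable:
  assumes "open U" "has_weak_gradient U u g"
  shows "weak_grad U u \<in> borel_measurable (lebesgue_on U)"
  using measurable_if_abs_integrable[OF assms(1)] has_weak_gradientD(2)[OF weak_grad_has[OF assms(2)]] by blast

lemma integral_lincomb:
  fixes f h :: "'a \<Rightarrow> 'b::euclidean_space"
  assumes "integrable M f" "integrable M h"
  shows "(\<integral>x. f x + t *\<^sub>R h x \<partial>M) = (\<integral>x. f x \<partial>M) + t *\<^sub>R (\<integral>x. h x \<partial>M)"
  using assms by simp

lemma has_weak_gradient_lincomb: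
  assumes U: "open U" and u: "has_weak_gradient U u g" and v: "has_weak_gradient U v h"
  shows "has_weak_gradient U (\<lambda>x. u x + t *\<^sub>R v x) (\<lambda>x. g x + t *\<^sub>R h x)"
proof (rule has_weak_gradientI)
  fix K assume K: "compact K" "K \<subseteq> U"
  show "(\<lambda>x. u x + t *\<^sub>R v x) absolutely_integrable_on K"
    using has_weak_gradientD(1)[OF u K] has_weak_gradientD(1)[OF v K]
    by (intro set_integral_add(1) absolutely_integrable_on_scaleR_iff[THEN iffD2]) auto
  show "(\<lambda>x. g x + t *\<^sub>R h x) absolutely_integrable_on K"
    using has_weak_gradientD(2)[OF u K] has_weak_gradientD(2)[OF v K]
    by (intro set_integral_add(1) absolutely_integrable_on_scaleR_iff[THEN iffD2]) auto
next
  fix \<phi> G K assume \<phi>: "has_C1_gradient UNIV \<phi> G" "compact K" "K \<subseteq> U" "\<And>x. x \<notin> K \<Longrightarrow> \<phi> x = 0"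
  have G0: "\<And>x. x \<notin> K \<Longrightarrow> G x = 0"
    by (rule C1_gradient_support[OF \<phi>(1) compact_imp_closed[OF \<phi>(2)] \<phi>(4)])
  have i: "integrable (lebesgue_on U) (\<lambda>x. u x *\<^sub>R G x)" "integrable (lebesgue_on U) (\<lambda>x. v x *\<^sub>R G x)"
    using abs_integrable_times_test[OF U \<phi>(2,3) _ C1_continuous(2)[OF \<phi>(1)] G0]
      has_weak_gradientD(1)[OF u \<phi>(2,3)] has_weak_gradientD(1)[OF v \<phi>(2,3)] by auto
  have j: "integrable (lebesgue_on U) (\<lambda>x. \<phi> x *\<^sub>R g x)" "integrable (lebesgue_on U) (\<lambda>x. \<phi> x *\<^sub>R h x)"
    using abs_integrable_scaleR_test[OF U \<phi>(2,3) _ C1_continuous(1)[OF \<phi>(1)] \<phi>(4)]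
      has_weak_gradientD(2)[OF u \<phi>(2,3)] has_weak_gradientD(2)[OF v \<phi>(2,3)] by auto
  have "(\<integral>x. (u x + t *\<^sub>R v x) *\<^sub>R G x \<partial>lebesgue_on U)
      = (\<integral>x. u x *\<^sub>R G x + t *\<^sub>R (v x *\<^sub>R G x) \<partial>lebesgue_on U)"
    by (simp add: scaleR_add_left)
  also have "\<dots> = - ((\<integral>x. \<phi> x *\<^sub>R g x \<partial>lebesgue_on U) + t *\<^sub>R (\<integral>x. \<phi> x *\<^sub>R h x \<partial>lebesgue_on U))"
  proof -
    have "(\<integral>x. u x *\<^sub>R G x \<partial>lebesgue_on U) = - (\<integral>x. \<phi> x *\<^sub>R g x \<partial>lebesgue_on U)"
      by (rule has_weak_gradientD(3)[OF u \<phi>])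
    moreover have "(\<integral>x. v x *\<^sub>R G x \<partial>lebesgue_on U) = - (\<integral>x. \<phi> x *\<^sub>R h x \<partial>lebesgue_on U)"
      by (rule has_weak_gradientD(3)[OF v \<phi>])
    ultimately show ?thesis unfolding integral_lincomb[OF i] by simp
  qed
  also have "\<dots> = - (\<integral>x. \<phi> x *\<^sub>R g x + t *\<^sub>R (\<phi> x *\<^sub>R h x) \<partial>lebesgue_on U)"
    unfolding integral_lincomb[OF j] by simp
  finally show "(\<integral>x. (u x + t *\<^sub>R v x) *\<^sub>R G x \<partial>lebesgue_on U)
      = - (\<integral>x. \<phi> x *\<^sub>R (g x + t *\<^sub>R h x) \<partial>lebesgue_on U)"
    by (simp add: scaleR_add_right mult.commute)
qed

lemma L2_abs_integrable:
  assumes "u \<in> L2 K" "compact K"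
  shows "u absolutely_integrable_on K"
  using L2_integrable(1)[OF lmeasurable_compact[OF assms(2)] assms(1)] assms(2)
  by (simp add: set_integrable_def integrable_restrict_space lmeasurable_compact fmeasurableD)

lemma has_weak_gradient_cong_AE:
  assumes U: "open U" and u: "has_weak_gradient U u g" and uv: "AE x in lebesgue_on U. u x = v x"
    and v: "v \<in> L2 U"
  shows "has_weak_gradient U v g"
proof (rule has_weak_gradientI)
  have um: "u \<in> borel_measurable (lebesgue_on U)"
    using measurable_if_abs_integrable[OF U] has_weak_gradientD(1)[OF u] by blast
  have vm: "v \<in> borel_measurable (lebesgue_on U)" using v by (rule L2D)
  fix K assume K: "compact K" "K \<subseteq> U"
  show "v absolutely_integrable_on K"
    using L2_abs_integrable[OF L2_subset[OF v K(2)] K(1)] U K by (simp add: fmeasurableD lmeasurable_compact)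
  show "g absolutely_integrable_on K" using has_weak_gradientD(2)[OF u K] .
next
  have um: "u \<in> borel_measurable (lebesgue_on U)"
    using measurable_if_abs_integrable[OF U] has_weak_gradientD(1)[OF u] by blast
  have vm: "v \<in> borel_measurable (lebesgue_on U)" using v by (rule L2D)
  fix \<phi> G K assume \<phi>: "has_C1_gradient UNIV \<phi> G" "compact K" "K \<subseteq> U" "\<And>x. x \<notin> K \<Longrightarrow> \<phi> x = 0"
  have "G \<in> borel_measurable borel"
    using C1_continuous(2)[OF \<phi>(1)] by (rule borel_measurable_continuous_onI)
  then have "G \<in> borel_measurable lebesgue" by (intro measurable_completion) simp
  then have Gm: "G \<in> borel_measurable (lebesgue_on U)" by (rule measurable_restrict_space1)
  have "(\<integral>x. v x *\<^sub>R G x \<partial>lebesgue_on U) = (\<integral>x. u x *\<^sub>R G x \<partial>lebesgue_on U)"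
  proof (rule integral_cong_AE)
    show "(\<lambda>x. v x *\<^sub>R G x) \<in> borel_measurable (lebesgue_on U)" "(\<lambda>x. u x *\<^sub>R G x) \<in> borel_measurable (lebesgue_on U)"
      by (rule borel_measurable_scaleR[OF vm Gm] borel_measurable_scaleR[OF um Gm])+
    show "AE x in lebesgue_on U. v x *\<^sub>R G x = u x *\<^sub>R G x"
      using uv by eventually_elim simp
  qed
  then show "(\<integral>x. v x *\<^sub>R G x \<partial>lebesgue_on U) = - (\<integral>x. \<phi> x *\<^sub>R g x \<partial>lebesgue_on U)"
    using has_weak_gradientD(3)[OF u \<phi>] by simp
qed

lemma has_weak_gradient_subset:
  assumes u: "has_weak_gradient U u g" and V: "open U" "open V" "V \<subseteq> U"
  shows "has_weak_gradient V u g"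
proof (rule has_weak_gradientI)
  fix \<phi> G K assume \<phi>: "has_C1_gradient UNIV \<phi> G" "compact K" "K \<subseteq> V" "\<And>x. x \<notin> K \<Longrightarrow> \<phi> x = 0"
  have G0: "\<And>x. x \<notin> K \<Longrightarrow> G x = 0"
    by (rule C1_gradient_support[OF \<phi>(1) compact_imp_closed[OF \<phi>(2)] \<phi>(4)])
  have "(\<integral>x. u x *\<^sub>R G x \<partial>lebesgue_on U) = - (\<integral>x. \<phi> x *\<^sub>R g x \<partial>lebesgue_on U)"
    using V \<phi>(3) by (intro has_weak_gradientD(3)[OF u \<phi>(1,2) _ \<phi>(4)]) auto
  moreover have "(\<integral>x. u x *\<^sub>R G x \<partial>lebesgue_on U) = (\<integral>x. u x *\<^sub>R G x \<partial>lebesgue_on V)"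
    using V \<phi>(3) G0 by (simp add: integral_restrict_space)
      (intro Bochner_Integration.integral_cong, auto simp: indicator_def)
  moreover have "(\<integral>x. \<phi> x *\<^sub>R g x \<partial>lebesgue_on U) = (\<integral>x. \<phi> x *\<^sub>R g x \<partial>lebesgue_on V)"
    using V \<phi>(3,4) by (simp add: integral_restrict_space)
      (intro Bochner_Integration.integral_cong, auto simp: indicator_def)
  ultimately show "(\<integral>x. u x *\<^sub>R G x \<partial>lebesgue_on V) = - (\<integral>x. \<phi> x *\<^sub>R g x \<partial>lebesgue_on V)" by simp
next
  fix K assume "compact K" "K \<subseteq> V"
  with V(3) have K: "compact K" "K \<subseteq> U" by auto
  show "u absolutely_integrable_on K" "g absolutely_integrable_on K"
    using has_weak_gradientD(1)[OF u K] has_weak_gradientD(2)[OF u K] by auto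
qed

text \<open>The approximating pairs satisfy integration by parts only asymptotically, by
  \<open>id\<close>. This admits approximations that jump across a circle, provided that the
  resulting boundary term tends to 0.\<close>

lemma weak_gradient_limit:
  assumes U: "open U" and v: "\<And>K. compact K \<Longrightarrow> K \<subseteq> U \<Longrightarrow> v \<in> L2 K" and g: "\<And>K. compact K \<Longrightarrow> K \<subseteq> U \<Longrightarrow> g \<in> L2 K"
    and vn: "\<And>n K. compact K \<Longrightarrow> K \<subseteq> U \<Longrightarrow> vn n \<in> L2 K" and gn: "\<And>n K. compact K \<Longrightarrow> K \<subseteq> U \<Longrightarrow> gn n \<in> L2 K"
    and vl: "\<And>K. compact K \<Longrightarrow> K \<subseteq> U \<Longrightarrow> (\<lambda>n::nat. L2norm K (\<lambda>x. vn n x - v x)) \<longlonglongrightarrow> 0"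
    and gl: "\<And>K. compact K \<Longrightarrow> K \<subseteq> U \<Longrightarrow> (\<lambda>n. L2norm K (\<lambda>x. gn n x - g x)) \<longlonglongrightarrow> 0"
    and id: "\<And>\<phi> G K. has_C1_gradient UNIV \<phi> G \<Longrightarrow> compact K \<Longrightarrow> K \<subseteq> U \<Longrightarrow> (\<And>x. x \<notin> K \<Longrightarrow> \<phi> x = 0) \<Longrightarrow>
      (\<lambda>n. (\<integral>x. vn n x *\<^sub>R G x \<partial>lebesgue_on K) + (\<integral>x. \<phi> x *\<^sub>R gn n x \<partial>lebesgue_on K)) \<longlonglongrightarrow> 0"
  shows "has_weak_gradient U v g"
proof (rule has_weak_gradientI)
  fix \<phi> G K assume \<phi>: "has_C1_gradient UNIV \<phi> G" "compact K" "K \<subseteq> U" "\<And>x. x \<notin> K \<Longrightarrow> \<phi> x = 0"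
  have G0: "\<And>x. x \<notin> K \<Longrightarrow> G x = 0"
    by (rule C1_gradient_support[OF \<phi>(1) compact_imp_closed[OF \<phi>(2)] \<phi>(4)])
  note K = \<phi>(2,3)
  have Km: "K \<in> lmeasurable" by (rule lmeasurable_compact[OF K(1)])
  have bm: "h \<in> borel_measurable (lebesgue_on K)" if "continuous_on UNIV h" for h :: "'a \<Rightarrow> 'c::euclidean_space"
  proof -
    have "h \<in> borel_measurable borel" using that by (rule borel_measurable_continuous_onI)
    then have "h \<in> borel_measurable lebesgue" by (intro measurable_completion) simp
    then show ?thesis by (rule measurable_restrict_space1)
  qed
  have L2c: "h \<in> L2 K" if h: "continuous_on UNIV h" "\<And>x. x \<notin> K \<Longrightarrow> h x = 0" for h :: "'a \<Rightarrow> 'c::euclidean_space"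
  proof -
    obtain B where "0 \<le> B" "\<And>x. norm (h x) \<le> B"
      using continuous_compact_support_bounded[OF h(1) K(1) h(2)] by blast
    then show ?thesis using L2_bounded(1)[OF Km bm[OF h(1)], of B] by blast
  qed
  \<comment> \<open>Convergence in L^2 passes to integrals against a fixed L^2 function; the
    vector-valued identities are reduced to it component by component.\<close>
  have pairing: "(\<lambda>n. \<integral>x. hn n x * p x \<partial>lebesgue_on K) \<longlonglongrightarrow> (\<integral>x. h x * p x \<partial>lebesgue_on K)"
    if "\<And>n. hn n \<in> L2 K" "h \<in> L2 K" "p \<in> L2 K" "(\<lambda>n. L2norm K (\<lambda>x. hn n x - h x)) \<longlonglongrightarrow> 0"
    for hn :: "nat \<Rightarrow> 'a \<Rightarrow> real" and h p
  proof (rule LIM_zero_cancel, rule Lim_null_comparison)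
    show "(\<lambda>n. L2norm K (\<lambda>x. hn n x - h x) * L2norm K p) \<longlonglongrightarrow> 0"
      using tendsto_mult_left_zero[OF that(4)] by simp
    show "\<forall>\<^sub>F n in sequentially. norm ((\<integral>x. hn n x * p x \<partial>lebesgue_on K) - (\<integral>x. h x * p x \<partial>lebesgue_on K))
        \<le> L2norm K (\<lambda>x. hn n x - h x) * L2norm K p"
    proof (rule always_eventually, rule allI)
      fix n
      have "(\<integral>x. hn n x * p x \<partial>lebesgue_on K) - (\<integral>x. h x * p x \<partial>lebesgue_on K) = (\<integral>x. (hn n x - h x) * p x \<partial>lebesgue_on K)"
        using L2_inner_integrable[OF that(1) that(3)] L2_inner_integrable[OF that(2,3)]
        by (simp add: left_diff_distrib)
      then show "norm ((\<integral>x. hn n x * p x \<partial>lebesgue_on K) - (\<integral>x. h x * p x \<partial>lebesgue_on K))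
        \<le> L2norm K (\<lambda>x. hn n x - h x) * L2norm K p"
        using L2_Cauchy_Schwarz[OF L2_diff[OF that(1,2)] that(3)] by simp
    qed
  qed
  have comp: "(\<lambda>x. h x \<bullet> b) \<in> L2 K" "L2norm K (\<lambda>x. h x \<bullet> b) \<le> L2norm K h" if "h \<in> L2 K" "b \<in> Basis"
    for h and b :: 'a
  proof -
    have "norm (h x \<bullet> b) \<le> norm (h x)" for x using Basis_le_norm[OF that(2)] by simp
    moreover have "(\<lambda>x. h x \<bullet> b) \<in> borel_measurable (lebesgue_on K)"
      using L2D(1)[OF that(1)] by measurable
    ultimately show "(\<lambda>x. h x \<bullet> b) \<in> L2 K" "L2norm K (\<lambda>x. h x \<bullet> b) \<le> L2norm K h"
      using L2_mono_bound[OF that(1)] by blast+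
  qed
  have ints: "integrable (lebesgue_on K) (\<lambda>x. h x *\<^sub>R G x)" if "h \<in> L2 K" for h
  proof -
    have "integrable (lebesgue_on K) (\<lambda>x. (h x *\<^sub>R G x) \<bullet> b)" if "b \<in> Basis" for b
      using L2_inner_integrable[OF \<open>h \<in> L2 K\<close> comp(1)[OF L2c[OF C1_continuous(2)[OF \<phi>(1)] G0] that]] by simp
    then have "integrable (lebesgue_on K) (\<lambda>x. \<Sum>b\<in>Basis. ((h x *\<^sub>R G x) \<bullet> b) *\<^sub>R b)"
      by (intro Bochner_Integration.integrable_sum integrable_scaleR_left)
    then show ?thesis by (simp only: euclidean_representation)
  qed
  have intp: "integrable (lebesgue_on K) (\<lambda>x. \<phi> x *\<^sub>R h x)" if "h \<in> L2 K" for h :: "'a \<Rightarrow> 'a"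
  proof -
    have "integrable (lebesgue_on K) (\<lambda>x. (\<phi> x *\<^sub>R h x) \<bullet> b)" if "b \<in> Basis" for b
      using L2_inner_integrable[OF L2c[OF C1_continuous(1)[OF \<phi>(1)] \<phi>(4)] comp(1)[OF \<open>h \<in> L2 K\<close> that]] by simp
    then have "integrable (lebesgue_on K) (\<lambda>x. \<Sum>b\<in>Basis. ((\<phi> x *\<^sub>R h x) \<bullet> b) *\<^sub>R b)"
      by (intro Bochner_Integration.integrable_sum integrable_scaleR_left)
    then show ?thesis by (simp only: euclidean_representation)
  qed
  have "((\<integral>x. v x *\<^sub>R G x \<partial>lebesgue_on K) + (\<integral>x. \<phi> x *\<^sub>R g x \<partial>lebesgue_on K)) \<bullet> b = 0" if b: "b \<in> Basis" for b
  proof -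
    have "(\<lambda>n. (\<integral>x. vn n x * (G x \<bullet> b) \<partial>lebesgue_on K)) \<longlonglongrightarrow> (\<integral>x. v x * (G x \<bullet> b) \<partial>lebesgue_on K)"
      by (intro pairing vn v K vl comp(1)[OF L2c b] C1_continuous(2)[OF \<phi>(1)] G0)
    moreover have "(\<lambda>n. (\<integral>x. (gn n x \<bullet> b) * \<phi> x \<partial>lebesgue_on K)) \<longlonglongrightarrow> (\<integral>x. (g x \<bullet> b) * \<phi> x \<partial>lebesgue_on K)"
    proof (rule pairing)
      show "(\<lambda>n. L2norm K (\<lambda>x. gn n x \<bullet> b - g x \<bullet> b)) \<longlonglongrightarrow> 0"
      proof (rule Lim_null_comparison[OF _ gl[OF K]])
        show "\<forall>\<^sub>F n in sequentially. norm (L2norm K (\<lambda>x. gn n x \<bullet> b - g x \<bullet> b)) \<le> L2norm K (\<lambda>x. gn n x - g x)"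
          using comp(2)[OF L2_diff[OF gn[OF K] g[OF K]] b] by (simp add: inner_diff_left)
      qed
    qed (intro comp(1)[OF _ b] gn g K L2c C1_continuous(1)[OF \<phi>(1)] \<phi>(4); assumption)+
    ultimately have "(\<lambda>n. (\<integral>x. vn n x * (G x \<bullet> b) \<partial>lebesgue_on K) + (\<integral>x. (gn n x \<bullet> b) * \<phi> x \<partial>lebesgue_on K))
      \<longlonglongrightarrow> (\<integral>x. v x * (G x \<bullet> b) \<partial>lebesgue_on K) + (\<integral>x. (g x \<bullet> b) * \<phi> x \<partial>lebesgue_on K)"
      by (rule tendsto_add)
    moreover have eq: "(\<integral>x. w x * (G x \<bullet> b) \<partial>lebesgue_on K) + (\<integral>x. (h x \<bullet> b) * \<phi> x \<partial>lebesgue_on K)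
      = ((\<integral>x. w x *\<^sub>R G x \<partial>lebesgue_on K) + (\<integral>x. \<phi> x *\<^sub>R h x \<partial>lebesgue_on K)) \<bullet> b"
      if "w \<in> L2 K" "h \<in> L2 K" for w h
      using integral_inner_left[OF ints[OF that(1)], of b] integral_inner_left[OF intp[OF that(2)], of b]
      by (simp add: inner_add_left mult.commute)
    ultimately have "(\<lambda>n. ((\<integral>x. vn n x *\<^sub>R G x \<partial>lebesgue_on K) + (\<integral>x. \<phi> x *\<^sub>R gn n x \<partial>lebesgue_on K)) \<bullet> b)
      \<longlonglongrightarrow> ((\<integral>x. v x *\<^sub>R G x \<partial>lebesgue_on K) + (\<integral>x. \<phi> x *\<^sub>R g x \<partial>lebesgue_on K)) \<bullet> b"
      using eq[OF vn[OF K] gn[OF K]] eq[OF v[OF K] g[OF K]] by simp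
    moreover have "(\<lambda>n. ((\<integral>x. vn n x *\<^sub>R G x \<partial>lebesgue_on K) + (\<integral>x. \<phi> x *\<^sub>R gn n x \<partial>lebesgue_on K)) \<bullet> b) \<longlonglongrightarrow> 0 \<bullet> b"
      by (intro tendsto_inner id tendsto_const \<phi>)
    ultimately show ?thesis using LIMSEQ_unique by fastforce
  qed
  then have "(\<integral>x. v x *\<^sub>R G x \<partial>lebesgue_on K) + (\<integral>x. \<phi> x *\<^sub>R g x \<partial>lebesgue_on K) = 0"
    by (intro euclidean_eqI[where 'a='a]) simp
  moreover have "(\<integral>x. v x *\<^sub>R G x \<partial>lebesgue_on U) = (\<integral>x. v x *\<^sub>R G x \<partial>lebesgue_on K)"
    using U K G0 Km by (simp add: integral_restrict_space fmeasurableD)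
      (intro Bochner_Integration.integral_cong, auto simp: indicator_def)
  moreover have "(\<integral>x. \<phi> x *\<^sub>R g x \<partial>lebesgue_on U) = (\<integral>x. \<phi> x *\<^sub>R g x \<partial>lebesgue_on K)"
    using U K \<phi>(4) Km by (simp add: integral_restrict_space fmeasurableD)
      (intro Bochner_Integration.integral_cong, auto simp: indicator_def)
  ultimately show "(\<integral>x. v x *\<^sub>R G x \<partial>lebesgue_on U) = - (\<integral>x. \<phi> x *\<^sub>R g x \<partial>lebesgue_on U)"
    by (simp add: eq_neg_iff_add_eq_0)
next
  fix K assume K: "compact K" "K \<subseteq> U"
  show "v absolutely_integrable_on K" "g absolutely_integrable_on K"
    using L2_abs_integrable[OF v[OF K] K(1)] L2_abs_integrable[OF g[OF K] K(1)] by auto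
qed

subsection \<open>Periodic functions on the plane\<close>

definition lat :: "real \<Rightarrow> (2 \<Rightarrow> int) \<Rightarrow> real^2" where
  "lat L k = (\<chi> i. 2 * L * of_int (k i))"

text \<open>Invariance under every lattice vector, for values in any type, so that gradients and
  extended nonnegative integrands are covered too.\<close>

definition lperiodic :: "real \<Rightarrow> (real^2 \<Rightarrow> 'b) \<Rightarrow> bool" where
  "lperiodic L w \<longleftrightarrow> (\<forall>x k. w (x + lat L k) = w x)"

text \<open>Half-open, so that for positive \<open>L\<close> exactly one lattice translate of each
  point lies in it.\<close>

definition cell :: "real \<Rightarrow> (real^2) set" where
  "cell L = {x. \<forall>i. - L \<le> x $ i \<and> x $ i < L}"

definition cell_index :: "real \<Rightarrow> real^2 \<Rightarrow> 2 \<Rightarrow> int" where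
  "cell_index L x i = \<lfloor>(x $ i + L) / (2 * L)\<rfloor>"

text \<open>The representative of \<open>x\<close> in the cell. It jumps across cell boundaries, so
  smoothness of a folded function has to be argued there.\<close>

definition fold_cell :: "real \<Rightarrow> real^2 \<Rightarrow> real^2" where
  "fold_cell L x = x - lat L (cell_index L x)"

lemma periodic_iff_lperiodic:
  fixes w :: "real^2 \<Rightarrow> real"
  shows "periodic L w \<longleftrightarrow> lperiodic L w"
proof
  assume p: "periodic L w"
  have step: "w (x + axis i (2 * L * of_int n)) = w x" for x i n
  proof (induction n arbitrary: x rule: int_induct[where k=0])
    case base
    have "x + axis i (2 * L * of_int 0) = x" by (simp add: vec_eq_iff axis_def)
    then show ?case by (simp only:)
  next
    case (step1 n)
    have "x + axis i (2 * L * of_int (n + 1)) = (x + axis i (2 * L * of_int n)) + axis i (2 * L)"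
      by (simp add: vec_eq_iff axis_def algebra_simps)
    then have "w (x + axis i (2 * L * of_int (n + 1))) = w (x + axis i (2 * L * of_int n))"
      using p unfolding periodic_def by metis
    then show ?case using step1 by metis
  next
    case (step2 n)
    have "w (x + axis i (2 * L * of_int (n - 1))) = w ((x + axis i (2 * L * of_int (n - 1))) + axis i (2 * L))"
      using p by (simp add: periodic_def)
    also have "(x + axis i (2 * L * of_int (n - 1))) + axis i (2 * L) = x + axis i (2 * L * of_int n)"
      by (simp add: vec_eq_iff axis_def algebra_simps)
    finally show ?case using step2 by simp
  qed
  have "lat L k = axis 1 (2 * L * of_int (k 1)) + axis 2 (2 * L * of_int (k 2))" for k
    by (simp add: vec_eq_iff lat_def axis_def forall_2)
  then show "lperiodic L w"
    unfolding lperiodic_def by (metis step add.assoc)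
next
  assume p: "lperiodic L w"
  have "axis i (2 * L) = lat L (\<lambda>j. if j = i then 1 else 0)" for i
    by (simp add: vec_eq_iff lat_def axis_def)
  then show "periodic L w" using p by (simp add: periodic_def lperiodic_def)
qed

lemma lperiodic_diff: "lperiodic L w \<Longrightarrow> w (x - lat L k) = w x"
  unfolding lperiodic_def by (metis diff_add_cancel)

lemma cell_iff:
  assumes "L > 0"
  shows "x - lat L k \<in> cell L \<longleftrightarrow> k = cell_index L x"
proof -
  have "- L \<le> x $ i - 2 * L * of_int (k i) \<and> x $ i - 2 * L * of_int (k i) < L
      \<longleftrightarrow> \<lfloor>(x $ i + L) / (2 * L)\<rfloor> = k i" for i
    using assms by (auto simp: floor_eq_iff field_simps)
  then show ?thesis
    by (auto simp: cell_def lat_def cell_index_def fun_eq_iff)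
qed

lemma fold_cell_in: "L > 0 \<Longrightarrow> fold_cell L x \<in> cell L"
  unfolding fold_cell_def by (simp add: cell_iff)

lemma fold_cell_eqI: "L > 0 \<Longrightarrow> x - lat L k \<in> cell L \<Longrightarrow> fold_cell L x = x - lat L k"
  by (simp add: cell_iff fold_cell_def)

lemma fold_cell_id: "L > 0 \<Longrightarrow> x \<in> cell L \<Longrightarrow> fold_cell L x = x"
  using fold_cell_eqI[of L x "\<lambda>i. 0"] by (simp add: lat_def zero_vec_def[symmetric])

lemma lperiodic_fold: "lperiodic L w \<Longrightarrow> w (fold_cell L x) = w x"
  by (simp add: fold_cell_def lperiodic_diff)

lemma fold_cell_add_lat:
  assumes "L > 0"
  shows "fold_cell L (x + lat L k) = fold_cell L x"
proof -
  have "lat L k + lat L (cell_index L x) = lat L (\<lambda>i. k i + cell_index L x i)"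
    by (simp add: lat_def vec_eq_iff algebra_simps)
  then have "(x + lat L k) - lat L (\<lambda>i. k i + cell_index L x i) = fold_cell L x"
    by (simp add: fold_cell_def algebra_simps)
  then show ?thesis using fold_cell_eqI[OF assms] fold_cell_in[OF assms] by metis
qed

lemma lperiodic_compose_fold: "L > 0 \<Longrightarrow> lperiodic L (\<lambda>x. f (fold_cell L x))"
  by (simp add: lperiodic_def fold_cell_add_lat)

section \<open>Integrals of periodic functions over the square and over bounded sets\<close>

lemma Omega_box: "Omega L = box (\<chi> i. - L) (\<chi> i. L)"
  by (auto simp: Omega_def box_def Basis_vec_def inner_axis)

lemma open_Omega: "open (Omega L)"
  by (simp add: Omega_box open_box)

lemma lmeasurable_Omega: "Omega L \<in> lmeasurable"
  by (simp add: Omega_box)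

lemma sets_Omega: "Omega L \<in> sets lebesgue" "Omega L \<in> sets borel"
  by (auto simp: Omega_box)

lemma measure_Omega:
  assumes "L > 0"
  shows "measure lebesgue (Omega L) = (2 * L)\<^sup>2"
proof -
  have "measure lborel (box (\<chi> i. - L :: real^2) (\<chi> i. L)) = (\<Prod>b\<in>Basis. ((\<chi> i. L) - (\<chi> i. - L) :: real^2) \<bullet> b)"
    by (rule measure_lborel_box) (use assms in \<open>auto simp: Basis_vec_def inner_axis\<close>)
  also have "\<dots> = (\<Prod>i\<in>(UNIV::2 set). 2 * L)"
    by (subst prod.reindex_bij_betw[of "\<lambda>i. axis i 1" UNIV Basis, symmetric])
      (auto simp: Basis_vec_def bij_betw_def inj_on_def axis_eq_axis inner_axis)
  also have "\<dots> = (2 * L)\<^sup>2" by simp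
  finally show ?thesis by (simp add: Omega_box)
qed

lemma Omega_subset_cell: "Omega L \<subseteq> cell L"
  by (auto simp: Omega_def cell_def intro: less_imp_le)

lemma cell_subset_cbox: "cell L \<subseteq> cbox (\<chi> i. - L) (\<chi> i. L)"
  by (auto simp: cell_def cbox_def Basis_vec_def inner_axis intro: less_imp_le)

lemma borel_cell[measurable]: "cell L \<in> sets borel"
proof -
  have "cell L = (\<Inter>i\<in>UNIV. {x. - L \<le> x $ i \<and> x $ i < L})" by (auto simp: cell_def)
  then show ?thesis by (auto intro!: sets.countable_INT'')
qed

lemma AE_cell_Omega: "AE x in lborel. x \<in> cell L \<longleftrightarrow> x \<in> Omega L"
proof -
  have "cbox (\<chi> i. - L) (\<chi> i. L) - box (\<chi> i. - L) ((\<chi> i. L) :: real^2) \<in> null_sets lebesgue"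
    using negligible_frontier_interval by (simp add: negligible_iff_null_sets)
  then have "AE x in lebesgue. x \<notin> cbox (\<chi> i. - L) (\<chi> i. L) - box (\<chi> i. - L) ((\<chi> i. L) :: real^2)"
    by (rule AE_not_in)
  then have "AE x in lborel. x \<notin> cbox (\<chi> i. - L) (\<chi> i. L) - box (\<chi> i. - L) ((\<chi> i. L) :: real^2)"
    by (simp only: AE_completion_iff)
  then show ?thesis
    by eventually_elim (use Omega_subset_cell[of L] cell_subset_cbox[of L] Omega_box[of L] in auto)
qed

lemma nn_integral_lborel_translation:
  fixes F :: "'a::euclidean_space \<Rightarrow> ennreal"
  assumes "F \<in> borel_measurable borel"
  shows "(\<integral>\<^sup>+x. F (x + c) \<partial>lborel) = (\<integral>\<^sup>+x. F x \<partial>lborel)"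
proof -
  have "(\<integral>\<^sup>+x. F x \<partial>lborel) = (\<integral>\<^sup>+x. F x \<partial>distr lborel borel ((+) c))"
    by (simp add: lborel_distr_plus)
  also have "\<dots> = (\<integral>\<^sup>+x. F (c + x) \<partial>lborel)" by (rule nn_integral_distr) (use assms in auto)
  finally show ?thesis by (simp add: add.commute)
qed

text \<open>The translates of the cell tile the plane. The sum is written as an integral over
  counting measure so that it can be inserted into Lebesgue integrals and exchanged with
  them.\<close>

lemma sum_cell_indicators:
  assumes "L > 0"
  shows "(\<integral>\<^sup>+k. indicator (cell L) (x - lat L k) \<partial>count_space UNIV) = 1"
proof -
  have "(\<lambda>k. indicator (cell L) (x - lat L k) :: ennreal) = indicator {cell_index L x}"
    using cell_iff[OF assms, of x] by (auto simp: indicator_def fun_eq_iff)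
  then show ?thesis by simp
qed

text \<open>Unfolding: the tiling is inserted, sum and integral are exchanged, and each term is
  translated back by periodicity. What remains is the tiling by the shifted cell, which again sums
  to 1.\<close>

lemma nn_integral_cell_translation:
  fixes h :: "real^2 \<Rightarrow> ennreal"
  assumes L: "L > 0" and h[measurable]: "h \<in> borel_measurable borel" and per: "lperiodic L h"
  shows "(\<integral>\<^sup>+x. h (x + z) * indicator (cell L) x \<partial>lborel) = (\<integral>\<^sup>+x. h x * indicator (cell L) x \<partial>lborel)"
proof -
  let ?i = "indicator (cell L) :: real^2 \<Rightarrow> ennreal"
  have "(\<integral>\<^sup>+x. h (x + z) * ?i x \<partial>lborel) = (\<integral>\<^sup>+x. h (x + z) * ?i ((x + z) - z) \<partial>lborel)" by simp
  also have "\<dots> = (\<integral>\<^sup>+y. h y * ?i (y - z) \<partial>lborel)"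
    by (rule nn_integral_lborel_translation[where F="\<lambda>y. h y * ?i (y - z)"]) measurable
  also have "\<dots> = (\<integral>\<^sup>+y. (\<integral>\<^sup>+k. h y * ?i (y - z) * ?i (y - lat L k) \<partial>count_space UNIV) \<partial>lborel)"
    by (simp add: nn_integral_cmult sum_cell_indicators[OF L])
  also have "\<dots> = (\<integral>\<^sup>+k. (\<integral>\<^sup>+y. h y * ?i (y - z) * ?i (y - lat L k) \<partial>lborel) \<partial>count_space UNIV)"
    by (rule nn_integral_count_space_nn_integral) (auto intro: countableI_type)
  also have "\<dots> = (\<integral>\<^sup>+k. (\<integral>\<^sup>+x. h x * ?i ((x - z) + lat L k) * ?i x \<partial>lborel) \<partial>count_space UNIV)"
  proof (rule nn_integral_cong)
    fix k
    have "(\<integral>\<^sup>+y. h y * ?i (y - z) * ?i (y - lat L k) \<partial>lborel)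
        = (\<integral>\<^sup>+x. h (x + lat L k) * ?i ((x + lat L k) - z) * ?i ((x + lat L k) - lat L k) \<partial>lborel)"
      by (rule nn_integral_lborel_translation[symmetric, where F="\<lambda>y. h y * ?i (y - z) * ?i (y - lat L k)"]) measurable
    also have "\<dots> = (\<integral>\<^sup>+x. h x * ?i ((x - z) + lat L k) * ?i x \<partial>lborel)"
      using per by (simp add: lperiodic_def algebra_simps)
    finally show "(\<integral>\<^sup>+y. h y * ?i (y - z) * ?i (y - lat L k) \<partial>lborel)
        = (\<integral>\<^sup>+x. h x * ?i ((x - z) + lat L k) * ?i x \<partial>lborel)" .
  qed
  also have "\<dots> = (\<integral>\<^sup>+x. (\<integral>\<^sup>+k. h x * ?i ((x - z) + lat L k) * ?i x \<partial>count_space UNIV) \<partial>lborel)"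
    by (rule nn_integral_count_space_nn_integral[symmetric]) (auto intro: countableI_type)
  also have "\<dots> = (\<integral>\<^sup>+x. h x * ?i x \<partial>lborel)"
  proof (rule nn_integral_cong)
    fix x
    \<comment> \<open>Translating back changed the sign of the lattice vectors; the bijection
      \<open>k \<mapsto> - k\<close> restores the form of the tiling identity.\<close>
    have "(\<integral>\<^sup>+k. ?i ((x - z) + lat L k) \<partial>count_space UNIV)
        = (\<integral>\<^sup>+k. ?i ((x - z) - lat L k) \<partial>count_space UNIV)"
    proof -
      have b: "bij_betw (\<lambda>k i. - k i) (UNIV :: (2 \<Rightarrow> int) set) UNIV"
        by (rule bij_betwI[where g="\<lambda>k i. - k i"]) auto
      have "lat L (\<lambda>i. - k i) = - lat L k" for k by (simp add: lat_def vec_eq_iff)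
      then show ?thesis
        using nn_integral_bij_count_space[OF b, of "\<lambda>k. ?i ((x - z) - lat L k)"] by simp
    qed
    then have "(\<integral>\<^sup>+k. ?i ((x - z) + lat L k) \<partial>count_space UNIV) = 1"
      using sum_cell_indicators[OF L, of "x - z"] by simp
    moreover have "(\<integral>\<^sup>+k. h x * ?i ((x - z) + lat L k) * ?i x \<partial>count_space UNIV)
      = (\<integral>\<^sup>+k. (h x * ?i x) * ?i ((x - z) + lat L k) \<partial>count_space UNIV)" by (simp add: ac_simps)
    ultimately show "(\<integral>\<^sup>+k. h x * ?i ((x - z) + lat L k) * ?i x \<partial>count_space UNIV) = h x * ?i x"
      by (simp add: nn_integral_cmult)
  qed
  finally show ?thesis .
qed

text \<open>A bounded set meets only finitely many cells, and each contributes the same integral. It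
  matters that \<open>N\<close> depends on \<open>K\<close> alone and not on the integrand.\<close>

lemma nn_integral_bounded_le_cell:
  assumes L: "L > 0" and K: "bounded K"
  obtains N :: nat where "\<And>h :: real^2 \<Rightarrow> ennreal. h \<in> borel_measurable borel \<Longrightarrow> lperiodic L h \<Longrightarrow>
    (\<integral>\<^sup>+x. h x * indicator K x \<partial>lborel) \<le> of_nat N * (\<integral>\<^sup>+x. h x * indicator (cell L) x \<partial>lborel)"
proof -
  obtain R where R: "\<And>x. x \<in> K \<Longrightarrow> norm x \<le> R" using K by (auto simp: bounded_iff)
  \<comment> \<open>Bounds the indices of the cells meeting \<open>K\<close>; the summand 1 makes
    the upper estimate strict, and a symmetric range of indices suffices.\<close>
  define m where "m = \<lceil>(R + L) / (2 * L)\<rceil> + 1"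
  define F where "F = {k :: 2 \<Rightarrow> int. \<forall>i. k i \<in> {-m..m}}"
  have "finite F"
    using finite_PiE[of UNIV "\<lambda>i::2. {-m..m}"] by (simp add: F_def PiE_def Pi_def extensional_def)
  have inF: "cell_index L x \<in> F" if "x \<in> K" for x
  proof -
    have "cell_index L x i \<in> {-m..m}" for i
    proof -
      have "\<bar>x $ i\<bar> \<le> R" using component_le_norm_cart[of x i] R[OF that] by simp
      then have "(x $ i + L) / (2 * L) \<le> (R + L) / (2 * L)" "(- (R + L)) / (2 * L) \<le> (x $ i + L) / (2 * L)"
        using L by (auto intro!: divide_right_mono)
      then have "(x $ i + L) / (2 * L) < of_int m" "- of_int m \<le> (x $ i + L) / (2 * L)"
        unfolding m_def minus_divide_left[symmetric] by linarith+
      then show ?thesis unfolding cell_index_def by (auto simp: le_floor_iff floor_le_iff)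
    qed
    then show ?thesis by (simp add: F_def)
  qed
  show ?thesis
  proof (rule that[of "card F"])
    fix h :: "real^2 \<Rightarrow> ennreal" assume h[measurable]: "h \<in> borel_measurable borel" and per: "lperiodic L h"
    let ?i = "indicator (cell L) :: real^2 \<Rightarrow> ennreal"
    have "(\<integral>\<^sup>+x. h x * indicator K x \<partial>lborel) \<le> (\<integral>\<^sup>+x. (\<Sum>k\<in>F. h x * ?i (x - lat L k)) \<partial>lborel)"
    proof (rule nn_integral_mono)
      fix x
      show "h x * indicator K x \<le> (\<Sum>k\<in>F. h x * ?i (x - lat L k))"
      proof (cases "x \<in> K")
        case True
        have "?i (x - lat L (cell_index L x)) = 1" using cell_iff[OF L, of x] by simp
        then have "h x * indicator K x = h x * ?i (x - lat L (cell_index L x))" using True by simp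
        also have "\<dots> \<le> (\<Sum>k\<in>F. h x * ?i (x - lat L k))"
          by (rule member_le_sum[OF inF[OF True]]) (use \<open>finite F\<close> in auto)
        finally show ?thesis .
      qed simp
    qed
    also have "\<dots> = (\<Sum>k\<in>F. \<integral>\<^sup>+x. h x * ?i (x - lat L k) \<partial>lborel)"
      by (rule nn_integral_sum) measurable
    also have "\<dots> = (\<Sum>k\<in>F. \<integral>\<^sup>+x. h x * ?i x \<partial>lborel)"
    proof (rule sum.cong[OF refl])
      fix k
      have "(\<integral>\<^sup>+x. h x * ?i (x - lat L k) \<partial>lborel) = (\<integral>\<^sup>+x. h (x + lat L k) * ?i ((x + lat L k) - lat L k) \<partial>lborel)"
        by (rule nn_integral_lborel_translation[symmetric, where F="\<lambda>x. h x * ?i (x - lat L k)"]) measurable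
      then show "(\<integral>\<^sup>+x. h x * ?i (x - lat L k) \<partial>lborel) = (\<integral>\<^sup>+x. h x * ?i x \<partial>lborel)"
        using per by (simp add: lperiodic_def)
    qed
    finally show "(\<integral>\<^sup>+x. h x * indicator K x \<partial>lborel) \<le> of_nat (card F) * (\<integral>\<^sup>+x. h x * ?i x \<partial>lborel)"
      by simp
  qed
qed

lemma nn_integral_cell_Omega: "(\<integral>\<^sup>+x. h x * indicator (cell L) x \<partial>lborel) = (\<integral>\<^sup>+x. h x \<partial>lebesgue_on (Omega L))"
proof -
  have "(\<integral>\<^sup>+x. h x * indicator (cell L) x \<partial>lborel) = (\<integral>\<^sup>+x. h x * indicator (Omega L) x \<partial>lborel)"
    by (rule nn_integral_cong_AE, use AE_cell_Omega[of L] in eventually_elim) (auto simp: indicator_def)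
  also have "\<dots> = (\<integral>\<^sup>+x. h x * indicator (Omega L) x \<partial>lebesgue)"
    by (simp only: nn_integral_completion)
  also have "\<dots> = (\<integral>\<^sup>+x. h x \<partial>lebesgue_on (Omega L))"
    by (subst nn_integral_restrict_space) (auto simp: sets_Omega)
  finally show ?thesis .
qed

lemma borel_measurable_lebesgue_onI:
  fixes u :: "'a::euclidean_space \<Rightarrow> 'b::euclidean_space"
  assumes "u \<in> borel_measurable borel"
  shows "u \<in> borel_measurable (lebesgue_on K)"
  using assms by (intro measurable_restrict_space1 measurable_completion) simp

lemma L2_nn_integral:
  assumes "u \<in> L2 U"
  shows "(\<integral>\<^sup>+x. ennreal ((norm (u x))\<^sup>2) \<partial>lebesgue_on U) = ennreal ((L2norm U u)\<^sup>2)"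
  unfolding L2norm_sq using L2D(2)[OF assms] by (intro nn_integral_eq_integral) auto

lemma L2_if_nn_integral:
  assumes "u \<in> borel_measurable (lebesgue_on U)"
    "(\<integral>\<^sup>+x. ennreal ((norm (u x))\<^sup>2) \<partial>lebesgue_on U) \<le> ennreal (c\<^sup>2)" "0 \<le> c"
  shows "u \<in> L2 U" "L2norm U u \<le> c"
proof -
  have "integrable (lebesgue_on U) (\<lambda>x. (norm (u x))\<^sup>2)"
    by (rule integrableI_bounded) (use assms in \<open>auto intro: le_less_trans\<close>)
  then show u: "u \<in> L2 U" using assms by (simp add: L2_def)
  have "(L2norm U u)\<^sup>2 \<le> c\<^sup>2" using assms L2_nn_integral[OF u] by (simp add: ennreal_le_iff)
  then show "L2norm U u \<le> c" by (rule power2_le_imp_le) (rule assms)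
qed

text \<open>Transfers L^2 convergence from the square to every bounded set, as weak gradients on the
  whole plane demand.\<close>

lemma L2norm_periodic_bounded:
  assumes L: "L > 0" and K: "bounded K" "K \<in> sets lebesgue"
  obtains N where "0 \<le> N" "\<And>u :: real^2 \<Rightarrow> 'b::euclidean_space. u \<in> borel_measurable borel \<Longrightarrow> lperiodic L u \<Longrightarrow>
    u \<in> L2 (Omega L) \<Longrightarrow> u \<in> L2 K \<and> L2norm K u \<le> N * L2norm (Omega L) u"
proof -
  obtain N where N: "\<And>h :: real^2 \<Rightarrow> ennreal. h \<in> borel_measurable borel \<Longrightarrow> lperiodic L h \<Longrightarrow>
    (\<integral>\<^sup>+x. h x * indicator K x \<partial>lborel) \<le> of_nat N * (\<integral>\<^sup>+x. h x * indicator (cell L) x \<partial>lborel)"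
    using nn_integral_bounded_le_cell[OF L K(1)] by blast
  show ?thesis
  proof (rule that[of "sqrt (real N)"])
    fix u :: "real^2 \<Rightarrow> 'b" assume u[measurable]: "u \<in> borel_measurable borel" and per: "lperiodic L u" and l2: "u \<in> L2 (Omega L)"
    define h where "h x = ennreal ((norm (u x))\<^sup>2)" for x
    have "(\<integral>\<^sup>+x. h x \<partial>lebesgue_on K) = (\<integral>\<^sup>+x. h x * indicator K x \<partial>lebesgue)"
      by (subst nn_integral_restrict_space) (auto simp: K)
    also have "\<dots> = (\<integral>\<^sup>+x. h x * indicator K x \<partial>lborel)" by (simp only: nn_integral_completion)
    also have "\<dots> \<le> of_nat N * (\<integral>\<^sup>+x. h x * indicator (cell L) x \<partial>lborel)"
      by (rule N) (use per in \<open>auto simp: h_def lperiodic_def\<close>)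
    also have "\<dots> = of_nat N * ennreal ((L2norm (Omega L) u)\<^sup>2)"
      unfolding nn_integral_cell_Omega h_def L2_nn_integral[OF l2] ..
    also have "\<dots> = ennreal ((sqrt (real N) * L2norm (Omega L) u)\<^sup>2)"
      by (simp add: power_mult_distrib ennreal_mult ennreal_of_nat_eq_real_of_nat)
    finally have b: "(\<integral>\<^sup>+x. ennreal ((norm (u x))\<^sup>2) \<partial>lebesgue_on K) \<le> ennreal ((sqrt (real N) * L2norm (Omega L) u)\<^sup>2)"
      by (simp add: h_def)
    show "u \<in> L2 K \<and> L2norm K u \<le> sqrt (real N) * L2norm (Omega L) u"
      using L2_if_nn_integral[OF borel_measurable_lebesgue_onI[OF u] b] by simp
  qed simp
qed

lemma lperiodic_lim: "(\<And>n. lperiodic L (u n)) \<Longrightarrow> lperiodic L (\<lambda>x. lim (\<lambda>n. u n x))"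
  by (simp add: lperiodic_def)

text \<open>Membership in \<open>H1_per\<close> asks for a representative that is periodic
  everywhere, whereas an L^2 limit is known only almost everywhere on the square. A subsequence
  converging almost everywhere supplies it, and the weak gradient is then identified on the whole
  plane.\<close>

lemma H1_per_limit:
  fixes v :: "real^2 \<Rightarrow> real" and g :: "real^2 \<Rightarrow> real^2"
  assumes L: "L > 0" and v: "v \<in> L2 (Omega L)" and g: "g \<in> L2 (Omega L)"
    and p: "\<And>n. p n \<in> borel_measurable borel" "\<And>n. lperiodic L (p n)" "\<And>n. p n \<in> L2 (Omega L)"
    and q: "\<And>n. q n \<in> borel_measurable borel" "\<And>n. lperiodic L (q n)" "\<And>n. q n \<in> L2 (Omega L)"
    and pv: "(\<lambda>n. L2norm (Omega L) (\<lambda>x. p n x - v x)) \<longlonglongrightarrow> 0"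
    and qg: "(\<lambda>n. L2norm (Omega L) (\<lambda>x. q n x - g x)) \<longlonglongrightarrow> 0"
    and id: "\<And>\<phi> G K. has_C1_gradient UNIV \<phi> G \<Longrightarrow> compact K \<Longrightarrow> (\<And>x. x \<notin> K \<Longrightarrow> \<phi> x = 0) \<Longrightarrow>
      (\<lambda>n. (\<integral>x. p n x *\<^sub>R G x \<partial>lebesgue_on K) + (\<integral>x. \<phi> x *\<^sub>R q n x \<partial>lebesgue_on K)) \<longlonglongrightarrow> 0"
  shows "v \<in> H1_per L" "has_weak_gradient (Omega L) v g"
proof -
  obtain s1 :: "nat \<Rightarrow> nat" where s1: "strict_mono s1" "AE x in lebesgue_on (Omega L). (\<lambda>n. p (s1 n) x) \<longlonglongrightarrow> v x"
    using L2_AE_subseq[OF p(3) v pv] by blast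
  have "(\<lambda>n. L2norm (Omega L) (\<lambda>x. q (s1 n) x - g x)) \<longlonglongrightarrow> 0"
    using LIMSEQ_subseq_LIMSEQ[OF qg s1(1)] by (simp add: o_def)
  from L2_AE_subseq[OF q(3) g this] obtain s2 :: "nat \<Rightarrow> nat" where s2: "strict_mono s2"
    "AE x in lebesgue_on (Omega L). (\<lambda>n. q (s1 (s2 n)) x) \<longlonglongrightarrow> g x" by blast
  define s where "s n = s1 (s2 n)" for n
  have s: "strict_mono s" using strict_mono_o[OF s1(1) s2(1)] unfolding s_def o_def .
  \<comment> \<open>\<open>lim\<close> is total: even where the subsequence diverges, it returns the
    same value at all lattice translates, so the periodicity of \<open>w\<close> is exact.\<close>
  define w where "w x = lim (\<lambda>n. p (s n) x)" for x
  define h where "h x = lim (\<lambda>n. q (s n) x)" for x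
  have wm: "w \<in> borel_measurable borel" unfolding w_def by (rule borel_measurable_lim_metric[OF p(1)])
  have hm: "h \<in> borel_measurable borel" unfolding h_def by (rule borel_measurable_lim_metric[OF q(1)])
  have wp: "lperiodic L w" unfolding w_def by (rule lperiodic_lim[OF p(2)])
  have hp: "lperiodic L h" unfolding h_def by (rule lperiodic_lim[OF q(2)])
  have vw: "AE x in lebesgue_on (Omega L). v x = w x"
    using s1(2)
  proof eventually_elim
    fix x assume "(\<lambda>n. p (s1 n) x) \<longlonglongrightarrow> v x"
    from LIMSEQ_subseq_LIMSEQ[OF this s2(1)] show "v x = w x" by (simp add: w_def s_def o_def limI)
  qed
  have gh: "AE x in lebesgue_on (Omega L). g x = h x"
    using s2(2) by eventually_elim (simp add: h_def s_def limI)
  have w2: "w \<in> L2 (Omega L)" by (rule L2_cong_AE[OF v vw borel_measurable_lebesgue_onI[OF wm]])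
  have h2: "h \<in> L2 (Omega L)" by (rule L2_cong_AE[OF g gh borel_measurable_lebesgue_onI[OF hm]])
  have "L2norm (Omega L) (\<lambda>x. p n x - w x) = L2norm (Omega L) (\<lambda>x. p n x - v x)" for n
    by (rule L2norm_cong_AE, use vw in eventually_elim) (use L2D(1)[OF p(3)] L2D(1)[OF v] L2D(1)[OF w2] in auto)
  then have pw: "(\<lambda>n. L2norm (Omega L) (\<lambda>x. p n x - w x)) \<longlonglongrightarrow> 0" using pv by simp
  have "L2norm (Omega L) (\<lambda>x. q n x - h x) = L2norm (Omega L) (\<lambda>x. q n x - g x)" for n
    by (rule L2norm_cong_AE, use gh in eventually_elim) (use L2D(1)[OF q(3)] L2D(1)[OF g] L2D(1)[OF h2] in auto)
  then have qh: "(\<lambda>n. L2norm (Omega L) (\<lambda>x. q n x - h x)) \<longlonglongrightarrow> 0" using qg by simp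
  have local: "u \<in> L2 K" "(\<lambda>n. L2norm K (\<lambda>x. r n x - u x)) \<longlonglongrightarrow> 0" "r n \<in> L2 K"
    if K: "compact K" and u: "u \<in> borel_measurable borel" "lperiodic L u" "u \<in> L2 (Omega L)"
      and r: "\<And>n. r n \<in> borel_measurable borel" "\<And>n. lperiodic L (r n)" "\<And>n. r n \<in> L2 (Omega L)"
      and ru: "(\<lambda>n. L2norm (Omega L) (\<lambda>x. r n x - u x)) \<longlonglongrightarrow> 0"
    for K u n and r :: "nat \<Rightarrow> real^2 \<Rightarrow> 'c::euclidean_space"
  proof -
    obtain N where N: "0 \<le> N" "\<And>u :: real^2 \<Rightarrow> 'c. u \<in> borel_measurable borel \<Longrightarrow> lperiodic L u \<Longrightarrow>
        u \<in> L2 (Omega L) \<Longrightarrow> u \<in> L2 K \<and> L2norm K u \<le> N * L2norm (Omega L) u"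
      using L2norm_periodic_bounded[OF L compact_imp_bounded[OF K] fmeasurableD[OF lmeasurable_compact[OF K]],
          where 'b='c] by blast
    show "u \<in> L2 K" "r n \<in> L2 K" using N(2) u r by blast+
    show "(\<lambda>n. L2norm K (\<lambda>x. r n x - u x)) \<longlonglongrightarrow> 0"
    proof (rule Lim_null_comparison)
      show "(\<lambda>n. N * L2norm (Omega L) (\<lambda>x. r n x - u x)) \<longlonglongrightarrow> 0"
        by (rule tendsto_mult_right_zero[OF ru])
      have "L2norm K (\<lambda>x. r n x - u x) \<le> N * L2norm (Omega L) (\<lambda>x. r n x - u x)" for n
      proof -
        have "(\<lambda>x. r n x - u x) \<in> borel_measurable borel" using u(1) r(1) by measurable
        moreover have "lperiodic L (\<lambda>x. r n x - u x)" using u(2) r(2) by (simp add: lperiodic_def)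
        ultimately show ?thesis using N(2) L2_diff[OF r(3)[of n] u(3)] by blast
      qed
      then show "\<forall>\<^sub>F n in sequentially. norm (L2norm K (\<lambda>x. r n x - u x)) \<le> N * L2norm (Omega L) (\<lambda>x. r n x - u x)"
        by simp
    qed
  qed
  note lw = local[OF _ wm wp w2 p pw] and lh = local[OF _ hm hp h2 q qh]
  have wh: "has_weak_gradient UNIV w h"
    by (rule weak_gradient_limit[where vn=p and gn=q]) (use lw lh id in simp_all)
  have "w \<in> H1_loc UNIV"
    unfolding H1_loc_def using wh lw(1) lh(1) by auto
  then show "v \<in> H1_per L"
    unfolding H1_per_def using wp vw periodic_iff_lperiodic by blast
  have "has_weak_gradient (Omega L) w h"
    by (rule has_weak_gradient_subset[OF wh]) (auto simp: open_Omega)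
  then have vh: "has_weak_gradient (Omega L) v h"
    by (rule has_weak_gradient_cong_AE[OF open_Omega _ _ v]) (use vw in \<open>eventually_elim, simp\<close>)
  have comp: "g absolutely_integrable_on K" if "compact K" "K \<subseteq> Omega L" for K
    by (rule L2_abs_integrable[OF L2_subset[OF g that(2)] that(1)])
      (use that in \<open>auto simp: sets_Omega fmeasurableD lmeasurable_compact\<close>)
  show "has_weak_gradient (Omega L) v g"
  proof (rule has_weak_gradientI)
    fix \<phi> G K assume \<phi>: "has_C1_gradient UNIV \<phi> G" "compact K" "K \<subseteq> Omega L" "\<And>x. x \<notin> K \<Longrightarrow> \<phi> x = 0"
    have pm: "\<phi> \<in> borel_measurable (lebesgue_on (Omega L))"
      by (intro borel_measurable_lebesgue_onI borel_measurable_continuous_onI C1_continuous(1)[OF \<phi>(1)])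
    have "(\<integral>x. \<phi> x *\<^sub>R g x \<partial>lebesgue_on (Omega L)) = (\<integral>x. \<phi> x *\<^sub>R h x \<partial>lebesgue_on (Omega L))"
    proof (rule integral_cong_AE)
      show "(\<lambda>x. \<phi> x *\<^sub>R g x) \<in> borel_measurable (lebesgue_on (Omega L))"
        "(\<lambda>x. \<phi> x *\<^sub>R h x) \<in> borel_measurable (lebesgue_on (Omega L))"
        by (rule borel_measurable_scaleR[OF pm L2D(1)[OF g]] borel_measurable_scaleR[OF pm L2D(1)[OF h2]])+
      show "AE x in lebesgue_on (Omega L). \<phi> x *\<^sub>R g x = \<phi> x *\<^sub>R h x"
        using gh by eventually_elim simp
    qed
    then show "(\<integral>x. v x *\<^sub>R G x \<partial>lebesgue_on (Omega L)) = - (\<integral>x. \<phi> x *\<^sub>R g x \<partial>lebesgue_on (Omega L))"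
      using has_weak_gradientD(3)[OF vh \<phi>] by simp
  next
    fix K assume K: "compact K" "K \<subseteq> Omega L"
    show "v absolutely_integrable_on K" using has_weak_gradientD(1)[OF vh K] .
    show "g absolutely_integrable_on K" using comp[OF K] .
  qed
qed

section \<open>Periodic continuously differentiable functions and their L^2 limits\<close>

lemma C1_shift:
  assumes "has_C1_gradient V u G" "open V"
  shows "has_C1_gradient {y. y - a \<in> V} (\<lambda>y. u (y - a)) (\<lambda>y. G (y - a))"
proof (rule C1_openI)
  show "open {y. y - a \<in> V}"
    using assms(2) open_vimage[of V "\<lambda>y. y - a"] by (simp add: vimage_def continuous_intros)
  show "continuous_on {y. y - a \<in> V} (\<lambda>y. G (y - a))"
    by (rule continuous_on_compose2[OF C1_continuous(2)[OF assms(1)]]) (auto intro!: continuous_intros)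
  show "((\<lambda>y. u (y - a)) has_derivative (\<lambda>h. G (x - a) \<bullet> h)) (at x)" if "x \<in> {y. y - a \<in> V}" for x
  proof -
    have d: "((\<lambda>y. y - a) has_derivative (\<lambda>h. h)) (at x)" by (auto intro!: derivative_eq_intros)
    have "(u has_derivative (\<lambda>h. G (x - a) \<bullet> h)) (at (x - a))"
      using C1_at[OF assms] that by simp
    from has_derivative_compose[OF d this] show ?thesis .
  qed
qed

definition PC1 :: "real \<Rightarrow> (real^2 \<Rightarrow> real) \<Rightarrow> (real^2 \<Rightarrow> real^2) \<Rightarrow> bool" where
  "PC1 L u G \<longleftrightarrow> lperiodic L u \<and> has_C1_gradient UNIV u G"

lemma PC1_gradient_periodic:
  assumes "PC1 L u G"
  shows "lperiodic L G"
  unfolding lperiodic_def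
proof (intro allI)
  fix x k
  have u: "has_C1_gradient UNIV u G" and per: "lperiodic L u" using assms by (auto simp: PC1_def)
  have "has_C1_gradient UNIV (\<lambda>y. u (y - (- lat L k))) (\<lambda>y. G (y - (- lat L k)))"
    using C1_shift[OF u open_UNIV, of "- lat L k"] by simp
  from C1_unique[OF this u, of UNIV x] show "G (x + lat L k) = G x"
    using per by (simp add: lperiodic_def)
qed

lemma lperiodic_continuous_bounded:
  fixes u :: "real^2 \<Rightarrow> 'b::euclidean_space"
  assumes L: "L > 0" and per: "lperiodic L u" and c: "continuous_on UNIV u"
  obtains B where "0 < B" "\<And>x. norm (u x) \<le> B"
proof -
  have "bounded (u ` cbox (\<chi> i. - L) (\<chi> i. L))"
    using c by (meson compact_cbox compact_continuous_image compact_imp_bounded continuous_on_subset subset_UNIV)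
  then obtain B where B: "B > 0" "\<And>x. x \<in> cbox (\<chi> i. - L) (\<chi> i. L) \<Longrightarrow> norm (u x) \<le> B"
    by (auto simp: bounded_pos)
  have "norm (u x) \<le> B" for x
    using B(2)[of "fold_cell L x"] fold_cell_in[OF L, of x] cell_subset_cbox[of L] lperiodic_fold[OF per, of x] by auto
  then show ?thesis using that B(1) by blast
qed

lemma lperiodic_continuous_L2:
  fixes u :: "real^2 \<Rightarrow> 'b::euclidean_space"
  assumes L: "L > 0" and per: "lperiodic L u" and c: "continuous_on UNIV u"
  shows "u \<in> L2 (Omega L)"
proof -
  obtain B where "0 < B" "\<And>x. norm (u x) \<le> B" using lperiodic_continuous_bounded[OF assms] by blast
  then show ?thesis
    using L2_bounded(1)[OF lmeasurable_Omega borel_measurable_lebesgue_onI[OF borel_measurable_continuous_onI[OF c]], of L B]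
    by simp
qed

lemma PC1_L2:
  assumes "L > 0" "PC1 L u G"
  shows "u \<in> L2 (Omega L)" "G \<in> L2 (Omega L)"
proof -
  have c: "has_C1_gradient UNIV u G" and p: "lperiodic L u" using assms(2) by (auto simp: PC1_def)
  show "u \<in> L2 (Omega L)" by (rule lperiodic_continuous_L2[OF assms(1) p C1_continuous(1)[OF c]])
  show "G \<in> L2 (Omega L)"
    by (rule lperiodic_continuous_L2[OF assms(1) PC1_gradient_periodic[OF assms(2)] C1_continuous(2)[OF c]])
qed

lemma PC1_mult:
  assumes "PC1 L u G" "PC1 L v H"
  shows "PC1 L (\<lambda>x. u x * v x) (\<lambda>x. u x *\<^sub>R H x + v x *\<^sub>R G x)"
  using assms C1_mult[of UNIV u G v H] by (simp add: PC1_def lperiodic_def)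

lemma PC1_lincomb:
  assumes "PC1 L u G" "PC1 L v H"
  shows "PC1 L (\<lambda>x. u x + t *\<^sub>R v x) (\<lambda>x. G x + t *\<^sub>R H x)"
  using assms C1_add[OF _ C1_scaleR, of UNIV u G v H t] by (simp add: PC1_def lperiodic_def)

text \<open>A point that folds onto the boundary of the cell has distance at least \<open>L\<close>
  from every lattice point, so a ball of radius \<open>L - \<rho>\<close> about it avoids all
  lattice translates of the disc of radius \<open>\<rho>\<close>. This handles the places where
  folding is discontinuous.\<close>

lemma fold_far_from_lattice:
  assumes "0 < L" "fold_cell L x \<notin> Omega L" "dist y x < L - \<rho>"
  shows "\<rho> < norm (fold_cell L y)"
proof (rule ccontr)
  assume "\<not> \<rho> < norm (fold_cell L y)"
  then have "norm (y - lat L (cell_index L y)) \<le> \<rho>" by (simp add: fold_cell_def)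
  then have n: "norm (x - lat L (cell_index L y)) < L"
    using assms(3) norm_triangle_ineq[of "x - y" "y - lat L (cell_index L y)"]
    by (simp add: dist_norm norm_minus_commute)
  have "\<bar>(x - lat L (cell_index L y)) $ i\<bar> < L" for i
    using n component_le_norm_cart[of "x - lat L (cell_index L y)" i] by linarith
  then have mem: "x - lat L (cell_index L y) \<in> Omega L" 
    unfolding Omega_def mem_Collect_eq abs_less_iff by (metis minus_less_iff)
  then have "fold_cell L x = x - lat L (cell_index L y)"
    using fold_cell_eqI[OF assms(1)] Omega_subset_cell by blast
  then show False using mem assms(2) by simp
qed

text \<open>Where folding is locally a translation, smoothness is inherited from \<open>u\<close>;
  near the remaining points the folded function is the constant \<open>c\<close>, so the jumps of
  the folding are invisible.\<close>

lemma PC1_periodic_extension: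
  assumes L: "L > 0" and \<rho>: "\<rho> < L" and u: "has_C1_gradient UNIV u G"
    and c: "\<And>x. \<rho> < norm x \<Longrightarrow> u x = c"
  shows "PC1 L (\<lambda>x. u (fold_cell L x)) (\<lambda>x. G (fold_cell L x))"
proof -
  have G0: "G x = 0" if "\<rho> < norm x" for x
    by (rule C1_unique[OF u C1_const[of UNIV c], of "- cball 0 \<rho>"]) (use that c in auto)
  have "has_C1_gradient UNIV (\<lambda>x. u (fold_cell L x)) (\<lambda>x. G (fold_cell L x))"
  proof (rule C1_local)
    fix x
    show "\<exists>F. open F \<and> x \<in> F \<and> has_C1_gradient F (\<lambda>x. u (fold_cell L x)) (\<lambda>x. G (fold_cell L x))"
    proof (cases "fold_cell L x \<in> Omega L")
      case True
      define V where "V = {y. y - lat L (cell_index L x) \<in> Omega L}"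
      have V: "open V" unfolding V_def
        using open_vimage[OF open_Omega, of "\<lambda>y. y - lat L (cell_index L x)"]
        by (simp add: vimage_def continuous_intros)
      have f: "fold_cell L y = y - lat L (cell_index L x)" if "y \<in> V" for y
        using fold_cell_eqI[OF L] Omega_subset_cell that unfolding V_def by blast
      have "has_C1_gradient V (\<lambda>y. u (y - lat L (cell_index L x))) (\<lambda>y. G (y - lat L (cell_index L x)))"
        unfolding V_def by (rule C1_shift[OF C1_subset[OF u] open_Omega]) simp
      then have "has_C1_gradient V (\<lambda>x. u (fold_cell L x)) (\<lambda>x. G (fold_cell L x))"
        by (rule C1_cong_open[OF _ V]) (simp_all add: f)
      moreover have "x \<in> V" using True by (simp add: V_def fold_cell_def)
      ultimately show ?thesis using V by blast
    next
      case False
      have "has_C1_gradient (ball x (L - \<rho>)) (\<lambda>x. u (fold_cell L x)) (\<lambda>x. G (fold_cell L x))"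
        by (rule C1_cong_open[OF C1_const[of _ c]])
          (use fold_far_from_lattice[OF L False] c G0 in \<open>auto simp: dist_commute\<close>)
      then show ?thesis using \<rho> by (intro exI[of _ "ball x (L - \<rho>)"]) auto
    qed
  qed
  then show ?thesis using lperiodic_compose_fold[OF L] by (simp add: PC1_def)
qed

text \<open>The closure in L^2 of the graph of the gradient on periodic C^1 functions.\<close>

definition per_limit :: "real \<Rightarrow> (real^2 \<Rightarrow> real) \<Rightarrow> (real^2 \<Rightarrow> real^2) \<Rightarrow> bool" where
  "per_limit L v g \<longleftrightarrow> v \<in> L2 (Omega L) \<and> g \<in> L2 (Omega L) \<and>
     (\<forall>e>0. \<exists>u G. PC1 L u G \<and> L2norm (Omega L) (\<lambda>x. v x - u x) < e \<and> L2norm (Omega L) (\<lambda>x. g x - G x) < e)"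

lemma per_limit_sequence:
  assumes "per_limit L v g"
  obtains u G where "\<And>n::nat. PC1 L (u n) (G n)" "(\<lambda>n. L2norm (Omega L) (\<lambda>x. u n x - v x)) \<longlonglongrightarrow> 0"
    "(\<lambda>n. L2norm (Omega L) (\<lambda>x. G n x - g x)) \<longlonglongrightarrow> 0"
proof -
  have "\<forall>n::nat. \<exists>u G. PC1 L u G \<and> L2norm (Omega L) (\<lambda>x. v x - u x) < inverse (real (Suc n))
      \<and> L2norm (Omega L) (\<lambda>x. g x - G x) < inverse (real (Suc n))"
    using assms unfolding per_limit_def by simp
  then obtain u G where uG: "\<And>n. PC1 L (u n) (G n)"
    "\<And>n. L2norm (Omega L) (\<lambda>x. v x - u n x) < inverse (real (Suc n))"
    "\<And>n. L2norm (Omega L) (\<lambda>x. g x - G n x) < inverse (real (Suc n))"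
    by (simp only: choice_iff) blast
  have lim: "a \<longlonglongrightarrow> 0" if "\<And>n. 0 \<le> a n" "\<And>n. a n < inverse (real (Suc n))" for a :: "nat \<Rightarrow> real"
    by (rule Lim_null_comparison[OF _ LIMSEQ_inverse_real_of_nat]) (use that in \<open>auto intro!: always_eventually less_imp_le simp del: of_nat_Suc\<close>)
  show ?thesis
  proof (rule that[of u G, OF uG(1)])
    show "(\<lambda>n. L2norm (Omega L) (\<lambda>x. u n x - v x)) \<longlonglongrightarrow> 0"
      by (rule lim[OF L2norm_nonneg]) (use uG(2) L2norm_diff_commute[of "Omega L" v] in simp)
    show "(\<lambda>n. L2norm (Omega L) (\<lambda>x. G n x - g x)) \<longlonglongrightarrow> 0"
      by (rule lim[OF L2norm_nonneg]) (use uG(3) L2norm_diff_commute[of "Omega L" g] in simp)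
  qed
qed

text \<open>One half of the description of \<open>H1_per\<close>: here the approximations satisfy
  integration by parts exactly, so the asymptotic identity is trivial.\<close>

lemma per_limit_H1_per:
  assumes L: "L > 0" and vg: "per_limit L v g"
  shows "v \<in> H1_per L" "has_weak_gradient (Omega L) v g"
proof -
  obtain u G where u: "\<And>n::nat. PC1 L (u n) (G n)" "(\<lambda>n. L2norm (Omega L) (\<lambda>x. u n x - v x)) \<longlonglongrightarrow> 0"
    "(\<lambda>n. L2norm (Omega L) (\<lambda>x. G n x - g x)) \<longlonglongrightarrow> 0" using per_limit_sequence[OF vg] by blast
  have c: "has_C1_gradient UNIV (u n) (G n)" for n using u(1) by (simp add: PC1_def)
  have id: "(\<lambda>n. (\<integral>x. u n x *\<^sub>R H x \<partial>lebesgue_on K) + (\<integral>x. \<phi> x *\<^sub>R G n x \<partial>lebesgue_on K)) \<longlonglongrightarrow> 0"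
    if \<phi>: "has_C1_gradient UNIV \<phi> H" "compact K" "\<And>x. x \<notin> K \<Longrightarrow> \<phi> x = 0" for \<phi> H K
  proof -
    have H0: "\<And>x. x \<notin> K \<Longrightarrow> H x = 0"
      by (rule C1_gradient_support[OF \<phi>(1) compact_imp_closed[OF \<phi>(2)] \<phi>(3)])
    have r: "(\<integral>x. f x \<partial>lebesgue_on K) = (\<integral>x. f x \<partial>lebesgue_on UNIV)" if "\<And>x. x \<notin> K \<Longrightarrow> f x = 0" for f :: "real^2 \<Rightarrow> real^2"
      using that fmeasurableD[OF lmeasurable_compact[OF \<phi>(2)]]
      by (simp add: integral_restrict_space lebesgue_on_UNIV_eq)
        (intro Bochner_Integration.integral_cong, auto simp: indicator_def)
    have "(\<integral>x. u n x *\<^sub>R H x \<partial>lebesgue_on K) + (\<integral>x. \<phi> x *\<^sub>R G n x \<partial>lebesgue_on K) = 0" for n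
      using integration_by_parts_C1[OF open_UNIV c[of n] \<phi>(1,2) _ \<phi>(3)] r[of "\<lambda>x. u n x *\<^sub>R H x"]
        r[of "\<lambda>x. \<phi> x *\<^sub>R G n x"] H0 \<phi>(3) by simp
    then show ?thesis by simp
  qed
  have "v \<in> H1_per L \<and> has_weak_gradient (Omega L) v g"
  proof -
    have 1: "v \<in> L2 (Omega L)" "g \<in> L2 (Omega L)" using vg by (auto simp: per_limit_def)
    have 2: "u n \<in> borel_measurable borel" "G n \<in> borel_measurable borel" for n
      using C1_continuous[OF c] by (auto intro: borel_measurable_continuous_onI)
    have 3: "lperiodic L (u n)" "lperiodic L (G n)" for n
      using u(1) PC1_gradient_periodic[OF u(1)] by (auto simp: PC1_def)
    show ?thesis
      using H1_per_limit[OF L 1 2(1) 3(1) PC1_L2(1)[OF L u(1)] 2(2) 3(2) PC1_L2(2)[OF L u(1)] u(2,3) id] by blast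
  qed
  then show "v \<in> H1_per L" "has_weak_gradient (Omega L) v g" by auto
qed

lemma per_limit_closed:
  assumes "v \<in> L2 (Omega L)" "g \<in> L2 (Omega L)" "L > 0"
    "\<And>e. e > 0 \<Longrightarrow> \<exists>v' g'. per_limit L v' g' \<and> L2norm (Omega L) (\<lambda>x. v x - v' x) < e \<and> L2norm (Omega L) (\<lambda>x. g x - g' x) < e"
  shows "per_limit L v g"
  unfolding per_limit_def
proof (intro conjI assms allI impI)
  fix e :: real assume "e > 0"
  then obtain v' g' where v': "per_limit L v' g'" "L2norm (Omega L) (\<lambda>x. v x - v' x) < e/2" "L2norm (Omega L) (\<lambda>x. g x - g' x) < e/2"
    using assms(4)[of "e/2"] by auto
  then obtain u G where u: "PC1 L u G" "L2norm (Omega L) (\<lambda>x. v' x - u x) < e/2" "L2norm (Omega L) (\<lambda>x. g' x - G x) < e/2"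
    using \<open>e > 0\<close> unfolding per_limit_def by (meson half_gt_zero)
  have "v' \<in> L2 (Omega L)" "g' \<in> L2 (Omega L)" using v'(1) by (auto simp: per_limit_def)
  then have "L2norm (Omega L) (\<lambda>x. v x - u x) < e" "L2norm (Omega L) (\<lambda>x. g x - G x) < e"
    using L2norm_triangle_diff[of v "Omega L" v' u] L2norm_triangle_diff[of g "Omega L" g' G] assms(1,2)
      PC1_L2[OF assms(3) u(1)] v' u by fastforce+
  then show "\<exists>u G. PC1 L u G \<and> L2norm (Omega L) (\<lambda>x. v x - u x) < e \<and> L2norm (Omega L) (\<lambda>x. g x - G x) < e"
    using u(1) by blast
qed

lemma L2norm_lincomb_le:
  assumes "a \<in> L2 U" "b \<in> L2 U"
  shows "L2norm U (\<lambda>x. a x + t *\<^sub>R b x) \<le> L2norm U a + \<bar>t\<bar> * L2norm U b"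
  using L2norm_triangle[OF assms(1) L2_scaleR[OF assms(2), of t]] by (simp add: L2norm_scaleR)

lemma per_limit_lincomb:
  assumes L: "L > 0" and vg: "per_limit L v g" "per_limit L v' g'"
  shows "per_limit L (\<lambda>x. v x + t *\<^sub>R v' x) (\<lambda>x. g x + t *\<^sub>R g' x)"
  unfolding per_limit_def
proof (intro conjI allI impI)
  have l2: "v \<in> L2 (Omega L)" "g \<in> L2 (Omega L)" "v' \<in> L2 (Omega L)" "g' \<in> L2 (Omega L)"
    using vg by (auto simp: per_limit_def)
  show "(\<lambda>x. v x + t *\<^sub>R v' x) \<in> L2 (Omega L)" "(\<lambda>x. g x + t *\<^sub>R g' x) \<in> L2 (Omega L)"
    by (rule L2_add[OF l2(1) L2_scaleR[OF l2(3)]] L2_add[OF l2(2) L2_scaleR[OF l2(4)]])+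
  fix e :: real assume "e > 0"
  \<comment> \<open>Errors \<open>d\<close> in both summands add up to
    \<open>d + \<bar>t\<bar> * d = e\<close>.\<close>
  define d where "d = e / (1 + \<bar>t\<bar>)"
  have "d > 0" using \<open>e > 0\<close> by (simp add: d_def add_pos_nonneg)
  have de: "d + \<bar>t\<bar> * d = e"
  proof -
    have "(1 + \<bar>t\<bar>) * d = e" unfolding d_def by (simp add: add_pos_nonneg less_imp_neq[symmetric])
    then show ?thesis by (simp add: algebra_simps)
  qed
  obtain u G where u: "PC1 L u G" "L2norm (Omega L) (\<lambda>x. v x - u x) < d" "L2norm (Omega L) (\<lambda>x. g x - G x) < d"
    using vg(1) \<open>d > 0\<close> unfolding per_limit_def by blast
  obtain u' G' where u': "PC1 L u' G'" "L2norm (Omega L) (\<lambda>x. v' x - u' x) < d" "L2norm (Omega L) (\<lambda>x. g' x - G' x) < d"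
    using vg(2) \<open>d > 0\<close> unfolding per_limit_def by blast
  have bound: "L2norm (Omega L) (\<lambda>x. (a x + t *\<^sub>R a' x) - (b x + t *\<^sub>R b' x)) < e"
    if "a \<in> L2 (Omega L)" "a' \<in> L2 (Omega L)" "b \<in> L2 (Omega L)" "b' \<in> L2 (Omega L)"
      "L2norm (Omega L) (\<lambda>x. a x - b x) < d" "L2norm (Omega L) (\<lambda>x. a' x - b' x) < d"
    for a a' b b' :: "real^2 \<Rightarrow> 'c::euclidean_space"
  proof -
    have "L2norm (Omega L) (\<lambda>x. (a x - b x) + t *\<^sub>R (a' x - b' x)) \<le> L2norm (Omega L) (\<lambda>x. a x - b x) + \<bar>t\<bar> * L2norm (Omega L) (\<lambda>x. a' x - b' x)"
      by (rule L2norm_lincomb_le[OF L2_diff[OF that(1,3)] L2_diff[OF that(2,4)]])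
    also have "\<dots> < d + \<bar>t\<bar> * d" using that(5,6) by (intro add_less_le_mono mult_left_mono) auto
    finally show ?thesis using de by (simp add: algebra_simps)
  qed
  show "\<exists>u G. PC1 L u G \<and> L2norm (Omega L) (\<lambda>x. (v x + t *\<^sub>R v' x) - u x) < e
      \<and> L2norm (Omega L) (\<lambda>x. (g x + t *\<^sub>R g' x) - G x) < e"
    using PC1_lincomb[OF u(1) u'(1), of t] bound[OF l2(1,3) PC1_L2(1)[OF L u(1)] PC1_L2(1)[OF L u'(1)] u(2) u'(2)]
      bound[OF l2(2,4) PC1_L2(2)[OF L u(1)] PC1_L2(2)[OF L u'(1)] u(3) u'(3)] by blast
qed

subsection \<open>Mollification\<close>

definition mollifier :: "real \<Rightarrow> ('a::euclidean_space \<Rightarrow> real) \<Rightarrow> ('a \<Rightarrow> 'a) \<Rightarrow> bool" where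
  "mollifier \<epsilon> \<rho> R \<longleftrightarrow> has_C1_gradient UNIV \<rho> R \<and> (\<forall>x. 0 \<le> \<rho> x) \<and> (\<forall>x. \<epsilon> < norm x \<longrightarrow> \<rho> x = 0) \<and>
     (\<integral>x. \<rho> x \<partial>lborel) = 1"

text \<open>The integral is taken with respect to the completed measure because \<open>w\<close> is
  in general only Lebesgue measurable.\<close>

definition mollify :: "('a::euclidean_space \<Rightarrow> real) \<Rightarrow> ('a \<Rightarrow> 'b::euclidean_space) \<Rightarrow> 'a \<Rightarrow> 'b" where
  "mollify \<rho> w x = (\<integral>y. \<rho> (x - y) *\<^sub>R w y \<partial>lebesgue)"

lemma mollifier_exists:
  assumes "\<epsilon> > 0"
  obtains \<rho> :: "'a::euclidean_space \<Rightarrow> real" and R where "mollifier \<epsilon> \<rho> R"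
proof -
  define b where "b x = (max 0 (\<epsilon>\<^sup>2 - x \<bullet> x))\<^sup>2" for x :: 'a
  have "has_C1_gradient UNIV (\<lambda>x::'a. \<epsilon>\<^sup>2 - x \<bullet> x) (\<lambda>x. - 2 *\<^sub>R x)"
    unfolding has_C1_gradient_def
    by (auto intro!: continuous_intros derivative_eq_intros simp: inner_commute)
  from C1_compose_real[OF this max_sq_deriv]
  have "has_C1_gradient UNIV b (\<lambda>x. (2 * max 0 (\<epsilon>\<^sup>2 - x \<bullet> x)) *\<^sub>R - 2 *\<^sub>R x)"
    unfolding b_def [abs_def] by (simp add: continuous_intros)
  then obtain B where B: "has_C1_gradient UNIV b B" by blast
  have b0: "b x = 0" if "\<epsilon> < norm x" for x
  proof -
    have "\<epsilon>\<^sup>2 \<le> (norm x)\<^sup>2" using that assms by (intro power_mono) auto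
    then show ?thesis by (simp add: b_def power2_norm_eq_inner)
  qed
  then have b0': "x \<notin> cball 0 \<epsilon> \<Longrightarrow> b x = 0" for x by simp
  have bi: "integrable lborel b"
    by (rule integrable_compact_support[OF C1_continuous(1)[OF B] compact_cball b0'])
  \<comment> \<open>A lower bound of \<open>b\<close> on the ball of half the radius, which makes
    the normalising integral positive.\<close>
  define c where "c = (\<epsilon>\<^sup>2 - (\<epsilon>/2)\<^sup>2)\<^sup>2"
  have "(\<epsilon>/2)\<^sup>2 < \<epsilon>\<^sup>2" using assms by (simp add: power2_eq_square)
  then have "c > 0" by (simp add: c_def)
  have "c * indicator (ball 0 (\<epsilon>/2)) x \<le> b x" for x
  proof (cases "x \<in> ball 0 (\<epsilon>/2)")
    case True
    then have "(norm x)\<^sup>2 \<le> (\<epsilon>/2)\<^sup>2" by (intro power_mono) auto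
    then have "c \<le> b x" unfolding c_def b_def using \<open>(\<epsilon>/2)\<^sup>2 < \<epsilon>\<^sup>2\<close>
      by (intro power_mono) (auto simp: power2_norm_eq_inner)
    then show ?thesis using True by simp
  qed (simp add: b_def)
  note le = this
  have ii: "integrable lborel (\<lambda>x::'a. c * indicator (ball 0 (\<epsilon>/2)) x)"
    by (intro integrable_mult_right integrable_real_indicator) (use emeasure_bounded_finite[OF bounded_ball] in auto)
  have "(\<integral>x. c * indicator (ball (0::'a) (\<epsilon>/2)) x \<partial>lborel) \<le> (\<integral>x. b x \<partial>lborel)"
    by (rule integral_mono[OF ii bi]) (rule le)
  moreover have "measure lborel (ball (0::'a) (\<epsilon>/2)) > 0"
    using content_ball_pos[of "\<epsilon>/2" "0::'a"] assms by simp
  ultimately have m: "(\<integral>x. b x \<partial>lborel) > 0"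
    using \<open>c > 0\<close> by (auto intro: less_le_trans[of 0 "c * measure lborel (ball (0::'a) (\<epsilon>/2))"])
  define \<rho> where "\<rho> x = (1 / (\<integral>x. b x \<partial>lborel)) *\<^sub>R b x" for x
  have "has_C1_gradient UNIV \<rho> (\<lambda>x. (1 / (\<integral>x. b x \<partial>lborel)) *\<^sub>R B x)"
    unfolding \<rho>_def by (rule C1_scaleR[OF B])
  moreover have "(\<integral>x. \<rho> x \<partial>lborel) = 1" using m by (simp add: \<rho>_def)
  ultimately have "mollifier \<epsilon> \<rho> (\<lambda>x. (1 / (\<integral>x. b x \<partial>lborel)) *\<^sub>R B x)"
    using m b0 by (auto simp: mollifier_def \<rho>_def b_def)
  then show ?thesis by (rule that)
qed

lemma integral_lborel_reflect:
  fixes F :: "'a::euclidean_space \<Rightarrow> 'b::euclidean_space"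
  assumes "F \<in> borel_measurable borel"
  shows "(\<integral>y. F (x - y) \<partial>lborel) = (\<integral>y. F y \<partial>lborel)"
proof -
  have d: "distr lborel borel (\<lambda>y::'a. x - y) = lborel"
    using lborel_affine_euclidean[of "\<lambda>_. -1" "x"]
    by (simp add: density_1 euclidean_representation sum_negf)
  have "(\<integral>y. F y \<partial>lborel) = (\<integral>y. F y \<partial>distr lborel borel (\<lambda>y. x - y))"
    by (simp only: d)
  also have "\<dots> = (\<integral>y. F (x - y) \<partial>lborel)" by (rule integral_distr) (use assms in auto)
  finally show ?thesis by simp
qed

lemma lebesgue_translation: "distr lebesgue lebesgue ((+) c) = (lebesgue :: 'a::euclidean_space measure)"
  using lebesgue_affine_euclidean[of "\<lambda>_. 1" c]
  by (simp add: density_1 euclidean_representation)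

lemma measurable_lebesgue_translation: "(+) (c::'a::euclidean_space) \<in> measurable lebesgue lebesgue"
  using lebesgue_affine_measurable[of "\<lambda>_. 1" c] by (simp add: euclidean_representation)

lemma integral_lebesgue_translation:
  fixes F :: "'a::euclidean_space \<Rightarrow> 'b::euclidean_space"
  assumes "F \<in> borel_measurable lebesgue"
  shows "(\<integral>y. F (c + y) \<partial>lebesgue) = (\<integral>y. F y \<partial>lebesgue)"
proof -
  have "(\<integral>y. F y \<partial>lebesgue) = (\<integral>y. F y \<partial>distr lebesgue lebesgue ((+) c))"
    by (simp only: lebesgue_translation)
  also have "\<dots> = (\<integral>y. F (c + y) \<partial>lebesgue)"
    by (rule integral_distr[OF measurable_lebesgue_translation assms])
  finally show ?thesis by simp
qed

lemma integrable_scaleR_bounded: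
  fixes w :: "'a::euclidean_space \<Rightarrow> 'b::euclidean_space"
  assumes "integrable lebesgue w" "continuous_on UNIV c" "\<And>y. \<bar>c y\<bar> \<le> (B::real)"
  shows "integrable lebesgue (\<lambda>y. c y *\<^sub>R w y)"
proof (rule Bochner_Integration.integrable_bound)
  show "integrable lebesgue (\<lambda>y. B *\<^sub>R w y)" by (rule integrable_scaleR_right[OF assms(1)])
  have "c \<in> borel_measurable lebesgue"
    by (intro measurable_completion) (simp add: borel_measurable_continuous_onI[OF assms(2)])
  then show "(\<lambda>y. c y *\<^sub>R w y) \<in> borel_measurable lebesgue"
    by (rule borel_measurable_scaleR[OF _ borel_measurable_integrable[OF assms(1)]])
  show "AE y in lebesgue. norm (c y *\<^sub>R w y) \<le> norm (B *\<^sub>R w y)"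
  proof (rule AE_I2)
    fix y
    have "\<bar>c y\<bar> * norm (w y) \<le> \<bar>B\<bar> * norm (w y)"
      using assms(3)[of y] by (intro mult_right_mono) auto
    then show "norm (c y *\<^sub>R w y) \<le> norm (B *\<^sub>R w y)" by (simp only: norm_scaleR)
  qed
qed

text \<open>The gradient has compact support and is thus uniformly continuous, so the linearisation
  error is uniform in the base point. This is what permits differentiation under the integral in a
  mollification.\<close>

lemma C1_uniform_linearization:
  fixes \<rho> :: "'a::euclidean_space \<Rightarrow> real"
  assumes \<rho>: "has_C1_gradient UNIV \<rho> R" and s: "\<And>x. \<epsilon> < norm x \<Longrightarrow> \<rho> x = 0" and e: "e > 0"
  obtains d where "d > 0" "\<And>z h. norm h < d \<Longrightarrow> \<bar>\<rho> (z + h) - \<rho> z - R z \<bullet> h\<bar> \<le> e * norm h"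
proof -
  have R0: "R x = 0" if "\<epsilon> < norm x" for x
    by (rule C1_gradient_support[OF \<rho> closed_cball[of 0 \<epsilon>]]) (use s that in auto)
  have "uniformly_continuous_on (cball 0 (\<epsilon> + 1)) R"
    by (intro compact_uniformly_continuous continuous_on_subset[OF C1_continuous(2)[OF \<rho>]]) auto
  then obtain d where d: "d > 0" "\<And>x y. x \<in> cball 0 (\<epsilon> + 1) \<Longrightarrow> y \<in> cball 0 (\<epsilon> + 1) \<Longrightarrow> dist y x < d \<Longrightarrow> dist (R y) (R x) < e"
    using e unfolding uniformly_continuous_on_def by metis
  have uc: "norm (R y - R x) \<le> e" if "norm (y - x) < min d 1" for x y
  proof (cases "x \<in> cball 0 (\<epsilon> + 1) \<and> y \<in> cball 0 (\<epsilon> + 1)")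
    case True
    then show ?thesis using d(2)[of x y] that by (auto simp: dist_norm)
  next
    case False
    then have "\<epsilon> < norm x \<and> \<epsilon> < norm y"
      using that norm_triangle_ineq2[of x y] norm_triangle_ineq2[of y x] by (auto simp: norm_minus_commute)
    then show ?thesis using R0 e by simp
  qed
  have lin: "\<bar>\<rho> (z + h) - \<rho> z - R z \<bullet> h\<bar> \<le> e * norm h" if h: "norm h < min d 1" for z h
  proof -
    have "norm (\<rho> (z + h) - \<rho> z - (\<lambda>k. R z \<bullet> k) ((z + h) - z)) \<le> norm ((z + h) - z) * e"
    proof (rule differentiable_bound_linearization[of z "z + h" "cball z (norm h)" \<rho> "\<lambda>x k. R x \<bullet> k" z e])
      show "z + t *\<^sub>R (z + h - z) \<in> cball z (norm h)" if "t \<in> {0..1}" for t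
        using that by (auto simp: dist_norm mult_left_le_one_le)
      show "(\<rho> has_derivative (\<lambda>k. R x \<bullet> k)) (at x within cball z (norm h))" for x
        using C1_at[OF \<rho>, of x] has_derivative_at_withinI by auto
      show "onorm ((\<lambda>k. R x \<bullet> k) - (\<lambda>k. R z \<bullet> k)) \<le> e" if "x \<in> cball z (norm h)" for x
      proof (rule onorm_bound)
        fix k
        have "norm (((\<lambda>k. R x \<bullet> k) - (\<lambda>k. R z \<bullet> k)) k) = \<bar>(R x - R z) \<bullet> k\<bar>" by (simp add: inner_diff_left)
        also have "\<dots> \<le> norm (R x - R z) * norm k" by (rule Cauchy_Schwarz_ineq2)
        also have "\<dots> \<le> e * norm k"
          using uc[of x z] that h by (intro mult_right_mono) (auto simp: dist_norm norm_minus_commute)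
        finally show "norm (((\<lambda>k. R x \<bullet> k) - (\<lambda>k. R z \<bullet> k)) k) \<le> e * norm k" .
      qed (use e in simp)
    qed simp
    then show ?thesis by (simp add: mult.commute)
  qed
  show ?thesis by (rule that[of "min d 1"]) (use d(1) lin in auto)
qed

lemma C1_support_bounds:
  fixes \<rho> :: "'a::euclidean_space \<Rightarrow> real"
  assumes \<rho>: "has_C1_gradient UNIV \<rho> R" and s: "\<And>x. \<epsilon> < norm x \<Longrightarrow> \<rho> x = 0"
  obtains B where "0 \<le> B" "\<And>x. \<bar>\<rho> x\<bar> \<le> B" "\<And>x. norm (R x) \<le> B"
proof -
  have R0: "x \<notin> cball 0 \<epsilon> \<Longrightarrow> R x = 0" for x
    by (rule C1_gradient_support[OF \<rho> closed_cball[of 0 \<epsilon>]]) (use s in auto)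
  obtain B1 where B1: "0 \<le> B1" "\<And>x. norm (\<rho> x) \<le> B1"
    using continuous_compact_support_bounded[OF C1_continuous(1)[OF \<rho>] compact_cball[of 0 \<epsilon>]] s by auto
  obtain B2 where B2: "0 \<le> B2" "\<And>x. norm (R x) \<le> B2"
    using continuous_compact_support_bounded[OF C1_continuous(2)[OF \<rho>] compact_cball[of 0 \<epsilon>] R0] by blast
  show ?thesis
    by (rule that[of "max B1 B2"]) (use B1 B2 in \<open>auto simp: le_max_iff_disj\<close>)
qed

lemma mollify_derivative_L1:
  fixes w :: "'a::euclidean_space \<Rightarrow> real"
  assumes \<rho>: "has_C1_gradient UNIV \<rho> R" and s: "\<And>x. \<epsilon> < norm x \<Longrightarrow> \<rho> x = 0" and w: "integrable lebesgue w"
  shows "(mollify \<rho> w has_derivative (\<lambda>h. (\<integral>y. w y *\<^sub>R R (x - y) \<partial>lebesgue) \<bullet> h)) (at x)"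
proof -
  obtain B where B: "0 \<le> B" "\<And>x. \<bar>\<rho> x\<bar> \<le> B" "\<And>x. norm (R x) \<le> B" using C1_support_bounds[OF \<rho> s] by blast
  have i\<rho>: "integrable lebesgue (\<lambda>y. \<rho> (x - y) *\<^sub>R w y)" for x
    by (rule integrable_scaleR_bounded[OF w _ B(2)])
      (intro continuous_on_compose2[OF C1_continuous(1)[OF \<rho>]] continuous_intros, auto)
  have iRh: "integrable lebesgue (\<lambda>y. (R (x - y) \<bullet> h) *\<^sub>R w y)" for h
  proof (rule integrable_scaleR_bounded[OF w])
    show "continuous_on UNIV (\<lambda>y. R (x - y) \<bullet> h)"
      by (intro continuous_intros continuous_on_compose2[OF C1_continuous(2)[OF \<rho>]]) auto
    show "\<bar>R (x - y) \<bullet> h\<bar> \<le> B * norm h" for y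
      using Cauchy_Schwarz_ineq2[of "R (x - y)" h] B(3)[of "x - y"]
      by (meson mult_right_mono norm_ge_zero order_trans)
  qed
  have iR: "integrable lebesgue (\<lambda>y. w y *\<^sub>R R (x - y))"
  proof -
    have "integrable lebesgue (\<lambda>y. \<Sum>b\<in>Basis. ((w y *\<^sub>R R (x - y)) \<bullet> b) *\<^sub>R b)"
      using iRh by (intro Bochner_Integration.integrable_sum integrable_scaleR_left) (simp add: mult.commute)
    then show ?thesis by (simp only: euclidean_representation)
  qed
  define M where "M = (\<integral>y. \<bar>w y\<bar> \<partial>lebesgue)"
  have "M \<ge> 0" by (simp add: M_def)
  show ?thesis
    unfolding has_derivative_at_alt
  proof (intro conjI allI impI)
    show "bounded_linear (\<lambda>h. (\<integral>y. w y *\<^sub>R R (x - y) \<partial>lebesgue) \<bullet> h)" by (rule bounded_linear_inner_right)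
    fix e :: real assume "e > 0"
    \<comment> \<open>The uniform error of the kernel is multiplied by the L^1 norm \<open>M\<close>
      of \<open>w\<close>; \<open>M + 1\<close> avoids a division by 0.\<close>
    define e' where "e' = e / (M + 1)"
    have "e' > 0" using \<open>e > 0\<close> \<open>M \<ge> 0\<close> by (simp add: e'_def)
    obtain d where d: "d > 0" "\<And>z h. norm h < d \<Longrightarrow> \<bar>\<rho> (z + h) - \<rho> z - R z \<bullet> h\<bar> \<le> e' * norm h"
      using C1_uniform_linearization[OF \<rho> s \<open>e' > 0\<close>] by blast
    have "norm (mollify \<rho> w y - mollify \<rho> w x - (\<integral>y. w y *\<^sub>R R (x - y) \<partial>lebesgue) \<bullet> (y - x)) \<le> e * norm (y - x)"
      if y: "norm (y - x) < d" for y
    proof -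
      define h where "h = y - x"
      have "mollify \<rho> w y - mollify \<rho> w x - (\<integral>y. w y *\<^sub>R R (x - y) \<partial>lebesgue) \<bullet> h
          = (\<integral>u. \<rho> (y - u) *\<^sub>R w u \<partial>lebesgue) - (\<integral>u. \<rho> (x - u) *\<^sub>R w u \<partial>lebesgue) - (\<integral>u. (R (x - u) \<bullet> h) *\<^sub>R w u \<partial>lebesgue)"
        using integral_inner_left[OF iR, of h] by (simp add: mollify_def mult.commute)
      also have "\<dots> = (\<integral>u. \<rho> (y - u) *\<^sub>R w u - \<rho> (x - u) *\<^sub>R w u - (R (x - u) \<bullet> h) *\<^sub>R w u \<partial>lebesgue)"
      proof -
        have "(\<integral>u. a u \<partial>lebesgue) - (\<integral>u. b u \<partial>lebesgue) - (\<integral>u. c u \<partial>lebesgue) = (\<integral>u. a u - b u - c u \<partial>lebesgue)"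
          if "integrable lebesgue a" "integrable lebesgue b" "integrable lebesgue c" for a b c :: "'a \<Rightarrow> real"
          using that by simp
        from this[OF i\<rho> i\<rho> iRh] show ?thesis .
      qed
      finally have eq: "mollify \<rho> w y - mollify \<rho> w x - (\<integral>y. w y *\<^sub>R R (x - y) \<partial>lebesgue) \<bullet> h
          = (\<integral>u. \<rho> (y - u) *\<^sub>R w u - \<rho> (x - u) *\<^sub>R w u - (R (x - u) \<bullet> h) *\<^sub>R w u \<partial>lebesgue)" .
      have "norm (mollify \<rho> w y - mollify \<rho> w x - (\<integral>y. w y *\<^sub>R R (x - y) \<partial>lebesgue) \<bullet> h)
          \<le> (\<integral>u. norm (\<rho> (y - u) *\<^sub>R w u - \<rho> (x - u) *\<^sub>R w u - (R (x - u) \<bullet> h) *\<^sub>R w u) \<partial>lebesgue)"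
        unfolding eq by (rule integral_norm_bound)
      also have "\<dots> \<le> (\<integral>u. (e' * norm h) * \<bar>w u\<bar> \<partial>lebesgue)"
      proof (rule integral_mono)
        show "integrable lebesgue (\<lambda>u. norm (\<rho> (y - u) *\<^sub>R w u - \<rho> (x - u) *\<^sub>R w u - (R (x - u) \<bullet> h) *\<^sub>R w u))"
          by (intro integrable_norm Bochner_Integration.integrable_diff i\<rho> iRh)
        show "integrable lebesgue (\<lambda>u. (e' * norm h) * \<bar>w u\<bar>)" using w by simp
        fix u
        have "\<bar>\<rho> (y - u) - \<rho> (x - u) - R (x - u) \<bullet> h\<bar> \<le> e' * norm h"
          using d(2)[of h "x - u"] y by (simp add: h_def)
        then have "\<bar>\<rho> (y - u) - \<rho> (x - u) - R (x - u) \<bullet> h\<bar> * \<bar>w u\<bar> \<le> (e' * norm h) * \<bar>w u\<bar>"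
          by (rule mult_right_mono) simp
        then show "norm (\<rho> (y - u) *\<^sub>R w u - \<rho> (x - u) *\<^sub>R w u - (R (x - u) \<bullet> h) *\<^sub>R w u) \<le> (e' * norm h) * \<bar>w u\<bar>"
          unfolding scaleR_left_diff_distrib[symmetric] norm_scaleR by simp
      qed
      also have "\<dots> = (e' * M) * norm h" by (simp add: M_def)
      also have "\<dots> \<le> e * norm h"
      proof (rule mult_right_mono)
        have "e' * M \<le> e' * (M + 1)" using \<open>e' > 0\<close> by (intro mult_left_mono) auto
        also have "\<dots> = e" using \<open>M \<ge> 0\<close> by (simp add: e'_def)
        finally show "e' * M \<le> e" .
      qed simp
      finally show ?thesis by (simp add: h_def)
    qed
    then show "\<exists>d>0. \<forall>y. norm (y - x) < d \<longrightarrow> norm (mollify \<rho> w y - mollify \<rho> w x - (\<integral>y. w y *\<^sub>R R (x - y) \<partial>lebesgue) \<bullet> (y - x)) \<le> e * norm (y - x)"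
      using d(1) by blast
  qed
qed

text \<open>The kernel is Lipschitz with constant \<open>B\<close>, so the mollification is
  Lipschitz with constant \<open>B\<close> times the L^1 norm of \<open>w\<close>.\<close>

lemma mollify_continuous_L1:
  fixes w :: "'a::euclidean_space \<Rightarrow> 'b::euclidean_space"
  assumes \<rho>: "has_C1_gradient UNIV \<rho> R" and s: "\<And>x. \<epsilon> < norm x \<Longrightarrow> \<rho> x = 0" and w: "integrable lebesgue w"
  shows "continuous_on UNIV (mollify \<rho> w)"
proof -
  obtain B where B: "0 \<le> B" "\<And>x. \<bar>\<rho> x\<bar> \<le> B" "\<And>x. norm (R x) \<le> B" using C1_support_bounds[OF \<rho> s] by blast
  have i\<rho>: "integrable lebesgue (\<lambda>y. \<rho> (x - y) *\<^sub>R w y)" for x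
    by (rule integrable_scaleR_bounded[OF w _ B(2)])
      (intro continuous_on_compose2[OF C1_continuous(1)[OF \<rho>]] continuous_intros, auto)
  define M where "M = (\<integral>y. norm (w y) \<partial>lebesgue)"
  have "M \<ge> 0" by (simp add: M_def)
  have lip: "dist (mollify \<rho> w y) (mollify \<rho> w x) \<le> (B * M) * dist y x" for x y
  proof -
    have "mollify \<rho> w y - mollify \<rho> w x = (\<integral>u. \<rho> (y - u) *\<^sub>R w u - \<rho> (x - u) *\<^sub>R w u \<partial>lebesgue)"
      using i\<rho> by (simp add: mollify_def)
    then have "norm (mollify \<rho> w y - mollify \<rho> w x) \<le> (\<integral>u. norm (\<rho> (y - u) *\<^sub>R w u - \<rho> (x - u) *\<^sub>R w u) \<partial>lebesgue)"
      using integral_norm_bound by metis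
    also have "\<dots> \<le> (\<integral>u. (B * norm (y - x)) * norm (w u) \<partial>lebesgue)"
    proof (rule integral_mono)
      show "integrable lebesgue (\<lambda>u. norm (\<rho> (y - u) *\<^sub>R w u - \<rho> (x - u) *\<^sub>R w u))"
        by (intro integrable_norm Bochner_Integration.integrable_diff i\<rho>)
      show "integrable lebesgue (\<lambda>u. (B * norm (y - x)) * norm (w u))" using w by simp
      fix u
      have "\<bar>\<rho> (y - u) - \<rho> (x - u)\<bar> * norm (w u) \<le> (B * norm (y - x)) * norm (w u)"
        using C1_lipschitz[OF \<rho> B(3), of "y - u" "x - u"] by (intro mult_right_mono) auto
      then show "norm (\<rho> (y - u) *\<^sub>R w u - \<rho> (x - u) *\<^sub>R w u) \<le> (B * norm (y - x)) * norm (w u)"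
        by (simp only: scaleR_left_diff_distrib[symmetric] norm_scaleR)
    qed
    also have "\<dots> = (B * M) * norm (y - x)" by (simp add: M_def)
    finally show ?thesis by (simp add: dist_norm)
  qed
  show ?thesis
    unfolding continuous_on_iff
  proof (intro ballI allI impI)
    fix x and e :: real assume "e > 0"
    have "dist (mollify \<rho> w y) (mollify \<rho> w x) < e" if "dist y x < e / (B * M + 1)" for y
    proof -
      have "(B * M) * dist y x \<le> (B * M + 1) * dist y x" by (intro mult_right_mono) auto
      also have "\<dots> < e"
        using that \<open>e > 0\<close> \<open>M \<ge> 0\<close> B(1) by (simp add: pos_less_divide_eq mult.commute add_nonneg_pos)
      finally show ?thesis using lip[of y x] by simp
    qed
    moreover have "e / (B * M + 1) > 0" using \<open>e > 0\<close> \<open>M \<ge> 0\<close> B(1) by (simp add: add_nonneg_pos)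
    ultimately show "\<exists>d>0. \<forall>y\<in>UNIV. dist y x < d \<longrightarrow> dist (mollify \<rho> w y) (mollify \<rho> w x) < e" by blast
  qed
qed

text \<open>The value at \<open>x\<close> sees \<open>w\<close> only within distance \<epsilon>, so
  a locally integrable function may be cut off before the estimates for integrable ones are
  applied.\<close>

lemma mollify_local:
  assumes "\<And>x. \<epsilon> < norm x \<Longrightarrow> \<rho> x = 0" "cball x \<epsilon> \<subseteq> K"
  shows "mollify \<rho> (\<lambda>y. indicat_real K y *\<^sub>R w y) x = mollify \<rho> w x"
  unfolding mollify_def
proof (intro Bochner_Integration.integral_cong refl)
  fix y
  show "\<rho> (x - y) *\<^sub>R indicat_real K y *\<^sub>R w y = \<rho> (x - y) *\<^sub>R w y"
    using assms(1)[of "x - y"] assms(2) by (cases "y \<in> K") (auto simp: dist_norm subset_eq not_le)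
qed

text \<open>Differentiation first falls on the kernel; the reflected kernel
  \<open>\<lambda>y. \<rho> (x - y)\<close> is then a test function and moves the derivative onto
  \<open>w\<close>. Hence the gradient is the mollified weak gradient.\<close>

lemma mollify_C1:
  fixes w :: "'a::euclidean_space \<Rightarrow> real"
  assumes \<rho>: "has_C1_gradient UNIV \<rho> R" and s: "\<And>x. \<epsilon> < norm x \<Longrightarrow> \<rho> x = 0" and w: "has_weak_gradient UNIV w g"
  shows "has_C1_gradient UNIV (mollify \<rho> w) (mollify \<rho> g)"
proof (rule C1_local)
  fix x0 :: 'a
  define K where "K = cball x0 (\<epsilon> + 1)"
  have wK: "integrable lebesgue (\<lambda>y. indicator K y *\<^sub>R w y)" and gK: "integrable lebesgue (\<lambda>y. indicator K y *\<^sub>R g y)"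
    using has_weak_gradientD(1,2)[OF w, of K] by (auto simp: set_integrable_def K_def)
  have sub: "cball x \<epsilon> \<subseteq> K" if "x \<in> ball x0 1" for x
  proof
    fix y assume "y \<in> cball x \<epsilon>"
    then show "y \<in> K" using that dist_triangle[of x0 y x] by (auto simp: K_def)
  qed
  have "has_C1_gradient (ball x0 1) (mollify \<rho> w) (mollify \<rho> g)"
  proof (rule C1_openI)
    have "continuous_on (ball x0 1) (mollify \<rho> (\<lambda>y. indicat_real K y *\<^sub>R g y))"
      by (rule continuous_on_subset[OF mollify_continuous_L1[OF \<rho> s gK]]) auto
    then show "continuous_on (ball x0 1) (mollify \<rho> g)"
      by (rule continuous_on_eq) (rule mollify_local[OF s sub])
    fix x assume x: "x \<in> ball x0 1"
    have R0: "R z = 0" if "\<epsilon> < norm z" for z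
      by (rule C1_gradient_support[OF \<rho> closed_cball[of 0 \<epsilon>]]) (use s that in auto)
    \<comment> \<open>The minus sign from the reflection cancels the one in the definition of the
      weak gradient.\<close>
    have "has_C1_gradient UNIV (\<lambda>y. \<rho> (x - y)) (\<lambda>y. - R (x - y))"
    proof (rule C1_openI)
      show "continuous_on UNIV (\<lambda>y. - R (x - y))"
        by (intro continuous_intros continuous_on_compose2[OF C1_continuous(2)[OF \<rho>]]) auto
      show "((\<lambda>y. \<rho> (x - y)) has_derivative (\<lambda>h. (- R (x - y)) \<bullet> h)) (at y)" for y
      proof -
        have d: "((\<lambda>y. x - y) has_derivative (\<lambda>h. - h)) (at y)" by (auto intro!: derivative_eq_intros)
        have "(\<rho> has_derivative (\<lambda>h. R (x - y) \<bullet> h)) (at (x - y))" using C1_at[OF \<rho>] by simp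
        from has_derivative_compose[OF d this] show ?thesis by simp
      qed
    qed simp
    from has_weak_gradientD(3)[OF w this compact_cball[of x \<epsilon>]]
    have ibp: "(\<integral>y. w y *\<^sub>R - R (x - y) \<partial>lebesgue_on UNIV) = - (\<integral>y. \<rho> (x - y) *\<^sub>R g y \<partial>lebesgue_on UNIV)"
      using s by (auto simp: dist_norm not_le)
    have "(\<integral>y. (indicat_real K y *\<^sub>R w y) *\<^sub>R R (x - y) \<partial>lebesgue) = (\<integral>y. w y *\<^sub>R R (x - y) \<partial>lebesgue)"
      using R0 sub[OF x] by (intro Bochner_Integration.integral_cong) (auto simp: indicator_def subset_eq dist_norm not_le)
    also have "\<dots> = mollify \<rho> g x"
      using ibp by (simp add: mollify_def lebesgue_on_UNIV_eq)
    finally have eq: "(\<integral>y. (indicat_real K y *\<^sub>R w y) *\<^sub>R R (x - y) \<partial>lebesgue) = mollify \<rho> g x" .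
    have "(mollify \<rho> (\<lambda>y. indicat_real K y *\<^sub>R w y) has_derivative (\<lambda>h. mollify \<rho> g x \<bullet> h)) (at x)"
      using mollify_derivative_L1[OF \<rho> s wK, where x=x] by (simp only: eq)
    then show "(mollify \<rho> w has_derivative (\<lambda>h. mollify \<rho> g x \<bullet> h)) (at x)"
      by (rule has_derivative_transform_within_open[OF _ open_ball x]) (rule mollify_local[OF s sub])
  qed simp
  then show "\<exists>F. open F \<and> x0 \<in> F \<and> has_C1_gradient F (mollify \<rho> w) (mollify \<rho> g)"
    by (intro exI[of _ "ball x0 1"]) auto
qed

subsection \<open>Convergence of mollifications in mean square\<close>

lemma mollifierD:
  assumes "mollifier \<epsilon> \<rho> R"
  shows "has_C1_gradient UNIV \<rho> R" "0 \<le> \<rho> x" "\<epsilon> < norm x \<Longrightarrow> \<rho> x = 0" "(\<integral>x. \<rho> x \<partial>lborel) = 1"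
    "integrable lborel \<rho>" "\<rho> \<in> borel_measurable borel"
proof -
  show *: "has_C1_gradient UNIV \<rho> R" "0 \<le> \<rho> x" "\<epsilon> < norm x \<Longrightarrow> \<rho> x = 0" "(\<integral>x. \<rho> x \<partial>lborel) = 1"
    using assms by (auto simp: mollifier_def)
  show "integrable lborel \<rho>"
    by (rule integrable_compact_support[OF C1_continuous(1)[OF *(1)] compact_cball[of 0 \<epsilon>]])
      (use assms in \<open>auto simp: mollifier_def\<close>)
  show "\<rho> \<in> borel_measurable borel" by (rule borel_measurable_continuous_onI[OF C1_continuous(1)[OF *(1)]])
qed

lemma mollifier_reflected:
  assumes "mollifier \<epsilon> \<rho> R"
  shows "(\<integral>y. \<rho> (x - y) \<partial>lborel) = 1" "(\<integral>\<^sup>+y. ennreal (\<rho> (x - y)) \<partial>lborel) = 1"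
    "(\<integral>\<^sup>+x. ennreal (\<rho> (x - y)) \<partial>lborel) = 1" "integrable lborel (\<lambda>y. \<rho> (x - y))"
proof -
  note m = mollifierD[OF assms]
  show 1: "(\<integral>y. \<rho> (x - y) \<partial>lborel) = 1" for x using integral_lborel_reflect[OF m(6), of x] m(4) by simp
  show i: "integrable lborel (\<lambda>y. \<rho> (x - y))" for x
    by (rule integrable_compact_support[where K="cball x \<epsilon>"])
      (use m(3) in \<open>auto intro!: continuous_on_compose2[OF C1_continuous(1)[OF m(1)]] continuous_intros simp: dist_norm not_le\<close>)
  show "(\<integral>\<^sup>+y. ennreal (\<rho> (x - y)) \<partial>lborel) = 1"
    using nn_integral_eq_integral[OF i, of x] m(2) 1 by simp
  have "(\<integral>\<^sup>+x. ennreal (\<rho> (x - y)) \<partial>lborel) = (\<integral>\<^sup>+x. ennreal (\<rho> x) \<partial>lborel)"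
    using nn_integral_lborel_translation[of "\<lambda>x. ennreal (\<rho> x)" "- y"] m(6) by simp
  then show "(\<integral>\<^sup>+x. ennreal (\<rho> (x - y)) \<partial>lborel) = 1"
    using nn_integral_eq_integral[OF m(5)] m(2,4) by simp
qed

lemma L2_UNIV_D:
  assumes "h \<in> L2 UNIV"
  shows "h \<in> borel_measurable lebesgue" "integrable lebesgue (\<lambda>x. (norm (h x))\<^sup>2)"
  using L2D[OF assms] by (simp_all add: lebesgue_on_UNIV_eq)

lemma L2_compact_support_integrable:
  fixes h :: "'a::euclidean_space \<Rightarrow> 'b::euclidean_space"
  assumes "h \<in> L2 UNIV" "\<And>x. r < norm x \<Longrightarrow> h x = 0"
  shows "integrable lebesgue h"
proof -
  have "h \<in> L2 (cball 0 r)" by (rule L2_subset[OF assms(1)]) auto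
  then have "h absolutely_integrable_on cball 0 r" by (rule L2_abs_integrable) simp
  moreover have "(\<lambda>x. indicator (cball 0 r) x *\<^sub>R h x) = h"
    using assms(2) by (auto simp: indicator_def fun_eq_iff not_le)
  ultimately show ?thesis by (simp add: set_integrable_def)
qed

text \<open>Jensen's inequality for the probability density \<open>\<rho> (x - y)\<close>, in a form
  ready for an exchange of integrals.\<close>

lemma mollify_norm_sq_le:
  fixes h :: "'a::euclidean_space \<Rightarrow> 'b::euclidean_space"
  assumes m: "mollifier \<epsilon> \<rho> R" and h: "h \<in> L2 UNIV" "\<And>x. r < norm x \<Longrightarrow> h x = 0"
  shows "ennreal ((norm (mollify \<rho> h x))\<^sup>2) \<le> (\<integral>\<^sup>+y. ennreal (\<rho> (x - y)) * ennreal ((norm (h y))\<^sup>2) \<partial>lebesgue)"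
proof -
  note D = mollifierD[OF m]
  obtain B where B: "0 \<le> B" "\<And>x. \<bar>\<rho> x\<bar> \<le> B" "\<And>x. norm (R x) \<le> B" using C1_support_bounds[OF D(1)] D(3) by blast
  have c: "continuous_on UNIV (\<lambda>y. \<rho> (x - y))"
    by (intro continuous_on_compose2[OF C1_continuous(1)[OF D(1)]] continuous_intros) auto
  have hi: "integrable lebesgue h" using L2_compact_support_integrable[OF h] .
  have i1: "integrable lebesgue (\<lambda>y. \<rho> (x - y) * norm (h y))"
    using integrable_scaleR_bounded[OF integrable_norm[OF hi] c B(2)] by simp
  have i2: "integrable lebesgue (\<lambda>y. \<rho> (x - y) * (norm (h y))\<^sup>2)"
    using integrable_scaleR_bounded[OF L2_UNIV_D(2)[OF h(1)] c B(2)] by simp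
  have i0: "integrable lebesgue (\<lambda>y. \<rho> (x - y))" "(\<integral>y. \<rho> (x - y) \<partial>lebesgue) = 1"
    using mollifier_reflected(1,4)[OF m, of x] D(6)
    by (simp_all add: integrable_completion integral_completion)
  define k where "k = (\<integral>y. \<rho> (x - y) * norm (h y) \<partial>lebesgue)"
  have "norm (mollify \<rho> h x) \<le> (\<integral>y. norm (\<rho> (x - y) *\<^sub>R h y) \<partial>lebesgue)"
    unfolding mollify_def by (rule integral_norm_bound)
  also have "\<dots> = k" unfolding k_def using D(2) by simp
  finally have "(norm (mollify \<rho> h x))\<^sup>2 \<le> k\<^sup>2" by (intro power_mono) auto
  \<comment> \<open>The variance of \<open>norm (h y)\<close> about its mean \<open>k\<close> is
    nonnegative; expanding the square gives the bound.\<close>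
  also have "k\<^sup>2 \<le> (\<integral>y. \<rho> (x - y) * (norm (h y))\<^sup>2 \<partial>lebesgue)"
  proof -
    have "0 \<le> (\<integral>y. \<rho> (x - y) * (norm (h y) - k)\<^sup>2 \<partial>lebesgue)" using D(2) by (intro integral_nonneg_AE) auto
    also have "\<dots> = (\<integral>y. \<rho> (x - y) * (norm (h y))\<^sup>2 - (2 * k) * (\<rho> (x - y) * norm (h y)) + k\<^sup>2 * \<rho> (x - y) \<partial>lebesgue)"
      by (simp add: power2_eq_square algebra_simps)
    also have "\<dots> = (\<integral>y. \<rho> (x - y) * (norm (h y))\<^sup>2 \<partial>lebesgue) - (2 * k) * k + k\<^sup>2"
      unfolding k_def using i0 i1 i2 by simp
    finally show ?thesis by (simp add: power2_eq_square)
  qed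
  finally have "ennreal ((norm (mollify \<rho> h x))\<^sup>2) \<le> ennreal (\<integral>y. \<rho> (x - y) * (norm (h y))\<^sup>2 \<partial>lebesgue)"
    by (rule ennreal_leI)
  also have "\<dots> = (\<integral>\<^sup>+y. ennreal (\<rho> (x - y) * (norm (h y))\<^sup>2) \<partial>lebesgue)"
    using nn_integral_eq_integral[OF i2] D(2) by simp
  also have "\<dots> = (\<integral>\<^sup>+y. ennreal (\<rho> (x - y)) * ennreal ((norm (h y))\<^sup>2) \<partial>lebesgue)"
    using D(2) by (simp add: ennreal_mult)
  finally show ?thesis .
qed

text \<open>Integrating Jensen's inequality over \<open>x\<close> and exchanging the integrals
  leaves the mass of the kernel in \<open>x\<close>, which is 1.\<close>

lemma mollify_L2_bound:
  fixes h :: "'a::euclidean_space \<Rightarrow> 'b::euclidean_space"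
  assumes m: "mollifier \<epsilon> \<rho> R" and h: "h \<in> L2 UNIV" "\<And>x. r < norm x \<Longrightarrow> h x = 0"
  shows "mollify \<rho> h \<in> L2 UNIV" "L2norm UNIV (mollify \<rho> h) \<le> L2norm UNIV h"
proof -
  note D = mollifierD[OF m]
  have [measurable]: "\<rho> \<in> borel_measurable borel" by (rule D(6))
  have "(\<lambda>y. ennreal ((norm (h y))\<^sup>2)) \<in> borel_measurable lebesgue" using L2_UNIV_D(1)[OF h(1)] by measurable
  \<comment> \<open>Tonelli's theorem is applied on the product of Borel measures, so the Lebesgue
    measurable square is replaced by a Borel function equal to it almost everywhere.\<close>
  from completion_ex_borel_measurable[OF this]
  obtain k where k: "k \<in> borel_measurable lborel" "AE y in lborel. ennreal ((norm (h y))\<^sup>2) = k y" by blast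
  have [measurable]: "k \<in> borel_measurable borel" using k(1) by simp
  have cont: "continuous_on UNIV (mollify \<rho> h)"
    by (rule mollify_continuous_L1[OF D(1) D(3) L2_compact_support_integrable[OF h]])
  have "(\<integral>\<^sup>+x. ennreal ((norm (mollify \<rho> h x))\<^sup>2) \<partial>lebesgue_on UNIV)
      \<le> (\<integral>\<^sup>+x. (\<integral>\<^sup>+y. ennreal (\<rho> (x - y)) * ennreal ((norm (h y))\<^sup>2) \<partial>lebesgue) \<partial>lborel)"
    unfolding lebesgue_on_UNIV_eq nn_integral_completion[of lborel "\<lambda>x. ennreal ((norm (mollify \<rho> h x))\<^sup>2)"]
    by (rule nn_integral_mono) (rule mollify_norm_sq_le[OF m h])
  also have "\<dots> = (\<integral>\<^sup>+x. (\<integral>\<^sup>+y. ennreal (\<rho> (x - y)) * k y \<partial>lborel) \<partial>lborel)"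
  proof (rule nn_integral_cong)
    fix x
    show "(\<integral>\<^sup>+y. ennreal (\<rho> (x - y)) * ennreal ((norm (h y))\<^sup>2) \<partial>lebesgue) = (\<integral>\<^sup>+y. ennreal (\<rho> (x - y)) * k y \<partial>lborel)"
      unfolding nn_integral_completion
      by (rule nn_integral_cong_AE, use k(2) in eventually_elim) simp
  qed
  also have "\<dots> = (\<integral>\<^sup>+y. (\<integral>\<^sup>+x. ennreal (\<rho> (x - y)) * k y \<partial>lborel) \<partial>lborel)"
  proof -
    have "(\<lambda>(x, y). ennreal (\<rho> (x - y)) * k y) \<in> borel_measurable (lborel \<Otimes>\<^sub>M lborel)" by measurable
    from lborel_pair.Fubini'[OF this] show ?thesis by simp
  qed
  also have "\<dots> = (\<integral>\<^sup>+y. k y \<partial>lborel)"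
    by (intro nn_integral_cong) (simp add: nn_integral_multc mollifier_reflected(3)[OF m])
  also have "\<dots> = (\<integral>\<^sup>+y. ennreal ((norm (h y))\<^sup>2) \<partial>lborel)"
    by (rule nn_integral_cong_AE, use k(2) in eventually_elim) simp
  also have "\<dots> = (\<integral>\<^sup>+y. ennreal ((norm (h y))\<^sup>2) \<partial>lebesgue_on UNIV)"
    by (simp add: lebesgue_on_UNIV_eq nn_integral_completion)
  also have "\<dots> = ennreal ((L2norm UNIV h)\<^sup>2)" by (rule L2_nn_integral[OF h(1)])
  finally have b: "(\<integral>\<^sup>+x. ennreal ((norm (mollify \<rho> h x))\<^sup>2) \<partial>lebesgue_on UNIV) \<le> ennreal ((L2norm UNIV h)\<^sup>2)" .
  show "mollify \<rho> h \<in> L2 UNIV" "L2norm UNIV (mollify \<rho> h) \<le> L2norm UNIV h"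
    using L2_if_nn_integral[OF borel_measurable_lebesgue_onI[OF borel_measurable_continuous_onI[OF cont]] b] by auto
qed

text \<open>A Lebesgue measurable function is an almost everywhere limit of continuous ones, but
  without a majorant. Truncating the values and cutting off in space provides one, so that dominated
  convergence applies.\<close>

lemma L2_continuous_approximation:
  fixes h :: "'a::euclidean_space \<Rightarrow> 'b::euclidean_space"
  assumes h: "h \<in> L2 UNIV" "\<And>x. r < norm x \<Longrightarrow> h x = 0" and r: "0 < r" and e: "e > 0"
  obtains c where "continuous_on UNIV c" "\<And>x. r + 1 < norm x \<Longrightarrow> c x = 0" "c \<in> L2 UNIV"
    "L2norm UNIV (\<lambda>x. c x - h x) < e"
proof -
  have hm: "h \<in> borel_measurable lebesgue" using L2_UNIV_D(1)[OF h(1)] .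
  \<comment> \<open>The radial retraction onto the closed ball of radius \<open>m\<close>: it is
    continuous and does not increase norms, so it bounds the values while preserving
    continuity.\<close>
  define T where "T m y = (m / max m (norm y)) *\<^sub>R y" for m and y :: 'b
  have Tc: "continuous_on UNIV (T m)" if "m > 0" for m
    unfolding T_def using that by (intro continuous_intros) (auto simp: max_def)
  have Tn: "norm (T m y) \<le> m" if "m > 0" for m y
    using that by (auto simp: T_def max_def field_simps)
  have Tid: "T m y = y" if "m > 0" "norm y \<le> m" for m y
    using that by (simp add: T_def max_def)
  have Tle: "norm (T m y) \<le> norm y" if "m > 0" for m y
    using that by (auto simp: T_def max_def divide_le_eq intro!: mult_left_le_one_le)
  have Tm: "(\<lambda>x. T m (f x)) \<in> borel_measurable lebesgue" if "m > 0" "f \<in> borel_measurable lebesgue" for m f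
    by (rule measurable_compose[OF that(2) borel_measurable_continuous_onI[OF Tc[OF that(1)]]])
  have "(\<lambda>n. L2norm UNIV (\<lambda>x. T (real (Suc n)) (h x) - h x)) \<longlonglongrightarrow> 0"
  proof (rule L2_dominated_convergence[where h=h])
    show "AE x in lebesgue_on UNIV. (\<lambda>n. T (real (Suc n)) (h x)) \<longlonglongrightarrow> h x"
    proof (rule AE_I2)
      fix x
      obtain N where "norm (h x) \<le> real N" using real_arch_simple by blast
      then have "\<forall>n\<ge>N. T (real (Suc n)) (h x) = h x" by (auto intro!: Tid)
      then show "(\<lambda>n. T (real (Suc n)) (h x)) \<longlonglongrightarrow> h x"
        by (intro tendsto_eventually) (auto simp: eventually_sequentially)
    qed
    show "(\<lambda>x. T (real (Suc n)) (h x)) \<in> borel_measurable (lebesgue_on UNIV)" for n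
      unfolding lebesgue_on_UNIV_eq by (rule Tm[OF _ hm]) simp
  qed (use hm Tle h(1) in \<open>auto simp: lebesgue_on_UNIV_eq simp del: of_nat_Suc\<close>)
  then have "\<forall>\<^sub>F n in sequentially. L2norm UNIV (\<lambda>x. T (real (Suc n)) (h x) - h x) < e/2"
    using e by (intro order_tendstoD(2)) auto
  then obtain n where n: "L2norm UNIV (\<lambda>x. T (real (Suc n)) (h x) - h x) < e/2"
    by (auto simp: eventually_sequentially)
  define m where "m = real (Suc n)"
  have "m > 0" by (simp add: m_def)
  define hT where "hT x = T m (h x)" for x
  have hTm: "hT \<in> borel_measurable lebesgue" unfolding hT_def by (rule Tm[OF \<open>m > 0\<close> hm])
  have hT2: "hT \<in> L2 UNIV"
    using L2_mono_bound(1)[OF h(1), of hT] hTm Tle[OF \<open>m > 0\<close>] by (simp add: hT_def lebesgue_on_UNIV_eq)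
  have "h measurable_on UNIV" by (rule lebesgue_measurable_imp_measurable_on[OF hm]) simp
  then obtain N g where g: "negligible N" "\<And>n. continuous_on UNIV (g n)" "\<And>x. x \<notin> N \<Longrightarrow> (\<lambda>n. g n x) \<longlonglongrightarrow> h x"
    unfolding measurable_on_def by auto
  \<comment> \<open>Equals 1 where \<open>h\<close> may be nonzero and vanishes beyond radius
    \<open>r + 1\<close>, which confines all approximations to one ball.\<close>
  define \<kappa> where "\<kappa> x = max 0 (min 1 (r + 1 - norm x))" for x :: 'a
  define c where "c k x = \<kappa> x *\<^sub>R T m (g k x)" for k x
  have \<kappa>: "continuous_on UNIV \<kappa>" "\<And>x. 0 \<le> \<kappa> x" "\<And>x. \<kappa> x \<le> 1" "\<And>x. r + 1 < norm x \<Longrightarrow> \<kappa> x = 0" "\<And>x. norm x \<le> r \<Longrightarrow> \<kappa> x = 1"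
    unfolding \<kappa>_def by (auto intro!: continuous_intros)
  have cc: "continuous_on UNIV (c k)" for k
    unfolding c_def by (intro continuous_intros \<kappa>(1) continuous_on_compose2[OF Tc[OF \<open>m > 0\<close>] g(2)]) auto
  have cm: "c k \<in> borel_measurable (lebesgue_on UNIV)" for k
    by (rule borel_measurable_lebesgue_onI[OF borel_measurable_continuous_onI[OF cc]])
  define H where "H x = indicat_real (cball 0 (r + 1)) x * m" for x :: 'a
  have I: "integrable lborel (\<lambda>x::'a. indicator (cball 0 (r + 1)) x *\<^sub>R m\<^sup>2)"
    by (rule borel_integrable_compact) auto
  then have "integrable lebesgue (\<lambda>x::'a. indicator (cball 0 (r + 1)) x *\<^sub>R m\<^sup>2)"
    using integrable_completion[OF borel_measurable_integrable[OF I]] by blast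
  moreover have "(\<lambda>x::'a. (norm (H x))\<^sup>2) = (\<lambda>x. indicator (cball 0 (r + 1)) x *\<^sub>R m\<^sup>2)"
    by (auto simp: H_def indicator_def fun_eq_iff)
  moreover have "H \<in> borel_measurable lebesgue" unfolding H_def
    by (intro borel_measurable_times borel_measurable_indicator borel_measurable_const) simp
  ultimately have H2: "H \<in> L2 UNIV" by (simp add: L2_def lebesgue_on_UNIV_eq)
  have cH: "norm (c k x) \<le> norm (H x)" for k x
  proof (cases "r + 1 < norm x")
    case False
    have "norm (c k x) \<le> 1 * m"
      unfolding c_def using \<kappa>(2,3)[of x] Tn[OF \<open>m > 0\<close>, of "g k x"] by (simp only: norm_scaleR) (intro mult_mono, auto)
    then show ?thesis using False \<open>m > 0\<close> by (simp add: H_def)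
  qed (simp add: c_def \<kappa>(4))
  have "(\<lambda>k. L2norm UNIV (\<lambda>x. c k x - hT x)) \<longlonglongrightarrow> 0"
  proof (rule L2_dominated_convergence[where h=H])
    have "AE x in lebesgue. x \<notin> N"
      using g(1) by (intro AE_not_in) (simp add: negligible_iff_null_sets)
    then show "AE x in lebesgue_on UNIV. (\<lambda>n. c n x) \<longlonglongrightarrow> hT x"
      unfolding lebesgue_on_UNIV_eq
    proof eventually_elim
      fix x assume "x \<notin> N"
      have "(\<lambda>k. T m (g k x)) \<longlonglongrightarrow> T m (h x)"
        using Tc[OF \<open>m > 0\<close>] g(3)[OF \<open>x \<notin> N\<close>]
        by (intro isCont_tendsto_compose[of _ "T m"]) (auto simp: continuous_on_eq_continuous_at)
      then have "(\<lambda>k. c k x) \<longlonglongrightarrow> \<kappa> x *\<^sub>R T m (h x)" unfolding c_def by (intro tendsto_intros)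
      moreover have "\<kappa> x *\<^sub>R T m (h x) = hT x"
        using \<kappa>(5)[of x] h(2)[of x] by (cases "norm x \<le> r") (auto simp: hT_def T_def)
      ultimately show "(\<lambda>k. c k x) \<longlonglongrightarrow> hT x" by simp
    qed
  qed (use cm hTm H2 cH in \<open>auto simp: lebesgue_on_UNIV_eq\<close>)
  then have "\<forall>\<^sub>F k in sequentially. L2norm UNIV (\<lambda>x. c k x - hT x) < e/2"
    using e by (intro order_tendstoD(2)) auto
  then obtain k where k: "L2norm UNIV (\<lambda>x. c k x - hT x) < e/2" by (auto simp: eventually_sequentially)
  have c2: "c k \<in> L2 UNIV" by (rule L2_mono_bound(1)[OF H2 cm]) (rule cH)
  show ?thesis
  proof (rule that[of "c k", OF cc _ c2])
    show "c k x = 0" if "r + 1 < norm x" for x by (simp add: c_def \<kappa>(4)[OF that])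
    show "L2norm UNIV (\<lambda>x. c k x - h x) < e"
      using L2norm_triangle_diff[OF c2 hT2 h(1)] k n by (simp add: hT_def m_def)
  qed
qed

text \<open>Uniform continuity makes the difference uniformly small on the ball of radius
  \<open>r + 1\<close>, and it vanishes outside; the finite measure of the ball turns this into an
  L^2 bound.\<close>

lemma mollify_continuous_converges:
  fixes c :: "'a::euclidean_space \<Rightarrow> 'b::euclidean_space"
  assumes c: "continuous_on UNIV c" "\<And>x. r < norm x \<Longrightarrow> c x = 0" "0 < r" and e: "e > 0"
  obtains d where "d > 0" "\<And>\<epsilon> \<rho> R. mollifier \<epsilon> \<rho> R \<Longrightarrow> \<epsilon> \<le> d \<Longrightarrow> L2norm UNIV (\<lambda>x. mollify \<rho> c x - c x) < e"
proof -
  define V where "V = sqrt (measure lebesgue (cball (0::'a) (r + 1)))"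
  have "V \<ge> 0" by (simp add: V_def)
  define \<eta> where "\<eta> = e / (V + 1)"
  have "\<eta> > 0" using e \<open>V \<ge> 0\<close> by (simp add: \<eta>_def)
  have "uniformly_continuous_on (cball 0 (r + 2)) c"
    by (intro compact_uniformly_continuous continuous_on_subset[OF c(1)]) auto
  then obtain d where d: "d > 0" "\<And>x y. x \<in> cball 0 (r + 2) \<Longrightarrow> y \<in> cball 0 (r + 2) \<Longrightarrow> dist y x < d \<Longrightarrow> dist (c y) (c x) < \<eta>"
    using \<open>\<eta> > 0\<close> unfolding uniformly_continuous_on_def by metis
  \<comment> \<open>At most 1, so that the mollification vanishes beyond radius
    \<open>r + 1\<close>; at most \<open>d / 2\<close>, to meet the strict bound in the uniform
    continuity.\<close>
  define d' where "d' = min (d / 2) 1"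
  show ?thesis
  proof (rule that[of d'])
    show "d' > 0" using d(1) by (simp add: d'_def)
    fix \<epsilon> and \<rho> :: "'a \<Rightarrow> real" and R assume m: "mollifier \<epsilon> \<rho> R" and \<epsilon>: "\<epsilon> \<le> d'"
    note D = mollifierD[OF m]
    have ci: "integrable lebesgue c"
      using integrable_compact_support[OF c(1) compact_cball[of 0 r]] c(2)
      by (simp add: integrable_completion borel_measurable_continuous_onI[OF c(1)])
    obtain B where B: "0 \<le> B" "\<And>x. \<bar>\<rho> x\<bar> \<le> B" "\<And>x. norm (R x) \<le> B" using C1_support_bounds[OF D(1)] D(3) by blast
    have diff: "norm (mollify \<rho> c x - c x) \<le> indicat_real (cball 0 (r + 1)) x * \<eta>" for x
    proof (cases "x \<in> cball 0 (r + 1)")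
      case True
      have cx: "continuous_on UNIV (\<lambda>y. \<rho> (x - y))"
        by (intro continuous_on_compose2[OF C1_continuous(1)[OF D(1)]] continuous_intros) auto
      have i1: "integrable lebesgue (\<lambda>y. \<rho> (x - y) *\<^sub>R c y)"
        by (rule integrable_scaleR_bounded[OF ci cx B(2)])
      have i0: "integrable lebesgue (\<lambda>y. \<rho> (x - y))" "(\<integral>y. \<rho> (x - y) \<partial>lebesgue) = 1"
        using mollifier_reflected(1,4)[OF m, of x] D(6) by (simp_all add: integrable_completion integral_completion)
      have "mollify \<rho> c x - c x = (\<integral>y. \<rho> (x - y) *\<^sub>R c y \<partial>lebesgue) - (\<integral>y. \<rho> (x - y) *\<^sub>R c x \<partial>lebesgue)"
        using i0 by (simp add: mollify_def)
      also have "\<dots> = (\<integral>y. \<rho> (x - y) *\<^sub>R c y - \<rho> (x - y) *\<^sub>R c x \<partial>lebesgue)"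
        by (rule Bochner_Integration.integral_diff[symmetric, OF i1 integrable_scaleR_left[OF i0(1)]])
      also have "\<dots> = (\<integral>y. \<rho> (x - y) *\<^sub>R (c y - c x) \<partial>lebesgue)" by (simp add: scaleR_diff_right)
      finally have "norm (mollify \<rho> c x - c x) \<le> (\<integral>y. norm (\<rho> (x - y) *\<^sub>R (c y - c x)) \<partial>lebesgue)"
        using integral_norm_bound by metis
      also have "\<dots> \<le> (\<integral>y. \<rho> (x - y) * \<eta> \<partial>lebesgue)"
      proof (rule integral_mono)
        have "integrable lebesgue (\<lambda>y. \<rho> (x - y) *\<^sub>R c y - \<rho> (x - y) *\<^sub>R c x)"
          by (rule Bochner_Integration.integrable_diff[OF i1 integrable_scaleR_left[OF i0(1)]])
        then show "integrable lebesgue (\<lambda>y. norm (\<rho> (x - y) *\<^sub>R (c y - c x)))" by (simp only: scaleR_diff_right[symmetric] integrable_norm)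
        show "integrable lebesgue (\<lambda>y. \<rho> (x - y) * \<eta>)" using i0(1) by simp
        fix y
        show "norm (\<rho> (x - y) *\<^sub>R (c y - c x)) \<le> \<rho> (x - y) * \<eta>"
        proof (cases "\<epsilon> < norm (x - y)")
          case False
          then have n: "norm (x - y) \<le> d / 2" "norm (x - y) \<le> 1" using \<epsilon> by (auto simp: d'_def)
          have "y \<in> cball 0 (r + 2)" "x \<in> cball 0 (r + 2)"
            using True n(2) norm_triangle_ineq2[of y x] by (auto simp: norm_minus_commute)
          then have "norm (c y - c x) \<le> \<eta>"
            using d(2)[of x y] n(1) d(1) by (simp add: dist_norm norm_minus_commute)
          then show ?thesis using D(2) by (simp add: mult_left_mono)
        qed (simp add: D(3))
      qed
      also have "\<dots> = \<eta>" using i0 by simp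
      finally show ?thesis using True by simp
    next
      case False
      have "\<rho> (x - y) *\<^sub>R c y = 0" for y
        using D(3)[of "x - y"] c(2)[of y] False \<epsilon> norm_triangle_ineq2[of x y] by (cases "r < norm y") (auto simp: d'_def)
      then have "mollify \<rho> c x = 0" unfolding mollify_def by (simp only: integral_zero)
      then show ?thesis using False c(2)[of x] c(3) by simp
    qed
    have cont: "continuous_on UNIV (\<lambda>x. mollify \<rho> c x - c x)"
      by (intro continuous_intros mollify_continuous_L1[OF D(1) D(3) ci] c(1))
    have "L2norm UNIV (\<lambda>x. mollify \<rho> c x - c x) \<le> V * \<eta>"
    proof (rule L2_if_nn_integral(2))
      show "(\<lambda>x. mollify \<rho> c x - c x) \<in> borel_measurable (lebesgue_on UNIV)"
        by (rule borel_measurable_lebesgue_onI[OF borel_measurable_continuous_onI[OF cont]])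
      show "0 \<le> V * \<eta>" using \<open>V \<ge> 0\<close> \<open>\<eta> > 0\<close> by simp
      have "(\<integral>\<^sup>+x. ennreal ((norm (mollify \<rho> c x - c x))\<^sup>2) \<partial>lebesgue_on UNIV)
          \<le> (\<integral>\<^sup>+x. ennreal (\<eta>\<^sup>2) * indicator (cball (0::'a) (r + 1)) x \<partial>lebesgue_on UNIV)"
      proof (rule nn_integral_mono)
        fix x
        have "(norm (mollify \<rho> c x - c x))\<^sup>2 \<le> (indicat_real (cball 0 (r + 1)) x * \<eta>)\<^sup>2"
          using diff[of x] by (intro power_mono) auto
        then show "ennreal ((norm (mollify \<rho> c x - c x))\<^sup>2) \<le> ennreal (\<eta>\<^sup>2) * indicator (cball 0 (r + 1)) x"
          by (auto simp: indicator_def ennreal_leI split: if_splits)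
      qed
      also have "\<dots> = ennreal (\<eta>\<^sup>2) * emeasure lebesgue (cball (0::'a) (r + 1))"
        by (simp add: lebesgue_on_UNIV_eq nn_integral_cmult_indicator)
      also have "\<dots> = ennreal (\<eta>\<^sup>2) * ennreal (measure lebesgue (cball (0::'a) (r + 1)))"
        by (subst emeasure_eq_measure2) (auto intro: fmeasurableD2)
      also have "\<dots> = ennreal ((V * \<eta>)\<^sup>2)"
        by (simp add: V_def power_mult_distrib ennreal_mult mult.commute)
      finally show "(\<integral>\<^sup>+x. ennreal ((norm (mollify \<rho> c x - c x))\<^sup>2) \<partial>lebesgue_on UNIV) \<le> ennreal ((V * \<eta>)\<^sup>2)" .
    qed
    also have "\<dots> < e"
    proof -
      have "V * \<eta> < (V + 1) * \<eta>" using \<open>\<eta> > 0\<close> by simp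
      also have "\<dots> = e" using \<open>V \<ge> 0\<close> by (simp add: \<eta>_def)
      finally show ?thesis .
    qed
    finally show "L2norm UNIV (\<lambda>x. mollify \<rho> c x - c x) < e" .
  qed
qed

lemma mollify_diff:
  fixes u v :: "'a::euclidean_space \<Rightarrow> 'b::euclidean_space"
  assumes m: "mollifier \<epsilon> \<rho> R" and u: "integrable lebesgue u" and v: "integrable lebesgue v"
  shows "mollify \<rho> (\<lambda>y. u y - v y) x = mollify \<rho> u x - mollify \<rho> v x"
proof -
  note D = mollifierD[OF m]
  obtain B where B: "0 \<le> B" "\<And>x. \<bar>\<rho> x\<bar> \<le> B" "\<And>x. norm (R x) \<le> B" using C1_support_bounds[OF D(1)] D(3) by blast
  have cx: "continuous_on UNIV (\<lambda>y. \<rho> (x - y))"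
    by (intro continuous_on_compose2[OF C1_continuous(1)[OF D(1)]] continuous_intros) auto
  show ?thesis
    unfolding mollify_def scaleR_diff_right
    by (rule Bochner_Integration.integral_diff; rule integrable_scaleR_bounded[OF _ cx B(2)]) (rule u v)+
qed

text \<open>Mollification does not increase the L^2 norm, so the continuous case extends by density,
  with \<open>e/3\<close> spent on each of three differences.\<close>

lemma mollify_L2_converges:
  fixes h :: "'a::euclidean_space \<Rightarrow> 'b::euclidean_space"
  assumes h: "h \<in> L2 UNIV" "\<And>x. r < norm x \<Longrightarrow> h x = 0" and r: "0 < r" and e: "e > 0"
  obtains d where "d > 0" "\<And>\<epsilon> \<rho> R. mollifier \<epsilon> \<rho> R \<Longrightarrow> \<epsilon> \<le> d \<Longrightarrow> L2norm UNIV (\<lambda>x. mollify \<rho> h x - h x) < e"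
proof -
  obtain c where c: "continuous_on UNIV c" "\<And>x. r + 1 < norm x \<Longrightarrow> c x = 0" "c \<in> L2 UNIV"
    "L2norm UNIV (\<lambda>x. c x - h x) < e/3"
    using L2_continuous_approximation[OF h r, of "e/3"] e by auto
  obtain d where d: "d > 0" "\<And>\<epsilon> \<rho> R. mollifier \<epsilon> \<rho> R \<Longrightarrow> \<epsilon> \<le> d \<Longrightarrow> L2norm UNIV (\<lambda>x. mollify \<rho> c x - c x) < e/3"
    using mollify_continuous_converges[where c=c and r="r+1" and e="e/3"] c(1,2) r e by auto
  show ?thesis
  proof (rule that[OF d(1)])
    fix \<epsilon> and \<rho> :: "'a \<Rightarrow> real" and R assume m: "mollifier \<epsilon> \<rho> R" "\<epsilon> \<le> d"
    have h': "\<And>x. r + 1 < norm x \<Longrightarrow> h x = 0" using h(2) by simp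
    have hc: "(\<lambda>x. h x - c x) \<in> L2 UNIV" "\<And>x. r + 1 < norm x \<Longrightarrow> h x - c x = 0"
      using L2_diff[OF h(1) c(3)] h' c(2) by auto
    have "(\<lambda>x. mollify \<rho> h x - mollify \<rho> c x) = mollify \<rho> (\<lambda>x. h x - c x)"
      using mollify_diff[OF m(1) L2_compact_support_integrable[OF h(1) h'] L2_compact_support_integrable[OF c(3,2)]]
      by auto
    then have 1: "L2norm UNIV (\<lambda>x. mollify \<rho> h x - mollify \<rho> c x) < e/3"
    proof -
      have "L2norm UNIV (mollify \<rho> (\<lambda>x. h x - c x)) \<le> L2norm UNIV (\<lambda>x. h x - c x)"
        by (rule mollify_L2_bound(2)[OF m(1) hc])
      then show ?thesis
        using c(4) L2norm_diff_commute[of UNIV c h]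
          \<open>(\<lambda>x. mollify \<rho> h x - mollify \<rho> c x) = mollify \<rho> (\<lambda>x. h x - c x)\<close> by simp
    qed
    have 2: "L2norm UNIV (\<lambda>x. mollify \<rho> c x - c x) < e/3" by (rule d(2)[OF m])
    have mh: "mollify \<rho> h \<in> L2 UNIV" "mollify \<rho> c \<in> L2 UNIV"
      using mollify_L2_bound(1)[OF m(1) h(1) h'] mollify_L2_bound(1)[OF m(1) c(3,2)] by auto
    show "L2norm UNIV (\<lambda>x. mollify \<rho> h x - h x) < e"
      using L2norm_triangle_diff[OF mh(1,2) h(1)] L2norm_triangle_diff[OF mh(2) c(3) h(1)] 1 2 c(4) by linarith
  qed
qed

lemma mollify_periodic:
  fixes w :: "real^2 \<Rightarrow> 'b::euclidean_space"
  assumes m: "mollifier \<epsilon> \<rho> R" and w: "w \<in> borel_measurable lebesgue" "lperiodic L w"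
  shows "lperiodic L (mollify \<rho> w)"
  unfolding lperiodic_def
proof (intro allI)
  fix x k
  have [measurable]: "\<rho> \<in> borel_measurable borel" by (rule mollifierD(6)[OF m])
  have "(\<lambda>y. \<rho> (x + lat L k - y)) \<in> borel_measurable lborel" by measurable
  then have "(\<lambda>y. \<rho> (x + lat L k - y)) \<in> borel_measurable lebesgue"
    by (rule measurable_completion)
  then have F: "(\<lambda>y. \<rho> (x + lat L k - y) *\<^sub>R w y) \<in> borel_measurable lebesgue"
    using w(1) by (rule borel_measurable_scaleR)
  have "mollify \<rho> w (x + lat L k) = (\<integral>y. \<rho> (x + lat L k - (lat L k + y)) *\<^sub>R w (lat L k + y) \<partial>lebesgue)"
    unfolding mollify_def by (rule integral_lebesgue_translation[OF F, symmetric])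
  also have "\<dots> = mollify \<rho> w x"
    using w(2) by (simp add: mollify_def lperiodic_def add.commute[of "lat L k"])
  finally show "mollify \<rho> w (x + lat L k) = mollify \<rho> w x" .
qed

lemma norm_Omega: "x \<in> Omega L \<Longrightarrow> norm x < 2 * L"
  using norm_le_l1_cart[of x] by (simp add: Omega_def sum_2 abs_less_iff) (smt (verit))

text \<open>Completeness of Lebesgue measure. An element of \<open>H1_per\<close> is only required
  to agree almost everywhere with a periodic function, and its measurability has to be derived from
  that.\<close>

lemma borel_measurable_AE_eq:
  fixes u v :: "'a::euclidean_space \<Rightarrow> 'b::euclidean_space"
  assumes u: "u \<in> borel_measurable (lebesgue_on S)" and uv: "AE x in lebesgue_on S. v x = u x" and S: "S \<in> sets lebesgue"
  shows "v \<in> borel_measurable (lebesgue_on S)"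
proof -
  have "AE x in lebesgue. x \<in> S \<longrightarrow> v x = u x"
    using uv S by (subst (asm) AE_restrict_space_iff) auto
  then obtain N where "{x \<in> space lebesgue. \<not> (x \<in> S \<longrightarrow> v x = u x)} \<subseteq> N" "emeasure lebesgue N = 0" "N \<in> sets lebesgue"
    by (rule AE_E)
  then have N: "N \<in> null_sets lebesgue" "{x. \<not> (x \<in> S \<longrightarrow> v x = u x)} \<subseteq> N"
    using null_setsI[of lebesgue N] by simp_all
  have "v measurable_on S"
  proof (rule measurable_on_spike)
    show "u measurable_on S" using u S by (simp add: measurable_on_iff_borel_measurable)
    show "negligible N" using N(1) by (simp add: negligible_iff_null_sets)
    show "v x = u x" if "x \<in> S - N" for x using that N(2) by auto
  qed
  then show ?thesis using S by (simp add: measurable_on_iff_borel_measurable)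
qed

text \<open>Converse of \<open>per_limit_H1_per\<close>: mollifying a periodic representative gives
  periodic C^1 functions. Convergence is proved for the representative cut off to a ball, which has
  the same mollification on the square.\<close>

lemma H1_per_per_limit:
  assumes L: "L > 0" and v: "v \<in> H1_per L"
  obtains g where "per_limit L v g"
proof -
  obtain w g where w: "lperiodic L w" "AE x in lebesgue_on (Omega L). v x = w x"
    "has_weak_gradient UNIV w g" "\<And>K. compact K \<Longrightarrow> w \<in> L2 K" "\<And>K. compact K \<Longrightarrow> g \<in> L2 K"
    using v periodic_iff_lperiodic unfolding H1_per_def H1_loc_def by auto
  have wm: "w \<in> borel_measurable lebesgue"
    using measurable_if_abs_integrable[OF open_UNIV] has_weak_gradientD(1)[OF w(3)] by (auto simp: lebesgue_on_UNIV_eq)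
  \<comment> \<open>Points of the square have norm below \<open>2 * L\<close>; the additional 1
    leaves room for mollifiers of radius at most 1.\<close>
  define r where "r = 2 * L + 1"
  define K where "K = cball (0::real^2) r"
  have r: "r > 0" using L by (simp add: r_def)
  have sub: "cball x \<epsilon> \<subseteq> K" if "x \<in> Omega L" "\<epsilon> \<le> 1" for x \<epsilon>
  proof
    fix y assume "y \<in> cball x \<epsilon>"
    then have "dist x y \<le> 1" using that(2) by simp
    then show "y \<in> K" using norm_Omega[OF that(1)] norm_triangle_ineq2[of y x] by (auto simp: K_def r_def dist_norm norm_minus_commute)
  qed
  have OK: "Omega L \<subseteq> K" using sub[of _ 0] by auto
  have cut: "(\<lambda>y. indicat_real K y *\<^sub>R u y) \<in> L2 UNIV" "\<And>x. r < norm x \<Longrightarrow> indicat_real K x *\<^sub>R u x = 0"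
    if "u \<in> L2 K" for u :: "real^2 \<Rightarrow> 'c::euclidean_space"
  proof -
    have km: "K \<in> sets lebesgue" by (simp add: K_def)
    have "(\<lambda>y. indicat_real K y *\<^sub>R u y) \<in> borel_measurable lebesgue"
      using L2D(1)[OF that] km by (simp add: borel_measurable_restrict_space_iff)
    moreover have "integrable lebesgue (\<lambda>x. indicator K x *\<^sub>R (norm (u x))\<^sup>2)"
      using L2D(2)[OF that] km by (simp add: integrable_restrict_space)
    moreover have "(\<lambda>x. (norm (indicat_real K x *\<^sub>R u x))\<^sup>2) = (\<lambda>x. indicator K x *\<^sub>R (norm (u x))\<^sup>2)"
      by (auto simp: indicator_def fun_eq_iff)
    ultimately show "(\<lambda>y. indicat_real K y *\<^sub>R u y) \<in> L2 UNIV" by (simp add: L2_def lebesgue_on_UNIV_eq)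
    show "\<And>x. r < norm x \<Longrightarrow> indicat_real K x *\<^sub>R u x = 0" by (simp add: K_def indicator_def)
  qed
  have L2K: "w \<in> L2 K" "g \<in> L2 K" using w(4,5) by (auto simp: K_def)
  have w2: "w \<in> L2 (Omega L)" and g2: "g \<in> L2 (Omega L)"
    using L2_subset[OF _ OK] L2K by (auto simp: K_def sets_Omega)
  have vm: "v \<in> borel_measurable (lebesgue_on (Omega L))"
    by (rule borel_measurable_AE_eq[OF L2D(1)[OF w2] _ sets_Omega(1)], use w(2) in eventually_elim) simp
  have wv: "AE x in lebesgue_on (Omega L). w x = v x" using w(2) by eventually_elim simp
  have v2: "v \<in> L2 (Omega L)" by (rule L2_cong_AE[OF w2 wv vm])
  have close: "L2norm (Omega L) (\<lambda>x. u x - mollify \<rho> u x) < e"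
    if u: "u \<in> L2 K" and m: "mollifier \<epsilon> \<rho> R" "\<epsilon> \<le> 1"
      and l: "L2norm UNIV (\<lambda>x. mollify \<rho> (\<lambda>y. indicat_real K y *\<^sub>R u y) x - indicat_real K x *\<^sub>R u x) < e"
    for u :: "real^2 \<Rightarrow> 'c::euclidean_space" and \<epsilon> \<rho> R e
  proof -
    have l2: "(\<lambda>x. mollify \<rho> (\<lambda>y. indicat_real K y *\<^sub>R u y) x - indicat_real K x *\<^sub>R u x) \<in> L2 UNIV"
      by (intro L2_diff cut(1)[OF u] mollify_L2_bound(1)[OF m(1) cut[OF u]])
    have "L2norm (Omega L) (\<lambda>x. u x - mollify \<rho> u x) = L2norm (Omega L) (\<lambda>x. mollify \<rho> u x - u x)"
      by (rule L2norm_diff_commute)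
    also have "\<dots> = L2norm (Omega L) (\<lambda>x. mollify \<rho> (\<lambda>y. indicat_real K y *\<^sub>R u y) x - indicat_real K x *\<^sub>R u x)"
    proof (rule L2norm_cong)
      fix x assume x: "x \<in> Omega L"
      have "mollify \<rho> (\<lambda>y. indicat_real K y *\<^sub>R u y) x = mollify \<rho> u x"
        by (rule mollify_local[OF mollifierD(3)[OF m(1)] sub[OF x m(2)]])
      then show "mollify \<rho> u x - u x = mollify \<rho> (\<lambda>y. indicat_real K y *\<^sub>R u y) x - indicat_real K x *\<^sub>R u x"
        using OK x by auto
    qed
    also have "\<dots> \<le> L2norm UNIV (\<lambda>x. mollify \<rho> (\<lambda>y. indicat_real K y *\<^sub>R u y) x - indicat_real K x *\<^sub>R u x)"
      by (rule L2norm_subset[OF l2]) (auto simp: sets_Omega)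
    finally show ?thesis using l by simp
  qed
  have "per_limit L v g"
    unfolding per_limit_def
  proof (intro conjI v2 g2 allI impI)
    fix e :: real assume "e > 0"
    obtain d1 where d1: "d1 > 0" "\<And>\<epsilon> \<rho> R. mollifier \<epsilon> \<rho> R \<Longrightarrow> \<epsilon> \<le> d1 \<Longrightarrow>
        L2norm UNIV (\<lambda>x. mollify \<rho> (\<lambda>y. indicat_real K y *\<^sub>R w y) x - indicat_real K x *\<^sub>R w x) < e"
      using mollify_L2_converges[OF cut[OF L2K(1)] r \<open>e > 0\<close>] by blast
    obtain d2 where d2: "d2 > 0" "\<And>\<epsilon> \<rho> R. mollifier \<epsilon> \<rho> R \<Longrightarrow> \<epsilon> \<le> d2 \<Longrightarrow>
        L2norm UNIV (\<lambda>x. mollify \<rho> (\<lambda>y. indicat_real K y *\<^sub>R g y) x - indicat_real K x *\<^sub>R g x) < e"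
      using mollify_L2_converges[OF cut[OF L2K(2)] r \<open>e > 0\<close>] by blast
    define \<epsilon> where "\<epsilon> = min (min d1 d2) 1"
    have "\<epsilon> > 0" "\<epsilon> \<le> d1" "\<epsilon> \<le> d2" "\<epsilon> \<le> 1" using d1(1) d2(1) by (auto simp: \<epsilon>_def)
    obtain \<rho> and R :: "real^2 \<Rightarrow> real^2" where m: "mollifier \<epsilon> \<rho> R" using mollifier_exists[OF \<open>\<epsilon> > 0\<close>] by blast
    note D = mollifierD[OF m]
    have pc: "PC1 L (mollify \<rho> w) (mollify \<rho> g)"
      unfolding PC1_def by (intro conjI mollify_periodic[OF m wm w(1)] mollify_C1[OF D(1) D(3) w(3)])
    have "L2norm (Omega L) (\<lambda>x. v x - mollify \<rho> w x) = L2norm (Omega L) (\<lambda>x. w x - mollify \<rho> w x)"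
      by (rule L2norm_cong_AE, use w(2) in eventually_elim)
        (use vm L2D(1)[OF w2] L2D(1)[OF PC1_L2(1)[OF L pc]] in auto)
    moreover have "L2norm (Omega L) (\<lambda>x. w x - mollify \<rho> w x) < e"
      by (rule close[OF L2K(1) m \<open>\<epsilon> \<le> 1\<close> d1(2)[OF m \<open>\<epsilon> \<le> d1\<close>]])
    moreover have "L2norm (Omega L) (\<lambda>x. g x - mollify \<rho> g x) < e"
      by (rule close[OF L2K(2) m \<open>\<epsilon> \<le> 1\<close> d2(2)[OF m \<open>\<epsilon> \<le> d2\<close>]])
    ultimately show "\<exists>u G. PC1 L u G \<and> L2norm (Omega L) (\<lambda>x. v x - u x) < e \<and> L2norm (Omega L) (\<lambda>x. g x - G x) < e"
      using pc by (intro exI[of _ "mollify \<rho> w"] exI[of _ "mollify \<rho> g"]) simp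
  qed
  then show ?thesis by (rule that)
qed

text \<open>Any gradient obtained from approximations may be replaced by the chosen
  \<open>weak_grad\<close>, since the two agree almost everywhere.\<close>

lemma H1_per_weak_grad:
  assumes L: "L > 0" and v: "v \<in> H1_per L"
  shows "per_limit L v (weak_grad (Omega L) v)"
proof -
  obtain g where g: "per_limit L v g" using H1_per_per_limit[OF assms] by blast
  have wg: "has_weak_gradient (Omega L) v g" using per_limit_H1_per[OF L g] by blast
  have m: "weak_grad (Omega L) v \<in> borel_measurable (lebesgue_on (Omega L))"
    by (rule weak_grad_measurable[OF open_Omega wg])
  have ae: "AE x in lebesgue_on (Omega L). weak_grad (Omega L) v x = g x"
    by (rule weak_grad_AE[OF open_Omega wg])
  have g2: "g \<in> L2 (Omega L)" using g by (simp add: per_limit_def)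
  have g2': "weak_grad (Omega L) v \<in> L2 (Omega L)"
    by (rule L2_cong_AE[OF g2 _ m], use ae in eventually_elim) simp
  have "L2norm (Omega L) (\<lambda>x. weak_grad (Omega L) v x - G x) = L2norm (Omega L) (\<lambda>x. g x - G x)"
    if "G \<in> L2 (Omega L)" for G
    by (rule L2norm_cong_AE, use ae in eventually_elim) (use m L2D(1)[OF g2] L2D(1)[OF that] in auto)
  note eq = this
  show ?thesis
    unfolding per_limit_def
  proof (intro conjI g2' allI impI)
    show "v \<in> L2 (Omega L)" using g by (simp add: per_limit_def)
    fix e :: real assume "e > 0"
    then obtain u G where u: "PC1 L u G" "L2norm (Omega L) (\<lambda>x. v x - u x) < e" "L2norm (Omega L) (\<lambda>x. g x - G x) < e"
      using g unfolding per_limit_def by blast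
    then show "\<exists>u G. PC1 L u G \<and> L2norm (Omega L) (\<lambda>x. v x - u x) < e
        \<and> L2norm (Omega L) (\<lambda>x. weak_grad (Omega L) v x - G x) < e"
      using eq[OF PC1_L2(2)[OF L u(1)]] by (intro exI[of _ u] exI[of _ G]) simp
  qed
qed

subsection \<open>The Poincare inequality\<close>

text \<open>The fundamental theorem of calculus along the segment from \<open>x\<close> to
  \<open>x + z\<close>, followed by Cauchy-Schwarz in \<open>t\<close>. The form with nonnegative
  integrals is made for Tonelli's theorem.\<close>

lemma C1_increment_sq_le:
  fixes u :: "'a::euclidean_space \<Rightarrow> real"
  assumes u: "has_C1_gradient UNIV u G"
  shows "ennreal ((u (x + z) - u x)\<^sup>2)
    \<le> ennreal ((norm z)\<^sup>2) * (\<integral>\<^sup>+t. ennreal ((norm (G (x + t *\<^sub>R z)))\<^sup>2) * indicator {0..1} t \<partial>lborel)"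
proof -
  define a where "a t = G (x + t *\<^sub>R z) \<bullet> z" for t
  have ca: "continuous_on UNIV a"
    unfolding a_def by (intro continuous_intros continuous_on_compose2[OF C1_continuous(2)[OF u]]) auto
  have am [measurable]: "a \<in> borel_measurable borel" by (rule borel_measurable_continuous_onI[OF ca])
  have "((\<lambda>t. u (x + t *\<^sub>R z)) has_vector_derivative a t) (at t within {0..1})" for t
  proof -
    have d: "((\<lambda>t. x + t *\<^sub>R z) has_derivative (\<lambda>s. s *\<^sub>R z)) (at t within {0..1})"
      by (auto intro!: derivative_eq_intros)
    have "(u has_derivative (\<lambda>h. G (x + t *\<^sub>R z) \<bullet> h)) (at (x + t *\<^sub>R z))" using C1_at[OF u] by simp
    from has_derivative_compose[OF d this] show ?thesis
      by (simp add: has_vector_derivative_def a_def)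
  qed
  then have "(\<integral>t. indicator {0..1} t *\<^sub>R a t \<partial>lborel) = u (x + 1 *\<^sub>R z) - u (x + 0 *\<^sub>R z)"
    by (rule integral_FTC_atLeastAtMost[OF zero_le_one _ continuous_on_subset[OF ca subset_UNIV]])
  moreover have "(\<integral>t. a t \<partial>lebesgue_on {0..1}) = (\<integral>t. indicator {0..1} t *\<^sub>R a t \<partial>lborel)"
  proof -
    have m: "(\<lambda>t. indicat_real {0..1} t *\<^sub>R a t) \<in> borel_measurable lborel" by measurable
    have "(\<integral>t. a t \<partial>lebesgue_on {0..1}) = (\<integral>t. indicator {0..1} t *\<^sub>R a t \<partial>lebesgue)"
      by (rule integral_restrict_space) simp
    then show ?thesis unfolding integral_completion[OF m] .
  qed
  ultimately have I: "(\<integral>t. a t \<partial>lebesgue_on {0..1}) = u (x + z) - u x" by simp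
  have lm: "{0..1::real} \<in> lmeasurable" by simp
  obtain B where B: "\<And>t. t \<in> {0..1} \<Longrightarrow> norm (a t) \<le> B"
    using compact_imp_bounded[OF compact_continuous_image[OF continuous_on_subset[OF ca] compact_Icc]]
    by (force simp: bounded_iff)
  have a2: "a \<in> L2 {0..1}"
    by (rule L2_bounded(1)[OF lm borel_measurable_lebesgue_onI[OF am], of "max 0 B"]) (use B in \<open>auto simp: le_max_iff_disj\<close>)
  have "\<bar>u (x + z) - u x\<bar> \<le> (\<integral>t. norm (a t) \<partial>lebesgue_on {0..1})"
    using integral_norm_bound[of "lebesgue_on {0..1}" a] unfolding I by simp
  also have "\<dots> \<le> L2norm {0..1} a" using L2_integrable(2)[OF lm a2] by simp
  finally have "\<bar>u (x + z) - u x\<bar>\<^sup>2 \<le> (L2norm {0..1} a)\<^sup>2" by (intro power_mono) auto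
  then have "ennreal ((u (x + z) - u x)\<^sup>2) \<le> (\<integral>\<^sup>+t. ennreal ((norm (a t))\<^sup>2) \<partial>lebesgue_on {0..1})"
    unfolding L2_nn_integral[OF a2] by (simp add: ennreal_leI)
  also have "\<dots> = (\<integral>\<^sup>+t. ennreal ((norm (a t))\<^sup>2) * indicator {0..1} t \<partial>lborel)"
    by (simp add: nn_integral_restrict_space nn_integral_completion)
  also have "\<dots> \<le> (\<integral>\<^sup>+t. ennreal ((norm z)\<^sup>2) * (ennreal ((norm (G (x + t *\<^sub>R z)))\<^sup>2) * indicator {0..1} t) \<partial>lborel)"
  proof (rule nn_integral_mono)
    fix t
    have "(norm (a t))\<^sup>2 \<le> (norm z * norm (G (x + t *\<^sub>R z)))\<^sup>2"
      unfolding a_def using Cauchy_Schwarz_ineq2[of "G (x + t *\<^sub>R z)" z] by (intro power_mono) (auto simp: mult.commute)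
    then have "ennreal ((norm (a t))\<^sup>2) \<le> ennreal ((norm z)\<^sup>2) * ennreal ((norm (G (x + t *\<^sub>R z)))\<^sup>2)"
      by (simp add: power_mult_distrib ennreal_mult[symmetric] ennreal_leI)
    then show "ennreal ((norm (a t))\<^sup>2) * indicator {0..1} t
        \<le> ennreal ((norm z)\<^sup>2) * (ennreal ((norm (G (x + t *\<^sub>R z)))\<^sup>2) * indicator {0..1} t)"
      by (auto simp: indicator_def)
  qed
  also have "\<dots> = ennreal ((norm z)\<^sup>2) * (\<integral>\<^sup>+t. ennreal ((norm (G (x + t *\<^sub>R z)))\<^sup>2) * indicator {0..1} t \<partial>lborel)"
  proof (rule nn_integral_cmult)
    have c: "continuous_on UNIV (\<lambda>t. G (x + t *\<^sub>R z))"
      by (intro continuous_intros continuous_on_compose2[OF C1_continuous(2)[OF u]]) auto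
    have [measurable]: "(\<lambda>t. G (x + t *\<^sub>R z)) \<in> borel_measurable borel" by (rule borel_measurable_continuous_onI[OF c])
    show "(\<lambda>t. ennreal ((norm (G (x + t *\<^sub>R z)))\<^sup>2) * indicator {0..1} t) \<in> borel_measurable lborel" by measurable
  qed
  finally show ?thesis .
qed

text \<open>By periodicity the energy over the cell is unchanged when the point is translated by
  \<open>t *\<^sub>R z\<close>, so the integral over \<open>t\<close> contributes the factor
  1.\<close>

lemma PC1_increment_L2:
  assumes L: "L > 0" and u: "PC1 L u G"
  shows "(\<integral>\<^sup>+x. ennreal ((u (x + z) - u x)\<^sup>2) * indicator (cell L) x \<partial>lborel)
    \<le> ennreal ((norm z)\<^sup>2) * (\<integral>\<^sup>+x. ennreal ((norm (G x))\<^sup>2) * indicator (cell L) x \<partial>lborel)"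
proof -
  have C: "has_C1_gradient UNIV u G" using u by (simp add: PC1_def)
  have [measurable]: "G \<in> borel_measurable borel" by (rule borel_measurable_continuous_onI[OF C1_continuous(2)[OF C]])
  let ?g = "\<lambda>x. ennreal ((norm (G x))\<^sup>2)"
  have gp: "lperiodic L ?g" using PC1_gradient_periodic[OF u] by (simp add: lperiodic_def)
  let ?E = "\<integral>\<^sup>+x. ?g x * indicator (cell L) x \<partial>lborel"
  have "(\<integral>\<^sup>+x. ennreal ((u (x + z) - u x)\<^sup>2) * indicator (cell L) x \<partial>lborel)
      \<le> (\<integral>\<^sup>+x. (ennreal ((norm z)\<^sup>2) * (\<integral>\<^sup>+t. ?g (x + t *\<^sub>R z) * indicator {0..1} t \<partial>lborel)) * indicator (cell L) x \<partial>lborel)"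
    by (intro nn_integral_mono mult_right_mono C1_increment_sq_le[OF C]) auto
  also have "\<dots> = (\<integral>\<^sup>+x. (\<integral>\<^sup>+t. ennreal ((norm z)\<^sup>2) * (?g (x + t *\<^sub>R z) * indicator {0..1} t) * indicator (cell L) x \<partial>lborel) \<partial>lborel)"
    by (intro nn_integral_cong) (simp add: nn_integral_cmult nn_integral_multc)
  also have "\<dots> = (\<integral>\<^sup>+t. (\<integral>\<^sup>+x. ennreal ((norm z)\<^sup>2) * (?g (x + t *\<^sub>R z) * indicator {0..1} t) * indicator (cell L) x \<partial>lborel) \<partial>lborel)"
  proof -
    have "(\<lambda>(x, t). ennreal ((norm z)\<^sup>2) * (?g (x + t *\<^sub>R z) * indicator {0..1} t) * indicator (cell L) x)
        \<in> borel_measurable (lborel \<Otimes>\<^sub>M lborel)" by measurable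
    from lborel_pair.Fubini'[OF this] show ?thesis by simp
  qed
  also have "\<dots> = (\<integral>\<^sup>+t. (ennreal ((norm z)\<^sup>2) * ?E) * indicator {0..1::real} t \<partial>lborel)"
  proof (rule nn_integral_cong)
    fix t :: real
    have "(\<integral>\<^sup>+x. ennreal ((norm z)\<^sup>2) * (?g (x + t *\<^sub>R z) * indicator {0..1} t) * indicator (cell L) x \<partial>lborel)
        = (\<integral>\<^sup>+x. (ennreal ((norm z)\<^sup>2) * indicator {0..1} t) * (?g (x + t *\<^sub>R z) * indicator (cell L) x) \<partial>lborel)"
      by (simp add: ac_simps)
    also have "\<dots> = (ennreal ((norm z)\<^sup>2) * indicator {0..1} t) * (\<integral>\<^sup>+x. ?g (x + t *\<^sub>R z) * indicator (cell L) x \<partial>lborel)"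
      by (rule nn_integral_cmult) measurable
    also have "(\<integral>\<^sup>+x. ?g (x + t *\<^sub>R z) * indicator (cell L) x \<partial>lborel) = ?E"
      by (rule nn_integral_cell_translation[OF L _ gp]) measurable
    finally show "(\<integral>\<^sup>+x. ennreal ((norm z)\<^sup>2) * (?g (x + t *\<^sub>R z) * indicator {0..1} t) * indicator (cell L) x \<partial>lborel)
        = (ennreal ((norm z)\<^sup>2) * ?E) * indicator {0..1} t" by (simp add: ac_simps)
  qed
  also have "\<dots> = ennreal ((norm z)\<^sup>2) * ?E"
    by (subst nn_integral_cmult_indicator) auto
  finally show ?thesis .
qed

lemma norm_cell: 
  assumes "x \<in> cell L"
  shows "norm x \<le> 2 * L"
proof -
  have *: "\<bar>x $ i\<bar> \<le> L" for i
  proof -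
    have "- L \<le> x $ i" "x $ i < L" using assms by (auto simp: cell_def)
    then show ?thesis by linarith
  qed
  have "\<bar>x $ 1\<bar> + \<bar>x $ 2\<bar> \<le> 2 * L" using add_mono[OF *[of 1] *[of 2]] by simp
  then show ?thesis using norm_le_l1_cart[of x] by (simp add: sum_2)
qed

text \<open>\<open>c - mean L u\<close> is the mean of \<open>c - u\<close>, so this is
  Cauchy-Schwarz; the choice \<open>c = 0\<close> bounds the mean itself.\<close>

lemma mean_deviation_sq_le:
  assumes L: "L > 0" and u: "u \<in> L2 (Omega L)"
  shows "(c - mean L u)\<^sup>2 \<le> 1 / (2 * L)\<^sup>2 * (L2norm (Omega L) (\<lambda>y. c - u y))\<^sup>2"
proof -
  let ?V = "measure lebesgue (Omega L)"
  have V: "?V = (2 * L)\<^sup>2" by (rule measure_Omega[OF L])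
  have Vp: "?V > 0" using L V by simp
  have ui: "integrable (lebesgue_on (Omega L)) u" by (rule L2_integrable(1)[OF lmeasurable_Omega u])
  have ci: "integrable (lebesgue_on (Omega L)) (\<lambda>y. c)"
    by (rule L2_integrable(1)[OF lmeasurable_Omega L2_const(1)[OF lmeasurable_Omega]])
  have d2: "(\<lambda>y. c - u y) \<in> L2 (Omega L)" by (rule L2_diff[OF L2_const(1)[OF lmeasurable_Omega] u])
  have "(\<integral>y. c \<partial>lebesgue_on (Omega L)) = ?V * c"
    by (simp add: measure_restrict_space sets_Omega)
  then have "(\<integral>y. c - u y \<partial>lebesgue_on (Omega L)) = ?V * c - (\<integral>y. u y \<partial>lebesgue_on (Omega L))"
    using ui ci by simp
  also have "\<dots> = ?V * (c - mean L u)" using Vp by (simp add: mean_def field_simps)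
  finally have "\<bar>?V * (c - mean L u)\<bar> \<le> (\<integral>y. norm (c - u y) \<partial>lebesgue_on (Omega L))"
    using integral_norm_bound[of "lebesgue_on (Omega L)" "\<lambda>y. c - u y"] by simp
  also have "\<dots> \<le> sqrt ?V * L2norm (Omega L) (\<lambda>y. c - u y)" by (rule L2_integrable(2)[OF lmeasurable_Omega d2])
  finally have "\<bar>?V * (c - mean L u)\<bar>\<^sup>2 \<le> (sqrt ?V * L2norm (Omega L) (\<lambda>y. c - u y))\<^sup>2" by (intro power_mono) auto
  then have "?V * (?V * (c - mean L u)\<^sup>2) \<le> ?V * (L2norm (Omega L) (\<lambda>y. c - u y))\<^sup>2"
    using Vp by (simp add: power_mult_distrib power2_eq_square[of ?V] mult.assoc)
  then have "?V * (c - mean L u)\<^sup>2 \<le> (L2norm (Omega L) (\<lambda>y. c - u y))\<^sup>2" using Vp by simp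
  then show ?thesis using Vp unfolding V[symmetric] by (simp add: field_simps)
qed

text \<open>The deviation from the mean is at most the mean square of the increments
  \<open>u (x + z) - u x\<close> over \<open>z\<close> in the cell, and each of these is controlled
  in L^2 by \<open>norm z\<close> times the energy norm. Periodicity thus replaces a compactness
  argument and gives an explicit constant.\<close>

lemma Poincare_PC1:
  assumes L: "L > 0" and u: "PC1 L u G"
  shows "L2norm (Omega L) (\<lambda>x. u x - mean L u) \<le> 2 * L * L2norm (Omega L) G"
proof -
  have C: "has_C1_gradient UNIV u G" and up: "lperiodic L u" using u by (auto simp: PC1_def)
  have [measurable]: "u \<in> borel_measurable borel" by (rule borel_measurable_continuous_onI[OF C1_continuous(1)[OF C]])
  note u2 = PC1_L2[OF L u]
  let ?E = "ennreal ((L2norm (Omega L) G)\<^sup>2)"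
  let ?i = "indicator (cell L) :: real^2 \<Rightarrow> ennreal"
  have E: "(\<integral>\<^sup>+x. ennreal ((norm (G x))\<^sup>2) * ?i x \<partial>lborel) = ?E"
    unfolding nn_integral_cell_Omega by (rule L2_nn_integral[OF u2(2)])
  have pt: "ennreal ((u x - mean L u)\<^sup>2) \<le> ennreal (1 / (2 * L)\<^sup>2) * (\<integral>\<^sup>+z. ennreal ((u (x + z) - u x)\<^sup>2) * ?i z \<partial>lborel)" for x
  proof -
    have d2: "(\<lambda>y. u x - u y) \<in> L2 (Omega L)" by (rule L2_diff[OF L2_const(1)[OF lmeasurable_Omega] u2(1)])
    have "ennreal ((u x - mean L u)\<^sup>2) \<le> ennreal (1 / (2 * L)\<^sup>2 * (L2norm (Omega L) (\<lambda>y. u x - u y))\<^sup>2)"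
      by (rule ennreal_leI[OF mean_deviation_sq_le[OF L u2(1)]])
    also have "\<dots> = ennreal (1 / (2 * L)\<^sup>2) * ennreal ((L2norm (Omega L) (\<lambda>y. u x - u y))\<^sup>2)"
      by (rule ennreal_mult) auto
    also have "ennreal ((L2norm (Omega L) (\<lambda>y. u x - u y))\<^sup>2) = (\<integral>\<^sup>+y. ennreal ((u x - u y)\<^sup>2) * ?i y \<partial>lborel)"
      unfolding nn_integral_cell_Omega using L2_nn_integral[OF d2] by simp
    \<comment> \<open>Recentring the average at \<open>x\<close>: the cell may be translated because
      the integrand is periodic in \<open>y\<close>.\<close>
    also have "\<dots> = (\<integral>\<^sup>+z. ennreal ((u x - u (z + x))\<^sup>2) * ?i z \<partial>lborel)"
      by (rule nn_integral_cell_translation[OF L, symmetric]) (use up in \<open>auto simp: lperiodic_def\<close>)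
    finally show ?thesis by (simp add: power2_commute add.commute)
  qed
  have "(\<integral>\<^sup>+x. ennreal ((norm (u x - mean L u))\<^sup>2) \<partial>lebesgue_on (Omega L)) = (\<integral>\<^sup>+x. ennreal ((u x - mean L u)\<^sup>2) * ?i x \<partial>lborel)"
    unfolding nn_integral_cell_Omega by simp
  also have "\<dots> \<le> (\<integral>\<^sup>+x. (ennreal (1 / (2 * L)\<^sup>2) * (\<integral>\<^sup>+z. ennreal ((u (x + z) - u x)\<^sup>2) * ?i z \<partial>lborel)) * ?i x \<partial>lborel)"
    by (intro nn_integral_mono mult_right_mono pt) auto
  also have "\<dots> = (\<integral>\<^sup>+x. (\<integral>\<^sup>+z. ennreal (1 / (2 * L)\<^sup>2) * (ennreal ((u (x + z) - u x)\<^sup>2) * ?i z) * ?i x \<partial>lborel) \<partial>lborel)"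
    by (intro nn_integral_cong) (simp add: nn_integral_cmult nn_integral_multc)
  also have "\<dots> = (\<integral>\<^sup>+z. (\<integral>\<^sup>+x. ennreal (1 / (2 * L)\<^sup>2) * (ennreal ((u (x + z) - u x)\<^sup>2) * ?i z) * ?i x \<partial>lborel) \<partial>lborel)"
  proof -
    have "(\<lambda>(x, z). ennreal (1 / (2 * L)\<^sup>2) * (ennreal ((u (x + z) - u x)\<^sup>2) * ?i z) * ?i x) \<in> borel_measurable (lborel \<Otimes>\<^sub>M lborel)"
      by measurable
    from lborel_pair.Fubini'[OF this] show ?thesis by simp
  qed
  also have "\<dots> \<le> (\<integral>\<^sup>+z. ?E * ?i z \<partial>lborel)"
  proof (rule nn_integral_mono)
    fix z
    show "(\<integral>\<^sup>+x. ennreal (1 / (2 * L)\<^sup>2) * (ennreal ((u (x + z) - u x)\<^sup>2) * ?i z) * ?i x \<partial>lborel) \<le> ?E * ?i z"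
    proof (cases "z \<in> cell L")
      case True
      have "(\<integral>\<^sup>+x. ennreal (1 / (2 * L)\<^sup>2) * (ennreal ((u (x + z) - u x)\<^sup>2) * ?i z) * ?i x \<partial>lborel)
          = (\<integral>\<^sup>+x. ennreal (1 / (2 * L)\<^sup>2) * (ennreal ((u (x + z) - u x)\<^sup>2) * ?i x) \<partial>lborel)"
        using True by (simp add: mult.assoc)
      also have "\<dots> = ennreal (1 / (2 * L)\<^sup>2) * (\<integral>\<^sup>+x. ennreal ((u (x + z) - u x)\<^sup>2) * ?i x \<partial>lborel)"
        by (rule nn_integral_cmult) measurable
      also have "\<dots> \<le> ennreal (1 / (2 * L)\<^sup>2) * (ennreal ((norm z)\<^sup>2) * ?E)"
        by (intro mult_left_mono) (use PC1_increment_L2[OF L u, of z] E in auto)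
      also have "\<dots> = ennreal (1 / (2 * L)\<^sup>2 * (norm z)\<^sup>2) * ?E"
        by (subst ennreal_mult) (auto simp: mult.assoc)
      also have "\<dots> \<le> 1 * ?E"
      proof (rule mult_right_mono)
        \<comment> \<open>The bound \<open>2 * L\<close> on the increments cancels the normalisation
          of the mean; the area of the cell then leaves the constant \<open>2 * L\<close>.\<close>
        have "(norm z)\<^sup>2 \<le> (2 * L)\<^sup>2" using norm_cell[OF True] by (intro power_mono) auto
        then have "1 / (2 * L)\<^sup>2 * (norm z)\<^sup>2 \<le> 1" using L by (simp add: field_simps)
        then show "ennreal (1 / (2 * L)\<^sup>2 * (norm z)\<^sup>2) \<le> 1" by (metis ennreal_1 ennreal_leI)
      qed simp
      finally show ?thesis using True by simp
    qed simp
  qed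
  also have "\<dots> = ?E * emeasure lborel (cell L)" by (rule nn_integral_cmult_indicator) simp
  also have "emeasure lborel (cell L) = ennreal ((2 * L)\<^sup>2)"
  proof -
    have "emeasure lborel (cell L) = (\<integral>\<^sup>+x. 1 * ?i x \<partial>lborel)" by simp
    also have "\<dots> = emeasure (lebesgue_on (Omega L)) (Omega L)" unfolding nn_integral_cell_Omega by simp
    also have "\<dots> = ennreal (measure lebesgue (Omega L))"
      using lmeasurable_Omega by (simp add: emeasure_restrict_space sets_Omega emeasure_eq_measure2 fmeasurableD2)
    finally show ?thesis using measure_Omega[OF L] by simp
  qed
  also have "?E * ennreal ((2 * L)\<^sup>2) = ennreal ((2 * L * L2norm (Omega L) G)\<^sup>2)"
    by (simp add: power_mult_distrib ennreal_mult mult.commute)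
  finally have b: "(\<integral>\<^sup>+x. ennreal ((norm (u x - mean L u))\<^sup>2) \<partial>lebesgue_on (Omega L)) \<le> ennreal ((2 * L * L2norm (Omega L) G)\<^sup>2)" .
  show ?thesis
    by (rule L2_if_nn_integral(2)[OF _ b]) (use L L2D(1)[OF u2(1)] in auto)
qed

lemma mean_le:
  assumes L: "L > 0" and u: "u \<in> L2 (Omega L)"
  shows "\<bar>mean L u\<bar> \<le> L2norm (Omega L) u / (2 * L)"
proof -
  have "(mean L u)\<^sup>2 \<le> (L2norm (Omega L) u / (2 * L))\<^sup>2"
    using mean_deviation_sq_le[OF L u, of 0] by (simp add: L2norm_def power_divide)
  then have "\<bar>mean L u\<bar> \<le> \<bar>L2norm (Omega L) u / (2 * L)\<bar>" by (simp only: abs_le_square_iff)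
  then show ?thesis using L by simp
qed

lemma mean_diff:
  assumes "u \<in> L2 (Omega L)" "v \<in> L2 (Omega L)"
  shows "mean L (\<lambda>x. u x - v x) = mean L u - mean L v"
  using L2_integrable(1)[OF lmeasurable_Omega assms(1)] L2_integrable(1)[OF lmeasurable_Omega assms(2)]
  by (simp add: mean_def right_diff_distrib)

lemma L2norm_const_Omega:
  assumes "L > 0"
  shows "L2norm (Omega L) (\<lambda>x. c :: real) = 2 * L * \<bar>c\<bar>"
  using L2_const(2)[OF lmeasurable_Omega, of L c] assms unfolding measure_Omega[OF assms] real_sqrt_abs by simp

lemma Poincare_mean:
  assumes L: "L > 0" and vg: "per_limit L v g"
  shows "L2norm (Omega L) (\<lambda>x. v x - mean L v) \<le> 2 * L * L2norm (Omega L) g"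
proof (rule field_le_epsilon)
  fix e :: real assume "e > 0"
  have v2: "v \<in> L2 (Omega L)" and g2: "g \<in> L2 (Omega L)" using vg by (auto simp: per_limit_def)
  \<comment> \<open>Replacing \<open>v\<close>, its mean and \<open>g\<close> by their
    approximations costs \<open>(2 * L + 2) * d\<close> altogether.\<close>
  define d where "d = e / (2 * L + 2)"
  have "d > 0" using \<open>e > 0\<close> L by (simp add: d_def)
  then obtain u G where u: "PC1 L u G" "L2norm (Omega L) (\<lambda>x. v x - u x) < d" "L2norm (Omega L) (\<lambda>x. g x - G x) < d"
    using vg unfolding per_limit_def by blast
  note u2 = PC1_L2[OF L u(1)]
  have k: "(\<lambda>x. c :: real) \<in> L2 (Omega L)" for c by (rule L2_const(1)[OF lmeasurable_Omega])
  have "L2norm (Omega L) (\<lambda>x. mean L u - mean L v) \<le> L2norm (Omega L) (\<lambda>x. v x - u x)"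
    using mean_le[OF L L2_diff[OF v2 u2(1)]] L unfolding mean_diff[OF v2 u2(1)] L2norm_const_Omega[OF L]
    by (simp add: field_simps abs_minus_commute)
  then have m: "L2norm (Omega L) (\<lambda>x. mean L u - mean L v) < d" using u(2) by simp
  have "L2norm (Omega L) (\<lambda>x. v x - mean L v)
      = L2norm (Omega L) (\<lambda>x. (v x - u x) + ((u x - mean L u) + (mean L u - mean L v)))" by simp
  also have "\<dots> \<le> L2norm (Omega L) (\<lambda>x. v x - u x) + L2norm (Omega L) (\<lambda>x. (u x - mean L u) + (mean L u - mean L v))"
    by (rule L2norm_triangle) (intro L2_add L2_diff v2 u2 k)+
  also have "\<dots> \<le> L2norm (Omega L) (\<lambda>x. v x - u x) + (L2norm (Omega L) (\<lambda>x. u x - mean L u) + L2norm (Omega L) (\<lambda>x. mean L u - mean L v))"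
    by (intro add_left_mono L2norm_triangle L2_diff u2 k)
  also have "\<dots> \<le> d + (2 * L * L2norm (Omega L) G + d)"
    using u(2) m Poincare_PC1[OF L u(1)] by linarith
  also have "2 * L * L2norm (Omega L) G \<le> 2 * L * (d + L2norm (Omega L) g)"
    using L2norm_le_add[OF u2(2) g2] u(3) L2norm_diff_commute[of "Omega L" g G] L by (intro mult_left_mono) auto
  finally have "L2norm (Omega L) (\<lambda>x. v x - mean L v) \<le> 2 * L * L2norm (Omega L) g + (2 * L + 2) * d"
    by (simp add: algebra_simps)
  moreover have "(2 * L + 2) * d = e" using L by (simp add: d_def)
  ultimately show "L2norm (Omega L) (\<lambda>x. v x - mean L v) \<le> 2 * L * L2norm (Omega L) g + e" by simp
qed

text \<open>Where \<open>v\<close> vanishes its deviation from the mean is the mean itself, which is thereby controlled.\<close>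

lemma Poincare_vanishing:
  assumes L: "L > 0" and D: "D \<in> lmeasurable" "D \<subseteq> Omega L" "measure lebesgue D > 0"
  obtains C where "0 \<le> C" "\<And>v g. per_limit L v g \<Longrightarrow> (\<And>x. x \<in> D \<Longrightarrow> v x = 0) \<Longrightarrow>
    L2norm (Omega L) v \<le> C * L2norm (Omega L) g"
proof (rule that)
  define s where "s = sqrt (measure lebesgue D)"
  have s: "s > 0" using D(3) by (simp add: s_def)
  show "0 \<le> 2 * L + 2 * L * (2 * L / s)" using L s by simp
  fix v g assume vg: "per_limit L v g" and v0: "\<And>x. x \<in> D \<Longrightarrow> v x = 0"
  have v2: "v \<in> L2 (Omega L)" using vg by (simp add: per_limit_def)
  have k: "(\<lambda>x. c :: real) \<in> L2 (Omega L)" for c by (rule L2_const(1)[OF lmeasurable_Omega])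
  have d2: "(\<lambda>x. v x - mean L v) \<in> L2 (Omega L)" by (intro L2_diff v2 k)
  have "s * \<bar>mean L v\<bar> = L2norm D (\<lambda>x. - mean L v)" using L2_const(2)[OF D(1), of "- mean L v"] by (simp add: s_def)
  also have "\<dots> = L2norm D (\<lambda>x. v x - mean L v)" by (rule L2norm_cong) (simp add: v0)
  also have "\<dots> \<le> L2norm (Omega L) (\<lambda>x. v x - mean L v)"
    by (rule L2norm_subset[OF d2 D(2) sets_Omega(1) fmeasurableD[OF D(1)]])
  also have P: "\<dots> \<le> 2 * L * L2norm (Omega L) g" by (rule Poincare_mean[OF L vg])
  finally have m: "\<bar>mean L v\<bar> \<le> 2 * L / s * L2norm (Omega L) g" using s by (simp add: field_simps)
  have "L2norm (Omega L) v \<le> L2norm (Omega L) (\<lambda>x. v x - mean L v) + L2norm (Omega L) (\<lambda>x. mean L v)"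
    by (rule L2norm_le_add[OF v2 k])
  also have "\<dots> \<le> 2 * L * L2norm (Omega L) g + 2 * L * (2 * L / s * L2norm (Omega L) g)"
    unfolding L2norm_const_Omega[OF L] by (intro add_mono P mult_left_mono m) (use L in auto)
  finally show "L2norm (Omega L) v \<le> (2 * L + 2 * L * (2 * L / s)) * L2norm (Omega L) g"
    by (simp add: algebra_simps)
qed

subsection \<open>Thin annuli and the trace on the circle\<close>

definition rot :: "real \<Rightarrow> real^2 \<Rightarrow> real^2" where
  "rot t x = vector [cos t * x $ 1 - sin t * x $ 2, sin t * x $ 1 + cos t * x $ 2]"

lemma rot_nth [simp]: "rot t x $ 1 = cos t * x $ 1 - sin t * x $ 2" "rot t x $ 2 = sin t * x $ 1 + cos t * x $ 2"
  by (simp_all add: rot_def)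

lemma circle_point_nth [simp]: "circle_point r t $ 1 = r * cos t" "circle_point r t $ 2 = r * sin t"
  by (simp_all add: circle_point_def)

lemma inner_real2: "(x :: real^2) \<bullet> y = x $ 1 * y $ 1 + x $ 2 * y $ 2"
  by (simp add: inner_vec_def sum_2)

lemma inner_rot: "rot t x \<bullet> rot t y = x \<bullet> y"
proof -
  have "rot t x \<bullet> rot t y = ((cos t)\<^sup>2 + (sin t)\<^sup>2) * (x $ 1 * y $ 1) + ((cos t)\<^sup>2 + (sin t)\<^sup>2) * (x $ 2 * y $ 2)"
    unfolding inner_real2 rot_nth by algebra
  then show ?thesis by (simp add: inner_real2)
qed

lemma orthogonal_rot: "orthogonal_transformation (rot t)"
  unfolding orthogonal_transformation_def
  by (auto intro!: linearI simp: inner_rot vec_eq_iff forall_2 algebra_simps)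

lemma rot_rot: "rot s (rot t x) = rot (s + t) x"
  by (simp add: vec_eq_iff forall_2 cos_add sin_add algebra_simps)

lemma rot_0 [simp]: "rot 0 x = x"
  by (simp add: vec_eq_iff forall_2)

lemma rot_circle_point: "rot t (circle_point r s) = circle_point r (t + s)"
  by (simp add: vec_eq_iff forall_2 cos_add sin_add algebra_simps)

lemma continuous_vec2:
  fixes f :: "'a::topological_space \<Rightarrow> real^2"
  assumes "continuous_on A (\<lambda>x. f x $ 1)" "continuous_on A (\<lambda>x. f x $ 2)"
  shows "continuous_on A f"
proof -
  have "continuous_on A (\<lambda>x. \<chi> i. f x $ i)"
    by (rule continuous_on_vec_lambda) (use assms exhaust_2 in metis)
  then show ?thesis by simp
qed

lemma continuous_rot: "continuous_on UNIV (\<lambda>p. rot (fst p) (snd p))"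
  by (rule continuous_vec2) (auto intro!: continuous_intros)

lemma continuous_circle_point: "continuous_on A (circle_point r)"
  by (rule continuous_vec2) (auto intro!: continuous_intros)

lemma norm_circle_point: "norm (circle_point r t) = \<bar>r\<bar>"
proof -
  have "circle_point r t \<bullet> circle_point r t = r\<^sup>2 * ((cos t)\<^sup>2 + (sin t)\<^sup>2)"
    unfolding inner_real2 circle_point_nth by algebra
  then show ?thesis by (simp add: norm_eq_sqrt_inner)
qed

lemma polar_form:
  fixes x :: "real^2"
  assumes "x \<noteq> 0"
  obtains s where "0 \<le> s" "s < 2 * pi" "x = circle_point (norm x) s"
proof -
  have "(x $ 1 / norm x)\<^sup>2 + (x $ 2 / norm x)\<^sup>2 = (x \<bullet> x) / (norm x)\<^sup>2"
    by (simp add: power_divide inner_real2 power2_eq_square add_divide_distrib)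
  also have "\<dots> = 1" using assms by (simp add: power2_norm_eq_inner)
  finally have "(x $ 1 / norm x)\<^sup>2 + (x $ 2 / norm x)\<^sup>2 = 1" .
  then obtain s where "0 \<le> s" "s < 2 * pi" "x $ 1 / norm x = cos s" "x $ 2 / norm x = sin s"
    by (rule sincos_total_2pi)
  then have "x $ 1 = norm x * cos s" "x $ 2 = norm x * sin s"
    using assms by (auto simp: divide_eq_eq mult.commute)
  then have "x = circle_point (norm x) s" unfolding vec_eq_iff forall_2 circle_point_nth by blast
  with \<open>0 \<le> s\<close> \<open>s < 2 * pi\<close> show ?thesis by (rule that)
qed

lemma measurable_rot: "rot t \<in> borel_measurable borel"
  by (rule borel_measurable_continuous_onI, rule continuous_vec2) (auto intro!: continuous_intros)

lemma distr_rot: "distr lborel borel (rot t) = lborel"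
proof (rule lborel_eqI[symmetric])
  note m = measurable_rot
  fix l u :: "real^2" assume lu: "\<And>b. b \<in> Basis \<Longrightarrow> l \<bullet> b \<le> u \<bullet> b"
  have eq: "rot t -` box l u = rot (- t) ` box l u"
  proof
    show "rot t -` box l u \<subseteq> rot (- t) ` box l u"
    proof
      fix x assume "x \<in> rot t -` box l u"
      moreover have "x = rot (- t) (rot t x)" by (simp add: rot_rot)
      ultimately show "x \<in> rot (- t) ` box l u" by blast
    qed
    show "rot (- t) ` box l u \<subseteq> rot t -` box l u" by (auto simp: rot_rot)
  qed
  have lm: "rot (- t) ` box l u \<in> lmeasurable" "measure lebesgue (rot (- t) ` box l u) = measure lebesgue (box l u)"
    using measurable_orthogonal_image[OF orthogonal_rot] measure_orthogonal_image[OF orthogonal_rot] by auto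
  have b: "rot t -` box l u \<in> sets borel" using measurable_sets[OF m[of t], of "box l u"] by simp
  have "emeasure (distr lborel borel (rot t)) (box l u) = emeasure lborel (rot t -` box l u)"
    using m by (subst emeasure_distr) auto
  also have "\<dots> = emeasure lebesgue (rot t -` box l u)" using b by simp
  also have "\<dots> = ennreal (measure lebesgue (rot (- t) ` box l u))"
    unfolding eq by (rule emeasure_eq_measure2[OF lm(1)])
  also have "\<dots> = ennreal (measure lborel (box l u))" using lm(2) by simp
  also have "\<dots> = (\<Prod>b\<in>Basis. (u - l) \<bullet> b)"
    using lu by (simp add: measure_lborel_box)
  finally show "emeasure (distr lborel borel (rot t)) (box l u) = (\<Prod>b\<in>Basis. (u - l) \<bullet> b)" .
qed simp

lemma nn_integral_rot:
  assumes "a \<in> borel_measurable borel"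
  shows "(\<integral>\<^sup>+x. a (rot t x) \<partial>lborel) = (\<integral>\<^sup>+x. a x \<partial>lborel)"
proof -
  note m = measurable_rot[of t]
  have "(\<integral>\<^sup>+x. a x \<partial>lborel) = (\<integral>\<^sup>+x. a x \<partial>distr lborel borel (rot t))" by (simp only: distr_rot)
  also have "\<dots> = (\<integral>\<^sup>+x. a (rot t x) \<partial>lborel)" by (rule nn_integral_distr) (use m assms in auto)
  finally show ?thesis by simp
qed

lemma integral_periodic_shift:
  fixes h :: "real \<Rightarrow> real"
  assumes h: "continuous_on UNIV h" and per: "\<And>t. h (t + p) = h t" and s: "0 \<le> s" "s \<le> p"
  shows "integral {0..p} (\<lambda>t. h (t + s)) = integral {0..p} h"
proof -
  have io: "h integrable_on {a..b}" for a b
    by (rule integrable_continuous_real[OF continuous_on_subset[OF h]]) simp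
  have "integral {0..p} (\<lambda>t. h (t + s)) = integral {s..p + s} h"
    using integral_shift_real_ivl[of s s "p + s" h] by simp
  also have "\<dots> = integral {s..p} h + integral {p..p + s} h"
    by (rule Henstock_Kurzweil_Integration.integral_combine[symmetric]) (use s io in auto)
  also have "integral {p..p + s} h = integral {0..s} h"
    using integral_shift_real_ivl[of p p "p + s" h] per by simp
  also have "integral {s..p} h + integral {0..s} h = integral {0..p} h"
    using Henstock_Kurzweil_Integration.integral_combine[of 0 s p h] s io by simp
  finally show ?thesis .
qed

text \<open>Writing \<open>x\<close> in polar form turns rotation into a shift of the angle, to
  which an integral over a full period is insensitive.\<close>

lemma nn_integral_circle:
  fixes b :: "real^2 \<Rightarrow> real"
  assumes b: "\<And>r s. continuous_on UNIV (\<lambda>t. b (circle_point \<rho> t))" "\<And>x. 0 \<le> b x" and x: "x \<noteq> 0" "norm x = \<rho>"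
  shows "(\<integral>\<^sup>+t. ennreal (b (rot t x)) * indicator {0..2*pi} t \<partial>lborel) = ennreal (integral {0..2*pi} (\<lambda>t. b (circle_point \<rho> t)))"
proof -
  obtain s where s: "0 \<le> s" "s < 2 * pi" "x = circle_point \<rho> s" using polar_form[OF x(1)] x(2) by auto
  define h where "h t = b (circle_point \<rho> t)" for t
  have h: "continuous_on UNIV h" unfolding h_def by (rule b(1))
  have per: "h (t + 2 * pi) = h t" for t by (simp add: h_def circle_point_def)
  have hs: "continuous_on UNIV (\<lambda>t. h (t + s))"
    by (intro continuous_on_compose2[OF h] continuous_intros) auto
  have [measurable]: "(\<lambda>t. h (t + s)) \<in> borel_measurable borel" by (rule borel_measurable_continuous_onI[OF hs])
  have "((\<lambda>t. h (t + s)) has_integral integral {0..2*pi} (\<lambda>t. h (t + s))) {0..2*pi}"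
    by (intro integrable_integral integrable_continuous_real continuous_on_subset[OF hs]) simp
  then have I: "((\<lambda>t. indicator {0..2*pi} t *\<^sub>R h (t + s)) has_integral integral {0..2*pi} (\<lambda>t. h (t + s))) UNIV"
  proof -
    have eq: "(\<lambda>t. indicator {0..2*pi} t *\<^sub>R h (t + s)) = (\<lambda>t. if t \<in> {0..2*pi} then h (t + s) else 0)"
      by (auto simp: indicator_def)
    show ?thesis unfolding eq has_integral_restrict_UNIV by fact
  qed
  have "(\<integral>\<^sup>+t. ennreal (b (rot t x)) * indicator {0..2*pi} t \<partial>lborel) = (\<integral>\<^sup>+t. ennreal (indicator {0..2*pi} t *\<^sub>R h (t + s)) \<partial>lborel)"
    unfolding s(3) rot_circle_point h_def by (intro nn_integral_cong) (auto simp: indicator_def)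
  also have "\<dots> = ennreal (integral {0..2*pi} (\<lambda>t. h (t + s)))"
  proof (rule nn_integral_has_integral_lborel[OF _ _ I])
    show "(\<lambda>t. indicat_real {0..2*pi} t *\<^sub>R h (t + s)) \<in> borel_measurable borel" by measurable
    show "0 \<le> indicat_real {0..2*pi} t *\<^sub>R h (t + s)" for t using b(2) by (simp add: h_def)
  qed
  also have "integral {0..2*pi} (\<lambda>t. h (t + s)) = integral {0..2*pi} h"
    by (rule integral_periodic_shift[OF h per]) (use s in auto)
  finally show ?thesis by (simp add: h_def [abs_def])
qed

text \<open>Here \<delta> is the increment of the squared radius, so in the plane the area is
  proportional to \<delta> and independent of \<open>r\<close>.\<close>

definition annulus :: "real \<Rightarrow> real \<Rightarrow> (real^2) set" where
  "annulus r \<delta> = {x. r\<^sup>2 < x \<bullet> x \<and> x \<bullet> x < r\<^sup>2 + \<delta>}"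

lemma annulus_alt:
  assumes "0 \<le> r"
  shows "annulus r \<delta> = ball 0 (sqrt (r\<^sup>2 + \<delta>)) - cball 0 r"
proof -
  have "r\<^sup>2 < x \<bullet> x \<longleftrightarrow> r < norm x" for x :: "real^2"
    using assms by (simp add: power2_norm_eq_inner[symmetric] power_mono_iff not_le[symmetric])
  moreover have "x \<bullet> x < r\<^sup>2 + \<delta> \<longleftrightarrow> norm x < sqrt (r\<^sup>2 + \<delta>)" for x :: "real^2"
    by (simp add: norm_eq_sqrt_inner)
  ultimately show ?thesis by (auto simp: annulus_def)
qed

lemma open_annulus: "open (annulus r \<delta>)"
  unfolding annulus_def by (intro open_Collect_conj open_Collect_less continuous_intros)

lemma emeasure_annulus:
  assumes "0 \<le> r" "0 \<le> \<delta>"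
  shows "emeasure lborel (annulus r \<delta>) = ennreal (measure lborel (ball (0::real^2) 1) * \<delta>)"
proof -
  let ?R = "sqrt (r\<^sup>2 + \<delta>)"
  have R: "r \<le> ?R" using assms by (intro real_le_rsqrt) auto
  have sub: "annulus r \<delta> = ball 0 ?R - ball 0 r - sphere 0 r" using annulus_alt[OF assms(1)] by auto
  have "emeasure lborel (annulus r \<delta>) = emeasure lebesgue (annulus r \<delta>)" using open_annulus by simp
  also have "\<dots> = ennreal (measure lebesgue (annulus r \<delta>))"
    unfolding annulus_alt[OF assms(1)] by (intro emeasure_eq_measure2 fmeasurable.Diff) auto
  also have "measure lebesgue (annulus r \<delta>) = measure lebesgue (ball (0::real^2) ?R) - measure lebesgue (ball (0::real^2) r)"
  proof -
    have "measure lebesgue (annulus r \<delta>) = measure lebesgue (ball (0::real^2) ?R - ball 0 r)"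
      by (rule measure_negligible_symdiff)
        (auto simp: sub intro!: negligible_subset[OF negligible_sphere[of "0::real^2" r]])
    also have "\<dots> = measure lebesgue (ball (0::real^2) ?R) - measure lebesgue (ball (0::real^2) r)"
      by (rule measurable_measure_Diff) (use R in auto)
    finally show ?thesis .
  qed
  also have "\<dots> = measure lborel (ball (0::real^2) 1) * \<delta>"
    using content_ball_conv_unit_ball[of ?R "0::real^2"] content_ball_conv_unit_ball[of r "0::real^2"] assms
    by (simp add: algebra_simps) (simp add: power2_eq_square)
  finally show ?thesis .
qed

text \<open>Averaging over all rotations replaces polar coordinates.\<close>

lemma nn_integral_annulus_radial:
  fixes w :: "real^2 \<Rightarrow> real"
  assumes r: "0 < r" and \<delta>: "0 \<le> \<delta>" and w: "continuous_on (sphere 0 r) w"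
  shows "(\<integral>\<^sup>+x. ennreal \<bar>w ((r / norm x) *\<^sub>R x)\<bar> * indicator (annulus r \<delta>) x \<partial>lborel)
    = ennreal (measure lborel (ball (0::real^2) 1) * \<delta> * (integral {0..2*pi} (\<lambda>t. \<bar>w (circle_point r t)\<bar>) / (2 * pi)))"
proof -
  let ?A = "annulus r \<delta>"
  let ?V = "measure lborel (ball (0::real^2) 1)"
  define b where "b x = \<bar>w ((r / norm x) *\<^sub>R x)\<bar>" for x :: "real^2"
  define I where "I = integral {0..2*pi} (\<lambda>t. \<bar>w (circle_point r t)\<bar>)"
  have bc: "continuous_on (- {0}) b"
    unfolding b_def using r
    by (intro continuous_intros continuous_on_compose2[OF w]) (auto simp: abs_mult split: if_splits)
  define a where "a x = ennreal (indicator ?A x *\<^sub>R b x)" for x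
  have A0: "?A \<subseteq> - {0}" using r by (auto simp: annulus_def)
  have am[measurable]: "a \<in> borel_measurable borel"
  proof -
    have "(\<lambda>x. indicator ?A x *\<^sub>R b x) \<in> borel_measurable borel"
      by (rule borel_measurable_continuous_on_indicator) (use open_annulus continuous_on_subset[OF bc A0] in auto)
    then show ?thesis unfolding a_def by measurable
  qed
  have a_eq: "(\<integral>\<^sup>+x. ennreal \<bar>w ((r / norm x) *\<^sub>R x)\<bar> * indicator ?A x \<partial>lborel) = (\<integral>\<^sup>+x. a x \<partial>lborel)"
    unfolding a_def b_def by (intro nn_integral_cong) (auto simp: indicator_def)
  have [measurable]: "(\<lambda>p. rot (fst p) (snd p)) \<in> borel_measurable borel"
    by (rule borel_measurable_continuous_onI[OF continuous_rot])
  have I0: "0 \<le> I" unfolding I_def by (rule integral_nonneg)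
      (auto intro!: integrable_continuous_real continuous_intros continuous_on_compose2[OF w] continuous_circle_point
        simp: norm_circle_point less_imp_le[OF r])
  \<comment> \<open>Under all rotations the radial projection of \<open>x\<close> runs once through
    the whole circle, so the angular integral is the same number \<open>I\<close> at every point of
    the annulus.\<close>
  have inner: "(\<integral>\<^sup>+t. a (rot t x) * indicator {0..2*pi} t \<partial>lborel) = ennreal I * indicator ?A x" for x
  proof (cases "x \<in> ?A")
    case True
    then have x0: "x \<noteq> 0" using A0 by auto
    have rA: "rot t x \<in> ?A" for t using True by (simp add: annulus_def inner_rot)
    have cp: "b (circle_point (norm x) t) = \<bar>w (circle_point r t)\<bar>" for t
    proof -
      have "(r / norm x) *\<^sub>R circle_point (norm x) t = circle_point r t"
        unfolding vec_eq_iff forall_2 using x0 by simp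
      then show ?thesis by (simp add: b_def norm_circle_point)
    qed
    have "(\<integral>\<^sup>+t. a (rot t x) * indicator {0..2*pi} t \<partial>lborel) = (\<integral>\<^sup>+t. ennreal (b (rot t x)) * indicator {0..2*pi} t \<partial>lborel)"
      using rA by (simp add: a_def)
    also have "\<dots> = ennreal (integral {0..2*pi} (\<lambda>t. b (circle_point (norm x) t)))"
    proof (rule nn_integral_circle)
      show "continuous_on UNIV (\<lambda>t. b (circle_point (norm x) t))"
      proof (rule continuous_on_compose2[OF bc continuous_circle_point])
        have "circle_point (norm x) t \<noteq> 0" for t
          using norm_circle_point[of "norm x" t] x0 by auto
        then show "range (circle_point (norm x)) \<subseteq> - {0}" by auto
      qed
    qed (use x0 in \<open>auto simp: b_def\<close>)
    finally show ?thesis using True by (simp add: cp I_def)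
  next
    case False
    then have "rot t x \<notin> ?A" for t by (simp add: annulus_def inner_rot)
    then show ?thesis using False by (simp add: a_def)
  qed
  \<comment> \<open>By rotation invariance of the area, integrating over all angles multiplies by
    \<open>2 * pi\<close>; the exchanged integral is the angular one just computed.\<close>
  have "ennreal (2 * pi) * (\<integral>\<^sup>+x. a x \<partial>lborel) = (\<integral>\<^sup>+t. (\<integral>\<^sup>+x. a x \<partial>lborel) * indicator {0..2*pi} t \<partial>lborel)"
    by (subst nn_integral_cmult_indicator) (auto simp: mult.commute)
  also have "\<dots> = (\<integral>\<^sup>+t. (\<integral>\<^sup>+x. a (rot t x) * indicator {0..2*pi} t \<partial>lborel) \<partial>lborel)"
  proof (rule nn_integral_cong)
    fix t
    have "(\<integral>\<^sup>+x. a (rot t x) * indicator {0..2*pi} t \<partial>lborel) = (\<integral>\<^sup>+x. a (rot t x) \<partial>lborel) * indicator {0..2*pi} t"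
      by (rule nn_integral_multc) (use measurable_compose[OF measurable_rot am] in simp)
    then show "(\<integral>\<^sup>+x. a x \<partial>lborel) * indicator {0..2*pi} t = (\<integral>\<^sup>+x. a (rot t x) * indicator {0..2*pi} t \<partial>lborel)"
      by (simp add: nn_integral_rot[OF am])
  qed
  also have "\<dots> = (\<integral>\<^sup>+x. (\<integral>\<^sup>+t. a (rot t x) * indicator {0..2*pi} t \<partial>lborel) \<partial>lborel)"
  proof -
    have [measurable]: "(\<lambda>p. a (rot (fst p) (snd p))) \<in> borel_measurable (borel \<Otimes>\<^sub>M borel)"
      unfolding borel_prod by (rule measurable_compose[OF borel_measurable_continuous_onI[OF continuous_rot] am])
    have "(\<lambda>p. a (rot (fst p) (snd p)) * indicator {0..2*pi} (fst p)) \<in> borel_measurable (borel \<Otimes>\<^sub>M borel)"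
      by measurable
    then have "(\<lambda>(t, x). a (rot t x) * indicator {0..2*pi} t) \<in> borel_measurable (lborel \<Otimes>\<^sub>M lborel)"
      unfolding case_prod_beta' measurable_cong_sets[OF sets_pair_measure_cong[OF sets_lborel sets_lborel] refl] .
    from lborel_pair.Fubini'[OF this] show ?thesis by simp
  qed
  also have "\<dots> = ennreal I * ennreal (?V * \<delta>)"
    unfolding inner using open_annulus[of r \<delta>] emeasure_annulus[of r \<delta>] r \<delta>
    by (subst nn_integral_cmult_indicator) auto
  finally have eq: "ennreal (2 * pi) * (\<integral>\<^sup>+x. a x \<partial>lborel) = ennreal (I * (?V * \<delta>))"
    using I0 by (simp add: ennreal_mult')
  have "(\<integral>\<^sup>+x. a x \<partial>lborel) = ennreal (1 / (2 * pi)) * (ennreal (2 * pi) * (\<integral>\<^sup>+x. a x \<partial>lborel))"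
    by (simp add: mult.assoc[symmetric] ennreal_mult[symmetric])
  also have "\<dots> = ennreal (?V * \<delta> * (I / (2 * pi)))"
    unfolding eq using I0 \<delta> by (simp add: ennreal_mult[symmetric] ac_simps)
  finally show ?thesis unfolding a_eq I_def .
qed

text \<open>By uniform continuity \<open>w\<close> differs little from its value at the radial
  projection. To leading order the integral is therefore the area of the annulus times the mean of
  the absolute value on the circle.\<close>

lemma annulus_trace:
  fixes w :: "real^2 \<Rightarrow> real"
  assumes r: "0 < r" "r < R" and w: "continuous_on {x. r \<le> norm x \<and> norm x \<le> R} w" and e: "e > 0"
  obtains d where "d > 0" "\<And>\<delta>. 0 < \<delta> \<Longrightarrow> \<delta> < d \<Longrightarrow>
    (\<integral>\<^sup>+x. ennreal \<bar>w x\<bar> * indicator (annulus r \<delta>) x \<partial>lborel)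
      \<le> ennreal (measure lborel (ball (0::real^2) 1) * \<delta> * (integral {0..2*pi} (\<lambda>t. \<bar>w (circle_point r t)\<bar>) / (2 * pi) + e))"
proof -
  let ?V = "measure lborel (ball (0::real^2) 1)"
  define S where "S = {x::real^2. r \<le> norm x \<and> norm x \<le> R}"
  have "S = cball 0 R - ball 0 r" by (auto simp: S_def)
  then have "compact S" by (simp add: compact_diff)
  then have "uniformly_continuous_on S w" using w by (intro compact_uniformly_continuous) (simp_all add: S_def)
  then obtain k where k: "k > 0" "\<And>x y. x \<in> S \<Longrightarrow> y \<in> S \<Longrightarrow> dist y x < k \<Longrightarrow> dist (w y) (w x) < e"
    using e unfolding uniformly_continuous_on_def by metis
  \<comment> \<open>Keeps the annulus inside the closed shell and each of its points closer than
    \<open>k\<close> to its projection.\<close>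
  define m where "m = min R (r + k)"
  have m: "r < m" "m \<le> R" "m \<le> r + k" using r k(1) by (auto simp: m_def)
  define d where "d = m\<^sup>2 - r\<^sup>2"
  have "d > 0" using m r power_strict_mono[of r m 2] by (simp add: d_def)
  show ?thesis
  proof (rule that[OF \<open>d > 0\<close>])
    fix \<delta> :: real assume \<delta>: "0 < \<delta>" "\<delta> < d"
    let ?A = "annulus r \<delta>"
    define I where "I = integral {0..2*pi} (\<lambda>t. \<bar>w (circle_point r t)\<bar>)"
    have cs: "continuous_on (sphere 0 r) w" by (rule continuous_on_subset[OF w]) (use r in auto)
    have I0: "0 \<le> I" unfolding I_def by (rule integral_nonneg)
      (auto intro!: integrable_continuous_real continuous_intros continuous_on_compose2[OF cs] continuous_circle_point
        simp: norm_circle_point less_imp_le[OF r(1)])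
    have pt: "ennreal \<bar>w x\<bar> * indicator ?A x \<le> ennreal \<bar>w ((r / norm x) *\<^sub>R x)\<bar> * indicator ?A x + ennreal e * indicator ?A x" for x
    proof (cases "x \<in> ?A")
      case True
      have "r\<^sup>2 < (norm x)\<^sup>2" "(norm x)\<^sup>2 < m\<^sup>2"
        using True \<delta> by (auto simp: annulus_def power2_norm_eq_inner d_def)
      then have n: "r < norm x" "norm x < m"
        using r m by (auto intro: power2_less_imp_less)
      then have x: "x \<in> S" using m by (auto simp: S_def)
      have y: "(r / norm x) *\<^sub>R x \<in> S" using n r by (auto simp: S_def)
      have eq: "x - (r / norm x) *\<^sub>R x = (1 - r / norm x) *\<^sub>R x" by (simp add: scaleR_diff_left)
      have "norm x > 0" using n r by linarith
      then have "0 \<le> 1 - r / norm x" "norm x \<noteq> 0" using n by (auto simp: divide_le_eq)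
      then have "dist x ((r / norm x) *\<^sub>R x) = norm x - r"
        unfolding dist_norm eq norm_scaleR by (simp only: abs_of_nonneg left_diff_distrib) simp
      then have "dist (w x) (w ((r / norm x) *\<^sub>R x)) < e" using k(2)[OF y x] n m by simp
      then have "\<bar>w x\<bar> \<le> \<bar>w ((r / norm x) *\<^sub>R x)\<bar> + e" by (simp add: dist_real_def)
      then have "ennreal \<bar>w x\<bar> \<le> ennreal \<bar>w ((r / norm x) *\<^sub>R x)\<bar> + ennreal e"
        using e by (simp add: ennreal_plus[symmetric] ennreal_leI del: ennreal_plus)
      then show ?thesis using True by simp
    qed simp
    have mA: "(\<lambda>x. ennreal \<bar>w ((r / norm x) *\<^sub>R x)\<bar> * indicator ?A x) \<in> borel_measurable lborel"
    proof -
      have "continuous_on ?A (\<lambda>x. \<bar>w ((r / norm x) *\<^sub>R x)\<bar>)"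
        using r by (intro continuous_intros continuous_on_compose2[OF cs]) (auto simp: annulus_def abs_mult)
      then have "(\<lambda>x. indicator ?A x *\<^sub>R \<bar>w ((r / norm x) *\<^sub>R x)\<bar>) \<in> borel_measurable borel"
        by (rule borel_measurable_continuous_on_indicator[rotated]) (use open_annulus in auto)
      then have "(\<lambda>x. ennreal (indicator ?A x *\<^sub>R \<bar>w ((r / norm x) *\<^sub>R x)\<bar>)) \<in> borel_measurable lborel" by measurable
      moreover have "(\<lambda>x. ennreal (indicator ?A x *\<^sub>R \<bar>w ((r / norm x) *\<^sub>R x)\<bar>)) = (\<lambda>x. ennreal \<bar>w ((r / norm x) *\<^sub>R x)\<bar> * indicator ?A x)"
        by (auto simp: indicator_def fun_eq_iff)
      ultimately show ?thesis by (simp only:)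
    qed
    have Am: "?A \<in> sets lborel" using open_annulus by simp
    have "(\<integral>\<^sup>+x. ennreal \<bar>w x\<bar> * indicator ?A x \<partial>lborel)
        \<le> (\<integral>\<^sup>+x. ennreal \<bar>w ((r / norm x) *\<^sub>R x)\<bar> * indicator ?A x + ennreal e * indicator ?A x \<partial>lborel)"
      by (rule nn_integral_mono) (rule pt)
    also have "\<dots> = (\<integral>\<^sup>+x. ennreal \<bar>w ((r / norm x) *\<^sub>R x)\<bar> * indicator ?A x \<partial>lborel) + (\<integral>\<^sup>+x. ennreal e * indicator ?A x \<partial>lborel)"
      by (rule nn_integral_add[OF mA]) (use Am in simp)
    also have "\<dots> = ennreal (?V * \<delta> * (I / (2 * pi))) + ennreal e * ennreal (?V * \<delta>)"
      using nn_integral_annulus_radial[OF r(1) _ cs, of \<delta>] emeasure_annulus[of r \<delta>] \<delta> r Am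
      by (simp add: I_def nn_integral_cmult_indicator)
    also have "\<dots> = ennreal (?V * \<delta> * (I / (2 * pi) + e))"
      using I0 \<delta> e by (simp add: ennreal_mult[symmetric] ennreal_plus[symmetric] algebra_simps del: ennreal_plus)
    finally show "(\<integral>\<^sup>+x. ennreal \<bar>w x\<bar> * indicator ?A x \<partial>lborel) \<le> ennreal (?V * \<delta> * (integral {0..2*pi} (\<lambda>t. \<bar>w (circle_point r t)\<bar>) / (2 * pi) + e))"
      unfolding I_def .
  qed
qed

subsection \<open>Functions on the perforated square\<close>

text \<open>For \<open>0 < r < L\<close> the complement of the closed discs about all lattice
  points. In contrast to the hull used for \<open>PC1_hole\<close> it is open, so derivatives there
  are two-sided and gradients unique.\<close>

definition outside :: "real \<Rightarrow> real \<Rightarrow> (real^2) set" where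
  "outside L r = {x. r < norm (fold_cell L x)}"

definition PC1_hole :: "real \<Rightarrow> real \<Rightarrow> (real^2 \<Rightarrow> real) \<Rightarrow> (real^2 \<Rightarrow> real^2) \<Rightarrow> bool" where
  "PC1_hole L r w G \<longleftrightarrow> lperiodic L w \<and> has_C1_gradient (periodic_hull L (closure (Omega_hole L r))) w G"

section \<open>Geometry of the perforated square and its periodic copies\<close>

lemma open_hole: "open (Omega_hole L r)"
  unfolding Omega_hole_def disc_def by (intro open_Diff open_Omega closed_cball)

lemma lmeasurable_hole: "Omega_hole L r \<in> lmeasurable"
  unfolding Omega_hole_def disc_def by (intro fmeasurable.Diff lmeasurable_Omega lmeasurable_cball)

lemma sets_hole: "Omega_hole L r \<in> sets lebesgue"
  using lmeasurable_hole by (rule fmeasurableD)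

lemma hole_subset: "Omega_hole L r \<subseteq> Omega L"
  by (auto simp: Omega_hole_def)

text \<open>A point of the right-hand side is approached along its ray: inwards if it lies beyond
  the circle, which also leaves the sides of the square, and outwards if it lies on the
  circle.\<close>

lemma closure_hole:
  assumes r: "0 < r" "r < L"
  shows "closure (Omega_hole L r) = {x. (\<forall>i. \<bar>x $ i\<bar> \<le> L) \<and> r \<le> norm x}"
proof
  have "closed {x::real^2. (\<forall>i. \<bar>x $ i\<bar> \<le> L) \<and> r \<le> norm x}"
    by (intro closed_Collect_conj closed_Collect_all closed_Collect_le continuous_intros)
  moreover have "Omega_hole L r \<subseteq> {x. (\<forall>i. \<bar>x $ i\<bar> \<le> L) \<and> r \<le> norm x}"
    by (auto simp: Omega_hole_def Omega_def disc_def abs_le_iff minus_le_iff less_imp_le)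
  ultimately show "closure (Omega_hole L r) \<subseteq> {x. (\<forall>i. \<bar>x $ i\<bar> \<le> L) \<and> r \<le> norm x}"
    by (intro closure_minimal)
  show "{x. (\<forall>i. \<bar>x $ i\<bar> \<le> L) \<and> r \<le> norm x} \<subseteq> closure (Omega_hole L r)"
  proof
    fix x :: "real^2" assume "x \<in> {x. (\<forall>i. \<bar>x $ i\<bar> \<le> L) \<and> r \<le> norm x}"
    then have x: "\<And>i. \<bar>x $ i\<bar> \<le> L" "r \<le> norm x" by auto
    have n: "norm x > 0" using x r by linarith
    have mem: "c *\<^sub>R x \<in> Omega_hole L r" if "\<And>i. \<bar>c\<bar> * \<bar>x $ i\<bar> < L" "r < \<bar>c\<bar> * norm x" for c
    proof -
      have "\<bar>(c *\<^sub>R x) $ i\<bar> < L" for i using that(1)[of i] by (simp add: abs_mult)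
      then have "c *\<^sub>R x \<in> Omega L" unfolding Omega_def mem_Collect_eq abs_less_iff by (metis minus_less_iff)
      then show ?thesis using that(2) by (simp add: Omega_hole_def disc_def)
    qed
    show "x \<in> closure (Omega_hole L r)"
      unfolding closure_approachable
    proof (intro allI impI)
      fix e :: real assume "e > 0"
      show "\<exists>y\<in>Omega_hole L r. dist y x < e"
      proof (cases "r < norm x")
        case True
        \<comment> \<open>Shrinking by \<open>1 - t\<close> uses up at most half of the distance to
          the circle and moves the point by at most \<open>e / 2\<close>.\<close>
        define t where "t = min (1/2) (min ((norm x - r) / (2 * norm x)) (e / (2 * norm x)))"
        have t: "0 < t" "t \<le> 1/2" "t \<le> (norm x - r) / (2 * norm x)" "t \<le> e / (2 * norm x)"
          using True n \<open>e > 0\<close> by (auto simp: t_def)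
        have tn: "t * norm x \<le> (norm x - r) / 2" "t * norm x \<le> e / 2"
          using t(3,4) n by (auto simp: field_simps)
        have "(1 - t) *\<^sub>R x \<in> Omega_hole L r"
        proof (rule mem)
          have "(1 - t) * \<bar>x $ i\<bar> < L" for i
          proof (cases "x $ i = 0")
            case False
            then have "(1 - t) * \<bar>x $ i\<bar> < 1 * \<bar>x $ i\<bar>" using t by (intro mult_strict_right_mono) auto
            then show ?thesis using x(1)[of i] by simp
          qed (use r in simp)
          then show "\<bar>1 - t\<bar> * \<bar>x $ i\<bar> < L" for i using t by simp
          have "(1 - t) * norm x = norm x - t * norm x" by (simp add: algebra_simps)
          then have "r < (1 - t) * norm x" using tn True by argo
          then show "r < \<bar>1 - t\<bar> * norm x" using t by simp
        qed
        moreover have "dist ((1 - t) *\<^sub>R x) x < e"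
        proof -
          have "(1 - t) *\<^sub>R x - x = (- t) *\<^sub>R x" by (simp add: algebra_simps)
          then have "dist ((1 - t) *\<^sub>R x) x = t * norm x" unfolding dist_norm using t by simp
          then show ?thesis using tn \<open>e > 0\<close> by linarith
        qed
        ultimately show ?thesis by blast
      next
        case False
        then have nr: "norm x = r" using x by simp
        \<comment> \<open>Stretching by \<open>1 + t\<close> uses up at most half of the gap
          \<open>L - r\<close> and moves the point by at most \<open>e / 2\<close>.\<close>
        define t where "t = min ((L - r) / (2 * r)) (e / (2 * r))"
        have t: "0 < t" "t \<le> (L - r) / (2 * r)" "t \<le> e / (2 * r)"
          using r \<open>e > 0\<close> by (auto simp: t_def)
        have tn: "t * r \<le> (L - r) / 2" "t * r \<le> e / 2" using t(2,3) r by (auto simp: field_simps)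
        have "(1 + t) *\<^sub>R x \<in> Omega_hole L r"
        proof (rule mem)
          show "\<bar>1 + t\<bar> * \<bar>x $ i\<bar> < L" for i
          proof -
            have "(1 + t) * \<bar>x $ i\<bar> \<le> (1 + t) * r"
              using component_le_norm_cart[of x i] nr t by (intro mult_left_mono) auto
            also have "\<dots> = r + t * r" by (simp add: algebra_simps)
            also have "\<dots> < L" using tn r by argo
            finally show ?thesis using t by simp
          qed
          show "r < \<bar>1 + t\<bar> * norm x" using t r nr by (simp add: algebra_simps)
        qed
        moreover have "dist ((1 + t) *\<^sub>R x) x < e"
        proof -
          have "(1 + t) *\<^sub>R x - x = t *\<^sub>R x" by (simp add: algebra_simps)
          then have "dist ((1 + t) *\<^sub>R x) x = t * r" unfolding dist_norm using t nr by simp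
          then show ?thesis using tn \<open>e > 0\<close> by linarith
        qed
        ultimately show ?thesis by blast
      qed
    qed
  qed
qed

lemma compact_closure_hole: "compact (closure (Omega_hole L r))"
proof -
  have "bounded (Omega_hole L r)"
    by (rule bounded_subset[OF _ hole_subset]) (simp add: Omega_box bounded_box)
  then show ?thesis by (simp add: compact_closure)
qed

lemma closure_hole_hull: "closure (Omega_hole L r) \<subseteq> periodic_hull L (closure (Omega_hole L r))"
proof
  fix x assume "x \<in> closure (Omega_hole L r)"
  moreover have "x + (\<chi> i. 2 * L * of_int ((\<lambda>i. 0) i)) = x" by (simp add: vec_eq_iff)
  ultimately show "x \<in> periodic_hull L (closure (Omega_hole L r))"
    unfolding periodic_hull_def mem_Collect_eq by (intro exI[of _ "\<lambda>i. 0"]) simp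
qed

lemma cell_abs_le: "x \<in> cell L \<Longrightarrow> \<bar>x $ i\<bar> \<le> L"
  by (auto simp: cell_def abs_le_iff minus_le_iff less_imp_le)

lemma outside_subset_hull:
  assumes r: "0 < r" "r < L"
  shows "outside L r \<subseteq> periodic_hull L (closure (Omega_hole L r))"
proof
  fix x assume "x \<in> outside L r"
  then have "fold_cell L x \<in> closure (Omega_hole L r)"
    unfolding closure_hole[OF r] using cell_abs_le[OF fold_cell_in] r by (auto simp: outside_def)
  moreover have "fold_cell L x = x + (\<chi> i. 2 * L * of_int (- cell_index L x i))"
    by (simp add: fold_cell_def lat_def vec_eq_iff)
  ultimately show "x \<in> periodic_hull L (closure (Omega_hole L r))"
    unfolding periodic_hull_def mem_Collect_eq by (intro exI[of _ "\<lambda>i. - cell_index L x i"]) simp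
qed

lemma fold_cell_locally_affine:
  assumes L: "L > 0" and "fold_cell L x \<in> Omega L"
  obtains V where "open V" "x \<in> V" "\<And>y. y \<in> V \<Longrightarrow> fold_cell L y = y - lat L (cell_index L x)"
proof -
  define V where "V = {y. y - lat L (cell_index L x) \<in> Omega L}"
  have "open V" unfolding V_def
    using open_vimage[OF open_Omega, of "\<lambda>y. y - lat L (cell_index L x)"]
    by (simp add: vimage_def continuous_intros)
  moreover have "fold_cell L y = y - lat L (cell_index L x)" if "y \<in> V" for y
    using fold_cell_eqI[OF L] Omega_subset_cell that unfolding V_def by blast
  moreover have "x \<in> V" using assms(2) by (simp add: V_def fold_cell_def)
  ultimately show ?thesis using that by blast
qed

text \<open>Folding is locally a translation at points that fold into the open square; at the others
  a ball of radius \<open>L - r\<close> avoids all discs.\<close>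

lemma open_outside:
  assumes r: "0 < r" "r < L"
  shows "open (outside L r)"
proof (rule Topological_Spaces.openI)
  fix x assume x: "x \<in> outside L r"
  have L: "L > 0" using r by simp
  show "\<exists>T. open T \<and> x \<in> T \<and> T \<subseteq> outside L r"
  proof (cases "fold_cell L x \<in> Omega L")
    case True
    obtain V where V: "open V" "x \<in> V" "\<And>y. y \<in> V \<Longrightarrow> fold_cell L y = y - lat L (cell_index L x)"
      using fold_cell_locally_affine[OF L True] by blast
    have "open {y. r < norm (y - lat L (cell_index L x))}"
      by (intro open_Collect_less continuous_intros)
    then have "open (V \<inter> {y. r < norm (y - lat L (cell_index L x))})" using V by blast
    then show ?thesis
      using V x by (intro exI[of _ "V \<inter> {y. r < norm (y - lat L (cell_index L x))}"]) (auto simp: outside_def)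
  next
    case False
    then show ?thesis
      using fold_far_from_lattice[OF L False] r
      by (intro exI[of _ "ball x (L - r)"]) (auto simp: outside_def dist_commute)
  qed
qed

lemma fold_Omega: "L > 0 \<Longrightarrow> x \<in> Omega L \<Longrightarrow> fold_cell L x = x"
  using fold_cell_id Omega_subset_cell by blast

lemma outside_Omega: "L > 0 \<Longrightarrow> x \<in> Omega L \<Longrightarrow> x \<in> outside L r \<longleftrightarrow> x \<in> Omega_hole L r"
  by (auto simp: outside_def fold_Omega Omega_hole_def disc_def)

lemma outside_periodic: "L > 0 \<Longrightarrow> x + lat L k \<in> outside L r \<longleftrightarrow> x \<in> outside L r"
  by (simp add: outside_def fold_cell_add_lat)

lemma PC1_hole_outside:
  assumes r: "0 < r" "r < L" and w: "PC1_hole L r w G"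
  shows "has_C1_gradient (outside L r) w G"
  using C1_subset[OF _ outside_subset_hull[OF r]] w by (auto simp: PC1_hole_def)

text \<open>Restricted to \<open>outside\<close>, since uniqueness of the gradient is drawn from an
  open set.\<close>

lemma PC1_hole_gradient_periodic:
  assumes r: "0 < r" "r < L" and w: "PC1_hole L r w G" and x: "x \<in> outside L r"
  shows "G (x + lat L k) = G x"
proof -
  have L: "L > 0" using r by simp
  note c = PC1_hole_outside[OF r w]
  have s: "{y. y - - lat L k \<in> outside L r} = outside L r" using outside_periodic[OF L] by auto
  have "has_C1_gradient (outside L r) (\<lambda>y. w (y - - lat L k)) (\<lambda>y. G (y - - lat L k))"
    using C1_shift[OF c open_outside[OF r], of "- lat L k"] unfolding s .
  from C1_unique[OF this c open_outside[OF r] order.refl x] show ?thesis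
    using w by (simp add: PC1_hole_def lperiodic_def)
qed

text \<open>Extension by zero into all lattice copies of the disc at once, which preserves
  periodicity; on the open square it agrees with \<open>zero_ext\<close>.\<close>

definition extend :: "real \<Rightarrow> real \<Rightarrow> (real^2 \<Rightarrow> 'b::real_vector) \<Rightarrow> real^2 \<Rightarrow> 'b" where
  "extend L r u x = (if x \<in> outside L r then u x else 0)"

lemma PC1_hole_bounded:
  assumes r: "0 < r" "r < L" and w: "PC1_hole L r w G"
  obtains B where "0 < B" "\<And>x. \<bar>extend L r w x\<bar> \<le> B" "\<And>x. norm (extend L r G x) \<le> B"
proof -
  have L: "L > 0" using r by simp
  let ?C = "closure (Omega_hole L r)"
  have c: "continuous_on ?C w" "continuous_on ?C G"
    using C1_continuous[of "periodic_hull L ?C" w G] w continuous_on_subset[OF _ closure_hole_hull]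
    by (auto simp: PC1_hole_def)
  obtain B1 where B1: "B1 > 0" "\<And>x. x \<in> ?C \<Longrightarrow> norm (w x) \<le> B1"
    using compact_imp_bounded[OF compact_continuous_image[OF c(1) compact_closure_hole]] by (auto simp: bounded_pos)
  obtain B2 where B2: "B2 > 0" "\<And>x. x \<in> ?C \<Longrightarrow> norm (G x) \<le> B2"
    using compact_imp_bounded[OF compact_continuous_image[OF c(2) compact_closure_hole]] by (auto simp: bounded_pos)
  have f: "fold_cell L x \<in> ?C" "fold_cell L x \<in> outside L r" if "x \<in> outside L r" for x
    using that cell_abs_le[OF fold_cell_in[OF L]] r fold_cell_id[OF L fold_cell_in[OF L]]
    by (auto simp: closure_hole[OF r] outside_def)
  have wf: "w (fold_cell L x) = w x" for x using w by (simp add: PC1_hole_def lperiodic_fold)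
  have Gf: "G (fold_cell L x) = G x" if "x \<in> outside L r" for x
    using PC1_hole_gradient_periodic[OF r w f(2)[OF that], of "cell_index L x"] by (simp add: fold_cell_def)
  show ?thesis
  proof (rule that[of "max B1 B2"])
    show "0 < max B1 B2" using B1(1) by simp
    show "\<bar>extend L r w x\<bar> \<le> max B1 B2" for x
      using B1(1) B1(2)[OF f(1), of x] wf[of x] by (auto simp: extend_def)
    show "norm (extend L r G x) \<le> max B1 B2" for x
      using B2(1) B2(2)[OF f(1), of x] Gf[of x] by (auto simp: extend_def)
  qed
qed

lemma extend_borel:
  fixes u :: "real^2 \<Rightarrow> 'b::euclidean_space"
  assumes r: "0 < r" "r < L" and u: "continuous_on (outside L r) u"
  shows "extend L r u \<in> borel_measurable borel"
proof -
  have "(\<lambda>x. indicator (outside L r) x *\<^sub>R u x) \<in> borel_measurable borel"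
    by (rule borel_measurable_continuous_on_indicator) (use open_outside[OF r] u in auto)
  moreover have "(\<lambda>x. indicator (outside L r) x *\<^sub>R u x) = extend L r u"
    by (auto simp: extend_def indicator_def fun_eq_iff)
  ultimately show ?thesis by simp
qed

lemma PC1_hole_extend:
  assumes r: "0 < r" "r < L" and w: "PC1_hole L r w G"
  shows "extend L r w \<in> borel_measurable borel" "extend L r G \<in> borel_measurable borel"
    "lperiodic L (extend L r w)" "lperiodic L (extend L r G)"
    "extend L r w \<in> L2 (Omega L)" "extend L r G \<in> L2 (Omega L)"
proof -
  have L: "L > 0" using r by simp
  note c = C1_continuous[OF PC1_hole_outside[OF r w]]
  show m: "extend L r w \<in> borel_measurable borel" "extend L r G \<in> borel_measurable borel"
    by (rule extend_borel[OF r c(1)] extend_borel[OF r c(2)])+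
  show "lperiodic L (extend L r w)" "lperiodic L (extend L r G)"
    using w outside_periodic[OF L] PC1_hole_gradient_periodic[OF r w]
    by (auto simp: lperiodic_def extend_def PC1_hole_def)
  obtain B where B: "0 < B" "\<And>x. \<bar>extend L r w x\<bar> \<le> B" "\<And>x. norm (extend L r G x) \<le> B"
    using PC1_hole_bounded[OF r w] by blast
  show "extend L r w \<in> L2 (Omega L)"
    by (rule L2_bounded(1)[OF lmeasurable_Omega borel_measurable_lebesgue_onI[OF m(1)], of L B]) (use B in auto)
  show "extend L r G \<in> L2 (Omega L)"
    by (rule L2_bounded(1)[OF lmeasurable_Omega borel_measurable_lebesgue_onI[OF m(2)], of L B]) (use B in auto)
qed

text \<open>A radial cutoff that vanishes up to squared radius \<open>r\<^sup>2 + \<delta>/2\<close>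
  and equals 1 from \<open>r\<^sup>2 + \<delta>\<close> on. Using the squared radius makes it smooth
  at the origin and matches the parameter of \<open>annulus\<close>; the margin
  \<open>\<delta>/2\<close> makes it vanish near the closed disc.\<close>

definition eta :: "real \<Rightarrow> real \<Rightarrow> real^2 \<Rightarrow> real" where
  "eta r \<delta> x = step (2 / \<delta> * (x \<bullet> x - r\<^sup>2) - 1)"

definition eta' :: "real \<Rightarrow> real \<Rightarrow> real^2 \<Rightarrow> real^2" where
  "eta' r \<delta> x = step' (2 / \<delta> * (x \<bullet> x - r\<^sup>2) - 1) *\<^sub>R (4 / \<delta>) *\<^sub>R x"

lemma C1_eta:
  assumes "0 < \<delta>"
  shows "has_C1_gradient UNIV (eta r \<delta>) (eta' r \<delta>)"
proof -
  have "has_C1_gradient UNIV (\<lambda>x::real^2. 2 / \<delta> * (x \<bullet> x - r\<^sup>2) - 1) (\<lambda>x. (4 / \<delta>) *\<^sub>R x)"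
    unfolding has_C1_gradient_def using assms
    by (auto intro!: continuous_intros derivative_eq_intros simp: inner_commute)
  from C1_step[OF this] show ?thesis unfolding eta_def eta'_def .
qed

lemma eta_0:
  assumes "0 < \<delta>" "x \<bullet> x \<le> r\<^sup>2 + \<delta> / 2"
  shows "eta r \<delta> x = 0" "eta' r \<delta> x = 0"
proof -
  have "2 / \<delta> * (x \<bullet> x - r\<^sup>2) - 1 \<le> 0" using assms by (simp add: field_simps)
  then show "eta r \<delta> x = 0" "eta' r \<delta> x = 0" by (simp_all add: eta_def eta'_def step_simps)
qed

lemma eta_1:
  assumes "0 < \<delta>" "r\<^sup>2 + \<delta> \<le> x \<bullet> x"
  shows "eta r \<delta> x = 1" "eta' r \<delta> x = 0"
proof -
  have "1 \<le> 2 / \<delta> * (x \<bullet> x - r\<^sup>2) - 1" using assms by (simp add: field_simps)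
  then show "eta r \<delta> x = 1" "eta' r \<delta> x = 0" by (simp_all add: eta_def eta'_def step_simps)
qed

text \<open>The factors are 2 from \<open>step'\<close>, \<open>4 / \<delta>\<close> from the inner
  function and \<open>L\<close> from the radius. Over an annulus of area proportional to \<delta>
  the integral of this bound no longer depends on \<delta>.\<close>

lemma norm_eta':
  assumes "0 < \<delta>" "r\<^sup>2 + \<delta> \<le> L\<^sup>2" "0 < L"
  shows "norm (eta' r \<delta> x) \<le> 8 * L / \<delta> * indicat_real (annulus r \<delta>) x"
proof (cases "x \<in> annulus r \<delta>")
  case True
  then have "(norm x)\<^sup>2 \<le> L\<^sup>2" using assms by (simp add: annulus_def power2_norm_eq_inner)
  then have "norm x \<le> L" using assms by (simp add: power2_le_iff_abs_le)
  have "norm (eta' r \<delta> x) = \<bar>step' (2 / \<delta> * (x \<bullet> x - r\<^sup>2) - 1)\<bar> * (4 / \<delta> * norm x)"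
    using assms by (simp add: eta'_def abs_mult)
  also have "\<dots> \<le> 2 * (4 / \<delta> * L)"
    by (rule mult_mono[OF step'_bound]) (use assms \<open>norm x \<le> L\<close> in \<open>auto intro!: mult_left_mono divide_right_mono\<close>)
  finally show ?thesis using True by simp
next
  case False
  then have "x \<bullet> x \<le> r\<^sup>2 + \<delta> / 2 \<or> r\<^sup>2 + \<delta> \<le> x \<bullet> x" using assms by (auto simp: annulus_def)
  then have "eta' r \<delta> x = 0" using eta_0(2) eta_1(2) assms by blast
  then show ?thesis using False by simp
qed

lemma eta_range: "0 \<le> eta r \<delta> x" "eta r \<delta> x \<le> 1"
  by (simp_all add: eta_def step_range)

lemma PC1_eta:
  assumes L: "L > 0" and \<delta>: "0 < \<delta>" "r\<^sup>2 + \<delta> < L\<^sup>2"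
  shows "PC1 L (\<lambda>x. eta r \<delta> (fold_cell L x)) (\<lambda>x. eta' r \<delta> (fold_cell L x))"
proof (rule PC1_periodic_extension[OF L _ C1_eta[OF \<delta>(1)]])
  show "sqrt (r\<^sup>2 + \<delta>) < L" using \<delta> L by (intro real_less_lsqrt) (auto simp: add_nonneg_pos less_imp_le)
  fix x :: "real^2" assume "sqrt (r\<^sup>2 + \<delta>) < norm x"
  then have "r\<^sup>2 + \<delta> < (norm x)\<^sup>2" using \<delta>
    by (metis add_nonneg_nonneg less_imp_le norm_ge_zero real_sqrt_less_iff real_sqrt_pow2 real_sqrt_unique zero_le_power2)
  then show "eta r \<delta> x = 1" using \<delta> by (intro eta_1) (auto simp: power2_norm_eq_inner)
qed

text \<open>Since \<open>eta\<close> vanishes in a neighbourhood of the closed discs, the product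
  does not see the jump of the extension.\<close>

lemma C1_eta_extend:
  assumes r: "0 < r" "r < L" and w: "PC1_hole L r w G" and \<delta>: "0 < \<delta>" "r\<^sup>2 + \<delta> < L\<^sup>2"
  shows "has_C1_gradient UNIV (\<lambda>x. eta r \<delta> (fold_cell L x) * extend L r w x)
    (\<lambda>x. eta r \<delta> (fold_cell L x) *\<^sub>R extend L r G x + extend L r w x *\<^sub>R eta' r \<delta> (fold_cell L x))"
proof (rule C1_local)
  fix x
  have L: "L > 0" using r by simp
  let ?e = "\<lambda>x. eta r \<delta> (fold_cell L x)" and ?e' = "\<lambda>x. eta' r \<delta> (fold_cell L x)"
  have C: "has_C1_gradient UNIV ?e ?e'" using PC1_eta[OF L \<delta>] by (simp add: PC1_def)
  show "\<exists>F. open F \<and> x \<in> F \<and> has_C1_gradient F (\<lambda>x. ?e x * extend L r w x) (\<lambda>x. ?e x *\<^sub>R extend L r G x + extend L r w x *\<^sub>R ?e' x)"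
  proof (cases "x \<in> outside L r")
    case True
    have "has_C1_gradient (outside L r) (\<lambda>x. ?e x * extend L r w x) (\<lambda>x. ?e x *\<^sub>R extend L r G x + extend L r w x *\<^sub>R ?e' x)"
      by (rule C1_cong_open[OF C1_mult[OF C1_subset[OF C] PC1_hole_outside[OF r w]] open_outside[OF r]])
        (auto simp: extend_def)
    then show ?thesis using True open_outside[OF r] by blast
  next
    case False
    then have n: "norm (fold_cell L x) \<le> r" by (simp add: outside_def)
    have "\<bar>fold_cell L x $ i\<bar> < L" for i using component_le_norm_cart[of "fold_cell L x" i] n r by linarith
    then have "fold_cell L x \<in> Omega L" unfolding Omega_def mem_Collect_eq abs_less_iff by (metis minus_less_iff)
    then obtain V where V: "open V" "x \<in> V" "\<And>y. y \<in> V \<Longrightarrow> fold_cell L y = y - lat L (cell_index L x)"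
      using fold_cell_locally_affine[OF L] by blast
    define U where "U = V \<inter> {y. (y - lat L (cell_index L x)) \<bullet> (y - lat L (cell_index L x)) < r\<^sup>2 + \<delta> / 2}"
    have U: "open U" unfolding U_def by (intro open_Int V open_Collect_less continuous_intros)
    have "fold_cell L x \<bullet> fold_cell L x \<le> r\<^sup>2"
      using power_mono[OF n norm_ge_zero, of 2] by (simp add: power2_norm_eq_inner)
    then have "x \<in> U" using V(2) V(3)[OF V(2)] \<delta> by (simp add: U_def)
    moreover have "has_C1_gradient U (\<lambda>x. ?e x * extend L r w x) (\<lambda>x. ?e x *\<^sub>R extend L r G x + extend L r w x *\<^sub>R ?e' x)"
    proof (rule C1_cong_open[OF C1_const[of U 0] U])
      fix y assume "y \<in> U"
      then have "fold_cell L y \<bullet> fold_cell L y \<le> r\<^sup>2 + \<delta> / 2" using V(3) by (auto simp: U_def)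
      then show "0 = ?e y * extend L r w y" "0 = ?e y *\<^sub>R extend L r G y + extend L r w y *\<^sub>R ?e' y"
        using eta_0[OF \<delta>(1)] by auto
    qed
    ultimately show ?thesis using U by blast
  qed
qed

section \<open>The boundary term of the extension by zero\<close>

lemma circle_L2norm_eq:
  assumes "0 \<le> r"
  shows "circle_L2norm r g = sqrt r * L2norm {0..2*pi} (\<lambda>t. g (circle_point r t))"
  using assms by (simp add: circle_L2norm_def L2norm_def real_sqrt_mult[symmetric] mult.commute)

text \<open>Cauchy-Schwarz on the interval of angles; the factor \<open>1 / sqrt r\<close> undoes
  the weight of arc length.\<close>

lemma circle_integral_le:
  assumes r: "0 < r" and w: "continuous_on (sphere 0 r) w"
  shows "integral {0..2*pi} (\<lambda>t. \<bar>w (circle_point r t)\<bar>) \<le> sqrt (2 * pi) / sqrt r * circle_L2norm r w"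
    "(\<lambda>t. w (circle_point r t)) \<in> L2 {0..2*pi}"
proof -
  let ?a = "\<lambda>t. w (circle_point r t)"
  have c: "continuous_on UNIV ?a"
    by (rule continuous_on_compose2[OF w continuous_circle_point]) (use r in \<open>auto simp: norm_circle_point\<close>)
  have lm: "{0..2*pi} \<in> lmeasurable" by simp
  obtain B where B: "\<And>t. t \<in> {0..2*pi} \<Longrightarrow> norm (?a t) \<le> B"
    using compact_imp_bounded[OF compact_continuous_image[OF continuous_on_subset[OF c] compact_Icc]]
    by (force simp: bounded_iff)
  show a2: "?a \<in> L2 {0..2*pi}"
    by (rule L2_bounded(1)[OF lm borel_measurable_lebesgue_onI[OF borel_measurable_continuous_onI[OF c]], of "max 0 B"])
      (use B in \<open>auto simp: le_max_iff_disj\<close>)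
  have "integral {0..2*pi} (\<lambda>t. \<bar>?a t\<bar>) = (\<integral>t. norm (?a t) \<partial>lebesgue_on {0..2*pi})"
    using lebesgue_integral_eq_integral[OF integrable_norm[OF L2_integrable(1)[OF lm a2]]] by simp
  also have "\<dots> \<le> sqrt (2 * pi) * L2norm {0..2*pi} ?a" using L2_integrable(2)[OF lm a2] by simp
  also have "\<dots> = sqrt (2 * pi) / sqrt r * circle_L2norm r w" using r by (simp add: circle_L2norm_eq)
  finally show "integral {0..2*pi} (\<lambda>t. \<bar>?a t\<bar>) \<le> sqrt (2 * pi) / sqrt r * circle_L2norm r w" .
qed

lemma PC1_hole_continuous:
  assumes r: "0 < r" "r < L" and w: "PC1_hole L r w G"
  shows "continuous_on {x. r \<le> norm x \<and> norm x \<le> L} w" "continuous_on (sphere 0 r) w"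
proof -
  have "{x::real^2. r \<le> norm x \<and> norm x \<le> L} \<subseteq> closure (Omega_hole L r)"
    unfolding closure_hole[OF r] by (auto intro: order_trans[OF component_le_norm_cart])
  also note closure_hole_hull
  finally show *: "continuous_on {x. r \<le> norm x \<and> norm x \<le> L} w"
    using C1_continuous(1) continuous_on_subset w unfolding PC1_hole_def by blast
  show "continuous_on (sphere 0 r) w" by (rule continuous_on_subset[OF *]) (use r in auto)
qed

lemma borel_fold_cell:
  assumes "L > 0"
  shows "fold_cell L \<in> borel_measurable borel"
proof -
  have "(\<lambda>x::real^2. x $ i - 2 * L * of_int \<lfloor>(x $ i + L) / (2 * L)\<rfloor>) \<in> borel_measurable borel" for i
  proof -
    have [measurable]: "(\<lambda>x::real^2. x $ i) \<in> borel_measurable borel"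
      by (rule borel_measurable_continuous_onI) (intro continuous_intros)
    show ?thesis by measurable
  qed
  then have "(\<lambda>x. fold_cell L x $ i) \<in> borel_measurable borel" for i
    by (simp add: fold_cell_def lat_def cell_index_def)
  then show ?thesis
    by (subst borel_measurable_euclidean_space) (auto simp: Basis_vec_def inner_axis)
qed

text \<open>Measures how far the extension by zero is from satisfying integration by parts. The jump
  is removed by a cutoff, and as its annulus shrinks the additional term is bounded by the mean of
  \<bar>w\<bar> on the circle. The constant is uniform in \<open>w\<close>, so that the estimate
  applies along an approximating sequence.\<close>

lemma boundary_term_bound:
  assumes r: "0 < r" "r < L" and \<phi>: "has_C1_gradient UNIV \<phi> H" "compact K" "\<And>x. x \<notin> K \<Longrightarrow> \<phi> x = 0"
  obtains C where "0 \<le> C" "\<And>w G. PC1_hole L r w G \<Longrightarrow>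
    norm ((\<integral>x. extend L r w x *\<^sub>R H x \<partial>lebesgue_on K) + (\<integral>x. \<phi> x *\<^sub>R extend L r G x \<partial>lebesgue_on K))
      \<le> C * circle_L2norm r w"
proof -
  have L: "L > 0" using r by simp
  have Km: "K \<in> lmeasurable" by (rule lmeasurable_compact[OF \<phi>(2)])
  have Ks: "K \<in> sets lebesgue" by (rule fmeasurableD[OF Km])
  interpret K: finite_measure "lebesgue_on K" by (rule finite_measure_lebesgue_on[OF Km])
  have H0: "\<And>x. x \<notin> K \<Longrightarrow> H x = 0"
    by (rule C1_gradient_support[OF \<phi>(1) compact_imp_closed[OF \<phi>(2)] \<phi>(3)])
  obtain M where M: "0 \<le> M" "\<And>x. norm (\<phi> x) \<le> M"
    using continuous_compact_support_bounded[OF C1_continuous(1)[OF \<phi>(1)] \<phi>(2,3)] by blast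
  obtain M' where M': "0 \<le> M'" "\<And>x. norm (H x) \<le> M'"
    using continuous_compact_support_bounded[OF C1_continuous(2)[OF \<phi>(1)] \<phi>(2) H0] by blast
  obtain N where N: "\<And>h :: real^2 \<Rightarrow> ennreal. h \<in> borel_measurable borel \<Longrightarrow> lperiodic L h \<Longrightarrow>
    (\<integral>\<^sup>+x. h x * indicator K x \<partial>lborel) \<le> of_nat N * (\<integral>\<^sup>+x. h x * indicator (cell L) x \<partial>lborel)"
    using nn_integral_bounded_le_cell[OF L compact_imp_bounded[OF \<phi>(2)]] by blast
  let ?V = "measure lborel (ball (0::real^2) 1)"
  \<comment> \<open>The bound \<open>M\<close> of the test function, the number \<open>N\<close>
    from covering \<open>K\<close> by cells, and the product of the gradient bound
    \<open>8 * L / \<delta>\<close> with the annulus area \<open>?V * \<delta>\<close>, from which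
    \<delta> has cancelled.\<close>
  define C0 where "C0 = M * real N * (8 * L * ?V)"
  have C0: "0 \<le> C0" using M L by (simp add: C0_def)
  have bm: "\<phi> \<in> borel_measurable borel" "H \<in> borel_measurable borel"
    using C1_continuous[OF \<phi>(1)] by (auto intro: borel_measurable_continuous_onI)
  show ?thesis
  proof (rule that)
    show "0 \<le> C0 / (2 * pi) * (sqrt (2 * pi) / sqrt r)" using C0 r by simp
    fix w G assume w: "PC1_hole L r w G"
    let ?w = "extend L r w" and ?G = "extend L r G"
    note x = PC1_hole_extend[OF r w]
    note [measurable] = x(1,2) bm borel_fold_cell[OF L]
    have [measurable]: "K \<in> sets borel" "annulus r \<delta> \<in> sets borel" for \<delta>
      using compact_imp_closed[OF \<phi>(2)] open_annulus by auto
    obtain B where B: "0 < B" "\<And>x. \<bar>?w x\<bar> \<le> B" "\<And>x. norm (?G x) \<le> B"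
      using PC1_hole_bounded[OF r w] by blast
    define I where "I = integral {0..2*pi} (\<lambda>t. \<bar>w (circle_point r t)\<bar>)"
    have I0: "0 \<le> I" unfolding I_def by (rule integral_nonneg)
      (auto intro!: integrable_continuous_real continuous_intros continuous_on_compose2[OF PC1_hole_continuous(2)[OF r w]]
         continuous_circle_point simp: norm_circle_point less_imp_le[OF r(1)])
    define f where "f x = ?w x *\<^sub>R H x + \<phi> x *\<^sub>R ?G x" for x
    have fm[measurable]: "f \<in> borel_measurable borel" unfolding f_def by measurable
    have ib: "integrable (lebesgue_on K) h" if "h \<in> borel_measurable borel" "\<And>x. norm (h x) \<le> D" for h :: "real^2 \<Rightarrow> 'c::euclidean_space" and D
      by (rule K.integrable_const_bound[of _ D]) (use that borel_measurable_lebesgue_onI in auto)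
    have b1: "norm (?w x *\<^sub>R H x) \<le> B * M'" "norm (\<phi> x *\<^sub>R ?G x) \<le> M * B" for x
      using mult_mono[OF B(2)[of x] M'(2)[of x]] mult_mono[OF M(2)[of x] B(3)[of x]] B(1) M(1) by auto
    have fb: "norm (f x) \<le> B * M' + M * B" for x
      unfolding f_def using norm_triangle_ineq[of "?w x *\<^sub>R H x" "\<phi> x *\<^sub>R ?G x"] b1[of x] by linarith
    have X: "(\<integral>x. ?w x *\<^sub>R H x \<partial>lebesgue_on K) + (\<integral>x. \<phi> x *\<^sub>R ?G x \<partial>lebesgue_on K) = (\<integral>x. f x \<partial>lebesgue_on K)"
      unfolding f_def by (rule Bochner_Integration.integral_add[symmetric]; rule ib[OF _ b1(1)] ib[OF _ b1(2)]; measurable)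
    have "norm (\<integral>x. f x \<partial>lebesgue_on K) \<le> C0 * (I / (2 * pi)) + e" if "e > 0" for e
    proof -
      define e' where "e' = e / (C0 + 1)"
      have e': "e' > 0" "C0 * e' \<le> e" using that C0 by (auto simp: e'_def field_simps)
      obtain d where d: "d > 0" "\<And>\<delta>. 0 < \<delta> \<Longrightarrow> \<delta> < d \<Longrightarrow>
        (\<integral>\<^sup>+x. ennreal \<bar>w x\<bar> * indicator (annulus r \<delta>) x \<partial>lborel) \<le> ennreal (?V * \<delta> * (I / (2 * pi) + e'))"
        unfolding I_def using annulus_trace[OF r PC1_hole_continuous(1)[OF r w] e'(1)] by blast
      \<comment> \<open>Thin enough for the trace estimate and for the annulus to fit into the
        square.\<close>
      define d' where "d' = min d (L\<^sup>2 - r\<^sup>2)"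
      have "r\<^sup>2 < L\<^sup>2" using r by (intro power_strict_mono) auto
      then have "d' > 0" using d(1) by (simp add: d'_def)
      \<comment> \<open>The denominator is at least 2, so every value is strictly below
        \<open>d'\<close>; the annuli shrink to the circle.\<close>
      define \<delta> where "\<delta> n = d' / (real n + 2)" for n :: nat
      have \<delta>: "0 < \<delta> n" "\<delta> n < d" "r\<^sup>2 + \<delta> n < L\<^sup>2" for n
      proof -
        show "0 < \<delta> n" using \<open>d' > 0\<close> by (simp add: \<delta>_def)
        have "\<delta> n < d' / 1" unfolding \<delta>_def using \<open>d' > 0\<close> by (intro divide_strict_left_mono) auto
        then show "\<delta> n < d" "r\<^sup>2 + \<delta> n < L\<^sup>2" by (auto simp: d'_def)
      qed
      have \<delta>0: "\<delta> \<longlonglongrightarrow> 0" 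
      proof -
        have "(\<lambda>n. d' * inverse (real (n + 2))) \<longlonglongrightarrow> d' * 0"
          by (intro tendsto_mult tendsto_const LIMSEQ_ignore_initial_segment[OF lim_inverse_n])
        then show ?thesis by (simp add: \<delta>_def [abs_def] divide_inverse add.commute)
      qed
      define h where "h n x = eta r (\<delta> n) (fold_cell L x)" for n x
      define h' where "h' n x = eta' r (\<delta> n) (fold_cell L x)" for n x
      have hC: "has_C1_gradient UNIV (h n) (h' n)" for n
        using PC1_eta[OF L \<delta>(1,3)] unfolding PC1_def h_def [abs_def] h'_def [abs_def] by blast
      have hm[measurable]: "h n \<in> borel_measurable borel" "h' n \<in> borel_measurable borel" for n
        using C1_continuous[OF hC] by (auto intro: borel_measurable_continuous_onI)
      have h01: "0 \<le> h n x" "h n x \<le> 1" for n x by (simp_all add: h_def eta_range)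
      have h'b: "norm (h' n x) \<le> 8 * L / \<delta> n * indicat_real (annulus r (\<delta> n)) (fold_cell L x)" for n x
        unfolding h'_def by (rule norm_eta'[OF \<delta>(1) less_imp_le[OF \<delta>(3)] L])
      \<comment> \<open>At a point of \<open>outside\<close> the cutoff equals 1 from some index on;
        elsewhere \<open>f\<close> vanishes, because both of its summands contain an extension by
        zero.\<close>
      have lim: "(\<lambda>n. \<integral>x. h n x *\<^sub>R f x \<partial>lebesgue_on K) \<longlonglongrightarrow> (\<integral>x. f x \<partial>lebesgue_on K)"
      proof (rule integral_dominated_convergence)
        show "integrable (lebesgue_on K) (\<lambda>x. B * M' + M * B)" by simp
        show "f \<in> borel_measurable (lebesgue_on K)" by (rule borel_measurable_lebesgue_onI[OF fm])
        show "(\<lambda>x. h n x *\<^sub>R f x) \<in> borel_measurable (lebesgue_on K)" for n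
          by (rule borel_measurable_lebesgue_onI) measurable
        show "AE x in lebesgue_on K. norm (h n x *\<^sub>R f x) \<le> B * M' + M * B" for n
        proof (rule AE_I2)
          fix x
          have "\<bar>h n x\<bar> * norm (f x) \<le> 1 * norm (f x)" using h01[of n x] by (intro mult_right_mono) auto
          then show "norm (h n x *\<^sub>R f x) \<le> B * M' + M * B" using fb[of x] by simp
        qed
        show "AE x in lebesgue_on K. (\<lambda>n. h n x *\<^sub>R f x) \<longlonglongrightarrow> f x"
        proof (rule AE_I2)
          fix x
          show "(\<lambda>n. h n x *\<^sub>R f x) \<longlonglongrightarrow> f x"
          proof (cases "x \<in> outside L r")
            case True
            let ?y = "fold_cell L x"
            have "r\<^sup>2 < (norm ?y)\<^sup>2" using True r by (intro power_strict_mono) (auto simp: outside_def)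
            then have "?y \<bullet> ?y - r\<^sup>2 > 0" by (simp add: power2_norm_eq_inner)
            then have "\<forall>\<^sub>F n in sequentially. \<delta> n < ?y \<bullet> ?y - r\<^sup>2" by (rule order_tendstoD(2)[OF \<delta>0])
            then have "\<forall>\<^sub>F n in sequentially. h n x *\<^sub>R f x = f x"
            proof eventually_elim
              fix n assume "\<delta> n < ?y \<bullet> ?y - r\<^sup>2"
              then have "h n x = 1" unfolding h_def by (intro eta_1 \<delta>) simp
              then show "h n x *\<^sub>R f x = f x" by simp
            qed
            then show ?thesis by (rule tendsto_eventually)
          next
            case False
            then have "f x = 0" by (simp add: f_def extend_def)
            then show ?thesis by simp
          qed
        qed
      qed
      \<comment> \<open>The product with the cutoff satisfies integration by parts exactly. What
        remains is \<open>?k\<close>, the test function times \<open>w\<close> times the gradient of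
        the cutoff.\<close>
      have bound: "norm (\<integral>x. h n x *\<^sub>R f x \<partial>lebesgue_on K) \<le> C0 * (I / (2 * pi) + e')" for n
      proof -
        let ?k = "\<lambda>x. \<phi> x *\<^sub>R ?w x *\<^sub>R h' n x"
        have F: "has_C1_gradient UNIV (\<lambda>x. h n x * ?w x) (\<lambda>x. h n x *\<^sub>R ?G x + ?w x *\<^sub>R h' n x)"
          unfolding h_def h'_def by (rule C1_eta_extend[OF r w \<delta>(1,3)])
        have res: "(\<integral>x. g x \<partial>lebesgue_on UNIV) = (\<integral>x. g x \<partial>lebesgue_on K)" if "\<And>x. x \<notin> K \<Longrightarrow> g x = 0" for g :: "real^2 \<Rightarrow> real^2"
          using that Ks by (simp add: integral_restrict_space lebesgue_on_UNIV_eq)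
            (intro Bochner_Integration.integral_cong, auto simp: indicator_def)
        have kb: "norm (?k x) \<le> M * (B * (8 * L / \<delta> n))" for x
        proof -
          have "norm (h' n x) \<le> 8 * L / \<delta> n"
            using h'b[of n x] L \<delta>(1)[of n] by (auto simp: indicator_def split: if_splits intro: order_trans)
          then have wb: "\<bar>?w x\<bar> * norm (h' n x) \<le> B * (8 * L / \<delta> n)" using B by (intro mult_mono) auto
          have "\<bar>\<phi> x\<bar> * (\<bar>?w x\<bar> * norm (h' n x)) \<le> M * (B * (8 * L / \<delta> n))"
            by (rule mult_mono[OF _ wb M(1)]) (use M(2)[of x] in auto)
          then show ?thesis by (simp only: norm_scaleR)
        qed
        have hG: "norm (\<phi> x *\<^sub>R h n x *\<^sub>R ?G x) \<le> M * (1 * B)" for x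
          using M(2)[of x] h01[of n x] B(3)[of x] B(1) M(1) by (simp only: norm_scaleR) (intro mult_mono, auto)
        have hw: "norm ((h n x * ?w x) *\<^sub>R H x) \<le> (1 * B) * M'" for x
          using M'(2)[of x] h01[of n x] B(2)[of x] B(1) M'(1) by (simp only: norm_scaleR real_norm_def abs_mult) (intro mult_mono, auto)
        have ik: "integrable (lebesgue_on K) ?k" by (rule ib[OF _ kb]) measurable
        have iG: "integrable (lebesgue_on K) (\<lambda>x. \<phi> x *\<^sub>R h n x *\<^sub>R ?G x)" by (rule ib[OF _ hG]) measurable
        have iw: "integrable (lebesgue_on K) (\<lambda>x. (h n x * ?w x) *\<^sub>R H x)" by (rule ib[OF _ hw]) measurable
        have "(\<integral>x. (h n x * ?w x) *\<^sub>R H x \<partial>lebesgue_on K) = - (\<integral>x. \<phi> x *\<^sub>R (h n x *\<^sub>R ?G x + ?w x *\<^sub>R h' n x) \<partial>lebesgue_on K)"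
          using integration_by_parts_C1[OF open_UNIV F \<phi>(1,2) _ \<phi>(3)] res[of "\<lambda>x. (h n x * ?w x) *\<^sub>R H x"] H0
            res[of "\<lambda>x. \<phi> x *\<^sub>R (h n x *\<^sub>R ?G x + ?w x *\<^sub>R h' n x)"] \<phi>(3) by simp
        also have "\<dots> = - ((\<integral>x. \<phi> x *\<^sub>R h n x *\<^sub>R ?G x \<partial>lebesgue_on K) + (\<integral>x. ?k x \<partial>lebesgue_on K))"
          unfolding scaleR_add_right using Bochner_Integration.integral_add[OF iG ik] by simp
        finally have ibp: "(\<integral>x. (h n x * ?w x) *\<^sub>R H x \<partial>lebesgue_on K) = - ((\<integral>x. \<phi> x *\<^sub>R h n x *\<^sub>R ?G x \<partial>lebesgue_on K) + (\<integral>x. ?k x \<partial>lebesgue_on K))" .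
        have "A + B = - C" if "A = - (B + C)" for A B C :: "real^2" unfolding that by simp
        from this[OF ibp]
        have "(\<integral>x. (h n x * ?w x) *\<^sub>R H x \<partial>lebesgue_on K) + (\<integral>x. \<phi> x *\<^sub>R h n x *\<^sub>R ?G x \<partial>lebesgue_on K) = - (\<integral>x. ?k x \<partial>lebesgue_on K)" .
        moreover have "(\<integral>x. h n x *\<^sub>R f x \<partial>lebesgue_on K) = (\<integral>x. (h n x * ?w x) *\<^sub>R H x \<partial>lebesgue_on K) + (\<integral>x. \<phi> x *\<^sub>R h n x *\<^sub>R ?G x \<partial>lebesgue_on K)"
          unfolding Bochner_Integration.integral_add[OF iw iG, symmetric] f_def by (simp add: algebra_simps)
        ultimately have "norm (\<integral>x. h n x *\<^sub>R f x \<partial>lebesgue_on K) = norm (\<integral>x. ?k x \<partial>lebesgue_on K)" by simp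
        also have "\<dots> \<le> (\<integral>x. norm (?k x) \<partial>lebesgue_on K)" by (rule integral_norm_bound)
        finally have "ennreal (norm (\<integral>x. h n x *\<^sub>R f x \<partial>lebesgue_on K)) \<le> ennreal (\<integral>x. norm (?k x) \<partial>lebesgue_on K)"
          by (rule ennreal_leI)
        also have "\<dots> = (\<integral>\<^sup>+x. ennreal (norm (?k x)) \<partial>lebesgue_on K)"
          by (rule nn_integral_eq_integral[symmetric, OF integrable_norm[OF ik]]) simp
        also have "\<dots> = (\<integral>\<^sup>+x. ennreal (norm (?k x)) * indicator K x \<partial>lborel)"
          using Ks by (subst nn_integral_restrict_space) (auto simp: nn_integral_completion)
        also have "\<dots> \<le> (\<integral>\<^sup>+x. ennreal (M * (8 * L / \<delta> n)) * ((ennreal \<bar>?w x\<bar> * indicator (annulus r (\<delta> n)) (fold_cell L x)) * indicator K x) \<partial>lborel)"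
        proof (rule nn_integral_mono)
          fix x
          have "norm (?k x) \<le> M * (\<bar>?w x\<bar> * (8 * L / \<delta> n * indicat_real (annulus r (\<delta> n)) (fold_cell L x)))"
            unfolding norm_scaleR real_norm_def[symmetric] by (intro mult_mono M h'b order.refl mult_left_mono) (use M in auto)
          also have "\<dots> = (M * (8 * L / \<delta> n)) * (\<bar>?w x\<bar> * indicat_real (annulus r (\<delta> n)) (fold_cell L x))" by simp
          finally have "ennreal (norm (?k x)) \<le> ennreal ((M * (8 * L / \<delta> n)) * (\<bar>?w x\<bar> * indicat_real (annulus r (\<delta> n)) (fold_cell L x)))"
            by (rule ennreal_leI)
          also have "\<dots> = ennreal (M * (8 * L / \<delta> n)) * (ennreal \<bar>?w x\<bar> * indicator (annulus r (\<delta> n)) (fold_cell L x))"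
            using M L \<delta>(1)[of n] by (subst ennreal_mult) (auto simp: indicator_def)
          finally show "ennreal (norm (?k x)) * indicator K x
            \<le> ennreal (M * (8 * L / \<delta> n)) * ((ennreal \<bar>?w x\<bar> * indicator (annulus r (\<delta> n)) (fold_cell L x)) * indicator K x)"
            by (auto simp: indicator_def)
        qed
        also have "\<dots> = ennreal (M * (8 * L / \<delta> n)) * (\<integral>\<^sup>+x. (ennreal \<bar>?w x\<bar> * indicator (annulus r (\<delta> n)) (fold_cell L x)) * indicator K x \<partial>lborel)"
          by (rule nn_integral_cmult) measurable
        \<comment> \<open>Apart from \<open>indicator K\<close> the integrand is periodic, so
          \<open>K\<close> is exchanged for one cell, where folding is the identity and only the
          annulus about the origin remains.\<close>
        also have "\<dots> \<le> ennreal (M * (8 * L / \<delta> n)) * (of_nat N * (\<integral>\<^sup>+x. (ennreal \<bar>?w x\<bar> * indicator (annulus r (\<delta> n)) (fold_cell L x)) * indicator (cell L) x \<partial>lborel))"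
        proof (intro mult_left_mono N)
          show "(\<lambda>x. ennreal \<bar>?w x\<bar> * indicator (annulus r (\<delta> n)) (fold_cell L x)) \<in> borel_measurable borel"
            by measurable
          show "lperiodic L (\<lambda>x. ennreal \<bar>?w x\<bar> * indicator (annulus r (\<delta> n)) (fold_cell L x))"
            using x(3) fold_cell_add_lat[OF L] by (simp add: lperiodic_def)
        qed simp
        also have "(\<integral>\<^sup>+x. (ennreal \<bar>?w x\<bar> * indicator (annulus r (\<delta> n)) (fold_cell L x)) * indicator (cell L) x \<partial>lborel)
            \<le> (\<integral>\<^sup>+x. ennreal \<bar>w x\<bar> * indicator (annulus r (\<delta> n)) x \<partial>lborel)"
          by (rule nn_integral_mono) (auto simp: indicator_def extend_def fold_cell_id[OF L])
        also have "\<dots> \<le> ennreal (?V * \<delta> n * (I / (2 * pi) + e'))" by (rule d(2)[OF \<delta>(1,2)])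
        finally have "ennreal (norm (\<integral>x. h n x *\<^sub>R f x \<partial>lebesgue_on K))
          \<le> ennreal (M * (8 * L / \<delta> n)) * (of_nat N * ennreal (?V * \<delta> n * (I / (2 * pi) + e')))"
          by (simp add: mult_left_mono)
        also have "\<dots> = ennreal ((M * (8 * L / \<delta> n)) * (real N * (?V * \<delta> n * (I / (2 * pi) + e'))))"
        proof -
          have "ennreal a * (of_nat N * ennreal b) = ennreal (a * (real N * b))" if "0 \<le> a" "0 \<le> b" for a b
            using that by (simp add: ennreal_mult ennreal_of_nat_eq_real_of_nat)
          moreover have "0 \<le> M * (8 * L / \<delta> n)" "0 \<le> ?V * \<delta> n * (I / (2 * pi) + e')"
            using M(1) L \<delta>(1)[of n] I0 e'(1) by (auto intro!: mult_nonneg_nonneg divide_nonneg_nonneg add_nonneg_nonneg)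
          ultimately show ?thesis by blast
        qed
        also have "(M * (8 * L / \<delta> n)) * (real N * (?V * \<delta> n * (I / (2 * pi) + e'))) = C0 * (I / (2 * pi) + e')"
          using \<delta>(1)[of n] by (simp add: C0_def)
        finally show ?thesis using C0 I0 e' by (simp add: ennreal_le_iff)
      qed
      have "norm (\<integral>x. f x \<partial>lebesgue_on K) \<le> C0 * (I / (2 * pi) + e')"
        by (rule LIMSEQ_le_const2[OF tendsto_norm[OF lim]]) (use bound in auto)
      then show ?thesis using e'(2) by (simp add: distrib_left)
    qed
    then have "norm (\<integral>x. f x \<partial>lebesgue_on K) \<le> C0 * (I / (2 * pi))" by (rule field_le_epsilon)
    also have "\<dots> = C0 / (2 * pi) * I" by simp
    also have "\<dots> \<le> C0 / (2 * pi) * (sqrt (2 * pi) / sqrt r * circle_L2norm r w)"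
      unfolding I_def by (intro mult_left_mono circle_integral_le(1)[OF r(1) PC1_hole_continuous(2)[OF r w]]) (use C0 in simp)
    finally show "norm ((\<integral>x. ?w x *\<^sub>R H x \<partial>lebesgue_on K) + (\<integral>x. \<phi> x *\<^sub>R ?G x \<partial>lebesgue_on K))
      \<le> C0 / (2 * pi) * (sqrt (2 * pi) / sqrt r) * circle_L2norm r w"
      unfolding X by (simp add: mult.assoc)
  qed
qed

text \<open>The graph closure for the perforated square. Smallness on the circle expresses the zero
  trace, and one approximating function serves for the norm and for the trace together.\<close>

definition V0_limit :: "real \<Rightarrow> real \<Rightarrow> (real^2 \<Rightarrow> real) \<Rightarrow> (real^2 \<Rightarrow> real^2) \<Rightarrow> bool" where
  "V0_limit L r v g \<longleftrightarrow> v \<in> L2 (Omega_hole L r) \<and> g \<in> L2 (Omega_hole L r) \<and>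
     (\<forall>e>0. \<exists>w G. PC1_hole L r w G \<and> L2norm (Omega_hole L r) (\<lambda>x. v x - w x) < e \<and>
        L2norm (Omega_hole L r) (\<lambda>x. g x - G x) < e \<and> circle_L2norm r w < e)"

lemma extend_hole:
  fixes u v :: "real^2 \<Rightarrow> 'b::euclidean_space"
  assumes L: "L > 0"
  shows "u \<in> L2 (Omega_hole L r) \<Longrightarrow> extend L r u \<in> L2 (Omega L)"
    "L2norm (Omega L) (extend L r u) = L2norm (Omega_hole L r) u"
    "(\<integral>x. extend L r u x \<bullet> v x \<partial>lebesgue_on (Omega L)) = (\<integral>x. u x \<bullet> v x \<partial>lebesgue_on (Omega_hole L r))"
proof -
  have e: "indicator (Omega L) x *\<^sub>R f (extend L r u x) = indicator (Omega_hole L r) x *\<^sub>R f (u x)"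
    if "f 0 = 0" for f :: "'b \<Rightarrow> 'c::real_vector" and x
    using that outside_Omega[OF L, of x r] hole_subset[of L r] by (auto simp: indicator_def extend_def)
  show "L2norm (Omega L) (extend L r u) = L2norm (Omega_hole L r) u"
    unfolding L2norm_def using e[of "\<lambda>y. (norm y)\<^sup>2"]
    by (simp add: integral_restrict_space sets_Omega sets_hole)
  show "(\<integral>x. extend L r u x \<bullet> v x \<partial>lebesgue_on (Omega L)) = (\<integral>x. u x \<bullet> v x \<partial>lebesgue_on (Omega_hole L r))"
  proof -
    have "indicator (Omega L) x *\<^sub>R (extend L r u x \<bullet> v x) = indicator (Omega_hole L r) x *\<^sub>R (u x \<bullet> v x)" for x
      using e[of "\<lambda>y. y \<bullet> v x" x] by simp
    then show ?thesis by (simp add: integral_restrict_space sets_Omega sets_hole)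
  qed
  assume u: "u \<in> L2 (Omega_hole L r)"
  have "extend L r u \<in> borel_measurable (lebesgue_on (Omega L))"
    using L2D(1)[OF u] e[of "\<lambda>y. y"] by (simp add: borel_measurable_restrict_space_iff sets_Omega sets_hole)
  moreover have "integrable (lebesgue_on (Omega L)) (\<lambda>x. (norm (extend L r u x))\<^sup>2)"
    using L2D(2)[OF u] e[of "\<lambda>y. (norm y)\<^sup>2"] by (simp add: integrable_restrict_space sets_Omega sets_hole)
  ultimately show "extend L r u \<in> L2 (Omega L)" by (simp add: L2_def)
qed

lemma extend_diff: "extend L r (\<lambda>x. u x - v x) x = extend L r u x - extend L r v x"
  by (simp add: extend_def)

text \<open>The extended approximations violate integration by parts by at most a constant times
  their norm on the circle. This tends to 0, so the asymptotic criterion for \<open>H1_per\<close>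
  applies.\<close>

lemma V0_limit_extend:
  assumes r: "0 < r" "r < L" and vg: "V0_limit L r v g"
  shows "extend L r v \<in> H1_per L" "has_weak_gradient (Omega L) (extend L r v) (extend L r g)"
proof -
  have L: "L > 0" using r by simp
  have v2: "v \<in> L2 (Omega_hole L r)" and g2: "g \<in> L2 (Omega_hole L r)" using vg by (auto simp: V0_limit_def)
  have "\<forall>n::nat. \<exists>w G. PC1_hole L r w G \<and> L2norm (Omega_hole L r) (\<lambda>x. v x - w x) < inverse (real (Suc n)) \<and>
        L2norm (Omega_hole L r) (\<lambda>x. g x - G x) < inverse (real (Suc n)) \<and> circle_L2norm r w < inverse (real (Suc n))"
    using vg unfolding V0_limit_def by simp
  then obtain w G where w: "\<And>n. PC1_hole L r (w n) (G n)"
    "\<And>n. L2norm (Omega_hole L r) (\<lambda>x. v x - w n x) < inverse (real (Suc n))"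
    "\<And>n. L2norm (Omega_hole L r) (\<lambda>x. g x - G n x) < inverse (real (Suc n))"
    "\<And>n. circle_L2norm r (w n) < inverse (real (Suc n))"
    by (simp only: choice_iff) blast
  have lim: "a \<longlonglongrightarrow> 0" if "\<And>n. 0 \<le> a n" "\<And>n. a n < inverse (real (Suc n))" for a :: "nat \<Rightarrow> real"
    by (rule Lim_null_comparison[OF _ LIMSEQ_inverse_real_of_nat])
      (use that in \<open>auto intro!: always_eventually less_imp_le simp del: of_nat_Suc\<close>)
  note x = PC1_hole_extend[OF r w(1)]
  have pv: "(\<lambda>n. L2norm (Omega L) (\<lambda>x. extend L r (w n) x - extend L r v x)) \<longlonglongrightarrow> 0"
  proof (rule lim[OF L2norm_nonneg])
    fix n
    have "L2norm (Omega L) (\<lambda>x. extend L r (w n) x - extend L r v x) = L2norm (Omega_hole L r) (\<lambda>x. w n x - v x)"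
      unfolding extend_diff[symmetric] extend_hole(2)[OF L] ..
    then show "L2norm (Omega L) (\<lambda>x. extend L r (w n) x - extend L r v x) < inverse (real (Suc n))"
      using w(2)[of n] L2norm_diff_commute[of "Omega_hole L r" v "w n"] by simp
  qed
  have qg: "(\<lambda>n. L2norm (Omega L) (\<lambda>x. extend L r (G n) x - extend L r g x)) \<longlonglongrightarrow> 0"
  proof (rule lim[OF L2norm_nonneg])
    fix n
    have "L2norm (Omega L) (\<lambda>x. extend L r (G n) x - extend L r g x) = L2norm (Omega_hole L r) (\<lambda>x. G n x - g x)"
      unfolding extend_diff[symmetric] extend_hole(2)[OF L] ..
    then show "L2norm (Omega L) (\<lambda>x. extend L r (G n) x - extend L r g x) < inverse (real (Suc n))"
      using w(3)[of n] L2norm_diff_commute[of "Omega_hole L r" g "G n"] by simp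
  qed
  have id: "(\<lambda>n. (\<integral>x. extend L r (w n) x *\<^sub>R H x \<partial>lebesgue_on K) + (\<integral>x. \<phi> x *\<^sub>R extend L r (G n) x \<partial>lebesgue_on K)) \<longlonglongrightarrow> 0"
    if \<phi>: "has_C1_gradient UNIV \<phi> H" "compact K" "\<And>x. x \<notin> K \<Longrightarrow> \<phi> x = 0" for \<phi> H K
  proof -
    obtain C where C: "0 \<le> C" "\<And>w G. PC1_hole L r w G \<Longrightarrow>
      norm ((\<integral>x. extend L r w x *\<^sub>R H x \<partial>lebesgue_on K) + (\<integral>x. \<phi> x *\<^sub>R extend L r G x \<partial>lebesgue_on K)) \<le> C * circle_L2norm r w"
      using boundary_term_bound[OF r \<phi>] by blast
    show ?thesis
    proof (rule Lim_null_comparison)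
      show "\<forall>\<^sub>F n in sequentially. norm ((\<integral>x. extend L r (w n) x *\<^sub>R H x \<partial>lebesgue_on K) + (\<integral>x. \<phi> x *\<^sub>R extend L r (G n) x \<partial>lebesgue_on K))
        \<le> C * inverse (real (Suc n))"
        by (intro always_eventually allI order_trans[OF C(2)[OF w(1)]] mult_left_mono less_imp_le[OF w(4)] C(1))
      show "(\<lambda>n. C * inverse (real (Suc n))) \<longlonglongrightarrow> 0"
        by (rule tendsto_mult_right_zero[OF LIMSEQ_inverse_real_of_nat])
    qed
  qed
  show "extend L r v \<in> H1_per L" "has_weak_gradient (Omega L) (extend L r v) (extend L r g)"
    by (rule H1_per_limit[OF L extend_hole(1)[OF L v2] extend_hole(1)[OF L g2] x(1) x(3) x(5) x(2) x(4) x(6) pv qg id]; assumption)+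
qed

lemma has_weak_gradient_cong:
  assumes "has_weak_gradient U u g" "\<And>x. x \<in> U \<Longrightarrow> u x = v x" "\<And>x. x \<in> U \<Longrightarrow> g x = h x"
  shows "has_weak_gradient U v h"
proof (rule has_weak_gradientI)
  fix K assume K: "compact K" "K \<subseteq> U"
  show "v absolutely_integrable_on K"
    using has_weak_gradientD(1)[OF assms(1) K] by (rule absolutely_integrable_spike[OF _ negligible_empty]) (use assms(2) K(2) in auto)
  show "h absolutely_integrable_on K"
    using has_weak_gradientD(2)[OF assms(1) K] by (rule absolutely_integrable_spike[OF _ negligible_empty]) (use assms(3) K(2) in auto)
next
  fix \<phi> G K assume \<phi>: "has_C1_gradient UNIV \<phi> G" "compact K" "K \<subseteq> U" "\<And>x. x \<notin> K \<Longrightarrow> \<phi> x = 0"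
  have "(\<integral>x. v x *\<^sub>R G x \<partial>lebesgue_on U) = (\<integral>x. u x *\<^sub>R G x \<partial>lebesgue_on U)"
    by (intro Bochner_Integration.integral_cong) (use assms(2) in auto)
  moreover have "(\<integral>x. \<phi> x *\<^sub>R h x \<partial>lebesgue_on U) = (\<integral>x. \<phi> x *\<^sub>R g x \<partial>lebesgue_on U)"
    by (intro Bochner_Integration.integral_cong) (use assms(3) in auto)
  ultimately show "(\<integral>x. v x *\<^sub>R G x \<partial>lebesgue_on U) = - (\<integral>x. \<phi> x *\<^sub>R h x \<partial>lebesgue_on U)"
    using has_weak_gradientD(3)[OF assms(1) \<phi>] by simp
qed

text \<open>Obtained by restriction: on the perforated square the extension coincides with
  \<open>v\<close>, and its gradient with \<open>g\<close>.\<close>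

lemma V0_limit_weak_gradient:
  assumes r: "0 < r" "r < L" and vg: "V0_limit L r v g"
  shows "has_weak_gradient (Omega_hole L r) v g"
proof -
  have L: "L > 0" using r by simp
  have "has_weak_gradient (Omega_hole L r) (extend L r v) (extend L r g)"
    by (rule has_weak_gradient_subset[OF V0_limit_extend(2)[OF r vg] open_Omega open_hole hole_subset])
  then show ?thesis
    by (rule has_weak_gradient_cong) (use outside_Omega[OF L] hole_subset[of L r] in \<open>auto simp: extend_def\<close>)
qed

lemma hole_subset_hull: "Omega_hole L r \<subseteq> periodic_hull L (closure (Omega_hole L r))"
  using closure_subset closure_hole_hull by (rule order_trans)

lemma PC1_hole_weak_gradient:
  assumes "PC1_hole L r w G"
  shows "has_weak_gradient (Omega_hole L r) w G"
  using C1_has_weak_gradient[OF open_hole C1_subset[OF _ hole_subset_hull]] assms by (auto simp: PC1_hole_def)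

lemma PC1_hole_L2:
  assumes r: "0 < r" "r < L" and w: "PC1_hole L r w G"
  shows "w \<in> L2 (Omega_hole L r)" "G \<in> L2 (Omega_hole L r)"
proof -
  have L: "L > 0" using r by simp
  have e: "extend L r u x = u x" if "x \<in> Omega_hole L r" for x and u :: "real^2 \<Rightarrow> 'b::real_vector"
    using that outside_Omega[OF L, of x r] hole_subset[of L r] by (auto simp: extend_def)
  show "w \<in> L2 (Omega_hole L r)"
    by (rule L2_cong[OF L2_subset[OF PC1_hole_extend(5)[OF r w] hole_subset sets_Omega(1) sets_hole] e])
  show "G \<in> L2 (Omega_hole L r)"
    by (rule L2_cong[OF L2_subset[OF PC1_hole_extend(6)[OF r w] hole_subset sets_Omega(1) sets_hole] e])
qed

text \<open>Removes the arbitrary choice of \<open>weak_grad\<close> from \<open>H1norm\<close> in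
  favour of the explicit gradients.\<close>

lemma H1norm_diff_PC1_hole:
  assumes r: "0 < r" "r < L" and w: "PC1_hole L r w G" and v: "v \<in> L2 (Omega_hole L r)"
    and g: "has_weak_gradient (Omega_hole L r) v g" "g \<in> L2 (Omega_hole L r)"
    and eq: "\<And>x. x \<in> Omega_hole L r \<Longrightarrow> \<phi> x = w x"
  shows "H1norm (Omega_hole L r) (\<lambda>x. v x - \<phi> x)
    = sqrt ((L2norm (Omega_hole L r) (\<lambda>x. v x - w x))\<^sup>2 + (L2norm (Omega_hole L r) (\<lambda>x. g x - G x))\<^sup>2)"
proof -
  let ?U = "Omega_hole L r"
  have "has_weak_gradient ?U (\<lambda>x. v x + (-1) *\<^sub>R w x) (\<lambda>x. g x + (-1) *\<^sub>R G x)"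
    by (rule has_weak_gradient_lincomb[OF open_hole g(1) PC1_hole_weak_gradient[OF w]])
  then have wg: "has_weak_gradient ?U (\<lambda>x. v x - \<phi> x) (\<lambda>x. g x - G x)"
    by (rule has_weak_gradient_cong) (auto simp: eq)
  have "L2norm ?U (weak_grad ?U (\<lambda>x. v x - \<phi> x)) = L2norm ?U (\<lambda>x. g x - G x)"
    by (rule L2norm_cong_AE[OF weak_grad_AE[OF open_hole wg] weak_grad_measurable[OF open_hole wg] L2D(1)[OF L2_diff[OF g(2) PC1_hole_L2(2)[OF r w]]]])
  moreover have "L2norm ?U (\<lambda>x. v x - \<phi> x) = L2norm ?U (\<lambda>x. v x - w x)"
    by (rule L2norm_cong) (simp add: eq)
  ultimately show ?thesis by (simp add: H1norm_def)
qed

lemma V0_weak_grad_L2: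
  assumes "v \<in> V0 L r"
  shows "v \<in> L2 (Omega_hole L r)" "has_weak_gradient (Omega_hole L r) v (weak_grad (Omega_hole L r) v)"
    "weak_grad (Omega_hole L r) v \<in> L2 (Omega_hole L r)"
proof -
  have "v \<in> H1 (Omega_hole L r)" using assms by (simp add: V0_def H1_per_hole_def)
  then obtain g where g: "v \<in> L2 (Omega_hole L r)" "has_weak_gradient (Omega_hole L r) v g" "g \<in> L2 (Omega_hole L r)"
    by (auto simp: H1_def)
  show "v \<in> L2 (Omega_hole L r)" by fact
  show "has_weak_gradient (Omega_hole L r) v (weak_grad (Omega_hole L r) v)" by (rule weak_grad_has[OF g(2)])
  have "AE x in lebesgue_on (Omega_hole L r). g x = weak_grad (Omega_hole L r) v x"
    using weak_grad_AE[OF open_hole g(2)] by eventually_elim simp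
  then show "weak_grad (Omega_hole L r) v \<in> L2 (Omega_hole L r)"
    by (rule L2_cong_AE[OF g(3) _ weak_grad_measurable[OF open_hole g(2)]])
qed

lemma circle_point_closure:
  assumes r: "0 < r" "r < L"
  shows "circle_point r t \<in> closure (Omega_hole L r)"
  unfolding closure_hole[OF r] using norm_circle_point[of r t] r
  by (auto intro: order_trans[OF component_le_norm_cart])

text \<open>The sequence from the definition of the trace alone suffices: it converges in the
  \<open>H1norm\<close> and its boundary values tend to 0.\<close>

lemma V0_imp_limit:
  assumes r: "0 < r" "r < L" and v: "v \<in> V0 L r"
  shows "V0_limit L r v (weak_grad (Omega_hole L r) v)"
  unfolding V0_limit_def
proof (intro conjI allI impI)
  let ?U = "Omega_hole L r"
  note v2 = V0_weak_grad_L2[OF v]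
  show "v \<in> L2 ?U" "weak_grad ?U v \<in> L2 ?U" by (fact v2)+
  fix e :: real assume e: "e > 0"
  obtain \<phi> where \<phi>: "\<And>n::nat. \<phi> n \<in> C1_per_hole L r" "(\<lambda>n. H1norm ?U (\<lambda>x. v x - \<phi> n x)) \<longlonglongrightarrow> 0"
    "(\<lambda>n. circle_L2norm r (\<lambda>x. \<phi> n x - 0)) \<longlonglongrightarrow> 0"
    using v unfolding V0_def has_trace_def by auto
  have "\<forall>\<^sub>F n in sequentially. H1norm ?U (\<lambda>x. v x - \<phi> n x) < e \<and> circle_L2norm r (\<lambda>x. \<phi> n x - 0) < e"
    by (intro eventually_conj order_tendstoD(2)[OF \<phi>(2) e] order_tendstoD(2)[OF \<phi>(3) e])
  then obtain n where n: "H1norm ?U (\<lambda>x. v x - \<phi> n x) < e" "circle_L2norm r (\<lambda>x. \<phi> n x - 0) < e"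
    by (auto simp: eventually_sequentially)
  obtain w G where w: "periodic L w" "\<And>x. x \<in> closure ?U \<Longrightarrow> \<phi> n x = w x" "has_C1_gradient (periodic_hull L (closure ?U)) w G"
    using \<phi>(1)[of n] unfolding C1_per_hole_def by auto
  have pc: "PC1_hole L r w G" using w by (simp add: PC1_hole_def periodic_iff_lperiodic)
  have "\<phi> n x = w x" if "x \<in> ?U" for x using w(2) closure_subset that by blast
  from H1norm_diff_PC1_hole[OF r pc v2(1,2,3) this]
  have h: "sqrt ((L2norm ?U (\<lambda>x. v x - w x))\<^sup>2 + (L2norm ?U (\<lambda>x. weak_grad ?U v x - G x))\<^sup>2) < e" using n(1) by simp
  have "L2norm ?U (\<lambda>x. v x - w x) < e" "L2norm ?U (\<lambda>x. weak_grad ?U v x - G x) < e"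
    using h real_sqrt_sum_squares_ge1[of "L2norm ?U (\<lambda>x. v x - w x)" "L2norm ?U (\<lambda>x. weak_grad ?U v x - G x)"]
      real_sqrt_sum_squares_ge2[of "L2norm ?U (\<lambda>x. weak_grad ?U v x - G x)" "L2norm ?U (\<lambda>x. v x - w x)"] by linarith+
  moreover have "circle_L2norm r w = circle_L2norm r (\<lambda>x. \<phi> n x - 0)"
    unfolding circle_L2norm_def using w(2) circle_point_closure[OF r] by simp
  ultimately show "\<exists>w G. PC1_hole L r w G \<and> L2norm ?U (\<lambda>x. v x - w x) < e \<and> L2norm ?U (\<lambda>x. weak_grad ?U v x - G x) < e \<and> circle_L2norm r w < e"
    using pc n(2) by (intro exI[of _ w] exI[of _ G]) simp
qed

text \<open>The same sequence witnesses both the membership in the closure and the zero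
  trace.\<close>

lemma V0_limit_imp:
  assumes r: "0 < r" "r < L" and vg: "V0_limit L r v g"
  shows "v \<in> V0 L r"
proof -
  let ?U = "Omega_hole L r"
  have v2: "v \<in> L2 ?U" "g \<in> L2 ?U" using vg by (auto simp: V0_limit_def)
  have wg: "has_weak_gradient ?U v g" by (rule V0_limit_weak_gradient[OF r vg])
  have "\<forall>n::nat. \<exists>w G. PC1_hole L r w G \<and> L2norm ?U (\<lambda>x. v x - w x) < inverse (real (Suc n)) \<and>
        L2norm ?U (\<lambda>x. g x - G x) < inverse (real (Suc n)) \<and> circle_L2norm r w < inverse (real (Suc n))"
    using vg unfolding V0_limit_def by simp
  then obtain w G where w: "\<And>n. PC1_hole L r (w n) (G n)"
    "\<And>n. L2norm ?U (\<lambda>x. v x - w n x) < inverse (real (Suc n))"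
    "\<And>n. L2norm ?U (\<lambda>x. g x - G n x) < inverse (real (Suc n))"
    "\<And>n. circle_L2norm r (w n) < inverse (real (Suc n))"
    by (simp only: choice_iff) blast
  have lim: "a \<longlonglongrightarrow> 0" if "\<And>n. 0 \<le> a n" "\<And>n. a n < inverse (real (Suc n))" for a :: "nat \<Rightarrow> real"
    by (rule Lim_null_comparison[OF _ LIMSEQ_inverse_real_of_nat])
      (use that in \<open>auto intro!: always_eventually less_imp_le simp del: of_nat_Suc\<close>)
  have c: "w n \<in> C1_per_hole L r" for n
    using w(1)[of n] unfolding C1_per_hole_def PC1_hole_def periodic_iff_lperiodic by auto
  have "(\<lambda>n. sqrt ((L2norm ?U (\<lambda>x. v x - w n x))\<^sup>2 + (L2norm ?U (\<lambda>x. g x - G n x))\<^sup>2)) \<longlonglongrightarrow> sqrt (0\<^sup>2 + 0\<^sup>2)"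
    by (intro tendsto_real_sqrt tendsto_add tendsto_power lim[OF L2norm_nonneg w(2)] lim[OF L2norm_nonneg w(3)])
  then have h: "(\<lambda>n. H1norm ?U (\<lambda>x. v x - w n x)) \<longlonglongrightarrow> 0"
    using H1norm_diff_PC1_hole[OF r w(1) v2(1) wg v2(2)] by simp
  have t: "(\<lambda>n. circle_L2norm r (\<lambda>x. w n x - 0)) \<longlonglongrightarrow> 0"
    by (rule lim) (use w(4) in \<open>auto simp: circle_L2norm_def r(1)[THEN less_imp_le] simp del: of_nat_Suc\<close>)
  have "v \<in> H1_per_hole L r"
    unfolding H1_per_hole_def H1_def using v2 wg c h by blast
  moreover have "has_trace L r v (\<lambda>x. 0)"
    unfolding has_trace_def circle_L2_def using c h t by auto
  ultimately show ?thesis by (simp add: V0_def)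
qed

lemma V0_limit_lincomb:
  assumes r: "0 < r" "r < L" and vg: "V0_limit L r v g" "V0_limit L r v' g'"
  shows "V0_limit L r (\<lambda>x. v x + t *\<^sub>R v' x) (\<lambda>x. g x + t *\<^sub>R g' x)"
  unfolding V0_limit_def
proof (intro conjI allI impI)
  let ?U = "Omega_hole L r"
  have l2: "v \<in> L2 ?U" "g \<in> L2 ?U" "v' \<in> L2 ?U" "g' \<in> L2 ?U"
    using vg by (auto simp: V0_limit_def)
  show "(\<lambda>x. v x + t *\<^sub>R v' x) \<in> L2 ?U" "(\<lambda>x. g x + t *\<^sub>R g' x) \<in> L2 ?U"
    by (rule L2_add[OF l2(1) L2_scaleR[OF l2(3)]] L2_add[OF l2(2) L2_scaleR[OF l2(4)]])+
  fix e :: real assume "e > 0"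
  define d where "d = e / (1 + \<bar>t\<bar>)"
  have "d > 0" using \<open>e > 0\<close> by (simp add: d_def add_pos_nonneg)
  have de: "d + \<bar>t\<bar> * d = e"
  proof -
    have "(1 + \<bar>t\<bar>) * d = e" unfolding d_def by (simp add: add_pos_nonneg less_imp_neq[symmetric])
    then show ?thesis by (simp add: algebra_simps)
  qed
  obtain w G where w: "PC1_hole L r w G" "L2norm ?U (\<lambda>x. v x - w x) < d" "L2norm ?U (\<lambda>x. g x - G x) < d" "circle_L2norm r w < d"
    using vg(1) \<open>d > 0\<close> unfolding V0_limit_def by blast
  obtain w' G' where w': "PC1_hole L r w' G'" "L2norm ?U (\<lambda>x. v' x - w' x) < d" "L2norm ?U (\<lambda>x. g' x - G' x) < d" "circle_L2norm r w' < d"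
    using vg(2) \<open>d > 0\<close> unfolding V0_limit_def by blast
  have bound: "L2norm ?U (\<lambda>x. (a x + t *\<^sub>R a' x) - (b x + t *\<^sub>R b' x)) < e"
    if "a \<in> L2 ?U" "a' \<in> L2 ?U" "b \<in> L2 ?U" "b' \<in> L2 ?U"
      "L2norm ?U (\<lambda>x. a x - b x) < d" "L2norm ?U (\<lambda>x. a' x - b' x) < d"
    for a a' b b' :: "real^2 \<Rightarrow> 'c::euclidean_space"
  proof -
    have "L2norm ?U (\<lambda>x. (a x - b x) + t *\<^sub>R (a' x - b' x)) \<le> L2norm ?U (\<lambda>x. a x - b x) + \<bar>t\<bar> * L2norm ?U (\<lambda>x. a' x - b' x)"
      by (rule L2norm_lincomb_le[OF L2_diff[OF that(1,3)] L2_diff[OF that(2,4)]])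
    also have "\<dots> < d + \<bar>t\<bar> * d" using that(5,6) by (intro add_less_le_mono mult_left_mono) auto
    finally show ?thesis using de by (simp add: algebra_simps)
  qed
  have pc: "PC1_hole L r (\<lambda>x. w x + t *\<^sub>R w' x) (\<lambda>x. G x + t *\<^sub>R G' x)"
    using w(1) w'(1) C1_add[OF _ C1_scaleR, of "periodic_hull L (closure ?U)" w G w' G' t]
    by (simp add: PC1_hole_def lperiodic_def)
  note k = circle_integral_le(2)[OF r(1) PC1_hole_continuous(2)[OF r w(1)]] circle_integral_le(2)[OF r(1) PC1_hole_continuous(2)[OF r w'(1)]]
  have "circle_L2norm r (\<lambda>x. w x + t *\<^sub>R w' x) \<le> circle_L2norm r w + \<bar>t\<bar> * circle_L2norm r w'"
    using mult_left_mono[OF L2norm_lincomb_le[OF k, of t], of "sqrt r"] r(1)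
    unfolding circle_L2norm_eq[OF less_imp_le[OF r(1)]] by (simp add: algebra_simps)
  also have "\<dots> < d + \<bar>t\<bar> * d" using w(4) w'(4) by (intro add_less_le_mono mult_left_mono) auto
  finally have ce: "circle_L2norm r (\<lambda>x. w x + t *\<^sub>R w' x) < e" using de by simp
  show "\<exists>w G. PC1_hole L r w G \<and> L2norm ?U (\<lambda>x. (v x + t *\<^sub>R v' x) - w x) < e
      \<and> L2norm ?U (\<lambda>x. (g x + t *\<^sub>R g' x) - G x) < e \<and> circle_L2norm r w < e"
    using pc ce bound[OF l2(1,3) PC1_hole_L2(1)[OF r w(1)] PC1_hole_L2(1)[OF r w'(1)] w(2) w'(2)]
      bound[OF l2(2,4) PC1_hole_L2(2)[OF r w(1)] PC1_hole_L2(2)[OF r w'(1)] w(3) w'(3)] by blast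
qed

text \<open>The triangle inequality handles the two L^2 distances; the bound on the circle is that
  of the inner approximation itself.\<close>

lemma V0_limit_closed:
  assumes r: "0 < r" "r < L" and l2: "v \<in> L2 (Omega_hole L r)" "g \<in> L2 (Omega_hole L r)"
    and app: "\<And>e. e > 0 \<Longrightarrow> \<exists>v' g'. V0_limit L r v' g' \<and> L2norm (Omega_hole L r) (\<lambda>x. v x - v' x) < e \<and> L2norm (Omega_hole L r) (\<lambda>x. g x - g' x) < e"
  shows "V0_limit L r v g"
  unfolding V0_limit_def
proof (intro conjI l2 allI impI)
  let ?U = "Omega_hole L r"
  fix e :: real assume e: "e > 0"
  obtain v' g' where v': "V0_limit L r v' g'" "L2norm ?U (\<lambda>x. v x - v' x) < e/2" "L2norm ?U (\<lambda>x. g x - g' x) < e/2"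
    using app[of "e/2"] e by auto
  have "e / 2 > 0" using e by simp
  with v'(1) obtain w G where w: "PC1_hole L r w G" "L2norm ?U (\<lambda>x. v' x - w x) < e/2" "L2norm ?U (\<lambda>x. g' x - G x) < e/2" "circle_L2norm r w < e/2"
    unfolding V0_limit_def by blast
  have l2': "v' \<in> L2 ?U" "g' \<in> L2 ?U" using v'(1) by (auto simp: V0_limit_def)
  have "L2norm ?U (\<lambda>x. v x - w x) < e" "L2norm ?U (\<lambda>x. g x - G x) < e" "circle_L2norm r w < e"
    using L2norm_triangle_diff[OF l2(1) l2'(1) PC1_hole_L2(1)[OF r w(1)]]
      L2norm_triangle_diff[OF l2(2) l2'(2) PC1_hole_L2(2)[OF r w(1)]] v' w e by linarith+
  then show "\<exists>w G. PC1_hole L r w G \<and> L2norm ?U (\<lambda>x. v x - w x) < e \<and> L2norm ?U (\<lambda>x. g x - G x) < e \<and> circle_L2norm r w < e"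
    using w(1) by blast
qed

text \<open>The function is its own approximation. This is the supply of concrete test functions on
  the perforated square.\<close>

lemma PC1_vanishing_V0_limit:
  assumes r: "0 < r" "r < L" and u: "PC1 L u G" and u0: "\<And>x. norm x \<le> r \<Longrightarrow> u x = 0"
  shows "V0_limit L r u G"
proof -
  have pc: "PC1_hole L r u G"
    using u C1_subset[of UNIV u G "periodic_hull L (closure (Omega_hole L r))"] by (simp add: PC1_hole_def PC1_def)
  have "circle_L2norm r u = 0"
    unfolding circle_L2norm_def using u0 norm_circle_point[of r] r by simp
  then show ?thesis
    unfolding V0_limit_def using PC1_hole_L2[OF r pc] pc by (auto intro!: exI[of _ u] exI[of _ G])
qed

text \<open>Makes the Poincare inequalities for periodic limits available to extensions by zero. The
  gradients \<open>weak_grad\<close> and \<open>extend L r g\<close> have L^2 distance 0, and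
  closedness allows the exchange.\<close>

lemma V0_limit_per_limit:
  assumes r: "0 < r" "r < L" and vg: "V0_limit L r v g"
  shows "per_limit L (extend L r v) (extend L r g)"
proof -
  have L: "L > 0" using r by simp
  note e = V0_limit_extend[OF r vg]
  have p: "per_limit L (extend L r v) (weak_grad (Omega L) (extend L r v))" by (rule H1_per_weak_grad[OF L e(1)])
  have g2: "extend L r g \<in> L2 (Omega L)" using vg by (auto simp: V0_limit_def intro: extend_hole(1)[OF L])
  have ae: "AE x in lebesgue_on (Omega L). weak_grad (Omega L) (extend L r v) x = extend L r g x"
    by (rule weak_grad_AE[OF open_Omega e(2)])
  show ?thesis
  proof (rule per_limit_closed[OF _ g2 L])
    show "extend L r v \<in> L2 (Omega L)" using p by (simp add: per_limit_def)
    fix d :: real assume "d > 0"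
    have "L2norm (Omega L) (\<lambda>x. extend L r g x - weak_grad (Omega L) (extend L r v) x) = L2norm (Omega L) (\<lambda>x. 0 :: real^2)"
      by (rule L2norm_cong_AE, use ae in eventually_elim)
        (use L2D(1)[OF g2] weak_grad_measurable[OF open_Omega e(2)] in auto)
    then show "\<exists>v' g'. per_limit L v' g' \<and> L2norm (Omega L) (\<lambda>x. extend L r v x - v' x) < d \<and> L2norm (Omega L) (\<lambda>x. extend L r g x - g' x) < d"
      using p \<open>d > 0\<close> by (intro exI[of _ "extend L r v"] exI[of _ "weak_grad (Omega L) (extend L r v)"]) simp
  qed
qed

subsection \<open>Cutoff functions of small energy\<close>

text \<open>In the plane the energy of a cutoff function is scale invariant, so the average of \<open>n\<close> cutoff
  functions with disjoint transition layers has energy of order \<open>1 / n\<close>.\<close>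

lemma small_energy_cutoff:
  assumes L: "L > 0" and e: "e > 0"
  obtains \<zeta> X \<rho> where "0 < \<rho>" "PC1 L \<zeta> X" "\<And>x. 0 \<le> \<zeta> x \<and> \<zeta> x \<le> 1" "\<And>x. norm x \<le> \<rho> \<Longrightarrow> \<zeta> x = 0"
    "L2norm (Omega L) (\<lambda>x. 1 - \<zeta> x) < e" "L2norm (Omega L) X < e"
proof -
  let ?V = "measure lborel (ball (0::real^2) 1)"
  \<comment> \<open>The energy bound of one layer: the squared gradient bound
    \<open>(16 / (3 * q k))\<^sup>2\<close> times the area \<open>?V * (3 * (q k)\<^sup>2)\<close>,
    in which \<open>q k\<close> cancels.\<close>
  define E where "E = 256 / 3 * ?V"
  have E: "0 \<le> E" by (simp add: E_def)
  have "E / e\<^sup>2 < real (nat \<lceil>E / e\<^sup>2\<rceil> + 1)" by linarith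
  then obtain n :: nat where n: "E / e\<^sup>2 < real n" "0 < n" by (metis add_gr_0 zero_less_one)
  have En: "sqrt (E / real n) < e"
  proof -
    have "E / real n < e\<^sup>2" using n e by (simp add: field_simps)
    then show ?thesis using e by (intro real_less_lsqrt) (auto simp: E)
  qed
  \<comment> \<open>The outer radius of all layers: below \<open>L\<close>, to fit into the cell,
    and so small that the disc where the cutoff may differ from 1 contributes less than
    \<open>e\<close> in L^2.\<close>
  define \<sigma> where "\<sigma> = min (L / 2) (e / (sqrt ?V + 1))"
  have sV: "0 \<le> sqrt ?V" by simp
  have \<sigma>: "0 < \<sigma>" "\<sigma> < L" "\<sigma> * sqrt ?V < e"
  proof -
    have p: "0 < e / (sqrt ?V + 1)" using e sV by (simp add: add_nonneg_pos)
    show "0 < \<sigma>" "\<sigma> < L" using L p by (auto simp: \<sigma>_def)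
    have "\<sigma> * sqrt ?V \<le> (e / (sqrt ?V + 1)) * sqrt ?V" unfolding \<sigma>_def by (intro mult_right_mono) auto
    also have "\<dots> < (e / (sqrt ?V + 1)) * (sqrt ?V + 1)" by (intro mult_strict_left_mono p) simp
    also have "\<dots> = e"
    proof -
      have "sqrt ?V + 1 > 0" using sV by linarith
      then show ?thesis by (metis nonzero_eq_divide_eq less_irrefl)
    qed
    finally show "\<sigma> * sqrt ?V < e" .
  qed
  define \<rho> where "\<rho> = \<sigma> / 2 ^ n"
  have \<rho>: "0 < \<rho>" "\<rho> * 2 ^ n = \<sigma>" using \<sigma> by (auto simp: \<rho>_def)
  define q where "q k = \<rho> * 2 ^ k" for k :: nat
  have q: "0 < q k" "\<rho> \<le> q k" for k using \<rho> by (auto simp: q_def)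
  \<comment> \<open>With parameter \<open>3 * (q k)\<^sup>2\<close> a layer reaches from radius
    \<open>q k\<close> exactly to \<open>q (Suc k)\<close>, so successive layers touch without
    overlapping. Averaging over dyadic layers imitates a logarithmic cutoff.\<close>
  have qs: "(q k)\<^sup>2 + 3 * (q k)\<^sup>2 = (q (Suc k))\<^sup>2" for k by (simp add: q_def power_mult_distrib)
  have qmono: "q j \<le> q k" if "j \<le> k" for j k using that \<rho> by (simp add: q_def power_increasing)
  have qn: "q n = \<sigma>" using \<rho> by (simp add: q_def)
  define s where "s k = eta (q k) (3 * (q k)\<^sup>2)" for k
  define s' where "s' k = eta' (q k) (3 * (q k)\<^sup>2)" for k
  have sC: "has_C1_gradient UNIV (s k) (s' k)" for k
    unfolding s_def s'_def by (rule C1_eta) (use q(1)[of k] in simp)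
  have s1: "s k x = 1" if "q (Suc k) \<le> norm x" for k x
  proof -
    have "(q (Suc k))\<^sup>2 \<le> (norm x)\<^sup>2" using that q(1)[of "Suc k"] by (intro power_mono) auto
    then show ?thesis unfolding s_def using q(1)[of k] qs[of k]
      by (intro eta_1) (auto simp: power2_norm_eq_inner)
  qed
  have s0: "s k x = 0" if "norm x \<le> q k" for k x
  proof -
    have "(norm x)\<^sup>2 \<le> (q k)\<^sup>2" using that by (intro power_mono) auto
    then have "x \<bullet> x \<le> (q k)\<^sup>2 + 3 * (q k)\<^sup>2 / 2"
      unfolding power2_norm_eq_inner using zero_le_power2[of "q k"] by linarith
    then show ?thesis unfolding s_def using q(1)[of k] by (intro eta_0) auto
  qed
  define A where "A k = annulus (q k) (3 * (q k)\<^sup>2)" for k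
  have s'b: "norm (s' k x) \<le> 16 / (3 * q k) * indicat_real (A k) x" for k x
  proof -
    \<comment> \<open>The gradient bound is applied with the outer radius \<open>2 * q k\<close> of
      the layer in place of the half-side of the square.\<close>
    have "norm (s' k x) \<le> 8 * (2 * q k) / (3 * (q k)\<^sup>2) * indicat_real (A k) x"
      unfolding s'_def A_def using q(1)[of k] by (intro norm_eta') (auto simp: power_mult_distrib)
    also have "8 * (2 * q k) / (3 * (q k)\<^sup>2) = 16 / (3 * q k)" using q(1)[of k] by (simp add: power2_eq_square)
    finally show ?thesis .
  qed
  have disj: "A j \<inter> A k = {}" if "j < k" for j k
  proof -
    have "(q (Suc j))\<^sup>2 \<le> (q k)\<^sup>2" using qmono[of "Suc j" k] that q(1)[of "Suc j"] by (intro power_mono) auto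
    then show ?thesis using qs[of j] by (auto simp: A_def annulus_def)
  qed
  have orth: "s' j x \<bullet> s' k x = 0" if "j \<noteq> k" for j k x
  proof -
    have "x \<notin> A j \<or> x \<notin> A k" using disj[of j k] disj[of k j] that by (cases "j < k") auto
    then show ?thesis using s'b[of j x] s'b[of k x] by auto
  qed
  define \<zeta>0 where "\<zeta>0 x = (1 / real n) *\<^sub>R (\<Sum>k<n. s k x)" for x
  define X0 where "X0 x = (1 / real n) *\<^sub>R (\<Sum>k<n. s' k x)" for x
  have C0: "has_C1_gradient UNIV \<zeta>0 X0"
    unfolding \<zeta>0_def X0_def by (intro C1_scaleR C1_sum sC)
  have \<zeta>1: "\<zeta>0 x = 1" if "\<sigma> \<le> norm x" for x
  proof -
    have "s k x = 1" if "k < n" for k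
      using s1[of k x] qmono[of "Suc k" n] \<open>\<sigma> \<le> norm x\<close> that qn by simp
    then show ?thesis using n by (simp add: \<zeta>0_def)
  qed
  have \<zeta>z: "\<zeta>0 x = 0" if "norm x \<le> \<rho>" for x
    using s0[of x] q(2) that by (simp add: \<zeta>0_def order_trans[OF that q(2)])
  have \<zeta>r: "0 \<le> \<zeta>0 x \<and> \<zeta>0 x \<le> 1" for x
  proof -
    have "(\<Sum>k<n. s k x) \<le> (\<Sum>k<n. 1)" by (intro sum_mono) (simp add: s_def eta_range)
    moreover have "0 \<le> (\<Sum>k<n. s k x)" by (intro sum_nonneg) (simp add: s_def eta_range)
    ultimately show ?thesis using n by (simp add: \<zeta>0_def field_simps)
  qed
  define \<zeta> where "\<zeta> x = \<zeta>0 (fold_cell L x)" for x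
  define X where "X x = X0 (fold_cell L x)" for x
  have P: "PC1 L \<zeta> X"
    unfolding \<zeta>_def X_def by (rule PC1_periodic_extension[OF L \<sigma>(2) C0]) (use \<zeta>1 in auto)
  have [measurable]: "s' k \<in> borel_measurable borel" for k
    by (rule borel_measurable_continuous_onI[OF C1_continuous(2)[OF sC]])
  have Am[measurable]: "A k \<in> sets borel" for k unfolding A_def using open_annulus by simp
  have part: "(\<integral>\<^sup>+x. ennreal ((norm (s' k x))\<^sup>2) \<partial>lborel) \<le> ennreal E" for k
  proof -
    have "(\<integral>\<^sup>+x. ennreal ((norm (s' k x))\<^sup>2) \<partial>lborel) \<le> (\<integral>\<^sup>+x. ennreal ((16 / (3 * q k))\<^sup>2) * indicator (A k) x \<partial>lborel)"
    proof (rule nn_integral_mono)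
      fix x
      have "(norm (s' k x))\<^sup>2 \<le> (16 / (3 * q k) * indicat_real (A k) x)\<^sup>2"
        using s'b[of k x] by (intro power_mono) auto
      then show "ennreal ((norm (s' k x))\<^sup>2) \<le> ennreal ((16 / (3 * q k))\<^sup>2) * indicator (A k) x"
        by (auto simp: indicator_def ennreal_leI split: if_splits)
    qed
    also have "\<dots> = ennreal ((16 / (3 * q k))\<^sup>2) * emeasure lborel (A k)"
      by (rule nn_integral_cmult_indicator) simp
    also have "emeasure lborel (A k) = ennreal (?V * (3 * (q k)\<^sup>2))"
      unfolding A_def by (rule emeasure_annulus) (use q(1)[of k] in auto)
    also have "ennreal ((16 / (3 * q k))\<^sup>2) * \<dots> = ennreal ((16 / (3 * q k))\<^sup>2 * (?V * (3 * (q k)\<^sup>2)))"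
      by (rule ennreal_mult[symmetric]) auto
    also have "(16 / (3 * q k))\<^sup>2 * (?V * (3 * (q k)\<^sup>2)) = E"
      using q(1)[of k] by (simp add: E_def power2_eq_square field_simps)
    finally show ?thesis .
  qed
  \<comment> \<open>The gradients have disjoint supports, hence Pythagoras: \<open>n\<close>
    energies of at most \<open>E\<close> divided by the square of \<open>n\<close> give
    \<open>E / n\<close>.\<close>
  have X2: "(norm (X0 x))\<^sup>2 = (1 / (real n)\<^sup>2) * (\<Sum>k<n. (norm (s' k x))\<^sup>2)" for x
  proof -
    have "(norm (\<Sum>k<n. s' k x))\<^sup>2 = (\<Sum>k<n. (norm (s' k x))\<^sup>2)"
      by (rule norm_sum_Pythagorean) (use orth in \<open>auto simp: pairwise_def orthogonal_def\<close>)
    then show ?thesis by (simp add: X0_def power_mult_distrib power_divide)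
  qed
  have "(\<integral>\<^sup>+x. ennreal ((norm (X x))\<^sup>2) \<partial>lebesgue_on (Omega L)) = (\<integral>\<^sup>+x. ennreal ((norm (X x))\<^sup>2) * indicator (cell L) x \<partial>lborel)"
    by (rule nn_integral_cell_Omega[symmetric])
  also have "\<dots> \<le> (\<integral>\<^sup>+x. ennreal (1 / (real n)\<^sup>2) * (\<Sum>k<n. ennreal ((norm (s' k x))\<^sup>2)) \<partial>lborel)"
  proof (rule nn_integral_mono)
    fix x
    have "ennreal ((norm (X0 x))\<^sup>2) = ennreal (1 / (real n)\<^sup>2) * (\<Sum>k<n. ennreal ((norm (s' k x))\<^sup>2))"
      unfolding X2 by (subst ennreal_mult) (auto intro!: sum_nonneg)
    then show "ennreal ((norm (X x))\<^sup>2) * indicator (cell L) x \<le> ennreal (1 / (real n)\<^sup>2) * (\<Sum>k<n. ennreal ((norm (s' k x))\<^sup>2))"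
      by (auto simp: indicator_def X_def fold_cell_id[OF L])
  qed
  also have "\<dots> = ennreal (1 / (real n)\<^sup>2) * (\<Sum>k<n. \<integral>\<^sup>+x. ennreal ((norm (s' k x))\<^sup>2) \<partial>lborel)"
  proof -
    have "(\<integral>\<^sup>+x. (\<Sum>k<n. ennreal ((norm (s' k x))\<^sup>2)) \<partial>lborel) = (\<Sum>k<n. \<integral>\<^sup>+x. ennreal ((norm (s' k x))\<^sup>2) \<partial>lborel)"
      by (rule nn_integral_sum) measurable
    moreover have "(\<lambda>x. \<Sum>k<n. ennreal ((norm (s' k x))\<^sup>2)) \<in> borel_measurable lborel" by measurable
    ultimately show ?thesis by (metis nn_integral_cmult)
  qed
  also have "\<dots> \<le> ennreal (1 / (real n)\<^sup>2) * (\<Sum>k<n. ennreal E)"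
    by (intro mult_left_mono sum_mono part) auto
  also have "\<dots> = ennreal (1 / (real n)\<^sup>2 * (real n * E))"
    using E by (subst ennreal_mult) (auto simp: ennreal_mult ennreal_of_nat_eq_real_of_nat)
  also have "1 / (real n)\<^sup>2 * (real n * E) = (sqrt (E / real n))\<^sup>2"
    using E n by (simp add: power2_eq_square)
  finally have "L2norm (Omega L) X \<le> sqrt (E / real n)"
    by (rule L2_if_nn_integral(2)[rotated]) (use E L2D(1)[OF PC1_L2(2)[OF L P]] in auto)
  then have XE: "L2norm (Omega L) X < e" using En by simp
  have "(\<integral>\<^sup>+x. ennreal ((norm (1 - \<zeta> x))\<^sup>2) \<partial>lebesgue_on (Omega L)) = (\<integral>\<^sup>+x. ennreal ((norm (1 - \<zeta> x))\<^sup>2) * indicator (cell L) x \<partial>lborel)"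
    by (rule nn_integral_cell_Omega[symmetric])
  also have "\<dots> \<le> (\<integral>\<^sup>+x. indicator (ball (0::real^2) \<sigma>) x \<partial>lborel)"
  proof (rule nn_integral_mono)
    fix x
    show "ennreal ((norm (1 - \<zeta> x))\<^sup>2) * indicator (cell L) x \<le> indicator (ball (0::real^2) \<sigma>) x"
    proof (cases "x \<in> cell L \<and> norm x < \<sigma>")
      case True
      have "(norm (1 - \<zeta> x))\<^sup>2 \<le> 1\<^sup>2" using \<zeta>r[of "fold_cell L x"] unfolding \<zeta>_def by (intro power_mono) auto
      then have "ennreal ((norm (1 - \<zeta> x))\<^sup>2) \<le> 1" by (metis ennreal_1 ennreal_leI one_power2)
      then show ?thesis using True by simp
    next
      case False
      then show ?thesis using \<zeta>1[of x] by (cases "x \<in> cell L") (auto simp: \<zeta>_def fold_cell_id[OF L])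
    qed
  qed
  also have "\<dots> = ennreal ((\<sigma> * sqrt ?V)\<^sup>2)"
  proof -
    have "emeasure lborel (ball (0::real^2) \<sigma>) = emeasure lebesgue (ball (0::real^2) \<sigma>)" by simp
    also have "\<dots> = ennreal (measure lebesgue (ball (0::real^2) \<sigma>))" by (rule emeasure_eq_measure2) simp
    also have "measure lebesgue (ball (0::real^2) \<sigma>) = (\<sigma> * sqrt ?V)\<^sup>2"
      using content_ball_conv_unit_ball[of \<sigma> "0::real^2"] \<sigma> by (simp add: power_mult_distrib)
    finally show ?thesis by simp
  qed
  finally have "L2norm (Omega L) (\<lambda>x. 1 - \<zeta> x) \<le> \<sigma> * sqrt ?V"
    by (rule L2_if_nn_integral(2)[rotated]) (use \<sigma> L2D(1)[OF PC1_L2(1)[OF L P]] in auto)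
  then have \<zeta>E: "L2norm (Omega L) (\<lambda>x. 1 - \<zeta> x) < e" using \<sigma>(3) by simp
  have \<zeta>z': "\<zeta> x = 0" if "norm x \<le> \<rho>" for x
  proof -
    have "\<rho> < L" using q(2)[of n] qn \<sigma> by simp
    have "\<bar>x $ i\<bar> < L" for i using component_le_norm_cart[of x i] that \<open>\<rho> < L\<close> by linarith
    then have "x \<in> Omega L" unfolding Omega_def mem_Collect_eq abs_less_iff by (metis minus_less_iff)
    then show ?thesis using \<zeta>z[OF that] by (simp add: \<zeta>_def fold_Omega[OF L])
  qed
  show ?thesis
    by (rule that[OF \<rho>(1) P _ \<zeta>z' \<zeta>E XE]) (use \<zeta>r in \<open>auto simp: \<zeta>_def\<close>)
qed

subsection \<open>The problems on the perforated and on the full square\<close>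

lemma integral_inner_cong_AE:
  assumes "AE x in lebesgue_on U. g x = h x" "g \<in> L2 U" "h \<in> L2 U" "k \<in> L2 U"
  shows "(\<integral>x. g x \<bullet> k x \<partial>lebesgue_on U) = (\<integral>x. h x \<bullet> k x \<partial>lebesgue_on U)"
proof (rule integral_cong_AE)
  show "AE x in lebesgue_on U. g x \<bullet> k x = h x \<bullet> k x" using assms(1) by eventually_elim simp
qed (use L2_inner_integrable[OF assms(2,4)] L2_inner_integrable[OF assms(3,4)] in \<open>auto intro: borel_measurable_integrable\<close>)

lemma V0_limit_D:
  assumes r: "0 < r" "r < L" and vg: "V0_limit L r v g"
  shows "v \<in> L2 (Omega_hole L r)" "g \<in> L2 (Omega_hole L r)" "v \<in> V0 L r"
    "AE x in lebesgue_on (Omega_hole L r). weak_grad (Omega_hole L r) v x = g x"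
    "V0_limit L r v (weak_grad (Omega_hole L r) v)" "weak_grad (Omega_hole L r) v \<in> L2 (Omega_hole L r)"
proof -
  show "v \<in> L2 (Omega_hole L r)" "g \<in> L2 (Omega_hole L r)" using vg by (auto simp: V0_limit_def)
  show *: "v \<in> V0 L r" by (rule V0_limit_imp[OF r vg])
  show "AE x in lebesgue_on (Omega_hole L r). weak_grad (Omega_hole L r) v x = g x"
    by (rule weak_grad_AE[OF open_hole V0_limit_weak_gradient[OF r vg]])
  show "V0_limit L r v (weak_grad (Omega_hole L r) v)" by (rule V0_imp_limit[OF r *])
  show "weak_grad (Omega_hole L r) v \<in> L2 (Omega_hole L r)" by (rule V0_weak_grad_L2(3)[OF *])
qed

text \<open>Restates the problem for pairs, with arbitrary representatives of the gradients, which
  is the form produced by minimisation.\<close>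

lemma hole_solution_iff:
  assumes r: "0 < r" "r < L" and uh: "V0_limit L r u h"
  shows "hole_solution L f r u \<longleftrightarrow> (\<forall>v g. V0_limit L r v g \<longrightarrow>
    (\<integral>x. h x \<bullet> g x \<partial>lebesgue_on (Omega_hole L r)) = (\<integral>x. f x * v x \<partial>lebesgue_on (Omega_hole L r)))"
proof -
  let ?U = "Omega_hole L r"
  note u = V0_limit_D[OF r uh]
  have eq: "(\<integral>x. weak_grad ?U u x \<bullet> weak_grad ?U v x \<partial>lebesgue_on ?U) = (\<integral>x. h x \<bullet> g x \<partial>lebesgue_on ?U)"
    if "V0_limit L r v g" for v g
  proof -
    note v = V0_limit_D[OF r that]
    have "(\<integral>x. weak_grad ?U u x \<bullet> weak_grad ?U v x \<partial>lebesgue_on ?U) = (\<integral>x. h x \<bullet> weak_grad ?U v x \<partial>lebesgue_on ?U)"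
      by (rule integral_inner_cong_AE[OF u(4,6,2) v(6)])
    also have "\<dots> = (\<integral>x. weak_grad ?U v x \<bullet> h x \<partial>lebesgue_on ?U)" by (simp add: inner_commute)
    also have "\<dots> = (\<integral>x. g x \<bullet> h x \<partial>lebesgue_on ?U)" by (rule integral_inner_cong_AE[OF v(4,6,2) u(2)])
    finally show ?thesis by (simp add: inner_commute)
  qed
  show ?thesis
  proof
    assume s: "hole_solution L f r u"
    show "\<forall>v g. V0_limit L r v g \<longrightarrow> (\<integral>x. h x \<bullet> g x \<partial>lebesgue_on ?U) = (\<integral>x. f x * v x \<partial>lebesgue_on ?U)"
    proof (intro allI impI)
      fix v g assume vg: "V0_limit L r v g"
      show "(\<integral>x. h x \<bullet> g x \<partial>lebesgue_on ?U) = (\<integral>x. f x * v x \<partial>lebesgue_on ?U)"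
        using s V0_limit_D(3)[OF r vg] unfolding eq[OF vg, symmetric] hole_solution_def by blast
    qed
  next
    assume h: "\<forall>v g. V0_limit L r v g \<longrightarrow> (\<integral>x. h x \<bullet> g x \<partial>lebesgue_on ?U) = (\<integral>x. f x * v x \<partial>lebesgue_on ?U)"
    show "hole_solution L f r u"
      unfolding hole_solution_def
    proof (intro conjI ballI u(3))
      fix v assume "v \<in> V0 L r"
      then have vg: "V0_limit L r v (weak_grad ?U v)" by (rule V0_imp_limit[OF r])
      show "(\<integral>x. weak_grad ?U u x \<bullet> weak_grad ?U v x \<partial>lebesgue_on ?U) = (\<integral>x. f x * v x \<partial>lebesgue_on ?U)"
        unfolding eq[OF vg] using h vg by blast
    qed
  qed
qed

text \<open>The extension vanishes on the disc, a set of positive measure. The constant may depend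
  on \<open>r\<close>, since the inequality is applied at one radius at a time.\<close>

lemma V0_limit_Poincare:
  assumes r: "0 < r" "r < L"
  obtains C where "0 \<le> C" "\<And>v g. V0_limit L r v g \<Longrightarrow> L2norm (Omega_hole L r) v \<le> C * L2norm (Omega_hole L r) g"
proof -
  have L: "L > 0" using r by simp
  have sub: "ball 0 r \<subseteq> Omega L"
  proof
    fix x :: "real^2" assume "x \<in> ball 0 r"
    then have "\<bar>x $ i\<bar> < L" for i using component_le_norm_cart[of x i] r by simp
    then show "x \<in> Omega L" unfolding Omega_def mem_Collect_eq abs_less_iff by (metis minus_less_iff)
  qed
  have pos: "measure lebesgue (ball (0::real^2) r) > 0" using content_ball_pos[OF r(1), of "0::real^2"] by simp
  obtain C where C: "0 \<le> C" "\<And>v g. per_limit L v g \<Longrightarrow> (\<And>x. x \<in> ball 0 r \<Longrightarrow> v x = 0) \<Longrightarrow>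
    L2norm (Omega L) v \<le> C * L2norm (Omega L) g"
    using Poincare_vanishing[OF L lmeasurable_ball sub pos] by blast
  show ?thesis
  proof (rule that[OF C(1)])
    fix v g assume vg: "V0_limit L r v g"
    have "L2norm (Omega L) (extend L r v) \<le> C * L2norm (Omega L) (extend L r g)"
    proof (rule C(2)[OF V0_limit_per_limit[OF r vg]])
      fix x :: "real^2" assume x: "x \<in> ball 0 r"
      then have "fold_cell L x = x" using sub by (intro fold_Omega[OF L]) auto
      then show "extend L r v x = 0" using x by (simp add: extend_def outside_def)
    qed
    then show "L2norm (Omega_hole L r) v \<le> C * L2norm (Omega_hole L r) g" by (simp only: extend_hole(2)[OF L])
  qed
qed

text \<open>Two weak equations tested with the difference of their solutions leave the energy of the
  difference equal to 0.\<close>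

lemma energy_unique:
  assumes h: "h \<in> L2 U" and k: "k \<in> L2 U"
    and eq: "(\<integral>x. h x \<bullet> (h x - k x) \<partial>lebesgue_on U) = (\<integral>x. k x \<bullet> (h x - k x) \<partial>lebesgue_on U)"
  shows "L2norm U (\<lambda>x. h x - k x) = 0"
proof -
  have d: "(\<lambda>x. h x - k x) \<in> L2 U" by (rule L2_diff[OF h k])
  have "(L2norm U (\<lambda>x. h x - k x))\<^sup>2 = (\<integral>x. h x \<bullet> (h x - k x) - k x \<bullet> (h x - k x) \<partial>lebesgue_on U)"
    unfolding L2norm_sq_inner by (simp add: inner_diff_left)
  also have "\<dots> = 0" using L2_inner_integrable[OF h d] L2_inner_integrable[OF k d] eq by simp
  finally show ?thesis by simp
qed

lemma hole_solution_exists_unique: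
  assumes r: "0 < r" "r < L" and f: "f \<in> L2 (Omega L)"
  shows "\<exists>u. hole_solution L f r u \<and>
    (\<forall>u'. hole_solution L f r u' \<longrightarrow> (AE x in lebesgue_on (Omega_hole L r). u' x = u x))"
proof -
  let ?U = "Omega_hole L r"
  have L: "L > 0" using r by simp
  have fU: "f \<in> L2 ?U" by (rule L2_subset[OF f hole_subset sets_Omega(1) sets_hole])
  obtain C where C: "0 \<le> C" "\<And>v g. V0_limit L r v g \<Longrightarrow> L2norm ?U v \<le> C * L2norm ?U g"
    using V0_limit_Poincare[OF r] by blast
  have zero: "V0_limit L r (\<lambda>x. 0) (\<lambda>x. 0)"
    by (rule PC1_vanishing_V0_limit[OF r]) (auto simp: PC1_def lperiodic_def C1_const)
  have l2: "v \<in> L2 ?U \<and> g \<in> L2 ?U" if "V0_limit L r v g" for v g using V0_limit_D(1,2)[OF r that] by blast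
  have "\<exists>u h. V0_limit L r u h \<and> (\<forall>v g. V0_limit L r v g \<longrightarrow>
      (\<integral>x. h x \<bullet> g x \<partial>lebesgue_on ?U) = (\<integral>x. f x * v x \<partial>lebesgue_on ?U))"
    by (rule L2_variational_solution[OF lmeasurable_hole fU l2 zero V0_limit_lincomb[OF r] C(2,1) V0_limit_closed[OF r]])
  then obtain u h where u: "V0_limit L r u h" "\<And>v g. V0_limit L r v g \<Longrightarrow>
      (\<integral>x. h x \<bullet> g x \<partial>lebesgue_on ?U) = (\<integral>x. f x * v x \<partial>lebesgue_on ?U)" by blast
  have sol: "hole_solution L f r u" using hole_solution_iff[OF r u(1)] u(2) by blast
  moreover have "AE x in lebesgue_on ?U. u' x = u x" if s': "hole_solution L f r u'" for u'
  proof -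
    have u': "V0_limit L r u' (weak_grad ?U u')"
      using s' V0_imp_limit[OF r] by (simp add: hole_solution_def)
    \<comment> \<open>The difference of two solutions is admissible as a test function by linearity;
      Poincare then turns equal gradients into equal functions.\<close>
    have d: "V0_limit L r (\<lambda>x. u' x - u x) (\<lambda>x. weak_grad ?U u' x - h x)"
      using V0_limit_lincomb[OF r u' u(1), of "-1"] by simp
    note l2 = V0_limit_D(1,2)[OF r u'] V0_limit_D(1,2)[OF r u(1)]
    have "L2norm ?U (\<lambda>x. weak_grad ?U u' x - h x) = 0"
    proof (rule energy_unique[OF l2(2,4)])
      have "(\<integral>x. weak_grad ?U u' x \<bullet> (weak_grad ?U u' x - h x) \<partial>lebesgue_on ?U) = (\<integral>x. f x * (u' x - u x) \<partial>lebesgue_on ?U)"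
        using iffD1[OF hole_solution_iff[OF r u'] s'] d by blast
      also have "\<dots> = (\<integral>x. h x \<bullet> (weak_grad ?U u' x - h x) \<partial>lebesgue_on ?U)" using u(2)[OF d] by simp
      finally show "(\<integral>x. weak_grad ?U u' x \<bullet> (weak_grad ?U u' x - h x) \<partial>lebesgue_on ?U)
        = (\<integral>x. h x \<bullet> (weak_grad ?U u' x - h x) \<partial>lebesgue_on ?U)" .
    qed
    then have "L2norm ?U (\<lambda>x. u' x - u x) = 0" using C(2)[OF d] L2norm_nonneg[of ?U "\<lambda>x. u' x - u x"] by simp
    from L2_AE_zero[OF V0_limit_D(1)[OF r d] this] show ?thesis by simp
  qed
  ultimately show ?thesis by blast
qed

lemma zero_ext_Omega: "L > 0 \<Longrightarrow> x \<in> Omega L \<Longrightarrow> extend L r u x = zero_ext r u x"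
  by (auto simp: extend_def zero_ext_def outside_def fold_Omega disc_def)

lemma zero_ext_H1_per:
  assumes r: "0 < r" "r < L" and vg: "V0_limit L r v g"
  shows "zero_ext r v \<in> H1_per L"
    "AE x in lebesgue_on (Omega L). weak_grad (Omega L) (zero_ext r v) x = extend L r g x"
    "weak_grad (Omega L) (zero_ext r v) \<in> borel_measurable (lebesgue_on (Omega L))"
proof -
  have L: "L > 0" using r by simp
  note e = V0_limit_extend[OF r vg]
  have wg: "has_weak_gradient (Omega L) (zero_ext r v) (extend L r g)"
    by (rule has_weak_gradient_cong[OF e(2) zero_ext_Omega[OF L]]) auto
  obtain w where w: "w \<in> H1_loc UNIV" "periodic L w" "AE x in lebesgue_on (Omega L). extend L r v x = w x"
    using e(1) by (auto simp: H1_per_def)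
  have "AE x in lebesgue_on (Omega L). extend L r v x = zero_ext r v x"
    by (rule AE_I2) (simp add: zero_ext_Omega[OF L])
  with w(3) have "AE x in lebesgue_on (Omega L). zero_ext r v x = w x" by eventually_elim simp
  then show "zero_ext r v \<in> H1_per L" using w by (auto simp: H1_per_def)
  show "AE x in lebesgue_on (Omega L). weak_grad (Omega L) (zero_ext r v) x = extend L r g x"
    by (rule weak_grad_AE[OF open_Omega wg])
  show "weak_grad (Omega L) (zero_ext r v) \<in> borel_measurable (lebesgue_on (Omega L))"
    by (rule weak_grad_measurable[OF open_Omega wg])
qed

section \<open>The periodic problem on the full square\<close>

lemma per_limit_D:
  assumes L: "L > 0" and vg: "per_limit L v g"
  shows "v \<in> L2 (Omega L)" "g \<in> L2 (Omega L)" "v \<in> H1_per L"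
    "AE x in lebesgue_on (Omega L). weak_grad (Omega L) v x = g x"
    "weak_grad (Omega L) v \<in> L2 (Omega L)"
proof -
  show "v \<in> L2 (Omega L)" "g \<in> L2 (Omega L)" using vg by (auto simp: per_limit_def)
  show *: "v \<in> H1_per L" by (rule per_limit_H1_per(1)[OF L vg])
  show "AE x in lebesgue_on (Omega L). weak_grad (Omega L) v x = g x"
    by (rule weak_grad_AE[OF open_Omega per_limit_H1_per(2)[OF L vg]])
  show "weak_grad (Omega L) v \<in> L2 (Omega L)" using H1_per_weak_grad[OF L *] by (simp add: per_limit_def)
qed

lemma limit_solution_iff:
  assumes L: "L > 0" and uh: "per_limit L u h"
  shows "limit_solution L f u \<longleftrightarrow> (\<forall>v g. per_limit L v g \<longrightarrow>
    (\<integral>x. h x \<bullet> g x \<partial>lebesgue_on (Omega L)) = (\<integral>x. f x * v x \<partial>lebesgue_on (Omega L))) \<and> mean L u = 0"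
proof -
  let ?U = "Omega L"
  note u = per_limit_D[OF L uh]
  have eq: "(\<integral>x. weak_grad ?U u x \<bullet> weak_grad ?U v x \<partial>lebesgue_on ?U) = (\<integral>x. h x \<bullet> g x \<partial>lebesgue_on ?U)"
    if "per_limit L v g" for v g
  proof -
    note v = per_limit_D[OF L that]
    have "(\<integral>x. weak_grad ?U u x \<bullet> weak_grad ?U v x \<partial>lebesgue_on ?U) = (\<integral>x. h x \<bullet> weak_grad ?U v x \<partial>lebesgue_on ?U)"
      by (rule integral_inner_cong_AE[OF u(4,5,2) v(5)])
    also have "\<dots> = (\<integral>x. weak_grad ?U v x \<bullet> h x \<partial>lebesgue_on ?U)" by (simp add: inner_commute)
    also have "\<dots> = (\<integral>x. g x \<bullet> h x \<partial>lebesgue_on ?U)" by (rule integral_inner_cong_AE[OF v(4,5,2) u(2)])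
    finally show ?thesis by (simp add: inner_commute)
  qed
  have m: "mean L u = 0 \<longleftrightarrow> (\<integral>x. u x \<partial>lebesgue_on ?U) = 0"
    using L by (simp add: mean_def measure_Omega)
  show ?thesis
  proof (intro iffI conjI allI impI)
    fix v g assume s: "limit_solution L f u" and vg: "per_limit L v g"
    show "(\<integral>x. h x \<bullet> g x \<partial>lebesgue_on ?U) = (\<integral>x. f x * v x \<partial>lebesgue_on ?U)"
      using s per_limit_D(3)[OF L vg] unfolding eq[OF vg, symmetric] limit_solution_def by blast
  next
    assume "limit_solution L f u"
    then show "mean L u = 0" unfolding m limit_solution_def by blast
  next
    assume h: "(\<forall>v g. per_limit L v g \<longrightarrow>
      (\<integral>x. h x \<bullet> g x \<partial>lebesgue_on ?U) = (\<integral>x. f x * v x \<partial>lebesgue_on ?U)) \<and> mean L u = 0"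
    show "limit_solution L f u"
      unfolding limit_solution_def
    proof (intro conjI ballI u(3))
      fix v assume "v \<in> H1_per L"
      then have vg: "per_limit L v (weak_grad ?U v)" by (rule H1_per_weak_grad[OF L])
      show "(\<integral>x. weak_grad ?U u x \<bullet> weak_grad ?U v x \<partial>lebesgue_on ?U) = (\<integral>x. f x * v x \<partial>lebesgue_on ?U)"
        unfolding eq[OF vg] using h vg by blast
    next
      show "(\<integral>x. u x \<partial>lebesgue_on ?U) = 0" using h unfolding m by blast
    qed
  qed
qed

lemma PC1_per_limit:
  assumes L: "L > 0" and u: "PC1 L u G"
  shows "per_limit L u G"
  unfolding per_limit_def
proof (intro conjI PC1_L2[OF L u] allI impI exI)
  fix e :: real assume "e > 0"
  then show "L2norm (Omega L) (\<lambda>x. u x - u x) < e" "L2norm (Omega L) (\<lambda>x. G x - G x) < e"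
    by simp_all
qed (rule u)

lemma per_limit_const: "L > 0 \<Longrightarrow> per_limit L (\<lambda>x. c) (\<lambda>x. 0)"
  by (rule PC1_per_limit) (simp_all add: PC1_def lperiodic_def C1_const)

lemma mean_lincomb:
  assumes "u \<in> L2 (Omega L)" "v \<in> L2 (Omega L)"
  shows "mean L (\<lambda>x. u x + t *\<^sub>R v x) = mean L u + t * mean L v"
  using L2_integrable(1)[OF lmeasurable_Omega assms(1)] L2_integrable(1)[OF lmeasurable_Omega assms(2)]
  by (simp add: mean_def distrib_left)

lemma mean_const: "L > 0 \<Longrightarrow> mean L (\<lambda>x. c) = c"
  using measure_Omega[of L] by (simp add: mean_def measure_restrict_space sets_Omega)

text \<open>Constants have zero energy, so coercivity is restored by minimising over functions of
  mean 0. That the resulting equation holds for all periodic test functions is where the vanishing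
  integral of \<open>f\<close> enters.\<close>

lemma limit_solution_exists_unique:
  assumes L: "L > 0" and f: "f \<in> L2 (Omega L)" and f0: "(\<integral>x. f x \<partial>lebesgue_on (Omega L)) = 0"
  obtains u0 h0 where "per_limit L u0 h0" "limit_solution L f u0"
    "\<And>u0'. limit_solution L f u0' \<Longrightarrow> AE x in lebesgue_on (Omega L). u0' x = u0 x"
proof -
  let ?U = "Omega L"
  let ?S = "\<lambda>v g. per_limit L v g \<and> mean L v = 0"
  have l2: "v \<in> L2 ?U \<and> g \<in> L2 ?U" if "?S v g" for v g using per_limit_D(1,2)[OF L] that by blast
  have P: "L2norm ?U v \<le> 2 * L * L2norm ?U g" if "?S v g" for v g using Poincare_mean[OF L, of v g] that by simp
  have lin: "?S (\<lambda>x. v x + t *\<^sub>R v' x) (\<lambda>x. g x + t *\<^sub>R g' x)" if "?S v g" "?S v' g'" for v g v' g' t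
    using per_limit_lincomb[OF L] mean_lincomb l2[OF that(1)] l2[OF that(2)] that by simp
  have closed: "?S v g" if vg: "v \<in> L2 ?U" "g \<in> L2 ?U"
    and app: "\<And>e. e > 0 \<Longrightarrow> \<exists>v' g'. ?S v' g' \<and> L2norm ?U (\<lambda>x. v x - v' x) < e \<and> L2norm ?U (\<lambda>x. g x - g' x) < e" for v g
  proof
    show "per_limit L v g" by (rule per_limit_closed[OF vg L]) (use app in blast)
    show "mean L v = 0"
    proof (rule ccontr)
      assume "mean L v \<noteq> 0"
      \<comment> \<open>The mean is continuous in L^2, so the constraint is closed: an approximation
        of mean 0 within this distance contradicts the bound on means.\<close>
      then have "2 * L * \<bar>mean L v\<bar> > 0" using L by simp
      from app[OF this] obtain v' g' where v': "?S v' g'" "L2norm ?U (\<lambda>x. v x - v' x) < 2 * L * \<bar>mean L v\<bar>" by blast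
      have v2: "v' \<in> L2 ?U" using l2[OF v'(1)] by blast
      have "\<bar>mean L v\<bar> \<le> L2norm ?U (\<lambda>x. v x - v' x) / (2 * L)"
        using mean_le[OF L L2_diff[OF vg(1) v2]] v'(1) unfolding mean_diff[OF vg(1) v2] by simp
      then show False using v'(2) L by (simp add: field_simps)
    qed
  qed
  have zero: "?S (\<lambda>x. 0) (\<lambda>x. 0)" using per_limit_const[OF L, of 0] mean_const[OF L, of 0] by simp
  have "\<exists>u h. ?S u h \<and> (\<forall>v g. ?S v g \<longrightarrow> (\<integral>x. h x \<bullet> g x \<partial>lebesgue_on ?U) = (\<integral>x. f x * v x \<partial>lebesgue_on ?U))"
    by (rule L2_variational_solution[OF lmeasurable_Omega f l2 zero lin P _ closed]) (use L in auto)
  then obtain u h where u: "per_limit L u h" "mean L u = 0"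
    "\<And>v g. ?S v g \<Longrightarrow> (\<integral>x. h x \<bullet> g x \<partial>lebesgue_on ?U) = (\<integral>x. f x * v x \<partial>lebesgue_on ?U)" by blast
  have sol: "limit_solution L f u"
    unfolding limit_solution_iff[OF L u(1)]
  proof (intro conjI allI impI u(2))
    fix v g assume vg: "per_limit L v g"
    note v = per_limit_D(1,2)[OF L vg]
    have k: "(\<lambda>x. 1::real) \<in> L2 ?U" by (rule L2_const(1)[OF lmeasurable_Omega])
    \<comment> \<open>Subtracting its mean makes any test function admissible without changing its
      gradient; the additional term on the right is a multiple of the integral of
      \<open>f\<close>.\<close>
    have "?S (\<lambda>x. v x + (- mean L v) *\<^sub>R 1) (\<lambda>x. g x + (- mean L v) *\<^sub>R 0)"
      using per_limit_lincomb[OF L vg per_limit_const[OF L, of 1], of "- mean L v"]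
        mean_lincomb[OF v(1) k, of "- mean L v"] mean_const[OF L, of 1] by simp
    from u(3)[OF this]
    have "(\<integral>x. h x \<bullet> g x \<partial>lebesgue_on ?U) = (\<integral>x. f x * v x - mean L v * f x \<partial>lebesgue_on ?U)"
      by (simp add: algebra_simps)
    also have "\<dots> = (\<integral>x. f x * v x \<partial>lebesgue_on ?U)"
      using L2_inner_integrable[OF f v(1)] L2_integrable(1)[OF lmeasurable_Omega f] f0 by simp
    finally show "(\<integral>x. h x \<bullet> g x \<partial>lebesgue_on ?U) = (\<integral>x. f x * v x \<partial>lebesgue_on ?U)" .
  qed
  show ?thesis
  proof (rule that[OF u(1) sol])
    fix u' assume s': "limit_solution L f u'"
    then have u': "per_limit L u' (weak_grad ?U u')" using H1_per_weak_grad[OF L] by (simp add: limit_solution_def)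
    have d: "per_limit L (\<lambda>x. u' x - u x) (\<lambda>x. weak_grad ?U u' x - h x)"
      using per_limit_lincomb[OF L u' u(1), of "-1"] by simp
    note l2 = per_limit_D(1,2)[OF L u'] per_limit_D(1,2)[OF L u(1)]
    have "L2norm ?U (\<lambda>x. weak_grad ?U u' x - h x) = 0"
      by (rule energy_unique[OF l2(2,4)])
        (use s' sol d in \<open>simp add: limit_solution_iff[OF L u'] limit_solution_iff[OF L u(1)]\<close>)
    moreover have "mean L (\<lambda>x. u' x - u x) = 0"
      using mean_diff[OF l2(1,3)] s' u(2) limit_solution_iff[OF L u'] by simp
    ultimately have "L2norm ?U (\<lambda>x. u' x - u x) = 0"
      using P[of "\<lambda>x. u' x - u x" "\<lambda>x. weak_grad ?U u' x - h x"] d L2norm_nonneg[of ?U "\<lambda>x. u' x - u x"] by simp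
    from L2_AE_zero[OF per_limit_D(1)[OF L d] this] show "AE x in lebesgue_on ?U. u' x = u x" by simp
  qed
qed

subsection \<open>Convergence and blow-up\<close>

text \<open>Moves the weak equation to the full square. The extended gradient of \<open>u\<close> is
  0 on the disc, so the values of \<open>g\<close> there do not enter.\<close>

lemma hole_solution_test:
  assumes r: "0 < r" "r < L" and s: "hole_solution L f r u" and vg: "V0_limit L r v g"
  shows "(\<integral>x. extend L r (weak_grad (Omega_hole L r) u) x \<bullet> g x \<partial>lebesgue_on (Omega L))
    = (\<integral>x. f x * extend L r v x \<partial>lebesgue_on (Omega L))"
proof -
  let ?U = "Omega_hole L r" and ?h = "weak_grad (Omega_hole L r) u"
  have L: "L > 0" using r by simp
  have uh: "V0_limit L r u ?h" using s V0_imp_limit[OF r] by (simp add: hole_solution_def)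
  have "(\<integral>x. extend L r ?h x \<bullet> g x \<partial>lebesgue_on (Omega L)) = (\<integral>x. ?h x \<bullet> g x \<partial>lebesgue_on ?U)"
    by (rule extend_hole(3)[OF L])
  also have "\<dots> = (\<integral>x. f x * v x \<partial>lebesgue_on ?U)"
    using iffD1[OF hole_solution_iff[OF r uh] s] vg by blast
  also have "\<dots> = (\<integral>x. v x \<bullet> f x \<partial>lebesgue_on ?U)" by (simp add: mult.commute)
  also have "\<dots> = (\<integral>x. extend L r v x \<bullet> f x \<partial>lebesgue_on (Omega L))" by (rule extend_hole(3)[OF L, symmetric])
  finally show ?thesis by (simp add: mult.commute)
qed

lemma hole_solution_test_PC1:
  assumes r: "0 < r" "r < L" and s: "hole_solution L f r u"
    and \<phi>: "PC1 L \<phi> \<Phi>" "\<And>x. norm x \<le> r \<Longrightarrow> \<phi> x = 0"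
  shows "(\<integral>x. extend L r (weak_grad (Omega_hole L r) u) x \<bullet> \<Phi> x \<partial>lebesgue_on (Omega L))
    = (\<integral>x. f x * \<phi> x \<partial>lebesgue_on (Omega L))"
proof -
  have L: "L > 0" using r by simp
  have "extend L r \<phi> x = \<phi> x" if "x \<in> Omega L" for x
    using \<phi>(2)[of x] zero_ext_Omega[OF L that, of r \<phi>] by (simp add: zero_ext_def disc_def)
  then have "(\<integral>x. f x * extend L r \<phi> x \<partial>lebesgue_on (Omega L)) = (\<integral>x. f x * \<phi> x \<partial>lebesgue_on (Omega L))"
    by (intro Bochner_Integration.integral_cong) auto
  then show ?thesis using hole_solution_test[OF r s PC1_vanishing_V0_limit[OF r \<phi>]] by simp
qed

lemma hole_solution_best_approximation:
  assumes r: "0 < r" "r < L" and s: "hole_solution L f r u"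
    and uh: "per_limit L u0 h0" and s0: "limit_solution L f u0"
    and \<phi>: "PC1 L \<phi> \<Phi>" "\<And>x. norm x \<le> r \<Longrightarrow> \<phi> x = 0"
  shows "L2norm (Omega L) (\<lambda>x. extend L r (weak_grad (Omega_hole L r) u) x - h0 x) \<le> L2norm (Omega L) (\<lambda>x. \<Phi> x - h0 x)"
proof -
  let ?U = "Omega L"
  have L: "L > 0" using r by simp
  define h where "h = weak_grad (Omega_hole L r) u"
  have vh: "V0_limit L r u h" unfolding h_def using s V0_imp_limit[OF r] by (simp add: hole_solution_def)
  have eh: "per_limit L (extend L r u) (extend L r h)" by (rule V0_limit_per_limit[OF r vh])
  define k where "k = extend L r h"
  define a where "a x = k x - h0 x" for x
  define b where "b x = \<Phi> x - h0 x" for x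
  have l2: "k \<in> L2 ?U" "h0 \<in> L2 ?U" "\<Phi> \<in> L2 ?U"
    using per_limit_D(2)[OF L eh] per_limit_D(2)[OF L uh] PC1_L2(2)[OF L \<phi>(1)] by (auto simp: k_def)
  have a2: "a \<in> L2 ?U" and b2: "b \<in> L2 ?U" unfolding a_def b_def using l2 by (auto intro: L2_diff)
  have lim: "(\<integral>x. h0 x \<bullet> g x \<partial>lebesgue_on ?U) = (\<integral>x. f x * v x \<partial>lebesgue_on ?U)" if "per_limit L v g" for v g
    using limit_solution_iff[OF L uh] s0 that by blast
  have ortho: "(\<integral>x. a x \<bullet> g x \<partial>lebesgue_on ?U) = 0"
    if "g \<in> L2 ?U" "(\<integral>x. k x \<bullet> g x \<partial>lebesgue_on ?U) = (\<integral>x. h0 x \<bullet> g x \<partial>lebesgue_on ?U)" for g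
    using that L2_inner_integrable[OF l2(1) that(1)] L2_inner_integrable[OF l2(2) that(1)]
    by (simp add: a_def inner_diff_left)
  \<comment> \<open>Where \<open>k\<close> and \<open>h\<close> differ, the other factor
    \<open>k\<close> is 0. This brings the energy into the form of the weak equation tested with the
    solution itself.\<close>
  have "(\<integral>x. k x \<bullet> k x \<partial>lebesgue_on ?U) = (\<integral>x. k x \<bullet> h x \<partial>lebesgue_on ?U)"
    by (intro Bochner_Integration.integral_cong) (auto simp: k_def extend_def)
  also have "\<dots> = (\<integral>x. h0 x \<bullet> k x \<partial>lebesgue_on ?U)"
    using hole_solution_test[OF r s vh] lim[OF eh] by (simp add: k_def h_def)
  finally have 1: "(\<integral>x. a x \<bullet> k x \<partial>lebesgue_on ?U) = 0" by (rule ortho[OF l2(1)])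
  have 2: "(\<integral>x. a x \<bullet> \<Phi> x \<partial>lebesgue_on ?U) = 0"
    by (rule ortho[OF l2(3)])
      (use hole_solution_test_PC1[OF r s \<phi>] lim[OF PC1_per_limit[OF L \<phi>(1)]] in \<open>simp add: k_def h_def\<close>)
  \<comment> \<open>As \<open>a\<close> is orthogonal to \<open>k\<close> and to
    \<open>\<Phi>\<close>, pairing it with \<open>k - h0\<close> or with \<open>\<Phi> - h0\<close>
    gives the same number; Cauchy-Schwarz then compares the norms.\<close>
  have "(\<integral>x. a x \<bullet> a x \<partial>lebesgue_on ?U) = - (\<integral>x. a x \<bullet> h0 x \<partial>lebesgue_on ?U)"
    using 1 L2_inner_integrable[OF a2 l2(1)] L2_inner_integrable[OF a2 l2(2)]
    by (simp add: a_def[of "_"] inner_diff_right)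
  also have "\<dots> = (\<integral>x. a x \<bullet> b x \<partial>lebesgue_on ?U)"
    using 2 L2_inner_integrable[OF a2 l2(3)] L2_inner_integrable[OF a2 l2(2)]
    by (simp add: b_def inner_diff_right)
  also have "\<dots> \<le> L2norm ?U a * L2norm ?U b" using L2_Cauchy_Schwarz[OF a2 b2] by linarith
  finally have "L2norm ?U a * L2norm ?U a \<le> L2norm ?U a * L2norm ?U b"
    unfolding L2norm_sq_inner[symmetric] by (simp add: power2_eq_square)
  then have "L2norm ?U a \<le> L2norm ?U b"
    using L2norm_nonneg[of ?U a] L2norm_nonneg[of ?U b] by (cases "L2norm ?U a = 0") auto
  then show ?thesis by (simp add: a_def[abs_def] b_def[abs_def] k_def h_def)
qed

text \<open>The gradient of the product of cutoff and \<open>\<phi>\<close> differs from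
  \<open>\<Phi>\<close> by
  \<open>\<phi> x *\<^sub>R X x - (1 - \<zeta> x) *\<^sub>R \<Phi> x\<close>. Both terms are small
  in L^2 because \<open>\<phi>\<close> and \<open>\<Phi>\<close> are bounded, which is the reason
  for approximating by C^1 functions before cutting off.\<close>

lemma vanishing_gradient_approximation:
  assumes L: "L > 0" and uh: "per_limit L u h" and e: "e > 0"
  obtains \<phi> \<Phi> \<rho> where "0 < \<rho>" "PC1 L \<phi> \<Phi>" "\<And>x. norm x \<le> \<rho> \<Longrightarrow> \<phi> x = 0" "L2norm (Omega L) (\<lambda>x. \<Phi> x - h x) < e"
proof -
  let ?U = "Omega L"
  have "e / 3 > 0" using e by simp
  then obtain \<phi> \<Phi> where \<phi>: "PC1 L \<phi> \<Phi>" "L2norm ?U (\<lambda>x. h x - \<Phi> x) < e / 3"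
    using uh unfolding per_limit_def by blast
  have c: "continuous_on UNIV \<phi>" "continuous_on UNIV \<Phi>" using \<phi>(1) C1_continuous by (auto simp: PC1_def)
  have p: "lperiodic L \<phi>" using \<phi>(1) by (simp add: PC1_def)
  obtain B1 where B1: "0 < B1" "\<And>x. norm (\<phi> x) \<le> B1" using lperiodic_continuous_bounded[OF L p c(1)] by blast
  obtain B2 where B2: "0 < B2" "\<And>x. norm (\<Phi> x) \<le> B2"
    using lperiodic_continuous_bounded[OF L PC1_gradient_periodic[OF \<phi>(1)] c(2)] by blast
  define B where "B = max B1 B2"
  have B: "0 < B" "norm (\<phi> x) \<le> B" "norm (\<Phi> x) \<le> B" for x
    using B1(1) B1(2)[of x] B2(2)[of x] by (auto simp: B_def)
  \<comment> \<open>The cutoff is chosen after \<open>\<phi>\<close>, so its energy can absorb the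
    bound \<open>B\<close>; the last third of \<open>e\<close> is the distance of
    \<open>\<Phi>\<close> from \<open>h\<close>.\<close>
  have "e / (3 * B) > 0" using e B(1) by simp
  then obtain \<zeta> X \<rho> where \<zeta>: "0 < \<rho>" "PC1 L \<zeta> X" "\<And>x. 0 \<le> \<zeta> x \<and> \<zeta> x \<le> 1" "\<And>x. norm x \<le> \<rho> \<Longrightarrow> \<zeta> x = 0"
    "L2norm ?U (\<lambda>x. 1 - \<zeta> x) < e / (3 * B)" "L2norm ?U X < e / (3 * B)"
    using small_energy_cutoff[OF L] by metis
  note m = PC1_mult[OF \<zeta>(2) \<phi>(1)]
  have l2: "h \<in> L2 ?U" "\<Phi> \<in> L2 ?U" "X \<in> L2 ?U" "\<zeta> \<in> L2 ?U" "\<phi> \<in> L2 ?U"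
    using per_limit_D(2)[OF L uh] PC1_L2[OF L \<phi>(1)] PC1_L2[OF L \<zeta>(2)] by auto
  have m2: "(\<lambda>x. \<zeta> x *\<^sub>R \<Phi> x + \<phi> x *\<^sub>R X x) \<in> L2 ?U" by (rule PC1_L2(2)[OF L m])
  have [measurable]: "\<phi> \<in> borel_measurable (lebesgue_on ?U)" "\<Phi> \<in> borel_measurable (lebesgue_on ?U)"
    "X \<in> borel_measurable (lebesgue_on ?U)" "\<zeta> \<in> borel_measurable (lebesgue_on ?U)"
    using l2 by (auto dest: L2D)
  have o2: "(\<lambda>x. 1 - \<zeta> x) \<in> L2 ?U" by (rule L2_diff[OF L2_const(1)[OF lmeasurable_Omega] l2(4)])
  have b1: "(\<lambda>x. \<phi> x *\<^sub>R X x) \<in> L2 ?U" "L2norm ?U (\<lambda>x. \<phi> x *\<^sub>R X x) \<le> B * L2norm ?U X"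
    using L2_mono_bound[OF L2_scaleR[OF l2(3), of B], of "\<lambda>x. \<phi> x *\<^sub>R X x"] B by (auto simp: L2norm_scaleR mult_right_mono)
  have b2: "(\<lambda>x. (1 - \<zeta> x) *\<^sub>R \<Phi> x) \<in> L2 ?U" "L2norm ?U (\<lambda>x. (1 - \<zeta> x) *\<^sub>R \<Phi> x) \<le> B * L2norm ?U (\<lambda>x. 1 - \<zeta> x)"
  proof -
    have "norm ((1 - \<zeta> x) *\<^sub>R \<Phi> x) \<le> norm (B *\<^sub>R (1 - \<zeta> x))" for x
      using mult_left_mono[OF B(3)[of x] abs_ge_zero[of "1 - \<zeta> x"]] B(1) by (simp add: abs_mult mult.commute)
    then show "(\<lambda>x. (1 - \<zeta> x) *\<^sub>R \<Phi> x) \<in> L2 ?U" "L2norm ?U (\<lambda>x. (1 - \<zeta> x) *\<^sub>R \<Phi> x) \<le> B * L2norm ?U (\<lambda>x. 1 - \<zeta> x)"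
      using L2_mono_bound[OF L2_scaleR[OF o2, of B], of "\<lambda>x. (1 - \<zeta> x) *\<^sub>R \<Phi> x"] B(1)
      unfolding L2norm_scaleR by simp_all
  qed
  have "L2norm ?U (\<lambda>x. (\<zeta> x *\<^sub>R \<Phi> x + \<phi> x *\<^sub>R X x) - h x)
      \<le> L2norm ?U (\<lambda>x. (\<zeta> x *\<^sub>R \<Phi> x + \<phi> x *\<^sub>R X x) - \<Phi> x) + L2norm ?U (\<lambda>x. \<Phi> x - h x)"
    by (rule L2norm_triangle_diff[OF m2 l2(2,1)])
  also have "(\<lambda>x. (\<zeta> x *\<^sub>R \<Phi> x + \<phi> x *\<^sub>R X x) - \<Phi> x) = (\<lambda>x. \<phi> x *\<^sub>R X x - (1 - \<zeta> x) *\<^sub>R \<Phi> x)"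
    by (simp add: algebra_simps)
  also have "L2norm ?U \<dots> \<le> L2norm ?U (\<lambda>x. \<phi> x *\<^sub>R X x) + L2norm ?U (\<lambda>x. (1 - \<zeta> x) *\<^sub>R \<Phi> x)"
    using L2norm_triangle[OF b1(1) L2_scaleR[OF b2(1), of "-1"]] unfolding L2norm_scaleR by (simp add: algebra_simps)
  also have "\<dots> < e / 3 + e / 3"
  proof (rule add_strict_mono)
    have "B * L2norm ?U X < B * (e / (3 * B))" using \<zeta>(6) B(1) by (intro mult_strict_left_mono)
    then show "L2norm ?U (\<lambda>x. \<phi> x *\<^sub>R X x) < e / 3" using b1(2) B(1) by simp
    have "B * L2norm ?U (\<lambda>x. 1 - \<zeta> x) < B * (e / (3 * B))" using \<zeta>(5) B(1) by (intro mult_strict_left_mono)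
    then show "L2norm ?U (\<lambda>x. (1 - \<zeta> x) *\<^sub>R \<Phi> x) < e / 3" using b2(2) B(1) by simp
  qed
  finally have fin: "L2norm ?U (\<lambda>x. (\<zeta> x *\<^sub>R \<Phi> x + \<phi> x *\<^sub>R X x) - h x) < e"
    using \<phi>(2) L2norm_diff_commute[of ?U h \<Phi>] by simp
  show ?thesis by (rule that[OF \<zeta>(1) m _ fin]) (simp add: \<zeta>(4))
qed

text \<open>A single approximation vanishing on a disc of radius \<open>\<rho>\<close> is a
  competitor for all smaller holes at once, so best approximation gives the limit.\<close>

lemma hole_solution_tendsto_gradient:
  assumes L: "L > 0" and uh: "per_limit L u0 h0" and s0: "limit_solution L f u0"
    and s: "\<And>r. 0 < r \<Longrightarrow> r < L \<Longrightarrow> hole_solution L f r (u r)"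
  shows "((\<lambda>r. L2norm (Omega L) (\<lambda>x. extend L r (weak_grad (Omega_hole L r) (u r)) x - h0 x)) \<longlongrightarrow> 0) (at_right 0)"
proof (rule tendstoI)
  fix e :: real assume e: "e > 0"
  obtain \<phi> \<Phi> \<rho> where \<phi>: "0 < \<rho>" "PC1 L \<phi> \<Phi>" "\<And>x. norm x \<le> \<rho> \<Longrightarrow> \<phi> x = 0" "L2norm (Omega L) (\<lambda>x. \<Phi> x - h0 x) < e"
    by (rule vanishing_gradient_approximation[OF L uh e]) (rule that)
  have "dist (L2norm (Omega L) (\<lambda>x. extend L r (weak_grad (Omega_hole L r) (u r)) x - h0 x)) 0 < e"
    if "0 < r" "r < min \<rho> L" for r
  proof -
    have r: "0 < r" "r < L" using that by auto
    have "L2norm (Omega L) (\<lambda>x. extend L r (weak_grad (Omega_hole L r) (u r)) x - h0 x) \<le> L2norm (Omega L) (\<lambda>x. \<Phi> x - h0 x)"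
      by (rule hole_solution_best_approximation[OF r s[OF r] uh s0 \<phi>(2)]) (use \<phi>(3) that in auto)
    then show ?thesis using \<phi>(4) by (simp add: dist_real_def)
  qed
  then show "\<forall>\<^sub>F r in at_right 0. dist (L2norm (Omega L) (\<lambda>x. extend L r (weak_grad (Omega_hole L r) (u r)) x - h0 x)) 0 < e"
    using \<phi>(1) L unfolding eventually_at_right_field by (intro exI[of _ "min \<rho> L"]) auto
qed

lemma hole_solution_zero_ext:
  assumes r: "0 < r" "r < L" and s: "hole_solution L f r u"
  shows "V0_limit L r u (weak_grad (Omega_hole L r) u)" "zero_ext r u \<in> H1_per L"
    "per_limit L (extend L r u) (extend L r (weak_grad (Omega_hole L r) u))"
    "AE x in lebesgue_on (Omega L). weak_grad (Omega L) (zero_ext r u) x = extend L r (weak_grad (Omega_hole L r) u) x"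
    "weak_grad (Omega L) (zero_ext r u) \<in> borel_measurable (lebesgue_on (Omega L))"
proof -
  show v: "V0_limit L r u (weak_grad (Omega_hole L r) u)"
    using s V0_imp_limit[OF r] by (simp add: hole_solution_def)
  note z = zero_ext_H1_per[OF r v]
  show "zero_ext r u \<in> H1_per L"
    "AE x in lebesgue_on (Omega L). weak_grad (Omega L) (zero_ext r u) x = extend L r (weak_grad (Omega_hole L r) u) x"
    "weak_grad (Omega L) (zero_ext r u) \<in> borel_measurable (lebesgue_on (Omega L))" by (fact z)+
  show "per_limit L (extend L r u) (extend L r (weak_grad (Omega_hole L r) u))" by (rule V0_limit_per_limit[OF r v])
qed

text \<open>The functions follow from the gradients by the Poincare inequality for
  \<open>extend L r (u r) - u0\<close>, whose mean is that of \<open>u r\<close> because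
  \<open>u0\<close> has mean 0. Its constant is the same for all radii.\<close>

lemma hole_solution_tendsto:
  assumes L: "L > 0" and uh: "per_limit L u0 h0" and s0: "limit_solution L f u0"
    and s: "\<And>r. 0 < r \<Longrightarrow> r < L \<Longrightarrow> hole_solution L f r (u r)"
  shows "((\<lambda>r. L2norm (Omega L) (\<lambda>x. zero_ext r (u r) x - mean L (zero_ext r (u r)) - u0 x)) \<longlongrightarrow> 0) (at_right 0)"
    "((\<lambda>r. L2norm (Omega L) (\<lambda>x. weak_grad (Omega L) (zero_ext r (u r)) x - weak_grad (Omega L) u0 x)) \<longlongrightarrow> 0) (at_right 0)"
proof -
  let ?U = "Omega L" and ?k = "\<lambda>r. extend L r (weak_grad (Omega_hole L r) (u r))"
  note T = hole_solution_tendsto_gradient[OF L uh s0 s]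
  note l0 = per_limit_D[OF L uh]
  have ev: "\<forall>\<^sub>F r in at_right 0. 0 < r \<and> r < L"
    using L unfolding eventually_at_right_field by blast
  have g: "L2norm ?U (\<lambda>x. weak_grad ?U (zero_ext r (u r)) x - weak_grad ?U u0 x) = L2norm ?U (\<lambda>x. ?k r x - h0 x)"
    if r: "0 < r" "r < L" for r
  proof (rule L2norm_cong_AE)
    note z = hole_solution_zero_ext[OF r s[OF r]]
    show "AE x in lebesgue_on ?U. weak_grad ?U (zero_ext r (u r)) x - weak_grad ?U u0 x = ?k r x - h0 x"
      using z(4) l0(4) by eventually_elim simp
    show "(\<lambda>x. weak_grad ?U (zero_ext r (u r)) x - weak_grad ?U u0 x) \<in> borel_measurable (lebesgue_on ?U)"
      by (intro borel_measurable_diff z(5) L2D(1)[OF l0(5)])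
    show "(\<lambda>x. ?k r x - h0 x) \<in> borel_measurable (lebesgue_on ?U)"
      by (intro borel_measurable_diff L2D(1)[OF l0(2)] L2D(1)[OF per_limit_D(2)[OF L z(3)]])
  qed
  show "((\<lambda>r. L2norm ?U (\<lambda>x. weak_grad ?U (zero_ext r (u r)) x - weak_grad ?U u0 x)) \<longlongrightarrow> 0) (at_right 0)"
    by (rule Lim_transform_eventually[OF T]) (use ev g in \<open>auto elim: eventually_mono\<close>)
  have m0: "mean L u0 = 0" using limit_solution_iff[OF L uh] s0 by blast
  have f: "L2norm ?U (\<lambda>x. zero_ext r (u r) x - mean L (zero_ext r (u r)) - u0 x) \<le> 2 * L * L2norm ?U (\<lambda>x. ?k r x - h0 x)"
    if r: "0 < r" "r < L" for r
  proof -
    note z = hole_solution_zero_ext[OF r s[OF r]]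
    have d: "per_limit L (\<lambda>x. extend L r (u r) x - u0 x) (\<lambda>x. ?k r x - h0 x)"
      using per_limit_lincomb[OF L z(3) uh, of "-1"] by simp
    have "mean L (extend L r (u r)) = mean L (zero_ext r (u r))"
      unfolding mean_def
      by (intro arg_cong2[where f="(*)"] Bochner_Integration.integral_cong) (auto simp: zero_ext_Omega[OF L])
    then have "mean L (\<lambda>x. extend L r (u r) x - u0 x) = mean L (zero_ext r (u r))"
      using mean_diff[OF per_limit_D(1)[OF L z(3)] l0(1)] m0 by simp
    then have "L2norm ?U (\<lambda>x. zero_ext r (u r) x - mean L (zero_ext r (u r)) - u0 x)
      = L2norm ?U (\<lambda>x. (extend L r (u r) x - u0 x) - mean L (\<lambda>x. extend L r (u r) x - u0 x))"
      by (intro L2norm_cong) (simp add: zero_ext_Omega[OF L])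
    then show ?thesis using Poincare_mean[OF L d] by simp
  qed
  show "((\<lambda>r. L2norm ?U (\<lambda>x. zero_ext r (u r) x - mean L (zero_ext r (u r)) - u0 x)) \<longlongrightarrow> 0) (at_right 0)"
  proof (rule Lim_null_comparison)
    show "\<forall>\<^sub>F r in at_right 0. norm (L2norm ?U (\<lambda>x. zero_ext r (u r) x - mean L (zero_ext r (u r)) - u0 x))
      \<le> 2 * L * L2norm ?U (\<lambda>x. ?k r x - h0 x)"
      using ev by eventually_elim (use f in simp)
    show "((\<lambda>r. 2 * L * L2norm ?U (\<lambda>x. ?k r x - h0 x)) \<longlongrightarrow> 0) (at_right 0)"
      by (rule tendsto_mult_right_zero[OF T])
  qed
qed

text \<open>Testing with a cutoff function of small energy bounds the mean of the load by the energy of the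
  solution.\<close>

lemma hole_solution_bounded_imp_mean_zero:
  assumes L: "L > 0" and f: "f \<in> L2 (Omega L)"
    and s: "\<And>r. 0 < r \<Longrightarrow> r < L \<Longrightarrow> hole_solution L f r (u r)"
    and B: "Bfun (\<lambda>r. L2norm (Omega L) (weak_grad (Omega L) (zero_ext r (u r)))) (at_right 0)"
  shows "(\<integral>x. f x \<partial>lebesgue_on (Omega L)) = 0"
proof (rule ccontr)
  let ?U = "Omega L"
  define I where "I = \<bar>\<integral>x. f x \<partial>lebesgue_on ?U\<bar>"
  assume "(\<integral>x. f x \<partial>lebesgue_on ?U) \<noteq> 0"
  then have I: "I > 0" by (simp add: I_def)
  obtain K where K: "K > 0" "\<forall>\<^sub>F r in at_right 0. norm (L2norm ?U (weak_grad ?U (zero_ext r (u r)))) \<le> K"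
    using B by (elim BfunE)
  \<comment> \<open>Small enough that \<open>(K + L2norm (Omega L) f) * e\<close> stays strictly
    below \<open>I\<close>; the summand 1 makes the inequality strict.\<close>
  define e where "e = I / (K + L2norm ?U f + 1)"
  have pos: "K + L2norm ?U f + 1 > 0" using K(1) L2norm_nonneg[of ?U f] by linarith
  have e: "e > 0" using I pos by (simp add: e_def)
  obtain \<zeta> X \<rho> where \<zeta>: "0 < \<rho>" "PC1 L \<zeta> X" "\<And>x. norm x \<le> \<rho> \<Longrightarrow> \<zeta> x = 0"
    "L2norm ?U (\<lambda>x. 1 - \<zeta> x) < e" "L2norm ?U X < e"
    using small_energy_cutoff[OF L e] by metis
  obtain b where b: "b > 0" "\<And>r. 0 < r \<Longrightarrow> r < b \<Longrightarrow> norm (L2norm ?U (weak_grad ?U (zero_ext r (u r)))) \<le> K"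
    using K(2) unfolding eventually_at_right_field by blast
  \<comment> \<open>One radius suffices: small enough for the cutoff to vanish on the hole and for
    the assumed energy bound to hold.\<close>
  define r where "r = min (min \<rho> L) b / 2"
  have r: "0 < r" "r < L" "r \<le> \<rho>" "r < b" using \<zeta>(1) L b(1) by (auto simp: r_def min_def)
  let ?k = "extend L r (weak_grad (Omega_hole L r) (u r))"
  note z = hole_solution_zero_ext[OF r(1,2) s[OF r(1,2)]]
  have k2: "?k \<in> L2 ?U" by (rule per_limit_D(2)[OF L z(3)])
  have "L2norm ?U ?k = L2norm ?U (weak_grad ?U (zero_ext r (u r)))"
    by (rule L2norm_cong_AE[symmetric, OF z(4,5) L2D(1)[OF k2]])
  then have kK: "L2norm ?U ?k \<le> K" using b(2)[OF r(1,4)] by simp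
  have \<zeta>2: "\<zeta> \<in> L2 ?U" "X \<in> L2 ?U" by (rule PC1_L2[OF L \<zeta>(2)])+
  have o2: "(\<lambda>x. 1 - \<zeta> x) \<in> L2 ?U" by (rule L2_diff[OF L2_const(1)[OF lmeasurable_Omega] \<zeta>2(1)])
  have "(\<integral>x. ?k x \<bullet> X x \<partial>lebesgue_on ?U) = (\<integral>x. f x * \<zeta> x \<partial>lebesgue_on ?U)"
    by (rule hole_solution_test_PC1[OF r(1,2) s[OF r(1,2)] \<zeta>(2)]) (use \<zeta>(3) r(3) in auto)
  then have "\<bar>\<integral>x. f x * \<zeta> x \<partial>lebesgue_on ?U\<bar> \<le> L2norm ?U ?k * L2norm ?U X" using L2_Cauchy_Schwarz[OF k2 \<zeta>2(2)] by simp
  also have "\<dots> \<le> K * e" using kK \<zeta>(5) K(1) by (intro mult_mono) auto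
  finally have 1: "\<bar>\<integral>x. f x * \<zeta> x \<partial>lebesgue_on ?U\<bar> \<le> K * e" .
  have "\<bar>\<integral>x. f x \<bullet> (1 - \<zeta> x) \<partial>lebesgue_on ?U\<bar> \<le> L2norm ?U f * L2norm ?U (\<lambda>x. 1 - \<zeta> x)"
    by (rule L2_Cauchy_Schwarz[OF f o2])
  also have "\<dots> \<le> L2norm ?U f * e" using \<zeta>(4) by (intro mult_left_mono) auto
  finally have 2: "\<bar>\<integral>x. f x \<bullet> (1 - \<zeta> x) \<partial>lebesgue_on ?U\<bar> \<le> L2norm ?U f * e" .
  \<comment> \<open>The load is split by the cutoff: the first part is an energy pairing with the
    solution, the second lives where the cutoff differs from 1.\<close>
  have "(\<integral>x. f x \<partial>lebesgue_on ?U) = (\<integral>x. f x * \<zeta> x + f x \<bullet> (1 - \<zeta> x) \<partial>lebesgue_on ?U)"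
    by (simp add: algebra_simps)
  also have "\<dots> = (\<integral>x. f x * \<zeta> x \<partial>lebesgue_on ?U) + (\<integral>x. f x \<bullet> (1 - \<zeta> x) \<partial>lebesgue_on ?U)"
    by (rule Bochner_Integration.integral_add) (use L2_inner_integrable[OF f \<zeta>2(1)] L2_inner_integrable[OF f o2] in auto)
  finally have "I \<le> K * e + L2norm ?U f * e" using 1 2 by (simp add: I_def)
  also have "\<dots> < (K + L2norm ?U f + 1) * e" using e by (simp add: algebra_simps)
  also have "\<dots> = I" using pos by (simp add: e_def)
  finally show False by simp
qed

theorem theorem2p1:
  fixes L :: real and f :: "real^2 \<Rightarrow> real"
  assumes "L > 0" and "f \<in> L2 (Omega L)"
  shows
    "(\<forall>r. 0 < r \<and> r < L \<longrightarrow>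
        (\<exists>u. hole_solution L f r u \<and>
             (\<forall>u'. hole_solution L f r u' \<longrightarrow>
                   (AE x in lebesgue_on (Omega_hole L r). u' x = u x)))) \<and>
     (\<forall>r u. 0 < r \<and> r < L \<and> hole_solution L f r u \<longrightarrow> zero_ext r u \<in> H1_per L) \<and>
     ((\<integral>x. f x \<partial>lebesgue_on (Omega L)) = 0 \<longrightarrow>
        (\<exists>u0. limit_solution L f u0 \<and>
              (\<forall>u0'. limit_solution L f u0' \<longrightarrow>
                     (AE x in lebesgue_on (Omega L). u0' x = u0 x)) \<and>
              (\<forall>u. (\<forall>r. 0 < r \<and> r < L \<longrightarrow> hole_solution L f r (u r)) \<longrightarrow>
                 ((\<lambda>r. L2norm (Omega L)
                     (\<lambda>x. zero_ext r (u r) x - mean L (zero_ext r (u r)) - u0 x))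
                   \<longlongrightarrow> 0) (at_right 0) \<and>
                 ((\<lambda>r. L2norm (Omega L)
                     (\<lambda>x. weak_grad (Omega L) (zero_ext r (u r)) x - weak_grad (Omega L) u0 x))
                   \<longlongrightarrow> 0) (at_right 0)))) \<and>
     ((\<integral>x. f x \<partial>lebesgue_on (Omega L)) \<noteq> 0 \<longrightarrow>
        (\<forall>u. (\<forall>r. 0 < r \<and> r < L \<longrightarrow> hole_solution L f r (u r)) \<longrightarrow>
           \<not> Bfun (\<lambda>r. L2norm (Omega L) (weak_grad (Omega L) (zero_ext r (u r)))) (at_right 0)))"
proof (intro conjI allI impI)
  show "\<exists>u. hole_solution L f r u \<and>
      (\<forall>u'. hole_solution L f r u' \<longrightarrow> (AE x in lebesgue_on (Omega_hole L r). u' x = u x))"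
    if "0 < r \<and> r < L" for r
    using hole_solution_exists_unique[of r L f] that assms(2) by blast
  show "zero_ext r u \<in> H1_per L" if "0 < r \<and> r < L \<and> hole_solution L f r u" for r u
    using hole_solution_zero_ext(2)[of r L f u] that by blast
next
  assume f0: "(\<integral>x. f x \<partial>lebesgue_on (Omega L)) = 0"
  obtain u0 h0 where u0: "per_limit L u0 h0" "limit_solution L f u0"
    "\<And>u0'. limit_solution L f u0' \<Longrightarrow> AE x in lebesgue_on (Omega L). u0' x = u0 x"
    using limit_solution_exists_unique[OF assms f0] by blast
  have "((\<lambda>r. L2norm (Omega L) (\<lambda>x. zero_ext r (u r) x - mean L (zero_ext r (u r)) - u0 x)) \<longlongrightarrow> 0) (at_right 0) \<and>
     ((\<lambda>r. L2norm (Omega L) (\<lambda>x. weak_grad (Omega L) (zero_ext r (u r)) x - weak_grad (Omega L) u0 x)) \<longlongrightarrow> 0) (at_right 0)"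
    if "\<forall>r. 0 < r \<and> r < L \<longrightarrow> hole_solution L f r (u r)" for u
    using hole_solution_tendsto[OF assms(1) u0(1,2), of u] that by blast
  then show "\<exists>u0. limit_solution L f u0 \<and>
      (\<forall>u0'. limit_solution L f u0' \<longrightarrow> (AE x in lebesgue_on (Omega L). u0' x = u0 x)) \<and>
      (\<forall>u. (\<forall>r. 0 < r \<and> r < L \<longrightarrow> hole_solution L f r (u r)) \<longrightarrow>
         ((\<lambda>r. L2norm (Omega L) (\<lambda>x. zero_ext r (u r) x - mean L (zero_ext r (u r)) - u0 x)) \<longlongrightarrow> 0) (at_right 0) \<and>
         ((\<lambda>r. L2norm (Omega L) (\<lambda>x. weak_grad (Omega L) (zero_ext r (u r)) x - weak_grad (Omega L) u0 x)) \<longlongrightarrow> 0) (at_right 0))"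
    using u0(2,3) by blast
next
  fix u
  assume f0: "(\<integral>x. f x \<partial>lebesgue_on (Omega L)) \<noteq> 0"
    and s: "\<forall>r. 0 < r \<and> r < L \<longrightarrow> hole_solution L f r (u r)"
  show "\<not> Bfun (\<lambda>r. L2norm (Omega L) (weak_grad (Omega L) (zero_ext r (u r)))) (at_right 0)"
    using hole_solution_bounded_imp_mean_zero[OF assms, of u] s f0 by blast
qed

end
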